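(* Let $H$ be a Hilbert space, let $n\ge 1$ be an integer and $\alpha>0$, and let $t\mapsto A(t)$, $t\in\mathbb{R}$, be a $C^{3n,\alpha}$ curve of unbounded self-adjoint operators in $H$ with common domain of definition $V$ and with compact resolvent. Suppose that the multiplicity of an eigenvalue of $A(t)$ never exceeds $n$ (for any $t\in\mathbb{R}$). Then the eigenvalues of $A(t)$ may be parameterized twice differentiably in $t$; that is, there is a sequence of twice differentiable functions $\lambda_i:\mathbb{R}\to\mathbb{R}$ which parameterizes the eigenvalues of $A(t)$, $t\in\mathbb R$.
   Context: $H$ is a complex Hilbert space. A curve $t\mapsto A(t)$, $t\in\mathbb{R}$, of unbounded self-adjoint operators in $H$ with common domain: there is a dense linear subspace $V\subseteq H$ which is the domain of definition of each $A(t)$, and $A(t)^*=A(t)$ for each $t$. A function $f$ of a real variable is called $C^{k,\alpha}$ if it is $k$ times differentiable and the expression $\frac{f^{(k)}(t)-f^{(k)}(s)}{|t-s|^\alpha}$ is locally bounded in $t\neq s$. The curve $A$ is called $C^{k,\alpha}$ if for each $u\in V$ and $v\in H$ the function $t\mapsto\langle A(t)u,v\rangle$ is $C^{k,\alpha}$. Compact resolvent: for each $t$, the operator $(A(t)-z)^{-1}:H\to H$ is compact for some (equivalently any) $z$ in the resolvent set of $A(t)$. A (finite or infinite) sequence of functions $\lambda_i:\mathbb{R}\to\mathbb{R}$ is said to parameterize the eigenvalues of $A(t)$ if for each $t\in\mathbb{R}$ and each $z\in\mathbb{R}$ the cardinality $|\{i:\lambda_i(t)=z\}|$ equals the multiplicity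 of $z$ as an eigenvalue of $A(t)$ (multiplicity $0$ if $z$ is not an eigenvalue). *)

theory Defs
  imports "HOL-Analysis.Analysis" "HOL-Library.Extended_Nat"
begin

text \<open>Complex Hilbert spaces as a type class on top of the real ones. The inner product is linear
  in its first argument. Positive definiteness, the norm and the topology are inherited from the
  real inner product, which is required to be the real part of the complex one.\<close>

class complex_hilbert_space = real_inner + complete_space +
  fixes scaleC :: "complex \<Rightarrow> 'a \<Rightarrow> 'a"  (infixr \<open>*\<^sub>C\<close> 75)
    and cinner :: "'a \<Rightarrow> 'a \<Rightarrow> complex"
  assumes scaleC_add_right: "a *\<^sub>C (x + y) = a *\<^sub>C x + a *\<^sub>C y"
    and scaleC_add_left: "(a + b) *\<^sub>C x = a *\<^sub>C x + b *\<^sub>C x"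
    and scaleC_scaleC: "a *\<^sub>C (b *\<^sub>C x) = (a * b) *\<^sub>C x"
    and scaleC_of_real: "complex_of_real r *\<^sub>C x = r *\<^sub>R x"
    and cinner_add_left: "cinner (x + y) z = cinner x z + cinner y z"
    and cinner_scaleC_left: "cinner (a *\<^sub>C x) y = a * cinner x y"
    and cinner_commute: "cinner x y = cnj (cinner y x)"
    and Re_cinner: "Re (cinner x y) = inner x y"

interpretation complex_vector:
  vector_space "scaleC :: complex \<Rightarrow> 'a \<Rightarrow> 'a::complex_hilbert_space"
proof
  fix x :: 'a
  show "1 *\<^sub>C x = x"
    using scaleC_of_real[of 1 x] by simp
qed (simp_all add: scaleC_add_right scaleC_add_left scaleC_scaleC)

instantiation complex :: complex_hilbert_space
begin

definition scaleC_complex :: "complex \<Rightarrow> complex \<Rightarrow> complex"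
  where "scaleC_complex a x = a * x"

definition cinner_complex :: "complex \<Rightarrow> complex \<Rightarrow> complex"
  where "cinner_complex x y = x * cnj y"

instance
  by standard
    (simp_all add: scaleC_complex_def cinner_complex_def algebra_simps scaleR_conv_of_real
      inner_complex_def)

end


text \<open>An unbounded operator is a domain \<open>V\<close> together with a function \<open>T\<close> whose values outside
  \<open>V\<close> are irrelevant. Since \<open>V\<close> is dense, the adjoint graph below is the graph of a function,
  namely of the adjoint of \<open>T\<close> on its maximal domain.\<close>

definition op_graph :: "'a set \<Rightarrow> ('a \<Rightarrow> 'a) \<Rightarrow> ('a \<times> 'a) set"
  where "op_graph V T = {(u, T u) | u. u \<in> V}"

definition adjoint_graph ::
    "'a::complex_hilbert_space set \<Rightarrow> ('a \<Rightarrow> 'a) \<Rightarrow> ('a \<times> 'a) set"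
  where "adjoint_graph V T = {(v, w). \<forall>u\<in>V. cinner (T u) v = cinner u w}"

definition self_adjoint_operator ::
    "'a::complex_hilbert_space set \<Rightarrow> ('a \<Rightarrow> 'a) \<Rightarrow> bool"
  where "self_adjoint_operator V T \<longleftrightarrow>
    complex_vector.subspace V \<and> closure V = UNIV \<and>
    (\<forall>u\<in>V. \<forall>v\<in>V. T (u + v) = T u + T v) \<and>
    (\<forall>c. \<forall>u\<in>V. T (c *\<^sub>C u) = c *\<^sub>C T u) \<and>
    adjoint_graph V T = op_graph V T"

definition resolvent ::
    "'a::complex_hilbert_space set \<Rightarrow> ('a \<Rightarrow> 'a) \<Rightarrow> complex \<Rightarrow> 'a \<Rightarrow> 'a"
  where "resolvent V T z = inv_into V (\<lambda>u. T u - z *\<^sub>C u)"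

definition resolvent_set ::
    "'a::complex_hilbert_space set \<Rightarrow> ('a \<Rightarrow> 'a) \<Rightarrow> complex set"
  where "resolvent_set V T =
    {z. bij_betw (\<lambda>u. T u - z *\<^sub>C u) V UNIV \<and> (\<exists>K. \<forall>x. norm (resolvent V T z x) \<le> K * norm x)}"

definition compact_operator :: "('a::complex_hilbert_space \<Rightarrow> 'a) \<Rightarrow> bool"
  where "compact_operator R \<longleftrightarrow>
    Vector_Spaces.linear scaleC scaleC R \<and> (\<forall>B. bounded B \<longrightarrow> compact (closure (R ` B)))"

definition has_compact_resolvent ::
    "'a::complex_hilbert_space set \<Rightarrow> ('a \<Rightarrow> 'a) \<Rightarrow> bool"
  where "has_compact_resolvent V T \<longleftrightarrow>
    (\<exists>z\<in>resolvent_set V T. compact_operator (resolvent V T z))"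

definition eigenspace ::
    "'a::complex_hilbert_space set \<Rightarrow> ('a \<Rightarrow> 'a) \<Rightarrow> complex \<Rightarrow> 'a set"
  where "eigenspace V T z = {u\<in>V. T u = z *\<^sub>C u}"

text \<open>The functions \<open>dim\<close> and \<open>card\<close> are 0 in the infinite case, hence the detour via \<open>enat\<close>.\<close>

definition multiplicity_at ::
    "'a::complex_hilbert_space set \<Rightarrow> ('a \<Rightarrow> 'a) \<Rightarrow> complex \<Rightarrow> enat"
  where "multiplicity_at V T z =
    (if \<exists>B. finite B \<and> complex_vector.span B = eigenspace V T z
     then enat (complex_vector.dim (eigenspace V T z)) else \<infinity>)"

definition ecard :: "'i set \<Rightarrow> enat"
  where "ecard S = (if finite S then enat (card S) else \<infinity>)"

text \<open>The sequence of functions is indexed by the natural numbers below \<open>N\<close>; it is infinite if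
  \<open>N = \<infinity>\<close>.\<close>

definition parameterizes_eigenvalues ::
    "enat \<Rightarrow> (nat \<Rightarrow> real \<Rightarrow> real) \<Rightarrow> 'a::complex_hilbert_space set \<Rightarrow> (real \<Rightarrow> 'a \<Rightarrow> 'a) \<Rightarrow> bool"
  where "parameterizes_eigenvalues N lam V A \<longleftrightarrow>
    (\<forall>t z. ecard {i. enat i < N \<and> lam i t = z} = multiplicity_at V (A t) (complex_of_real z))"


definition higher_derivative :: "nat \<Rightarrow> (real \<Rightarrow> 'b::real_normed_vector) \<Rightarrow> real \<Rightarrow> 'b"
  where "higher_derivative k f = ((\<lambda>g t. vector_derivative g (at t)) ^^ k) f"

definition times_differentiable :: "nat \<Rightarrow> (real \<Rightarrow> 'b::real_normed_vector) \<Rightarrow> bool"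
  where "times_differentiable k f \<longleftrightarrow> (\<forall>j<k. \<forall>t. higher_derivative j f differentiable (at t))"

text \<open>The difference quotient is bounded near every point of the plane, including the points of
  the diagonal, where the quotient itself is not considered.\<close>

definition locally_Hoelder :: "real \<Rightarrow> (real \<Rightarrow> 'b::real_normed_vector) \<Rightarrow> bool"
  where "locally_Hoelder \<alpha> g \<longleftrightarrow>
    (\<forall>p. \<exists>U. open U \<and> p \<in> U \<and>
      bounded ((\<lambda>(t, s). (g t - g s) /\<^sub>R (\<bar>t - s\<bar> powr \<alpha>)) ` {(t, s) \<in> U. t \<noteq> s}))"

definition C_k_alpha :: "nat \<Rightarrow> real \<Rightarrow> (real \<Rightarrow> 'b::real_normed_vector) \<Rightarrow> bool"
  where "C_k_alpha k \<alpha> f \<longleftrightarrow> times_differentiable k f \<and> locally_Hoelder \<alpha> (higher_derivative k f)"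

definition C_k_alpha_curve ::
    "nat \<Rightarrow> real \<Rightarrow> 'a::complex_hilbert_space set \<Rightarrow> (real \<Rightarrow> 'a \<Rightarrow> 'a) \<Rightarrow> bool"
  where "C_k_alpha_curve k \<alpha> V A \<longleftrightarrow> (\<forall>u\<in>V. \<forall>v. C_k_alpha k \<alpha> (\<lambda>t. cinner (A t u) v))"

end

theory Submission
  imports Defs
begin

text \<open>
  Consider an eigenvalue \<open>z\<close> of multiplicity \<open>n\<close> at time \<open>t0\<close>. Second order perturbation theory assigns to
  it \<open>n\<close> jets \<open>z + \<mu> * h + \<nu> * h\<^sup>2\<close>. The slopes \<open>\<mu>\<close> are the eigenvalues of the compression of the
  derivative \<open>A1\<close> to the eigenspace, and the \<open>\<nu>\<close> those of the compression of
  \<open>A2 - A1 \<circ> S \<circ> A1\<close> to the eigenspaces of the first compression, where \<open>A2\<close> is half of the second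
  derivative and \<open>S\<close> the reduced resolvent. The corresponding approximate eigenvectors
  \<open>b + h *\<^sub>R x + h\<^sup>2 *\<^sub>R y\<close> have residuals of order \<open>\<bar>h\<bar> ^ 3\<close> (\<open>quasimodes\<close>). Counting eigenvalues
  (\<open>quasimode_count\<close>) shows that each jet is followed up to \<open>o(h\<^sup>2)\<close> by exactly as many eigenvalues as its
  multiplicity says. The expansions hold in norm and locally uniformly relative to the operator,
  although the curve is only weakly differentiable, by the principle of uniform boundedness
  (\<open>curve_derivatives\<close>, \<open>family_bound\<close>).

  So at each time the spectrum is a multiset of jets, and the task is to arrange these multisets into
  functions of time that follow, at each time, the jet they take there. This is a purely real
  question. Distinct jets have disjoint windows of size \<open>\<eta> * h\<^sup>2\<close>, and local functions are found by
  induction on the multiplicity (\<open>local_branch\<close>): within the window of a jet, either there are several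
  jets, of smaller multiplicity, or only one. The slopes are bounded by a multiple of
  \<open>1 + \<bar>z\<bar>\<close>, which makes the functions global (\<open>global_branch\<close>), and one splits them off one by one
  until nothing is left (\<open>jet_system_parameterization\<close>).

  Such a function has derivative \<open>\<mu>\<close>, but a pointwise expansion of second order does not make \<open>\<mu>\<close>
  differentiable. This is where convexity comes in. For \<open>c\<close> slightly below \<open>z\<close>, the sum of the \<open>k\<close>
  largest eigenvalues of the resolvent at \<open>c\<close> is a maximum over orthonormal families (\<open>ky_fan\<close>), hence
  semiconvex in \<open>t\<close> (\<open>resolvent_sum_subgradient\<close>). The slopes of a convex function with an expansion of
  second order have the expected expansion of first order (\<open>convex_expansion_slopes\<close>). Differences of
  consecutive sums carry this over to the eigenvalues numbered by size, and from these to the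
  functions above, which coincide at each time with one of finitely many of them
  (\<open>branch_slope_differentiable\<close>).
\<close>

section \<open>Jets, windows and branches\<close>

datatype jet = Jet (jet_val: real) (jet_slope: real) (jet_curv: real)

definition jet_poly :: "real \<Rightarrow> jet \<Rightarrow> real \<Rightarrow> real"
  where "jet_poly t0 J t = jet_val J + jet_slope J * (t - t0) + jet_curv J * (t - t0)\<^sup>2"

text \<open>Windows consist of jets rather than numbers, so that multiplicities can be summed
  over them, but they constrain only the value of a jet.\<close>

definition window :: "real \<Rightarrow> jet \<Rightarrow> real \<Rightarrow> real \<Rightarrow> jet set"
  where "window t0 J \<eta> t = {J'. \<bar>jet_val J' - jet_poly t0 J t\<bar> \<le> \<eta> * (t - t0)\<^sup>2}"

definition follows :: "(real \<Rightarrow> jet) \<Rightarrow> jet \<Rightarrow> real \<Rightarrow> real set \<Rightarrow> bool"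
  where "follows \<phi> J T S \<longleftrightarrow> (\<forall>\<eta>>0. \<forall>\<^sub>F t in at T within S. \<phi> t \<in> window T J \<eta> t)"

text \<open>This is a Peano expansion of order 2 at every point. It makes the values
  differentiable with derivative \<open>jet_slope\<close>, but says nothing on the regularity of
  the slopes.\<close>

definition branch :: "(real \<Rightarrow> jet \<Rightarrow> bool) \<Rightarrow> (real \<Rightarrow> jet) \<Rightarrow> real set \<Rightarrow> bool"
  where "branch P \<phi> D \<longleftrightarrow> (\<forall>t\<in>D. P t (\<phi> t) \<and> follows \<phi> (\<phi> t) t UNIV)"

lemma eventually_pos_at:
  fixes g :: "real \<Rightarrow> real"
  assumes "isCont g a" "g a > 0"
  shows "\<forall>\<^sub>F t in at a. g t > 0"
  using assms by (metis isCont_def order_tendstoD(1))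

lemma window_mono: "\<eta> \<le> \<eta>' \<Longrightarrow> window t0 J \<eta> t \<subseteq> window t0 J \<eta>' t"
  unfolding window_def using mult_right_mono[of \<eta> \<eta>' "(t - t0)\<^sup>2"] by auto

lemma continuous_jet_poly [continuous_intros]: "isCont (jet_poly t0 J) t"
  unfolding jet_poly_def by (intro continuous_intros)

lemma jet_poly_self [simp]: "jet_poly t J t = jet_val J"
  by (simp add: jet_poly_def)

text \<open>The difference of the two polynomials is dominated by its first nonzero coefficient,
  whose order is at most 2.\<close>

lemma jet_polys_separate:
  assumes "J1 \<noteq> J2"
  shows "\<forall>\<^sub>F \<eta> in at_right 0. \<forall>\<^sub>F t in at t0. 2 * \<eta> * (t - t0)\<^sup>2 < \<bar>jet_poly t0 J1 t - jet_poly t0 J2 t\<bar>"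
proof -
  obtain z1 a1 b1 z2 a2 b2 where J: "J1 = Jet z1 a1 b1" "J2 = Jet z2 a2 b2"
    by (cases J1, cases J2) auto
  define d where "d h = (z1 - z2) + (a1 - a2) * h + (b1 - b2) * h\<^sup>2" for h :: real
  have d: "jet_poly t0 J1 t - jet_poly t0 J2 t = d (t - t0)" for t
    by (simp add: J jet_poly_def d_def algebra_simps)
  consider "z1 \<noteq> z2" | "z1 = z2" "a1 \<noteq> a2" | "z1 = z2" "a1 = a2" "b1 \<noteq> b2"
    using assms J by auto
  then show ?thesis
  proof cases
    case 1
    have "\<forall>\<^sub>F t in at t0. 0 < \<bar>d (t - t0)\<bar> - 2 * \<eta> * (t - t0)\<^sup>2" for \<eta>
      by (rule eventually_pos_at) (use 1 in \<open>auto simp: d_def intro!: continuous_intros\<close>)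
    then show ?thesis unfolding d by (auto elim: eventually_mono intro!: always_eventually)
  next
    case 2
    have ev: "\<forall>\<^sub>F t in at t0. 0 < \<bar>(a1 - a2) + (b1 - b2) * (t - t0)\<bar> - 2 * \<eta> * \<bar>t - t0\<bar>" for \<eta>
      by (rule eventually_pos_at) (use 2 in \<open>auto intro!: continuous_intros\<close>)
    have "\<forall>\<^sub>F t in at t0. 2 * \<eta> * (t - t0)\<^sup>2 < \<bar>d (t - t0)\<bar>" for \<eta>
      using ev[of \<eta>] eventually_neq_at_within[of t0 t0 UNIV]
    proof eventually_elim
      case (elim t)
      have "\<bar>d (t - t0)\<bar> = \<bar>(a1 - a2) + (b1 - b2) * (t - t0)\<bar> * \<bar>t - t0\<bar>"
        unfolding abs_mult[symmetric] using 2 by (simp add: d_def algebra_simps power2_eq_square)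
      moreover have "2 * \<eta> * (t - t0)\<^sup>2 = (2 * \<eta> * \<bar>t - t0\<bar>) * \<bar>t - t0\<bar>"
        using power2_abs[of "t - t0"] unfolding power2_eq_square by (metis mult.assoc)
      moreover have "(2 * \<eta> * \<bar>t - t0\<bar>) * \<bar>t - t0\<bar> < \<bar>(a1 - a2) + (b1 - b2) * (t - t0)\<bar> * \<bar>t - t0\<bar>"
        by (rule mult_strict_right_mono) (use elim in auto)
      ultimately show ?case by linarith
    qed
    then show ?thesis unfolding d by (intro always_eventually) auto
  next
    case 3
    have "\<forall>\<^sub>F t in at t0. 2 * \<eta> * (t - t0)\<^sup>2 < \<bar>d (t - t0)\<bar>" if "\<eta> < \<bar>b1 - b2\<bar> / 2" for \<eta>
      using eventually_neq_at_within[of t0 t0 UNIV]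
    proof eventually_elim
      case (elim t)
      have "\<bar>d (t - t0)\<bar> = \<bar>b1 - b2\<bar> * (t - t0)\<^sup>2"
        using 3 by (simp add: d_def abs_mult)
      moreover have "2 * \<eta> * (t - t0)\<^sup>2 < \<bar>b1 - b2\<bar> * (t - t0)\<^sup>2"
        by (rule mult_strict_right_mono) (use that elim in auto)
      ultimately show ?case by simp
    qed
    then show ?thesis unfolding d eventually_at_right_field
      using 3 by (intro exI[of _ "\<bar>b1 - b2\<bar> / 2"]) auto
  qed
qed

lemma windows_separate:
  assumes "finite F"
  shows "\<forall>\<^sub>F \<eta> in at_right 0. \<forall>\<^sub>F t in at t0.
    \<forall>J1\<in>F. \<forall>J2\<in>F. J1 \<noteq> J2 \<longrightarrow> window t0 J1 \<eta> t \<inter> window t0 J2 \<eta> t = {}"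
proof -
  have *: "\<forall>\<^sub>F \<eta> in at_right 0. \<forall>\<^sub>F t in at t0. J1 \<noteq> J2 \<longrightarrow> window t0 J1 \<eta> t \<inter> window t0 J2 \<eta> t = {}"
    for J1 J2
  proof (cases "J1 = J2")
    case False
    from jet_polys_separate[OF this, of t0] show ?thesis
    proof eventually_elim
      case (elim \<eta>)
      then show ?case
      proof eventually_elim
        case (elim t)
        then show ?case by (auto simp: window_def)
      qed
    qed
  qed simp
  have "\<forall>\<^sub>F \<eta> in at_right 0. \<forall>J1\<in>F. \<forall>J2\<in>F. \<forall>\<^sub>F t in at t0.
      J1 \<noteq> J2 \<longrightarrow> window t0 J1 \<eta> t \<inter> window t0 J2 \<eta> t = {}"
    using assms * by (intro eventually_ball_finite ballI)
  then show ?thesis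
    by eventually_elim (use assms in \<open>intro eventually_ball_finite ballI; auto\<close>)
qed

text \<open>Away from \<open>t0\<close> a window has room around each of its members, and
  branches are continuous there.\<close>

lemma window_open:
  assumes "J1 \<in> window t0 J \<eta> t1" "t1 \<noteq> t0" "\<eta> < \<eta>'"
  shows "\<forall>\<^sub>F t in at t1. window t1 J1 \<eta>1 t \<subseteq> window t0 J \<eta>' t"
proof -
  have "\<forall>\<^sub>F t in at t1. 0 < \<eta>' * (t - t0)\<^sup>2 - \<eta>1 * (t - t1)\<^sup>2 - \<bar>jet_poly t1 J1 t - jet_poly t0 J t\<bar>"
  proof (rule eventually_pos_at)
    have "\<bar>jet_val J1 - jet_poly t0 J t1\<bar> \<le> \<eta> * (t1 - t0)\<^sup>2" using assms by (simp add: window_def)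
    also have "\<dots> < \<eta>' * (t1 - t0)\<^sup>2" using assms by simp
    finally show "0 < \<eta>' * (t1 - t0)\<^sup>2 - \<eta>1 * (t1 - t1)\<^sup>2 - \<bar>jet_poly t1 J1 t1 - jet_poly t0 J t1\<bar>"
      by simp
  qed (intro continuous_intros)
  then show ?thesis by eventually_elim (auto simp: window_def)
qed

lemma followsD: "follows \<phi> J T S \<Longrightarrow> \<eta> > 0 \<Longrightarrow> \<forall>\<^sub>F t in at T within S. \<phi> t \<in> window T J \<eta> t"
  by (simp add: follows_def)

lemma follows_cong:
  assumes "\<forall>\<^sub>F t in at T within S. \<phi> t = \<psi> t" "follows \<phi> J T S"
  shows "follows \<psi> J T S"
  unfolding follows_def
proof (intro allI impI)
  fix \<eta> :: real assume "\<eta> > 0"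
  from followsD[OF assms(2) this] assms(1) show "\<forall>\<^sub>F t in at T within S. \<psi> t \<in> window T J \<eta> t"
    by eventually_elim simp
qed

lemma branch_local:
  assumes "\<And>t. t \<in> D \<Longrightarrow> \<exists>U \<psi>. open U \<and> t \<in> U \<and> branch P \<psi> U \<and> (\<forall>s\<in>U. \<phi> s = \<psi> s)"
  shows "branch P \<phi> D"
  unfolding branch_def
proof
  fix t assume "t \<in> D"
  from assms[OF this] obtain U \<psi> where U: "open U" "t \<in> U" "branch P \<psi> U" "\<forall>s\<in>U. \<phi> s = \<psi> s" by auto
  have "\<forall>\<^sub>F s in at t. \<psi> s = \<phi> s"
    using U by (auto simp: eventually_at_topological)
  with U show "P t (\<phi> t) \<and> follows \<phi> (\<phi> t) t UNIV"
    by (auto simp: branch_def intro: follows_cong)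
qed

lemma branch_subset: "branch P \<phi> D \<Longrightarrow> D' \<subseteq> D \<Longrightarrow> branch P \<phi> D'"
  by (auto simp: branch_def)

lemma follows_imp_derivative:
  assumes "follows \<phi> (\<phi> t) t UNIV"
  shows "((\<lambda>s. jet_val (\<phi> s)) has_real_derivative jet_slope (\<phi> t)) (at t)"
proof -
  define z a b where "z = jet_val (\<phi> t)" "a = jet_slope (\<phi> t)" "b = jet_curv (\<phi> t)"
  have "((\<lambda>s. (jet_val (\<phi> s) - z) / (s - t) - a) \<longlongrightarrow> 0) (at t)"
  proof (rule Lim_null_comparison)
    show "\<forall>\<^sub>F s in at t. norm ((jet_val (\<phi> s) - z) / (s - t) - a) \<le> (\<bar>b\<bar> + 1) * \<bar>s - t\<bar>"
      using followsD[OF assms zero_less_one] eventually_neq_at_within[of t t UNIV]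
    proof eventually_elim
      case (elim s)
      then have "\<bar>jet_val (\<phi> s) - (z + a * (s - t) + b * (s - t)\<^sup>2)\<bar> \<le> (s - t)\<^sup>2"
        by (simp add: window_def jet_poly_def z_a_b_def)
      then have "\<bar>jet_val (\<phi> s) - z - a * (s - t)\<bar> \<le> (s - t)\<^sup>2 + \<bar>b * (s - t)\<^sup>2\<bar>" by linarith
      also have "\<dots> = (\<bar>b\<bar> + 1) * \<bar>s - t\<bar> * \<bar>s - t\<bar>"
        by (simp add: abs_mult algebra_simps flip: power2_eq_square)
      finally have "\<bar>jet_val (\<phi> s) - z - a * (s - t)\<bar> / \<bar>s - t\<bar> \<le> (\<bar>b\<bar> + 1) * \<bar>s - t\<bar>"
        using elim by (simp add: pos_divide_le_eq)
      moreover have "(jet_val (\<phi> s) - z) / (s - t) - a = (jet_val (\<phi> s) - z - a * (s - t)) / (s - t)"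
        using elim by (simp add: field_simps)
      ultimately show ?case by (simp add: abs_divide)
    qed
    have "((\<lambda>s. (\<bar>b\<bar> + 1) * \<bar>s - t\<bar>) \<longlongrightarrow> (\<bar>b\<bar> + 1) * \<bar>t - t\<bar>) (at t)"
      by (intro tendsto_intros)
    then show "((\<lambda>s. (\<bar>b\<bar> + 1) * \<bar>s - t\<bar>) \<longlongrightarrow> 0) (at t)" by simp
  qed
  then show ?thesis unfolding has_field_derivative_iff z_a_b_def by (simp add: LIM_zero_iff)
qed

lemma branch_isCont:
  assumes "branch P \<phi> S" "t \<in> S"
  shows "isCont (\<lambda>s. jet_val (\<phi> s)) t"
  using follows_imp_derivative[of \<phi> t] assms DERIV_isCont unfolding branch_def by blast

text \<open>Close to \<open>T\<close> the values are confined to finitely many windows that are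
  pairwise disjoint, and by continuity they cannot pass from one to another on a connected set.\<close>

lemma branch_limit:
  assumes S: "connected S" "open S" "T \<notin> S" "at T within S \<noteq> bot"
    and cont: "\<And>t. t \<in> S \<Longrightarrow> isCont (\<lambda>s. jet_val (\<phi> s)) t" and F: "finite F"
    and cover: "\<And>\<eta>. \<eta> > 0 \<Longrightarrow> \<forall>\<^sub>F t in at T within S. \<exists>J\<in>F. \<phi> t \<in> window T J \<eta> t"
  obtains J where "J \<in> F" "follows \<phi> J T S"
proof -
  obtain \<eta> :: real where \<eta>: "\<eta> > 0" and
    sep: "\<forall>\<^sub>F t in at T. \<forall>J1\<in>F. \<forall>J2\<in>F. J1 \<noteq> J2 \<longrightarrow> window T J1 \<eta> t \<inter> window T J2 \<eta> t = {}"
  proof -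
    obtain b :: real where "b > 0" and b: "\<And>\<eta>. 0 < \<eta> \<Longrightarrow> \<eta> < b \<Longrightarrow> \<forall>\<^sub>F t in at T.
        \<forall>J1\<in>F. \<forall>J2\<in>F. J1 \<noteq> J2 \<longrightarrow> window T J1 \<eta> t \<inter> window T J2 \<eta> t = {}"
      using windows_separate[OF F, of T] unfolding eventually_at_right_field by blast
    show ?thesis using that[of "b/2"] b[of "b/2"] \<open>b > 0\<close> by simp
  qed
  have "\<forall>\<^sub>F t in at T within S. (\<forall>J1\<in>F. \<forall>J2\<in>F. J1 \<noteq> J2 \<longrightarrow> window T J1 \<eta> t \<inter> window T J2 \<eta> t = {})
      \<and> (\<exists>J\<in>F. \<phi> t \<in> window T J (\<eta>/2) t)"
    using cover[of "\<eta>/2"] \<eta> filter_leD[OF at_le[of S UNIV T] sep] by (intro eventually_conj) simp_all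
  then obtain \<delta> where \<delta>: "\<delta> > 0" and
    d: "\<forall>t\<in>S. t \<noteq> T \<and> dist t T < \<delta> \<longrightarrow>
      (\<forall>J1\<in>F. \<forall>J2\<in>F. J1 \<noteq> J2 \<longrightarrow> window T J1 \<eta> t \<inter> window T J2 \<eta> t = {})
      \<and> (\<exists>J\<in>F. \<phi> t \<in> window T J (\<eta>/2) t)"
    unfolding eventually_at by auto
  define S' where "S' = S \<inter> ball T \<delta>"
  have d': "(\<forall>J1\<in>F. \<forall>J2\<in>F. J1 \<noteq> J2 \<longrightarrow> window T J1 \<eta> t \<inter> window T J2 \<eta> t = {})
      \<and> (\<exists>J\<in>F. \<phi> t \<in> window T J (\<eta>/2) t)" if "t \<in> S'" for t
    using d that \<open>T \<notin> S\<close> by (metis IntD1 IntD2 S'_def dist_commute mem_ball)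
  have "convex S" using S(1) by (simp add: is_interval_connected_1 flip: is_interval_convex_1)
  then have S': "open S'" "connected S'"
    using S unfolding S'_def by (auto intro!: convex_connected convex_Int)
  have half: "window T J (\<eta>/2) t \<subseteq> window T J \<eta> t" for J t using \<eta> by (intro window_mono) auto
  define g where "g t = (SOME J. J \<in> F \<and> \<phi> t \<in> window T J (\<eta>/2) t)" for t
  have g: "g t \<in> F" "\<phi> t \<in> window T (g t) (\<eta>/2) t" if "t \<in> S'" for t
    using someI_ex[of "\<lambda>J. J \<in> F \<and> \<phi> t \<in> window T J (\<eta>/2) t"] d'[OF that]
    by (auto simp: g_def)
  have g_unique: "g t = J" if "t \<in> S'" "J \<in> F" "\<phi> t \<in> window T J \<eta> t" for t J
    using d'[OF that(1)] g[OF that(1)] half that by blast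
  have "g constant_on S'"
  proof (rule locally_constant_imp_constant[OF S'(2)])
    fix t1 assume t1: "t1 \<in> S'"
    then have "t1 \<noteq> T" using S by (auto simp: S'_def)
    have "\<forall>\<^sub>F t in at t1. 0 < \<eta> * (t - T)\<^sup>2 - \<bar>jet_val (\<phi> t) - jet_poly T (g t1) t\<bar>"
    proof (rule eventually_pos_at)
      have "\<bar>jet_val (\<phi> t1) - jet_poly T (g t1) t1\<bar> \<le> \<eta> / 2 * (t1 - T)\<^sup>2"
        using g(2)[OF t1] by (simp add: window_def)
      also have "\<dots> < \<eta> * (t1 - T)\<^sup>2" using \<open>t1 \<noteq> T\<close> \<eta> by simp
      finally show "0 < \<eta> * (t1 - T)\<^sup>2 - \<bar>jet_val (\<phi> t1) - jet_poly T (g t1) t1\<bar>" by simp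
      show "isCont (\<lambda>t. \<eta> * (t - T)\<^sup>2 - \<bar>jet_val (\<phi> t) - jet_poly T (g t1) t\<bar>) t1"
        by (intro continuous_intros cont) (use t1 in \<open>simp add: S'_def\<close>)
    qed
    then have "\<forall>\<^sub>F t in at t1. \<phi> t \<in> window T (g t1) \<eta> t"
      by eventually_elim (simp add: window_def)
    then obtain U where "open U" "t1 \<in> U" "\<And>t. t \<in> U \<Longrightarrow> t \<noteq> t1 \<Longrightarrow> \<phi> t \<in> window T (g t1) \<eta> t"
      unfolding eventually_at_topological by auto
    then show "\<exists>T. openin (top_of_set S') T \<and> t1 \<in> T \<and> (\<forall>x\<in>T. g x = g t1)"
      using g_unique[OF _ g(1)[OF t1]] t1 by (intro exI[of _ "S' \<inter> U"]) (auto simp: openin_open)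
  qed
  then obtain J where J: "\<And>t. t \<in> S' \<Longrightarrow> g t = J" by (auto simp: constant_on_def)
  have ev: "\<forall>\<^sub>F t in at T within S. t \<in> S'"
    using \<delta> by (auto simp: eventually_at S'_def dist_commute intro!: exI[of _ \<delta>])
  then obtain t where "t \<in> S'"
    using S(4) eventually_happens' by blast
  then have "J \<in> F" using J g by metis
  moreover have "follows \<phi> J T S"
    unfolding follows_def
  proof (intro allI impI)
    fix \<epsilon> :: real assume "\<epsilon> > 0"
    then have "\<forall>\<^sub>F t in at T within S. \<exists>J\<in>F. \<phi> t \<in> window T J (min \<epsilon> \<eta>) t"
      using cover \<eta> by simp
    with ev show "\<forall>\<^sub>F t in at T within S. \<phi> t \<in> window T J \<epsilon> t"
    proof eventually_elim
      case (elim t)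
      then obtain J' where "J' \<in> F" "\<phi> t \<in> window T J' (min \<epsilon> \<eta>) t" by auto
      moreover from this have "g t = J'"
        using g_unique[of t J'] elim window_mono[of "min \<epsilon> \<eta>" \<eta>] by auto
      ultimately show ?case
        using J[OF elim(1)] subsetD[OF window_mono[of "min \<epsilon> \<eta>" \<epsilon> T J' t]] by simp
    qed
  qed
  ultimately show ?thesis using that by blast
qed

text \<open>Zorn's lemma for graphs of branches over intervals: if the domain of a maximal
  branch had an end point \<open>T\<close> in \<open>C\<close>, the branch could be continued
  across \<open>T\<close> through its limiting jet.\<close>

lemma branch_extend:
  assumes C: "open C" "connected C" "t0 \<in> C" and P0: "P t0 J0"
    and loc: "\<And>t J. t \<in> C \<Longrightarrow> P t J \<Longrightarrow> \<exists>\<delta>>0. \<exists>\<phi>. \<phi> t = J \<and> branch P \<phi> {t-\<delta><..<t+\<delta>}"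
    and lim: "\<And>T S \<phi>. T \<in> C \<Longrightarrow> T \<notin> S \<Longrightarrow> open S \<Longrightarrow> connected S \<Longrightarrow> S \<subseteq> C \<Longrightarrow>
      at T within S \<noteq> bot \<Longrightarrow> branch P \<phi> S \<Longrightarrow> \<exists>J. P T J \<and> follows \<phi> J T S"
  shows "\<exists>\<phi>. \<phi> t0 = J0 \<and> branch P \<phi> C"
proof -
  define ok where "ok D \<phi> \<longleftrightarrow> open D \<and> connected D \<and> t0 \<in> D \<and> D \<subseteq> C \<and> \<phi> t0 = J0 \<and> branch P \<phi> D" for D \<phi>
  define gr where "gr D \<phi> = (\<lambda>t. (t, \<phi> t)) ` D" for D and \<phi> :: "real \<Rightarrow> jet"
  define \<A> where "\<A> = {gr D \<phi> | D \<phi>. ok D \<phi>}"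
  have gr_iff: "(t, J) \<in> gr D \<phi> \<longleftrightarrow> t \<in> D \<and> J = \<phi> t" for t J D \<phi> by (auto simp: gr_def)
  have shrink: "\<exists>\<phi>. \<phi> t = J \<and> branch P \<phi> {t-\<delta><..<t+\<delta>}" if sh: "\<exists>\<phi>. \<phi> t = J \<and> branch P \<phi> {t-\<delta>'<..<t+\<delta>'}" and le: "\<delta> \<le> \<delta>'" for t J \<delta> \<delta>'
  proof -
    obtain \<phi> where "\<phi> t = J" "branch P \<phi> {t-\<delta>'<..<t+\<delta>'}" using sh by blast
    moreover have "{t-\<delta><..<t+\<delta>} \<subseteq> {t-\<delta>'<..<t+\<delta>'}" using le by auto
    ultimately show ?thesis using branch_subset by blast
  qed
  have "\<exists>M\<in>\<A>. \<forall>X\<in>\<A>. M \<subseteq> X \<longrightarrow> X = M"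
  proof (rule subset_Zorn_nonempty)
    obtain \<delta>1 where "\<delta>1 > 0" and \<delta>1: "\<exists>\<phi>. \<phi> t0 = J0 \<and> branch P \<phi> {t0-\<delta>1<..<t0+\<delta>1}"
      using loc[OF C(3) P0] by auto
    obtain \<delta>2 where "\<delta>2 > 0" and \<delta>2: "ball t0 \<delta>2 \<subseteq> C" using C by (meson open_contains_ball)
    define \<delta> where "\<delta> = min \<delta>1 \<delta>2"
    have "\<delta> > 0" using \<open>\<delta>1 > 0\<close> \<open>\<delta>2 > 0\<close> by (simp add: \<delta>_def)
    moreover obtain \<phi> where "\<phi> t0 = J0" "branch P \<phi> {t0-\<delta><..<t0+\<delta>}"
    proof -
      have "\<delta> \<le> \<delta>1" by (simp add: \<delta>_def)
      then show ?thesis using shrink[OF \<delta>1] that by auto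
    qed
    moreover have "{t0-\<delta><..<t0+\<delta>} \<subseteq> C" using \<delta>2 by (auto simp: \<delta>_def dist_real_def subset_iff)
    ultimately have "ok {t0-\<delta><..<t0+\<delta>} \<phi>" by (auto simp: ok_def)
    then show "\<A> \<noteq> {}" by (auto simp: \<A>_def)
  next
    fix \<C> assume ne: "\<C> \<noteq> {}" and ch: "subset.chain \<A> \<C>"
    have fromA: "\<exists>D \<phi>. ok D \<phi> \<and> G = gr D \<phi>" if "G \<in> \<C>" for G
    proof -
      have "G \<in> \<A>" using ch that by (auto simp: subset_chain_def)
      then show ?thesis by (auto simp: \<A>_def)
    qed
    have single: "J = J'" if mem: "(t, J) \<in> \<Union>\<C>" "(t, J') \<in> \<Union>\<C>" for t J J'
    proof -
      obtain G G' where G: "G \<in> \<C>" "G' \<in> \<C>" "(t, J) \<in> G" "(t, J') \<in> G'" using mem by auto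
      then have "G \<subseteq> G' \<or> G' \<subseteq> G" using ch by (auto simp: subset_chain_def)
      then consider "(t, J) \<in> G'" "(t, J') \<in> G'" | "(t, J) \<in> G" "(t, J') \<in> G" using G by blast
      then show ?thesis using fromA[OF G(1)] fromA[OF G(2)] by cases (auto simp: gr_iff)
    qed
    define D where "D = fst ` \<Union>\<C>"
    define \<phi> where "\<phi> t = (THE J. (t, J) \<in> \<Union>\<C>)" for t
    have \<phi>: "\<phi> t = J" if "(t, J) \<in> \<Union>\<C>" for t J
      unfolding \<phi>_def using that single by (intro the_equality) auto
    have memD: "t \<in> D" if "(t, J) \<in> \<Union>\<C>" for t J
      unfolding D_def using that by (metis fst_conv imageI)
    have gr: "\<Union>\<C> = gr D \<phi>"
    proof (intro set_eqI iffI; clarify)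
      fix t J assume "(t, J) \<in> gr D \<phi>"
      then have "t \<in> D" "J = \<phi> t" by (simp_all add: gr_iff)
      moreover from \<open>t \<in> D\<close> obtain J' where "(t, J') \<in> \<Union>\<C>" unfolding D_def by force
      ultimately show "(t, J) \<in> \<Union>\<C>" using \<phi> by metis
    next
      fix t J G assume "(t, J) \<in> G" "G \<in> \<C>"
      then have "(t, J) \<in> \<Union>\<C>" by blast
      then show "(t, J) \<in> gr D \<phi>" using \<phi> memD by (simp only: gr_iff)
    qed
    have piece: "\<exists>U \<psi>. ok U \<psi> \<and> t \<in> U \<and> U \<subseteq> D \<and> (\<forall>s\<in>U. \<phi> s = \<psi> s)" if tD: "t \<in> D" for t
    proof -
      obtain x where "x \<in> \<Union>\<C>" "t = fst x" using tD unfolding D_def image_iff by blast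
      then obtain J G where G: "G \<in> \<C>" "(t, J) \<in> G" by (metis UnionE prod.collapse)
      obtain U \<psi> where U: "ok U \<psi>" "G = gr U \<psi>" using fromA[OF G(1)] by auto
      have *: "(s, \<psi> s) \<in> \<Union>\<C>" if "s \<in> U" for s
      proof -
        have "(s, \<psi> s) \<in> G" using that U by (simp add: gr_iff)
        then show ?thesis using G(1) by blast
      qed
      have "t \<in> U" using U G by (simp add: gr_iff)
      then show ?thesis using U(1) *[THEN \<phi>] *[THEN memD] by blast
    qed
    have "D = \<Union>{U. U \<subseteq> D \<and> open U \<and> connected U \<and> t0 \<in> U}"
    proof (intro equalityI subsetI)
      fix t assume "t \<in> D"
      from piece[OF this] obtain U \<psi> where "ok U \<psi>" "t \<in> U" "U \<subseteq> D" by metis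
      then show "t \<in> \<Union>{U. U \<subseteq> D \<and> open U \<and> connected U \<and> t0 \<in> U}" by (auto simp: ok_def)
    qed auto
    moreover have "connected (\<Union>{U. U \<subseteq> D \<and> open U \<and> connected U \<and> t0 \<in> U})"
      by (rule connected_Union) auto
    moreover have "open (\<Union>{U. U \<subseteq> D \<and> open U \<and> connected U \<and> t0 \<in> U})" by auto
    moreover have "t0 \<in> D \<and> \<phi> t0 = J0"
    proof -
      obtain G U \<psi> where "G \<in> \<C>" "G = gr U \<psi>" "ok U \<psi>" using ne fromA by blast
      then have "(t0, J0) \<in> \<Union>\<C>" by (intro UnionI[of G]) (simp_all add: gr_iff ok_def)
      then show ?thesis using \<phi> memD by blast
    qed
    moreover have "D \<subseteq> C"
    proof
      fix t assume "t \<in> D"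
      from piece[OF this] obtain U \<psi> where "ok U \<psi>" "t \<in> U" by metis
      then show "t \<in> C" by (auto simp: ok_def)
    qed
    moreover have "branch P \<phi> D"
    proof (rule branch_local)
      fix t assume "t \<in> D"
      from piece[OF this] obtain U \<psi> where "ok U \<psi>" "t \<in> U" "\<forall>s\<in>U. \<phi> s = \<psi> s" by metis
      then show "\<exists>U \<psi>. open U \<and> t \<in> U \<and> branch P \<psi> U \<and> (\<forall>s\<in>U. \<phi> s = \<psi> s)"
        by (intro exI[of _ U] exI[of _ \<psi>]) (simp add: ok_def)
    qed
    ultimately have "ok D \<phi>" by (auto simp: ok_def)
    then show "\<Union>\<C> \<in> \<A>" using gr by (auto simp: \<A>_def)
  qed
  then obtain M where M: "M \<in> \<A>" "\<And>X. X \<in> \<A> \<Longrightarrow> M \<subseteq> X \<Longrightarrow> X = M" by blast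
  obtain D \<phi> where ok: "ok D \<phi>" and gr: "M = gr D \<phi>" using M(1) by (auto simp: \<A>_def)
  have max: "gr D' \<phi>' = gr D \<phi>" if "ok D' \<phi>'" "gr D \<phi> \<subseteq> gr D' \<phi>'" for D' \<phi>'
    using M(2)[of "gr D' \<phi>'"] that by (auto simp: \<A>_def gr)
  have D: "open D" "connected D" "t0 \<in> D" "D \<subseteq> C" "\<phi> t0 = J0" "branch P \<phi> D" using ok by (auto simp: ok_def)
  have iv: "x \<in> D" if "a \<in> D" "b \<in> D" "a \<le> x" "x \<le> b" for a b x
    using D(2) that by (meson connected_iff_interval)
  have "D = C"
  proof (rule ccontr)
    assume "D \<noteq> C"
    have "\<not> C \<inter> closure D \<subseteq> D"
    proof
      assume "C \<inter> closure D \<subseteq> D"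
      then have "D = C \<inter> closure D" using D closure_subset by auto
      then have "closedin (top_of_set C) D" by (metis closed_closure closedin_closed_Int)
      moreover have "openin (top_of_set C) D" using D by (simp add: open_openin_trans open_subset)
      ultimately show False using C(2) D(3) \<open>D \<noteq> C\<close> unfolding connected_clopen by auto
    qed
    then obtain T where T: "T \<in> C" "T \<in> closure D" "T \<notin> D" by auto
    have bot: "at T within D \<noteq> bot"
      using T by (simp add: trivial_limit_within closure_def)
    obtain J where J: "P T J" "follows \<phi> J T D" using lim[OF T(1,3) D(1,2,4) bot D(6)] by auto
    obtain \<delta>1 where "\<delta>1 > 0" and \<delta>1: "\<exists>\<phi>. \<phi> T = J \<and> branch P \<phi> {T-\<delta>1<..<T+\<delta>1}"
      using loc[OF T(1) J(1)] by auto
    obtain \<delta>2 where "\<delta>2 > 0" and \<delta>2: "ball T \<delta>2 \<subseteq> C" using C T by (meson open_contains_ball)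
    define \<delta> where "\<delta> = min (min \<delta>1 \<delta>2) \<bar>t0 - T\<bar>"
    have "\<delta> > 0" using \<open>\<delta>1 > 0\<close> \<open>\<delta>2 > 0\<close> T D by (auto simp: \<delta>_def)
    define B where "B = {T-\<delta><..<T+\<delta>}"
    have "B \<subseteq> C" using \<delta>2 by (auto simp: \<delta>_def dist_real_def subset_iff B_def)
    obtain \<psi> where \<psi>: "\<psi> T = J" "branch P \<psi> B"
    proof -
      have "\<delta> \<le> \<delta>1" by (simp add: \<delta>_def)
      then show ?thesis using shrink[OF \<delta>1] that by (auto simp: B_def)
    qed
    have near: "\<exists>d\<in>D. \<bar>d - T\<bar> < e" if "e > 0" for e
      using T(2) that by (auto simp: closure_approachable dist_real_def)
    have "\<exists>V. open V \<and> B - D - {T} \<subseteq> V \<and> V \<subseteq> B \<and> V \<inter> D = {}"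
    proof (cases "t0 < T")
      case True
      have "x \<in> D" if x: "T - \<delta> < x" "x < T" for x
      proof -
        obtain d where "d \<in> D" "\<bar>d - T\<bar> < T - x" using near[of "T - x"] x by auto
        then show ?thesis using iv[of t0 d x] D(3) that True by (auto simp: \<delta>_def)
      qed
      moreover have "x \<notin> D" if "x \<ge> T" for x using iv[of t0 x T] that D(3) T True by auto
      ultimately show ?thesis by (intro exI[of _ "{T<..<T+\<delta>}"]) (force simp: B_def)
    next
      case False
      then have lt: "T < t0" using T D by (metis linorder_less_linear)
      have "x \<in> D" if x: "x < T + \<delta>" "T < x" for x
      proof -
        obtain d where "d \<in> D" "\<bar>d - T\<bar> < x - T" using near[of "x - T"] x by auto
        then show ?thesis using iv[of d t0 x] D(3) that lt by (auto simp: \<delta>_def)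
      qed
      moreover have "x \<notin> D" if "x \<le> T" for x using iv[of x t0 T] that D(3) T lt by auto
      ultimately show ?thesis by (intro exI[of _ "{T-\<delta><..<T}"]) (force simp: B_def)
    qed
    then obtain V where V: "open V" "B - D - {T} \<subseteq> V" "V \<subseteq> B" "V \<inter> D = {}" by auto
    define \<phi>' where "\<phi>' t = (if t \<in> D then \<phi> t else \<psi> t)" for t
    have "branch P \<phi>' (D \<union> B)"
    proof -
      have "branch P \<phi>' (D \<union> V)"
      proof (rule branch_local)
        fix t assume t: "t \<in> D \<union> V"
        show "\<exists>U \<psi>. open U \<and> t \<in> U \<and> branch P \<psi> U \<and> (\<forall>s\<in>U. \<phi>' s = \<psi> s)"
        proof (cases "t \<in> D")
          case True
          then show ?thesis using D by (intro exI[of _ D] exI[of _ \<phi>]) (simp add: \<phi>'_def)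
        next
          case False
          have "\<forall>s\<in>V. \<phi>' s = \<psi> s" using V(4) by (auto simp: \<phi>'_def)
          moreover have "t \<in> V" using t False by blast
          ultimately show ?thesis using V \<psi> branch_subset[of P \<psi> B V]
            by (intro exI[of _ V] exI[of _ \<psi>]) simp
        qed
      qed
      moreover have "follows \<phi>' J T UNIV" unfolding follows_def
      proof (intro allI impI)
        fix \<eta> :: real assume "\<eta> > 0"
        have "\<forall>\<^sub>F t in at T. \<psi> t \<in> window T J \<eta> t"
          using \<psi> \<open>\<delta> > 0\<close> \<open>\<eta> > 0\<close> by (auto simp: branch_def B_def intro: followsD)
        moreover have "\<forall>\<^sub>F t in at T. t \<in> D \<longrightarrow> \<phi> t \<in> window T J \<eta> t"
          using followsD[OF J(2) \<open>\<eta> > 0\<close>] by (simp add: eventually_at_filter)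
        ultimately show "\<forall>\<^sub>F t in at T. \<phi>' t \<in> window T J \<eta> t"
          by eventually_elim (simp add: \<phi>'_def)
      qed
      moreover have "\<phi>' T = J" using T \<psi> by (simp add: \<phi>'_def)
      ultimately show ?thesis using V J by (auto simp: branch_def)
    qed
    moreover have "connected (D \<union> B)"
    proof (rule connected_Un)
      show "D \<inter> B \<noteq> {}" using near[OF \<open>\<delta> > 0\<close>] by (force simp: B_def)
    qed (use D in \<open>auto simp: B_def\<close>)
    ultimately have "ok (D \<union> B) \<phi>'" using D \<open>B \<subseteq> C\<close> by (auto simp: ok_def \<phi>'_def B_def)
    from max[OF this] have "gr (D \<union> B) \<phi>' = gr D \<phi>" by (force simp: gr_iff \<phi>'_def gr_def)
    moreover have "(T, \<phi>' T) \<in> gr (D \<union> B) \<phi>'" using \<open>\<delta> > 0\<close> by (simp add: gr_iff B_def)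
    ultimately have "(T, \<phi>' T) \<in> gr D \<phi>" by simp
    then show False using T by (simp add: gr_iff)
  qed
  then show ?thesis using D by auto
qed

section \<open>Systems of jets and their branches\<close>

lemma sum_subset_eq_imp_eq:
  fixes f :: "'b \<Rightarrow> nat"
  assumes "finite B" "A \<subseteq> B" "\<And>x. x \<in> B \<Longrightarrow> f x > 0" "sum f A = sum f B"
  shows "A = B"
proof -
  have "sum f (B - A) = 0"
    using assms sum.subset_diff[of A B f] by simp
  then have "B - A = {}" using assms(1,3) by (metis DiffD1 all_not_in_conv finite_Diff less_numeral_extra(3) sum_eq_0_iff)
  then show ?thesis using assms(2) by auto
qed

definition counts :: "(real \<Rightarrow> jet \<Rightarrow> nat) \<Rightarrow> real \<Rightarrow> jet \<Rightarrow> real \<Rightarrow> bool"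
  where "counts m t0 J \<eta> \<longleftrightarrow> (\<forall>\<^sub>F t in at t0.
      finite {J'\<in>window t0 J \<eta> t. m t J' > 0} \<and> sum (m t) {J'\<in>window t0 J \<eta> t. m t J' > 0} = m t0 J)"

text \<open>The value \<open>m t J\<close> is the multiplicity of the jet \<open>J\<close> at
  time \<open>t\<close>. By \<open>count\<close>, a jet is followed by as many jets at nearby
  times as its multiplicity says; by \<open>proper\<close>, whatever comes close to a value
  follows one of finitely many jets with this value; \<open>growth\<close> keeps branches from
  escaping to infinity in finite time.\<close>

locale jet_system =
  fixes m :: "real \<Rightarrow> jet \<Rightarrow> nat"
  assumes count: "\<forall>\<^sub>F \<eta> in at_right 0. counts m t0 J \<eta>"
    and proper: "\<exists>\<epsilon>>0. \<exists>F. finite F \<and> (\<forall>J\<in>F. jet_val J = z0) \<and>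
      (\<forall>J. m t0 J > 0 \<and> \<bar>jet_val J - z0\<bar> < \<epsilon> \<longrightarrow> J \<in> F) \<and>
      (\<forall>\<eta>>0. \<forall>\<^sub>F t in at t0. \<forall>J'. m t J' > 0 \<and> \<bar>jet_val J' - z0\<bar> < \<epsilon> \<longrightarrow> (\<exists>J\<in>F. J' \<in> window t0 J \<eta> t))"
    and growth: "\<exists>C. \<forall>t J. \<bar>t\<bar> \<le> T \<and> m t J > 0 \<longrightarrow> \<bar>jet_slope J\<bar> \<le> C * (1 + \<bar>jet_val J\<bar>)"
begin

definition refined :: "(real \<Rightarrow> jet set) \<Rightarrow> real \<Rightarrow> real \<Rightarrow> real \<Rightarrow> bool"
  where "refined W t1 \<eta> t \<longleftrightarrow>
      (\<forall>J\<in>W t1. {J'\<in>window t1 J \<eta> t. m t J' > 0} \<noteq> {} \<and> {J'\<in>window t1 J \<eta> t. m t J' > 0} \<subseteq> W t) \<and>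
      (\<forall>J1\<in>W t1. \<forall>J2\<in>W t1. J1 \<noteq> J2 \<longrightarrow> window t1 J1 \<eta> t \<inter> window t1 J2 \<eta> t = {}) \<and>
      W t \<subseteq> (\<Union>J\<in>W t1. window t1 J \<eta> t)"

text \<open>The windows of the jets in \<open>W t1\<close> are disjoint and the jets in them
  already account for the whole multiplicity of \<open>W t\<close>, so that nothing of \<open>W
  t\<close> lies outside.\<close>

lemma refine:
  assumes fin: "finite (W t1)" and pos: "\<And>t J. J \<in> W t \<Longrightarrow> m t J > 0"
    and total: "\<forall>\<^sub>F t in at t1. finite (W t) \<and> sum (m t) (W t) = sum (m t1) (W t1)"
    and sub: "\<And>J \<eta>. J \<in> W t1 \<Longrightarrow> \<forall>\<^sub>F t in at t1. {J'\<in>window t1 J \<eta> t. m t J' > 0} \<subseteq> W t"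
  shows "\<forall>\<^sub>F \<eta> in at_right 0. \<forall>\<^sub>F t in at t1. refined W t1 \<eta> t"
proof -
  define S where "S J \<eta> t = {J'\<in>window t1 J \<eta> t. m t J' > 0}" for J \<eta> t
  have "\<forall>\<^sub>F \<eta> in at_right 0. \<forall>J\<in>W t1. \<forall>\<^sub>F t in at t1. finite (S J \<eta> t) \<and> sum (m t) (S J \<eta> t) = m t1 J"
    unfolding S_def counts_def[symmetric] using fin count by (intro eventually_ball_finite ballI)
  with windows_separate[OF fin, of t1] show ?thesis
  proof eventually_elim
    case (elim \<eta>)
    have "\<forall>\<^sub>F t in at t1. \<forall>J\<in>W t1. finite (S J \<eta> t) \<and> sum (m t) (S J \<eta> t) = m t1 J"
      using fin elim(2) by (intro eventually_ball_finite)
    moreover have "\<forall>\<^sub>F t in at t1. \<forall>J\<in>W t1. S J \<eta> t \<subseteq> W t"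
      unfolding S_def using fin sub by (intro eventually_ball_finite) auto
    ultimately show ?case using elim(1) total
    proof eventually_elim
      case (elim t)
      have "sum (m t) (\<Union>J\<in>W t1. S J \<eta> t) = (\<Sum>J\<in>W t1. sum (m t) (S J \<eta> t))"
        using fin elim by (intro sum.UNION_disjoint) (auto simp: S_def, blast)
      also have "\<dots> = sum (m t1) (W t1)" using elim by (intro sum.cong) auto
      finally have "(\<Union>J\<in>W t1. S J \<eta> t) = W t"
        using elim pos by (intro sum_subset_eq_imp_eq[of _ _ "m t"]) auto
      then have cov: "W t \<subseteq> (\<Union>J\<in>W t1. window t1 J \<eta> t)" by (auto simp: S_def)
      have ne: "S J \<eta> t \<noteq> {}" if "J \<in> W t1" for J
        using elim(1) pos[OF that] that by (metis less_numeral_extra(3) sum.empty)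
      show ?case unfolding refined_def S_def[symmetric]
        by (intro conjI ballI ne cov) (use elim in simp_all)
    qed
  qed
qed

lemma refine_cover:
  assumes "finite (W t1)" "\<And>t J. J \<in> W t \<Longrightarrow> m t J > 0"
    and "\<forall>\<^sub>F t in at t1. finite (W t) \<and> sum (m t) (W t) = sum (m t1) (W t1)"
    and "\<And>J \<eta>. J \<in> W t1 \<Longrightarrow> \<forall>\<^sub>F t in at t1. {J'\<in>window t1 J \<eta> t. m t J' > 0} \<subseteq> W t"
    and "\<eta> > 0"
  shows "\<forall>\<^sub>F t in at t1. W t \<subseteq> (\<Union>J\<in>W t1. window t1 J \<eta> t)"
proof -
  have "\<forall>\<^sub>F \<eta>' in at_right 0. \<eta>' < \<eta>" using \<open>\<eta> > 0\<close> by (simp add: eventually_at_right_field) auto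
  moreover have "\<forall>\<^sub>F \<eta> in at_right 0. \<forall>\<^sub>F t in at t1. refined W t1 \<eta> t"
    using assms(1-4) by (rule refine)
  ultimately obtain \<eta>' where \<eta>': "\<eta>' < \<eta>" "\<forall>\<^sub>F t in at t1. refined W t1 \<eta>' t"
    using eventually_happens'[OF trivial_limit_at_right_real eventually_conj] by blast
  from \<eta>'(2) show ?thesis
  proof eventually_elim
    case (elim t)
    then have "W t \<subseteq> (\<Union>J\<in>W t1. window t1 J \<eta>' t)" by (simp only: refined_def)
    also have "\<dots> \<subseteq> (\<Union>J\<in>W t1. window t1 J \<eta> t)"
      using \<eta>'(1) by (intro UN_mono window_mono) auto
    finally show ?case .
  qed
qed

lemma countE:
  obtains b where "b > 0" "\<And>\<eta>. 0 < \<eta> \<Longrightarrow> \<eta> < b \<Longrightarrow> counts m t0 J \<eta>"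
  using count[of t0 J] unfolding eventually_at_right_field by blast

text \<open>By induction on the multiplicity. Let \<open>W t\<close> consist of the jets in a
  window of \<open>J0\<close>. At times where \<open>W t\<close> has several members, these have
  smaller multiplicity than \<open>J0\<close>; the set of such times is open, and on each of its
  components branches exist by the induction hypothesis and \<open>branch_extend\<close>. At the
  other times \<open>W t\<close> is a single jet, which everything in \<open>W\<close> follows.
  So the branches on the components, together with the single jets, form a branch, and it
  follows \<open>J0\<close> at \<open>t0\<close> because \<open>W t\<close> eventually lies in
  every smaller window.\<close>

lemma local_branch:
  assumes "m t0 J0 > 0"
  shows "\<exists>\<delta>>0. \<exists>\<phi>. \<phi> t0 = J0 \<and> branch (\<lambda>t J. m t J > 0) \<phi> {t0-\<delta><..<t0+\<delta>}"
  using assms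
proof (induction "m t0 J0" arbitrary: t0 J0 rule: less_induct)
  case less
  define k where "k = m t0 J0"
  obtain b where "b > 0" and b': "\<And>\<eta>. 0 < \<eta> \<Longrightarrow> \<eta> < b \<Longrightarrow> counts m t0 J0 \<eta>"
    by (rule countE[of t0 J0]) (rule that)
  have b: "\<forall>\<^sub>F t in at t0.
      finite {J'\<in>window t0 J0 \<eta> t. m t J' > 0} \<and> sum (m t) {J'\<in>window t0 J0 \<eta> t. m t J' > 0} = k"
    if "0 < \<eta>" "\<eta> < b" for \<eta>
    using b'[OF that] by (simp only: counts_def k_def)
  define \<eta> where "\<eta> = b / 2"
  have \<eta>: "\<eta> > 0" "\<eta> < b" using \<open>b > 0\<close> by (auto simp: \<eta>_def)
  define W where "W t = {J'\<in>window t0 J0 \<eta> t. m t J' > 0}" for t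
  have sum_window: "\<forall>\<^sub>F t in at t0. W t \<subseteq> window t0 J0 \<epsilon> t" if "0 < \<epsilon>" "\<epsilon> \<le> \<eta>" for \<epsilon>
    using b[OF that(1) order_le_less_trans[OF that(2) \<eta>(2)]] b[OF \<eta>]
  proof eventually_elim
    case (elim t)
    have "{J'\<in>window t0 J0 \<epsilon> t. m t J' > 0} = W t"
      unfolding W_def using elim that \<eta> window_mono[OF that(2)]
      by (intro sum_subset_eq_imp_eq[of _ _ "m t"]) auto
    then show ?case by auto
  qed
  have "\<forall>\<^sub>F t in at t0. finite (W t) \<and> sum (m t) (W t) = k \<and> W t \<subseteq> window t0 J0 (\<eta>/2) t"
    using b[OF \<eta>] sum_window[of "\<eta>/2"] \<eta> unfolding W_def[symmetric]
    by (auto elim: eventually_elim2)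
  then obtain \<delta> where "\<delta> > 0" and \<delta>: "\<And>t. t \<noteq> t0 \<Longrightarrow> \<bar>t - t0\<bar> < \<delta> \<Longrightarrow>
      finite (W t) \<and> sum (m t) (W t) = k \<and> W t \<subseteq> window t0 J0 (\<eta>/2) t"
    unfolding eventually_at by (auto simp: dist_real_def)
  define D where "D = ball t0 \<delta> - {t0}"
  have D: "open D" unfolding D_def by auto
  have W: "finite (W t)" "sum (m t) (W t) = k" "W t \<subseteq> window t0 J0 (\<eta>/2) t" if "t \<in> D" for t
    using \<delta>[of t] that by (auto simp: D_def dist_real_def abs_minus_commute)
  have Wpos: "m t J > 0" if "J \<in> W t" for t J using that by (simp add: W_def)
  have Wne: "W t \<noteq> {}" if "t \<in> D" for t using W(2)[OF that] less.prems by (auto simp: k_def)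
  have evD: "\<forall>\<^sub>F t in at t1. t \<in> D" if "t1 \<in> D" for t1
    using D that by (metis eventually_at_topological)
  have Wsub: "\<forall>\<^sub>F t in at t1. window t1 J \<epsilon> t \<subseteq> window t0 J0 \<eta> t" if "t1 \<in> D" "J \<in> W t1" for t1 J \<epsilon>
    using window_open[of J t0 J0 "\<eta>/2" t1 \<eta> \<epsilon>] W[OF that(1)] that \<eta> by (auto simp: D_def)
  have Wsub': "\<forall>\<^sub>F t in at t1. {J'\<in>window t1 J \<epsilon> t. m t J' > 0} \<subseteq> W t" if "t1 \<in> D" "J \<in> W t1" for t1 J \<epsilon>
    using Wsub[OF that, of \<epsilon>] by eventually_elim (auto simp: W_def)
  have Wtotal: "\<forall>\<^sub>F t in at t1. finite (W t) \<and> sum (m t) (W t) = sum (m t1) (W t1)" if "t1 \<in> D" for t1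
    using evD[OF that] by eventually_elim (use W that in auto)
  have ref: "\<forall>\<^sub>F \<epsilon> in at_right 0. \<forall>\<^sub>F t in at t1. refined W t1 \<epsilon> t" if "t1 \<in> D" for t1
    using W(1)[OF that] Wpos Wtotal[OF that] Wsub'[OF that] by (rule refine)
  have cov: "\<forall>\<^sub>F t in at t1. W t \<subseteq> (\<Union>J\<in>W t1. window t1 J \<epsilon> t)" if "t1 \<in> D" "\<epsilon> > 0" for t1 \<epsilon>
    using W(1)[OF that(1)] Wpos Wtotal[OF that(1)] Wsub'[OF that(1)] that(2) by (rule refine_cover)
  define O' where "O' = {t\<in>D. \<exists>J1\<in>W t. \<exists>J2\<in>W t. J1 \<noteq> J2}"
  have openO: "open O'"
  proof (subst open_subopen, intro ballI)
    fix t1 assume t1: "t1 \<in> O'"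
    then have "t1 \<in> D" by (simp add: O'_def)
    obtain \<epsilon> where ev: "\<forall>\<^sub>F t in at t1. refined W t1 \<epsilon> t"
      using eventually_happens'[OF trivial_limit_at_right_real ref[OF \<open>t1 \<in> D\<close>]] by blast
    have "\<forall>\<^sub>F t in at t1. t \<in> O'"
      using ev evD[OF \<open>t1 \<in> D\<close>]
    proof eventually_elim
      case (elim t)
      obtain J1 J2 where J: "J1 \<in> W t1" "J2 \<in> W t1" "J1 \<noteq> J2" using t1 by (auto simp: O'_def)
      have *: "\<exists>J'. J' \<in> window t1 J \<epsilon> t \<and> J' \<in> W t" if "J \<in> W t1" for J
      proof -
        have "{J'\<in>window t1 J \<epsilon> t. m t J' > 0} \<noteq> {}" "{J'\<in>window t1 J \<epsilon> t. m t J' > 0} \<subseteq> W t"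
          using elim(1) that by (auto simp: refined_def)
        then show ?thesis by blast
      qed
      obtain J1' where J1': "J1' \<in> window t1 J1 \<epsilon> t" "J1' \<in> W t" using *[OF J(1)] by blast
      obtain J2' where J2': "J2' \<in> window t1 J2 \<epsilon> t" "J2' \<in> W t" using *[OF J(2)] by blast
      have "window t1 J1 \<epsilon> t \<inter> window t1 J2 \<epsilon> t = {}"
        using elim(1) J unfolding refined_def by blast
      then have "J1' \<noteq> J2'" using J1' J2' by blast
      then show ?case using elim(2) J1' J2' by (auto simp: O'_def)
    qed
    then obtain U where U: "open U" "t1 \<in> U" "\<And>t. t \<in> U \<Longrightarrow> t \<noteq> t1 \<Longrightarrow> t \<in> O'"
      by (auto simp: eventually_at_topological)
    have "U \<subseteq> O'" using U(3) t1 by auto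
    then show "\<exists>T. open T \<and> t1 \<in> T \<and> T \<subseteq> O'" using U(1,2) by auto
  qed
  define P where "P t J \<longleftrightarrow> J \<in> W t" for t J
  have small: "m t J < k" if tJ: "t \<in> O'" "J \<in> W t" for t J
  proof -
    obtain J' where "J' \<in> W t" "J' \<noteq> J" using tJ by (auto simp: O'_def)
    then have "sum (m t) {J, J'} \<le> sum (m t) (W t)"
      using tJ W by (intro sum_mono2) (auto simp: O'_def)
    then show ?thesis using \<open>J' \<noteq> J\<close> W(2)[of t] tJ Wpos[OF \<open>J' \<in> W t\<close>] by (auto simp: O'_def)
  qed
  have comp: "\<exists>\<phi>. branch P \<phi> C" if C: "C \<in> components O'" for C
  proof -
    have CO: "C \<subseteq> O'" "open C" "connected C" "C \<noteq> {}"
      using C openO by (auto simp: in_components_subset in_components_connected in_components_nonempty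
          intro: open_components)
    have CD: "C \<subseteq> D" using CO by (auto simp: O'_def)
    obtain t1 where "t1 \<in> C" using CO by auto
    moreover from this obtain J1 where "J1 \<in> W t1" using Wne CD by blast
    ultimately have t1: "t1 \<in> C" "J1 \<in> W t1" by auto
    have "\<exists>\<phi>. \<phi> t1 = J1 \<and> branch P \<phi> C"
    proof (rule branch_extend)
      fix t J assume t: "t \<in> C" "P t J"
      then have tD: "t \<in> D" "t \<in> O'" "J \<in> W t" using CD CO by (auto simp: P_def)
      have "m t J < m t0 J0" using small tD by (simp add: k_def)
      from less.hyps[OF this] Wpos[OF tD(3)] obtain \<delta>1 \<phi> where \<phi>: "\<delta>1 > 0" "\<phi> t = J"
        "branch (\<lambda>t J. m t J > 0) \<phi> {t-\<delta>1<..<t+\<delta>1}" by auto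
      have "follows \<phi> J t UNIV" using \<phi> by (auto simp: branch_def)
      from followsD[OF this, of 1] Wsub[OF tD(1,3), of 1]
      have "\<forall>\<^sub>F s in at t. \<phi> s \<in> window t0 J0 \<eta> s" by (auto elim: eventually_elim2)
      then obtain \<delta>2 where \<delta>2: "\<delta>2 > 0" "\<And>s. s \<noteq> t \<Longrightarrow> \<bar>s - t\<bar> < \<delta>2 \<Longrightarrow> \<phi> s \<in> window t0 J0 \<eta> s"
        unfolding eventually_at by (auto simp: dist_real_def)
      have win: "\<phi> s \<in> window t0 J0 \<eta> s" if "\<bar>s - t\<bar> < \<delta>2" for s
        using \<delta>2(2)[of s] that \<phi>(2) tD(3) by (cases "s = t") (auto simp: W_def)
      have "branch P \<phi> {t - min \<delta>1 \<delta>2<..<t + min \<delta>1 \<delta>2}"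
        unfolding branch_def
      proof
        fix s assume "s \<in> {t - min \<delta>1 \<delta>2<..<t + min \<delta>1 \<delta>2}"
        then have "s \<in> {t-\<delta>1<..<t+\<delta>1}" "\<bar>s - t\<bar> < \<delta>2" by auto
        then show "P s (\<phi> s) \<and> follows \<phi> (\<phi> s) s UNIV"
          using \<phi>(3) win[of s] unfolding branch_def P_def W_def by blast
      qed
      then show "\<exists>\<delta>>0. \<exists>\<phi>. \<phi> t = J \<and> branch P \<phi> {t-\<delta><..<t+\<delta>}"
        using \<phi>(1,2) \<delta>2(1) by (intro exI[of _ "min \<delta>1 \<delta>2"]) auto
    next
      fix T S \<phi>
      assume T: "T \<in> C" "T \<notin> S" and S: "open S" "connected S" "S \<subseteq> C" "at T within S \<noteq> bot" "branch P \<phi> S"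
      have TD: "T \<in> D" using T CD by auto
      have inS: "\<forall>\<^sub>F t in at T within S. t \<in> S" by (simp add: eventually_at_filter)
      have "\<forall>\<^sub>F t in at T within S. \<exists>J\<in>W T. \<phi> t \<in> window T J \<epsilon> t" if "\<epsilon> > 0" for \<epsilon>
        using filter_leD[OF at_le[OF subset_UNIV] cov[OF TD that]] inS
      proof eventually_elim
        case (elim t)
        have "\<phi> t \<in> W t" using S(5) elim by (auto simp: branch_def P_def)
        then show ?case using elim by auto
      qed
      from branch_limit[OF S(2,1) T(2) S(4) branch_isCont[OF S(5)] W(1)[OF TD] this]
      show "\<exists>J. P T J \<and> follows \<phi> J T S" by (auto simp: P_def)
    qed (use CO t1 in \<open>auto simp: P_def\<close>)
    then show ?thesis by auto
  qed
  then obtain \<Phi> where \<Phi>: "\<And>C. C \<in> components O' \<Longrightarrow> branch P (\<Phi> C) C" by metis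
  define \<phi> where "\<phi> t = (if t = t0 then J0 else if t \<in> O' then \<Phi> (connected_component_set O' t) t
      else (SOME J. J \<in> W t))" for t
  have t0: "t0 \<notin> D" "\<And>t. t \<in> O' \<Longrightarrow> t \<noteq> t0" by (auto simp: D_def O'_def)
  have brO: "branch P \<phi> O'"
  proof (rule branch_local)
    fix t assume t: "t \<in> O'"
    define C where "C = connected_component_set O' t"
    have "C \<in> components O'" using t by (auto simp: components_def C_def)
    moreover have "\<forall>s\<in>C. \<phi> s = \<Phi> C s"
      using t0 connected_component_eq[of _ O' t] connected_component_subset[of O' t]
      by (auto simp: \<phi>_def C_def)
    moreover have "t \<in> C" using t by (simp add: C_def)
    ultimately show "\<exists>U \<psi>. open U \<and> t \<in> U \<and> branch P \<psi> U \<and> (\<forall>s\<in>U. \<phi> s = \<psi> s)"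
      using \<Phi> openO open_components by blast
  qed
  have \<phi>W: "\<phi> t \<in> W t" if "t \<in> D" for t
  proof (cases "t \<in> O'")
    case True
    then show ?thesis using brO by (auto simp: branch_def P_def)
  next
    case False
    then show ?thesis using someI_ex[of "\<lambda>J. J \<in> W t"] Wne[OF that] that t0 by (auto simp: \<phi>_def)
  qed
  have "m t (\<phi> t) > 0 \<and> follows \<phi> (\<phi> t) t UNIV" if "t \<in> ball t0 \<delta>" for t
  proof (cases "t = t0")
    case True
    have "follows \<phi> J0 t0 UNIV" unfolding follows_def
    proof (intro allI impI)
      fix \<epsilon> :: real assume "\<epsilon> > 0"
      then have "\<forall>\<^sub>F t in at t0. W t \<subseteq> window t0 J0 (min \<epsilon> \<eta>) t" using \<eta> by (intro sum_window) auto
      moreover have "\<forall>\<^sub>F t in at t0. t \<in> D"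
        using \<open>\<delta> > 0\<close> by (auto simp: eventually_at D_def dist_commute intro!: exI[of _ \<delta>])
      ultimately show "\<forall>\<^sub>F t in at t0. \<phi> t \<in> window t0 J0 \<epsilon> t"
      proof eventually_elim
        case (elim t)
        then show ?case using \<phi>W[of t] subsetD[OF window_mono[of "min \<epsilon> \<eta>" \<epsilon> t0 J0 t]] by auto
      qed
    qed
    then show ?thesis using True less.prems by (simp add: \<phi>_def)
  next
    case False
    then have tD: "t \<in> D" using that by (simp add: D_def)
    have "follows \<phi> (\<phi> t) t UNIV"
    proof (cases "t \<in> O'")
      case True
      then show ?thesis using brO by (auto simp: branch_def)
    next
      case False
      then have single: "W t = {\<phi> t}" using \<phi>W[OF tD] tD by (auto simp: O'_def)
      show ?thesis unfolding follows_def
      proof (intro allI impI)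
        fix \<epsilon> :: real assume "\<epsilon> > 0"
        from cov[OF tD this] evD[OF tD] show "\<forall>\<^sub>F s in at t. \<phi> s \<in> window t (\<phi> t) \<epsilon> s"
          by eventually_elim (use \<phi>W single in auto)
      qed
    qed
    then show ?thesis using Wpos[OF \<phi>W[OF tD]] by simp
  qed
  then have "branch (\<lambda>t J. m t J > 0) \<phi> {t0-\<delta><..<t0+\<delta>}"
    by (auto simp: branch_def dist_real_def)
  then show ?case using \<open>\<delta> > 0\<close> by (intro exI[of _ \<delta>] conjI exI[of _ \<phi>]) (auto simp: \<phi>_def)
qed

definition positive :: "real \<Rightarrow> jet \<Rightarrow> bool" where "positive t J \<longleftrightarrow> m t J > 0"

text \<open>The values of a branch satisfy the differential inequality \<open>\<bar>f'\<bar>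
  \<le> C * (1 + \<bar>f\<bar>)\<close>, which bounds the derivative of \<open>arsinh f\<close>.\<close>

lemma arsinh_Lipschitz:
  assumes br: "branch positive \<phi> S" and "convex S" and "\<And>t. t \<in> S \<Longrightarrow> \<bar>t\<bar> \<le> T"
    and C: "\<And>t J. \<bar>t\<bar> \<le> T \<Longrightarrow> m t J > 0 \<Longrightarrow> \<bar>jet_slope J\<bar> \<le> C * (1 + \<bar>jet_val J\<bar>)"
    and "s \<in> S" "t \<in> S"
  shows "\<bar>arsinh (jet_val (\<phi> s)) - arsinh (jet_val (\<phi> t))\<bar> \<le> 2 * C * \<bar>s - t\<bar>"
proof -
  define f where "f s = jet_val (\<phi> s)" for s
  have "norm (arsinh (f s) - arsinh (f t)) \<le> (2 * C) * norm (s - t)"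
  proof (rule field_differentiable_bound[OF \<open>convex S\<close>])
    fix z assume z: "z \<in> S"
    have "(f has_real_derivative jet_slope (\<phi> z)) (at z within S)"
      using follows_imp_derivative[of \<phi> z] br z unfolding branch_def f_def[abs_def]
      by (blast intro: DERIV_subset)
    then show "((\<lambda>s. arsinh (f s)) has_field_derivative (1 / sqrt ((f z)\<^sup>2 + 1)) * jet_slope (\<phi> z)) (at z within S)"
      by (rule DERIV_chain2[OF arsinh_real_has_field_derivative])
    have pos: "0 < sqrt ((f z)\<^sup>2 + 1)" by (simp add: add_nonneg_pos)
    have "\<bar>f z\<bar> \<le> sqrt ((f z)\<^sup>2 + 1)" "1 \<le> sqrt ((f z)\<^sup>2 + 1)" by (auto simp: real_le_rsqrt)
    then have le: "1 + \<bar>f z\<bar> \<le> 2 * sqrt ((f z)\<^sup>2 + 1)" by linarith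
    have sl: "\<bar>jet_slope (\<phi> z)\<bar> \<le> C * (1 + \<bar>f z\<bar>)"
      using C[of z "\<phi> z"] br z assms(3)[OF z] by (auto simp: branch_def positive_def f_def)
    have "0 \<le> C * (1 + \<bar>f z\<bar>)" using sl by linarith
    moreover have "0 < 1 + \<bar>f z\<bar>" by linarith
    ultimately have "C \<ge> 0" by (metis mult_neg_pos not_less)
    have "\<bar>jet_slope (\<phi> z)\<bar> \<le> 2 * C * sqrt ((f z)\<^sup>2 + 1)"
      using sl mult_left_mono[OF le \<open>C \<ge> 0\<close>] by (simp add: algebra_simps)
    then show "norm ((1 / sqrt ((f z)\<^sup>2 + 1)) * jet_slope (\<phi> z)) \<le> 2 * C"
      using pos by (simp add: abs_mult pos_divide_le_eq)
  qed (use assms in auto)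
  then show ?thesis by (simp add: f_def)
qed

text \<open>At an end point of its domain \<open>arsinh\<close> of the values of a branch is
  uniformly continuous, hence the values converge to some \<open>z\<close>. The branch then
  follows one of the finitely many jets with value \<open>z\<close>, and counting shows that
  this jet has positive multiplicity.\<close>

lemma global_branch:
  assumes "m t0 J0 > 0"
  shows "\<exists>\<phi>. \<phi> t0 = J0 \<and> branch positive \<phi> UNIV"
proof (rule branch_extend)
  show "\<exists>\<delta>>0. \<exists>\<phi>. \<phi> t = J \<and> branch positive \<phi> {t-\<delta><..<t+\<delta>}" if "positive t J" for t J
    using local_branch[of t J] that by (simp add: positive_def[abs_def])
next
  fix T S \<phi>
  assume T: "T \<notin> S" and S: "open S" "connected S" "at T within S \<noteq> bot" and br: "branch positive \<phi> S"
  obtain C where C: "\<And>t J. \<bar>t\<bar> \<le> \<bar>T\<bar> + 1 \<Longrightarrow> m t J > 0 \<Longrightarrow> \<bar>jet_slope J\<bar> \<le> C * (1 + \<bar>jet_val J\<bar>)"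
    using growth[of "\<bar>T\<bar> + 1"] by blast
  define S' where "S' = S \<inter> ball T 1"
  have "convex S" using S(2) by (simp add: is_interval_connected_1 flip: is_interval_convex_1)
  then have "convex S'" by (auto simp: S'_def intro: convex_Int)
  have br': "branch positive \<phi> S'" using br by (rule branch_subset) (auto simp: S'_def)
  define g where "g t = arsinh (jet_val (\<phi> t))" for t
  have lip: "\<bar>g s - g t\<bar> \<le> 2 * C * \<bar>s - t\<bar>" if "s \<in> S'" "t \<in> S'" for s t
    unfolding g_def by (rule arsinh_Lipschitz[OF br' \<open>convex S'\<close> _ C that]) (auto simp: S'_def dist_real_def)
  have "(2 * \<bar>C\<bar>)-lipschitz_on S' g"
  proof (rule lipschitz_onI)
    fix s t assume "s \<in> S'" "t \<in> S'"
    from lip[OF this] have "\<bar>g s - g t\<bar> \<le> 2 * C * \<bar>s - t\<bar>" .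
    also have "\<dots> \<le> 2 * \<bar>C\<bar> * \<bar>s - t\<bar>" by (intro mult_right_mono) auto
    finally show "dist (g s) (g t) \<le> 2 * \<bar>C\<bar> * dist s t" by (simp add: dist_real_def)
  qed simp
  then have "uniformly_continuous_on S' g" by (rule lipschitz_on_uniformly_continuous)
  moreover have "at T within S' = at T within S"
    by (rule at_within_nhd[of _ "ball T 1"]) (auto simp: S'_def)
  moreover from this have "at T within S' \<noteq> bot" using S(3) by simp
  then have "T \<in> closure S'" by (simp add: trivial_limit_within closure_def)
  ultimately obtain l where l: "(g \<longlongrightarrow> l) (at T within S)"
    using uniformly_continuous_on_extension_at_closure by metis
  define z where "z = sinh l"
  have "((\<lambda>t. sinh (g t)) \<longlongrightarrow> z) (at T within S)" unfolding z_def by (intro tendsto_intros l)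
  then have fz: "((\<lambda>t. jet_val (\<phi> t)) \<longlongrightarrow> z) (at T within S)" by (simp add: g_def)
  obtain \<epsilon> F where \<epsilon>: "\<epsilon> > 0" and F: "finite F" and cov: "\<And>\<eta>. \<eta> > 0 \<Longrightarrow> \<forall>\<^sub>F t in at T. \<forall>J'. m t J' > 0 \<and>
      \<bar>jet_val J' - z\<bar> < \<epsilon> \<longrightarrow> (\<exists>J\<in>F. J' \<in> window T J \<eta> t)"
    using proper[where ?t0.0=T and ?z0.0=z] by blast
  have inS: "\<forall>\<^sub>F t in at T within S. positive t (\<phi> t)"
    using br by (auto simp: eventually_at_filter branch_def)
  have "\<forall>\<^sub>F t in at T within S. \<exists>J\<in>F. \<phi> t \<in> window T J \<eta> t" if "\<eta> > 0" for \<eta>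
    using filter_leD[OF at_le[OF subset_UNIV] cov[OF that]] tendstoD[OF fz \<epsilon>] inS
    by eventually_elim (auto simp: dist_real_def positive_def)
  from branch_limit[OF S(2,1) T S(3) branch_isCont[OF br] F this] obtain J where J: "J \<in> F" "follows \<phi> J T S" by blast
  obtain b where "b > 0" and b: "\<And>\<eta>. 0 < \<eta> \<Longrightarrow> \<eta> < b \<Longrightarrow> counts m T J \<eta>"
    by (rule countE[of T J]) (rule that)
  have c: "counts m T J (b/2)" using b[of "b/2"] \<open>b > 0\<close> by simp
  have b2: "b / 2 > 0" using \<open>b > 0\<close> by simp
  have "\<forall>\<^sub>F t in at T within S. m T J > 0"
    using filter_leD[OF at_le[OF subset_UNIV] c[unfolded counts_def]] followsD[OF J(2) b2] inS
  proof eventually_elim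
    case (elim t)
    let ?A = "{J'\<in>window T J (b/2) t. m t J' > 0}"
    have "\<phi> t \<in> ?A" using elim by (simp add: positive_def)
    then have "m t (\<phi> t) \<le> sum (m t) ?A" using elim by (intro member_le_sum) auto
    then show ?case using elim by (simp add: positive_def)
  qed
  then have "m T J > 0" using S(3) by (simp add: eventually_const)
  then show "\<exists>J. positive T J \<and> follows \<phi> J T S" using J by (auto simp: positive_def)
qed (use assms in \<open>auto simp: positive_def\<close>)

definition remove :: "(real \<Rightarrow> jet) \<Rightarrow> real \<Rightarrow> jet \<Rightarrow> nat"
  where "remove \<phi> t J = m t J - (if \<phi> t = J then 1 else 0)"

lemma remove_add:
  assumes "branch positive \<phi> UNIV"
  shows "m t J = remove \<phi> t J + (if \<phi> t = J then 1 else 0)"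
  using assms by (auto simp: remove_def branch_def positive_def Suc_leI)

text \<open>Near \<open>t0\<close> the removed branch lies in the window of its own jet at
  \<open>t0\<close> and, as windows are disjoint, in no other.\<close>

lemma jet_system_remove:
  assumes br: "branch positive \<phi> UNIV"
  shows "jet_system (remove \<phi>)"
proof
  have le: "remove \<phi> t J \<le> m t J" for t J by (simp add: remove_def)
  have pos: "m t J > 0" if "remove \<phi> t J > 0" for t J using that le[of t J] by linarith
  have fol: "follows \<phi> (\<phi> t) t UNIV" for t using br by (simp add: branch_def)
  show "\<exists>C. \<forall>t J. \<bar>t\<bar> \<le> T \<and> remove \<phi> t J > 0 \<longrightarrow> \<bar>jet_slope J\<bar> \<le> C * (1 + \<bar>jet_val J\<bar>)" for T
    using growth[of T] pos by meson
  show "\<exists>\<epsilon>>0. \<exists>F. finite F \<and> (\<forall>J\<in>F. jet_val J = z0) \<and>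
      (\<forall>J. remove \<phi> t0 J > 0 \<and> \<bar>jet_val J - z0\<bar> < \<epsilon> \<longrightarrow> J \<in> F) \<and>
      (\<forall>\<eta>>0. \<forall>\<^sub>F t in at t0. \<forall>J'. remove \<phi> t J' > 0 \<and> \<bar>jet_val J' - z0\<bar> < \<epsilon> \<longrightarrow> (\<exists>J\<in>F. J' \<in> window t0 J \<eta> t))"
    for t0 z0
  proof -
    obtain \<epsilon> F where *: "\<epsilon> > 0" "finite F" "\<forall>J\<in>F. jet_val J = z0"
      "\<forall>J. m t0 J > 0 \<and> \<bar>jet_val J - z0\<bar> < \<epsilon> \<longrightarrow> J \<in> F" and
      ev: "\<And>\<eta>. \<eta> > 0 \<Longrightarrow> \<forall>\<^sub>F t in at t0. \<forall>J'. m t J' > 0 \<and> \<bar>jet_val J' - z0\<bar> < \<epsilon> \<longrightarrow> (\<exists>J\<in>F. J' \<in> window t0 J \<eta> t)"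
      using proper[where ?t0.0=t0 and ?z0.0=z0] by blast
    have a: "\<forall>\<eta>>0. \<forall>\<^sub>F t in at t0. \<forall>J'. remove \<phi> t J' > 0 \<and> \<bar>jet_val J' - z0\<bar> < \<epsilon> \<longrightarrow>
        (\<exists>J\<in>F. J' \<in> window t0 J \<eta> t)"
    proof (intro allI impI)
      fix \<eta> :: real assume "\<eta> > 0"
      from ev[OF this] show "\<forall>\<^sub>F t in at t0. \<forall>J'. remove \<phi> t J' > 0 \<and> \<bar>jet_val J' - z0\<bar> < \<epsilon> \<longrightarrow>
        (\<exists>J\<in>F. J' \<in> window t0 J \<eta> t)"
        by eventually_elim (use pos in simp)
    qed
    have b: "\<forall>J. remove \<phi> t0 J > 0 \<and> \<bar>jet_val J - z0\<bar> < \<epsilon> \<longrightarrow> J \<in> F" using *(4) pos by simp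
    show ?thesis by (intro exI[of _ \<epsilon>] conjI exI[of _ F]) (fact *(1) *(2) *(3) a b)+
  qed
  show "\<forall>\<^sub>F \<eta> in at_right 0. counts (remove \<phi>) t0 J \<eta>" for t0 J
    using count[of t0 J] windows_separate[of "{J, \<phi> t0}" t0, simplified] eventually_at_right_less[of "0::real"]
  proof eventually_elim
    case (elim \<eta>)
    show ?case unfolding counts_def
      using elim(1)[unfolded counts_def] elim(2) followsD[OF fol \<open>0 < \<eta>\<close>, of t0]
    proof eventually_elim
      case (elim t)
      let ?A = "{J'\<in>window t0 J \<eta> t. m t J' > 0}" and ?B = "{J'\<in>window t0 J \<eta> t. remove \<phi> t J' > 0}"
      have fin: "finite ?A" "?B \<subseteq> ?A" using elim pos by auto
      then have "finite ?B" by (rule finite_subset[rotated])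
      have "sum (remove \<phi> t) ?A = sum (remove \<phi> t) ?B"
        using fin by (intro sum.mono_neutral_right) auto
      moreover have "sum (m t) ?A = sum (remove \<phi> t) ?A + (\<Sum>J'\<in>?A. if \<phi> t = J' then 1 else 0)"
        using remove_add[OF br, of t] by (simp add: sum.distrib)
      moreover have "(\<Sum>J'\<in>?A. if \<phi> t = J' then 1 else 0) = (if \<phi> t \<in> ?A then 1 else 0)"
        using fin by simp
      moreover have "m t (\<phi> t) > 0" using br by (simp add: branch_def positive_def)
      moreover have "\<phi> t \<in> window t0 J \<eta> t \<longleftrightarrow> J = \<phi> t0" using elim by auto
      ultimately have "sum (remove \<phi> t) ?B + (if J = \<phi> t0 then 1 else 0) = m t0 J"
        using elim by simp
      then have "sum (remove \<phi> t) ?B = remove \<phi> t0 J"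
        using remove_add[OF br, of t0 J] by (cases "J = \<phi> t0") simp_all
      with \<open>finite ?B\<close> show ?case by (rule conjI)
    qed
  qed
qed

lemma finite_jets_bounded: "finite {J. m t0 J > 0 \<and> \<bar>jet_val J\<bar> \<le> M}"
proof -
  obtain \<epsilon> F where *: "\<And>z. \<epsilon> z > 0" "\<And>z. finite (F z)"
    "\<And>z J. m t0 J > 0 \<Longrightarrow> \<bar>jet_val J - z\<bar> < \<epsilon> z \<Longrightarrow> J \<in> F z"
    using proper[where ?t0.0=t0] by metis
  have cover: "{-M..M} \<subseteq> (\<Union>z\<in>{-M..M}. ball z (\<epsilon> z))" using *(1) by auto
  obtain Z where Z: "finite Z" "{-M..M} \<subseteq> (\<Union>z\<in>Z. ball z (\<epsilon> z))"
    by (rule compactE_image[OF compact_Icc _ cover]) (simp_all add: that)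
  have "{J. m t0 J > 0 \<and> \<bar>jet_val J\<bar> \<le> M} \<subseteq> (\<Union>z\<in>Z. F z)"
  proof clarify
    fix J assume J: "m t0 J > 0" "\<bar>jet_val J\<bar> \<le> M"
    then have "jet_val J \<in> {-M..M}" by auto
    then obtain z where "z \<in> Z" "jet_val J \<in> ball z (\<epsilon> z)" using Z by blast
    then show "J \<in> (\<Union>z\<in>Z. F z)" using *(3)[OF J(1)] by (auto simp: dist_real_def abs_minus_commute)
  qed
  then show ?thesis using Z(1) *(2) by (meson finite_UN finite_subset)
qed

text \<open>The choice of the least value at time 0 guarantees that every jet at time 0 is used
  up after finitely many removals.\<close>

definition least_branch :: "(real \<Rightarrow> jet) \<Rightarrow> bool"
  where "least_branch \<phi> \<longleftrightarrow> branch positive \<phi> UNIV \<and> (\<forall>J. m 0 J > 0 \<longrightarrow> \<bar>jet_val (\<phi> 0)\<bar> \<le> \<bar>jet_val J\<bar>)"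

lemma least_branch_exists:
  assumes "m 0 J0 > 0"
  shows "\<exists>\<phi>. least_branch \<phi>"
proof -
  let ?A = "{J. m 0 J > 0 \<and> \<bar>jet_val J\<bar> \<le> \<bar>jet_val J0\<bar>}"
  have "finite ?A" "?A \<noteq> {}" using finite_jets_bounded assms by auto
  then obtain J where J: "J \<in> ?A" "\<And>J'. J' \<in> ?A \<Longrightarrow> \<bar>jet_val J\<bar> \<le> \<bar>jet_val J'\<bar>"
    using ex_min_if_finite[of "(\<lambda>J. \<bar>jet_val J\<bar>) ` ?A"]
    by (metis (no_types, lifting) arg_min_if_finite(1) arg_min_least)
  obtain \<phi> where "\<phi> 0 = J" "branch positive \<phi> UNIV" using global_branch J by blast
  moreover have "\<bar>jet_val J\<bar> \<le> \<bar>jet_val J'\<bar>" if "m 0 J' > 0" for J'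
    using J that by (cases "\<bar>jet_val J'\<bar> \<le> \<bar>jet_val J0\<bar>") auto
  ultimately show ?thesis by (auto simp: least_branch_def)
qed

text \<open>Any branch through \<open>J\<close> at time \<open>t\<close> meets time 0 in a
  bounded region. Once all jets in this region are used up, \<open>J\<close> must be used up as
  well.\<close>

lemma jets_reach_zero:
  obtains M where "\<And>\<phi>. branch positive \<phi> UNIV \<Longrightarrow> \<phi> t = J \<Longrightarrow> \<bar>jet_val (\<phi> 0)\<bar> \<le> M"
proof -
  obtain C where C: "\<And>s J. \<bar>s\<bar> \<le> \<bar>t\<bar> \<Longrightarrow> m s J > 0 \<Longrightarrow> \<bar>jet_slope J\<bar> \<le> C * (1 + \<bar>jet_val J\<bar>)"
    using growth[of "\<bar>t\<bar>"] by blast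
  show thesis
  proof (rule that)
    fix \<phi> assume \<phi>: "branch positive \<phi> UNIV" "\<phi> t = J"
    have "\<bar>arsinh (jet_val (\<phi> 0)) - arsinh (jet_val (\<phi> t))\<bar> \<le> 2 * C * \<bar>0 - t\<bar>"
      by (rule arsinh_Lipschitz[OF branch_subset[OF \<phi>(1)] _ _ C, of "{-\<bar>t\<bar>..\<bar>t\<bar>}"]) auto
    then have le: "\<bar>arsinh (jet_val (\<phi> 0))\<bar> \<le> 2 * C * \<bar>t\<bar> + \<bar>arsinh (jet_val J)\<bar>" using \<phi>(2) by simp
    have "\<bar>sinh x\<bar> = sinh \<bar>x\<bar>" for x :: real by (simp add: abs_if)
    then have "\<bar>jet_val (\<phi> 0)\<bar> = sinh \<bar>arsinh (jet_val (\<phi> 0))\<bar>" by (metis sinh_arsinh_real)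
    also have "\<dots> \<le> sinh (2 * C * \<bar>t\<bar> + \<bar>arsinh (jet_val J)\<bar>)" using le by (simp only: sinh_real_le_iff)
    finally show "\<bar>jet_val (\<phi> 0)\<bar> \<le> sinh (2 * C * \<bar>t\<bar> + \<bar>arsinh (jet_val J)\<bar>)" .
  qed
qed

end

definition alive :: "(real \<Rightarrow> jet \<Rightarrow> nat) \<Rightarrow> bool" where "alive s \<longleftrightarrow> (\<exists>J. s 0 J > 0)"

definition pick :: "(real \<Rightarrow> jet \<Rightarrow> nat) \<Rightarrow> real \<Rightarrow> jet"
  where "pick s = (SOME \<phi>. jet_system.least_branch s \<phi>)"

definition peel :: "(real \<Rightarrow> jet \<Rightarrow> nat) \<Rightarrow> real \<Rightarrow> jet \<Rightarrow> nat"
  where "peel s = (if alive s then jet_system.remove s (pick s) else s)"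

lemma pick_least_branch:
  assumes "jet_system s" "alive s"
  shows "jet_system.least_branch s (pick s)"
proof -
  obtain J where "s 0 J > 0" using assms(2) by (auto simp: alive_def)
  from jet_system.least_branch_exists[OF assms(1) this] show ?thesis
    unfolding pick_def by (rule someI_ex)
qed

lemma pick_branch:
  assumes "jet_system s" "alive s"
  shows "branch (jet_system.positive s) (pick s) UNIV"
  using pick_least_branch[OF assms] jet_system.least_branch_def[OF assms(1)] by blast

lemma jet_system_peel: "jet_system s \<Longrightarrow> jet_system (peel s)"
  unfolding peel_def using pick_branch jet_system.jet_system_remove by auto

lemma peel_add:
  assumes "jet_system s"
  shows "s t J = peel s t J + (if alive s \<and> pick s t = J then 1 else 0)"
  using jet_system.remove_add[OF assms pick_branch[OF assms], of t J] by (auto simp: peel_def)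

text \<open>Branches are split off one after the other, and \<open>res K\<close> is what remains
  after \<open>K\<close> steps. The point is that it vanishes at a given jet for large
  \<open>K\<close>: the number \<open>c K\<close> of remaining jets at time 0 from which the
  given one could be reached decreases strictly until it is 0.\<close>

theorem jet_system_parameterization:
  assumes "jet_system m"
  shows "\<exists>N \<phi>s. (\<forall>i. enat i < N \<longrightarrow> branch (\<lambda>t J. m t J > 0) (\<phi>s i) UNIV) \<and>
    (\<forall>t J. finite {i. enat i < N \<and> \<phi>s i t = J} \<and> card {i. enat i < N \<and> \<phi>s i t = J} = m t J)"
proof -
  define res where "res i = (peel ^^ i) m" for i
  have res_Suc: "res (Suc i) = peel (res i)" for i by (simp add: res_def)
  have js: "jet_system (res i)" for i
    by (induction i) (simp_all add: res_Suc jet_system_peel, simp add: res_def assms)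
  define live where "live i \<longleftrightarrow> alive (res i)" for i
  define \<phi>s where "\<phi>s i = pick (res i)" for i
  have step: "res i t J = res (Suc i) t J + (if live i \<and> \<phi>s i t = J then 1 else 0)" for i t J
    using peel_add[OF js, of i t J] by (simp add: res_Suc live_def \<phi>s_def)
  have decomp: "m t J = res j t J + card {i. i < j \<and> live i \<and> \<phi>s i t = J}" for j t J
  proof (induction j)
    case 0
    then show ?case by (simp add: res_def)
  next
    case (Suc j)
    have "{i. i < Suc j \<and> live i \<and> \<phi>s i t = J} = {i. i < j \<and> live i \<and> \<phi>s i t = J} \<union>
        (if live j \<and> \<phi>s j t = J then {j} else {})" by (auto simp: less_Suc_eq)
    then have "card {i. i < Suc j \<and> live i \<and> \<phi>s i t = J} = card {i. i < j \<and> live i \<and> \<phi>s i t = J} +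
        (if live j \<and> \<phi>s j t = J then 1 else 0)" by simp
    then show ?case using Suc step[of j t J] by simp
  qed
  have res_le: "res j t J \<le> m t J" for j t J using decomp[of t J j] by simp
  have dead_Suc: "\<not> live (Suc i)" if "\<not> live i" for i
    using that by (simp add: live_def res_Suc peel_def)
  have live_mono: "live i" if "live j" "i \<le> j" for i j
    using that(2,1) by (induction rule: dec_induct) (use dead_Suc in auto)
  define N where "N = (if \<forall>i. live i then \<infinity> else enat (LEAST i. \<not> live i))"
  have N: "enat i < N \<longleftrightarrow> live i" for i
  proof (cases "\<forall>i. live i")
    case False
    then have "\<not> live (LEAST i. \<not> live i)" by (metis LeastI)
    then have "i < (LEAST i. \<not> live i) \<longleftrightarrow> live i"
      using not_less_Least[of i "\<lambda>i. \<not> live i"] live_mono[of i "LEAST i. \<not> live i"]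
      by (metis live_mono not_less)
    then show ?thesis using False by (simp add: N_def)
  qed (simp add: N_def)
  have br: "branch (jet_system.positive (res i)) (\<phi>s i) UNIV" if "live i" for i
    using pick_branch[OF js] that by (simp add: live_def \<phi>s_def)
  have pos: "res i t (\<phi>s i t) > 0" if "live i" for i t
    using br[OF that] by (simp add: branch_def jet_system.positive_def[OF js])
  have br': "branch (\<lambda>t J. m t J > 0) (\<phi>s i) UNIV" if "live i" for i
    using br[OF that] res_le pos[OF that] unfolding branch_def by (metis less_le_trans)
  have exhaust: "\<exists>K. res K t J = 0" for t J
  proof -
    obtain M where M: "\<And>\<phi>. branch (jet_system.positive m) \<phi> UNIV \<Longrightarrow> \<phi> t = J \<Longrightarrow> \<bar>jet_val (\<phi> 0)\<bar> \<le> M"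
      by (rule jet_system.jets_reach_zero[OF assms, of t J]) (rule that)
    define A where "A = {J. m 0 J > 0 \<and> \<bar>jet_val J\<bar> \<le> M}"
    have A: "finite A" unfolding A_def by (rule jet_system.finite_jets_bounded[OF assms])
    define c where "c i = sum (res i 0) A" for i
    have c_step: "c (Suc i) < c i" if "c i > 0" for i
    proof -
      obtain J1 where J1: "J1 \<in> A" "res i 0 J1 > 0" using \<open>c i > 0\<close> unfolding c_def
        by (metis bot_nat_0.not_eq_extremum sum.neutral)
      then have "live i" by (auto simp: live_def alive_def)
      then have "jet_system.least_branch (res i) (\<phi>s i)"
        using pick_least_branch[OF js] by (simp add: live_def \<phi>s_def)
      then have "\<bar>jet_val (\<phi>s i 0)\<bar> \<le> \<bar>jet_val J1\<bar>"
        using J1 by (simp add: jet_system.least_branch_def[OF js])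
      then have inA: "\<phi>s i 0 \<in> A"
        using J1 pos[OF \<open>live i\<close>, of 0] res_le[of i 0 "\<phi>s i 0"] by (auto simp: A_def)
      have "c i = c (Suc i) + (\<Sum>J\<in>A. if live i \<and> \<phi>s i 0 = J then 1 else 0)"
        unfolding c_def using step[of i 0] by (simp add: sum.distrib)
      then show ?thesis using A inA \<open>live i\<close> by simp
    qed
    have "c i \<le> c 0 - i" for i
    proof (induction i)
      case (Suc i)
      have "c (Suc i) \<le> c i" unfolding c_def using step[of i 0] by (intro sum_mono) simp
      then show ?case using Suc c_step[of i] by (cases "c i > 0") auto
    qed simp
    then have "c (c 0) = 0" by (metis diff_self_eq_0 le_zero_eq)
    then have zero: "res (c 0) 0 J' = 0" if "J' \<in> A" for J' using A that by (simp add: c_def)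
    have "res (c 0) t J = 0"
    proof (rule ccontr)
      assume "res (c 0) t J \<noteq> 0"
      then obtain \<phi> where \<phi>: "\<phi> t = J" "branch (jet_system.positive (res (c 0))) \<phi> UNIV"
        using jet_system.global_branch[OF js] by blast
      then have p: "res (c 0) s (\<phi> s) > 0" for s
        by (simp add: branch_def jet_system.positive_def[OF js])
      then have "m s (\<phi> s) > 0" for s using res_le by (metis less_le_trans)
      then have "branch (jet_system.positive m) \<phi> UNIV"
        using \<phi>(2) by (simp add: branch_def jet_system.positive_def[OF assms])
      from M[OF this \<phi>(1)] have "\<phi> 0 \<in> A" using \<open>\<And>s. m s (\<phi> s) > 0\<close> by (simp add: A_def)
      then show False using zero p[of 0] by auto
    qed
    then show ?thesis by blast
  qed
  have "finite {i. live i \<and> \<phi>s i t = J} \<and> card {i. live i \<and> \<phi>s i t = J} = m t J" for t J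
  proof -
    obtain K where K: "res K t J = 0" using exhaust by blast
    have "res (Suc i) t J \<le> res i t J" for i using step[of i t J] by simp
    then have mono: "res j t J \<le> res i t J" if "i \<le> j" for i j
      using that by (rule lift_Suc_antimono_le)
    have "i < K" if "live i" "\<phi>s i t = J" for i
    proof (rule ccontr)
      assume "\<not> i < K"
      then have "res i t J = 0" using mono[of K i] K by simp
      then show False using pos[OF that(1), of t] that(2) by simp
    qed
    then have "{i. live i \<and> \<phi>s i t = J} = {i. i < K \<and> live i \<and> \<phi>s i t = J}" by auto
    then show ?thesis using decomp[of t J K] K by simp
  qed
  then show ?thesis using br' N by (intro exI[of _ N] exI[of _ \<phi>s]) simp
qed

section \<open>Quadratic expansions of convex functions\<close>

text \<open>A Peano expansion of order 2; the set \<open>S\<close> is there for one-sided ones.\<close>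

definition expands :: "(real \<Rightarrow> real) \<Rightarrow> real \<Rightarrow> real \<Rightarrow> real \<Rightarrow> real \<Rightarrow> real set \<Rightarrow> bool"
  where "expands G A B D t0 S \<longleftrightarrow> (\<forall>\<kappa>>0. \<forall>\<^sub>F t in at t0 within S.
    \<bar>G t - (A + B * (t - t0) + D * (t - t0)\<^sup>2)\<bar> \<le> \<kappa> * (t - t0)\<^sup>2)"

lemma expands_add:
  assumes "expands G A B D t0 S" "expands G' A' B' D' t0 S"
  shows "expands (\<lambda>t. G t + G' t) (A + A') (B + B') (D + D') t0 S"
  unfolding expands_def
proof (intro allI impI)
  fix \<kappa> :: real assume "\<kappa> > 0"
  then have "\<forall>\<^sub>F t in at t0 within S. \<bar>G t - (A + B * (t - t0) + D * (t - t0)\<^sup>2)\<bar> \<le> \<kappa> / 2 * (t - t0)\<^sup>2"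
    "\<forall>\<^sub>F t in at t0 within S. \<bar>G' t - (A' + B' * (t - t0) + D' * (t - t0)\<^sup>2)\<bar> \<le> \<kappa> / 2 * (t - t0)\<^sup>2"
    using assms half_gt_zero unfolding expands_def by blast+
  then show "\<forall>\<^sub>F t in at t0 within S.
      \<bar>G t + G' t - (A + A' + (B + B') * (t - t0) + (D + D') * (t - t0)\<^sup>2)\<bar> \<le> \<kappa> * (t - t0)\<^sup>2"
  proof eventually_elim
    case (elim t)
    have "G t + G' t - (A + A' + (B + B') * (t - t0) + (D + D') * (t - t0)\<^sup>2) =
      (G t - (A + B * (t - t0) + D * (t - t0)\<^sup>2)) + (G' t - (A' + B' * (t - t0) + D' * (t - t0)\<^sup>2))"
      by (simp add: distrib_right)
    moreover have "\<kappa> * (t - t0)\<^sup>2 = \<kappa> / 2 * (t - t0)\<^sup>2 + \<kappa> / 2 * (t - t0)\<^sup>2" by simp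
    ultimately show ?case using elim by linarith
  qed
qed

lemma expands_exact:
  assumes "\<And>t. G t = A + B * (t - t0) + D * (t - t0)\<^sup>2"
  shows "expands G A B D t0 S"
  unfolding expands_def assms by (auto intro!: always_eventually)

lemma expands_sum:
  assumes "\<And>j. j < k \<Longrightarrow> expands (G j) (a j) (b j) (d j) t0 S"
  shows "expands (\<lambda>t. \<Sum>j<k. G j t) (\<Sum>j<k. a j) (\<Sum>j<k. b j) (\<Sum>j<(k::nat). d j) t0 S"
  using assms
proof (induction k)
  case 0
  then show ?case by (auto intro: expands_exact)
next
  case (Suc k)
  then show ?case by (auto intro: expands_add)
qed

lemma expands_reciprocal:
  assumes w: "w > 0" and Y: "expands Y w \<mu> \<nu> t0 S"
  shows "expands (\<lambda>t. 1 / Y t) (1 / w) (- \<mu> / w\<^sup>2) (\<mu>\<^sup>2 / w ^ 3 - \<nu> / w\<^sup>2) t0 S"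
  unfolding expands_def
proof (intro allI impI)
  fix \<kappa> :: real assume "\<kappa> > 0"
  define a b c where "a = 1 / w" "b = - \<mu> / w\<^sup>2" "c = \<mu>\<^sup>2 / w ^ 3 - \<nu> / w\<^sup>2"
  define K1 where "K1 = \<bar>b * \<nu> + c * \<mu>\<bar> + \<bar>c * \<nu>\<bar>"
  define K2 where "K2 = \<bar>a\<bar> + \<bar>b\<bar> + \<bar>c\<bar>"
  have K: "K1 \<ge> 0" "K2 \<ge> 0" by (auto simp: K1_def K2_def)
  define \<kappa>' where "\<kappa>' = min 1 (\<kappa> * w / (4 * (K2 + 1)))"
  have "\<kappa>' > 0" using \<open>\<kappa> > 0\<close> w K by (simp add: \<kappa>'_def)
  define d where "d = min 1 (\<kappa> * w / (4 * (K1 + 1)))"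
  have "d > 0" using \<open>\<kappa> > 0\<close> w K by (simp add: d_def)
  have "\<forall>\<^sub>F t in at t0. 0 < w / 2 + \<mu> * (t - t0) + \<nu> * (t - t0)\<^sup>2 - (t - t0)\<^sup>2"
    by (rule eventually_pos_at) (use w in \<open>auto intro!: continuous_intros\<close>)
  moreover have "\<forall>\<^sub>F t in at t0. 0 < d - \<bar>t - t0\<bar>"
    by (rule eventually_pos_at) (use \<open>d > 0\<close> in \<open>auto intro!: continuous_intros\<close>)
  ultimately have "\<forall>\<^sub>F t in at t0. 0 < w / 2 + \<mu> * (t - t0) + \<nu> * (t - t0)\<^sup>2 - (t - t0)\<^sup>2 \<and> 0 < d - \<bar>t - t0\<bar>"
    by (rule eventually_conj)
  then have "\<forall>\<^sub>F t in at t0 within S. 0 < w / 2 + \<mu> * (t - t0) + \<nu> * (t - t0)\<^sup>2 - (t - t0)\<^sup>2 \<and> 0 < d - \<bar>t - t0\<bar>"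
    by (rule filter_leD[OF at_le[OF subset_UNIV]])
  moreover have "\<forall>\<^sub>F t in at t0 within S. \<bar>Y t - (w + \<mu> * (t - t0) + \<nu> * (t - t0)\<^sup>2)\<bar> \<le> \<kappa>' * (t - t0)\<^sup>2"
    using Y \<open>\<kappa>' > 0\<close> by (simp add: expands_def)
  ultimately show "\<forall>\<^sub>F t in at t0 within S. \<bar>1 / Y t - (1 / w + - \<mu> / w\<^sup>2 * (t - t0) +
      (\<mu>\<^sup>2 / w ^ 3 - \<nu> / w\<^sup>2) * (t - t0)\<^sup>2)\<bar> \<le> \<kappa> * (t - t0)\<^sup>2"
  proof eventually_elim
    case (elim t)
    define h where "h = t - t0"
    define e where "e = Y t - (w + \<mu> * h + \<nu> * h\<^sup>2)"
    define P where "P = a + b * h + c * h\<^sup>2"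
    have h: "\<bar>h\<bar> \<le> d" "\<bar>h\<bar> \<le> 1" using elim(1) by (auto simp: h_def d_def)
    have h2: "h\<^sup>2 \<le> 1" using h(2) by (simp add: abs_square_le_1)
    have e: "\<bar>e\<bar> \<le> \<kappa>' * h\<^sup>2" using elim(2) by (simp add: e_def h_def)
    also have "\<dots> \<le> 1 * h\<^sup>2" by (intro mult_right_mono) (auto simp: \<kappa>'_def)
    finally have "\<bar>e\<bar> \<le> h\<^sup>2" by simp
    then have Y2: "Y t > w / 2" using elim(1) by (auto simp: e_def h_def)
    then have Y0: "Y t > 0" using w by linarith
    have abc: "a * w = 1" "a * \<mu> + b * w = 0" "a * \<nu> + b * \<mu> + c * w = 0"
      using w by (auto simp: a_b_c_def field_simps power2_eq_square power3_eq_cube)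
    have "P * Y t = a * w + (a * \<mu> + b * w) * h + (a * \<nu> + b * \<mu> + c * w) * h\<^sup>2
        + ((b * \<nu> + c * \<mu>) * h + c * \<nu> * h\<^sup>2) * h\<^sup>2 + P * e"
      unfolding P_def e_def by (simp add: algebra_simps power2_eq_square)
    then have PY: "1 - P * Y t = - (((b * \<nu> + c * \<mu>) * h + c * \<nu> * h\<^sup>2) * h\<^sup>2 + P * e)"
      using abc by simp
    have hh: "h\<^sup>2 \<le> \<bar>h\<bar>" using mult_right_mono[OF h(2), of "\<bar>h\<bar>"] by (simp add: power2_eq_square flip: abs_mult)
    have "\<bar>(b * \<nu> + c * \<mu>) * h + c * \<nu> * h\<^sup>2\<bar> \<le> \<bar>b * \<nu> + c * \<mu>\<bar> * \<bar>h\<bar> + \<bar>c * \<nu>\<bar> * h\<^sup>2"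
      using abs_triangle_ineq[of "(b * \<nu> + c * \<mu>) * h" "c * \<nu> * h\<^sup>2"] by (simp add: abs_mult)
    also have "\<dots> \<le> K1 * \<bar>h\<bar>" using mult_left_mono[OF hh, of "\<bar>c * \<nu>\<bar>"] by (simp add: K1_def distrib_right)
    finally have "\<bar>((b * \<nu> + c * \<mu>) * h + c * \<nu> * h\<^sup>2) * h\<^sup>2\<bar> \<le> K1 * \<bar>h\<bar> * h\<^sup>2"
      by (simp add: abs_mult mult_right_mono)
    also have "\<dots> \<le> \<kappa> * w / 4 * h\<^sup>2"
    proof (rule mult_right_mono)
      have "K1 * \<bar>h\<bar> \<le> (K1 + 1) * (\<kappa> * w / (4 * (K1 + 1)))"
        using h(1) K by (intro mult_mono) (auto simp: d_def)
      moreover have "(K1 + 1) * (\<kappa> * w / (4 * (K1 + 1))) = \<kappa> * w / 4"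
        using K by (simp add: field_simps add_nonneg_eq_0_iff)
      ultimately show "K1 * \<bar>h\<bar> \<le> \<kappa> * w / 4" by (rule ord_le_eq_trans)
    qed simp
    finally have 1: "\<bar>((b * \<nu> + c * \<mu>) * h + c * \<nu> * h\<^sup>2) * h\<^sup>2\<bar> \<le> \<kappa> * w / 4 * h\<^sup>2" .
    have "\<bar>P\<bar> \<le> \<bar>a\<bar> + \<bar>b * h\<bar> + \<bar>c * h\<^sup>2\<bar>" unfolding P_def by linarith
    also have "\<dots> \<le> K2"
      using mult_left_mono[OF h(2), of "\<bar>b\<bar>"] mult_left_mono[OF h2, of "\<bar>c\<bar>"] by (simp add: K2_def abs_mult)
    finally have "\<bar>P * e\<bar> \<le> K2 * (\<kappa>' * h\<^sup>2)" using e K by (simp add: abs_mult mult_mono)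
    also have "\<dots> \<le> \<kappa> * w / 4 * h\<^sup>2"
    proof -
      have "K2 * \<kappa>' \<le> (K2 + 1) * (\<kappa> * w / (4 * (K2 + 1)))"
        using K \<open>\<kappa>' > 0\<close> by (intro mult_mono) (auto simp: \<kappa>'_def)
      moreover have "(K2 + 1) * (\<kappa> * w / (4 * (K2 + 1))) = \<kappa> * w / 4"
        using K by (simp add: field_simps add_nonneg_eq_0_iff)
      ultimately have "K2 * \<kappa>' \<le> \<kappa> * w / 4" by (rule ord_le_eq_trans)
      then show ?thesis using mult_right_mono[of "K2 * \<kappa>'" "\<kappa> * w / 4" "h\<^sup>2"] by (simp add: mult.assoc)
    qed
    finally have 2: "\<bar>P * e\<bar> \<le> \<kappa> * w / 4 * h\<^sup>2" .
    have "\<bar>1 - P * Y t\<bar> \<le> \<kappa> * w / 4 * h\<^sup>2 + \<kappa> * w / 4 * h\<^sup>2"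
      unfolding PY using 1 2 by linarith
    also have "\<dots> = \<kappa> * h\<^sup>2 * (w / 2)" by simp
    also have "\<dots> \<le> \<kappa> * h\<^sup>2 * Y t" using Y2 \<open>\<kappa> > 0\<close> by (intro mult_left_mono) auto
    finally have "\<bar>1 - P * Y t\<bar> / Y t \<le> \<kappa> * h\<^sup>2" using Y0 by (simp add: pos_divide_le_eq)
    moreover have "1 / Y t - P = (1 - P * Y t) / Y t" using Y0 by (simp add: field_simps)
    ultimately have "\<bar>1 / Y t - P\<bar> \<le> \<kappa> * h\<^sup>2" using Y0 by (simp add: abs_divide)
    then show ?case by (simp add: P_def h_def a_b_c_def)
  qed
qed

lemma convex_on_subgradients:
  fixes g :: "real \<Rightarrow> real"
  assumes "convex I" and sub: "\<And>t. t \<in> I \<Longrightarrow> \<exists>p. \<forall>s\<in>I. g s \<ge> g t + p * (s - t)"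
  shows "convex_on I g"
proof (rule convex_onI)
  fix u x y :: real assume u: "0 < u" "u < 1" and xy: "x \<in> I" "y \<in> I"
  define z where "z = (1 - u) *\<^sub>R x + u *\<^sub>R y"
  have "z \<in> I" using convexD_alt[OF assms(1) xy, of u] u by (simp add: z_def)
  then obtain p where p: "\<And>s. s \<in> I \<Longrightarrow> g s \<ge> g z + p * (s - z)" using sub by blast
  have "(1 - u) * g x \<ge> (1 - u) * (g z + p * (x - z))" "u * g y \<ge> u * (g z + p * (y - z))"
    using p[OF xy(1)] p[OF xy(2)] u by (auto intro: mult_left_mono)
  moreover have "(1 - u) * (g z + p * (x - z)) + u * (g z + p * (y - z)) = g z"
    by (simp add: z_def algebra_simps)
  ultimately show "g ((1 - u) *\<^sub>R x + u *\<^sub>R y) \<le> (1 - u) * g x + u * g y"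
    unfolding z_def[symmetric] by linarith
qed (rule assms)

lemma convex_on_slopes:
  fixes g :: "real \<Rightarrow> real"
  assumes g: "convex_on I g" and I: "t - \<tau> \<in> I" "t + \<tau> \<in> I" and x: "x \<noteq> t" "\<bar>x - t\<bar> < \<tau>"
  shows "(g (t - \<tau>) - g t) / (- \<tau>) \<le> (g x - g t) / (x - t)"
    and "(g x - g t) / (x - t) \<le> (g (t + \<tau>) - g t) / \<tau>"
proof -
  have cI: "convex I" using g by (simp add: convex_on_def)
  have mem: "y \<in> I" if "\<bar>y - t\<bar> \<le> \<tau>" for y
    using I mem_is_interval_1_I[of I "t - \<tau>" "t + \<tau>" y] cI that by (simp add: is_interval_convex_1 abs_le_iff)
  have flip: "(a - b) / (u - v) = (b - a) / (v - u)" for a b u v :: real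
    by (metis minus_diff_eq minus_divide_divide)
  have \<tau>: "\<tau> > 0" using x by linarith
  have t: "t \<in> I" and xI: "x \<in> I" using mem x \<tau> by auto
  consider "x > t" | "x < t" using x(1) by linarith
  then have "(g (t - \<tau>) - g t) / (- \<tau>) \<le> (g x - g t) / (x - t) \<and> (g x - g t) / (x - t) \<le> (g (t + \<tau>) - g t) / \<tau>"
  proof cases
    case 1
    have "(g t - g x) / (t - x) \<le> (g t - g (t + \<tau>)) / (t - (t + \<tau>))"
      using x 1 by (intro convex_on_slope_le(1)[OF g t I(2)]) auto
    moreover have "(g (t - \<tau>) - g t) / ((t - \<tau>) - t) \<le> (g (t - \<tau>) - g x) / ((t - \<tau>) - x)"
      using x 1 \<tau> by (intro convex_on_slope_le(1)[OF g I(1) xI]) auto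
    moreover have "(g (t - \<tau>) - g x) / ((t - \<tau>) - x) \<le> (g t - g x) / (t - x)"
      using x 1 \<tau> by (intro convex_on_slope_le(2)[OF g I(1) xI]) auto
    ultimately show ?thesis using flip[of "g t" "g x" t x] flip[of "g t" "g (t + \<tau>)" t "t + \<tau>"] by simp
  next
    case 2
    have "(g x - g t) / (x - t) \<le> (g x - g (t + \<tau>)) / (x - (t + \<tau>))"
      using x 2 \<tau> by (intro convex_on_slope_le(1)[OF g xI I(2)]) auto
    moreover have "(g x - g (t + \<tau>)) / (x - (t + \<tau>)) \<le> (g t - g (t + \<tau>)) / (t - (t + \<tau>))"
      using x 2 \<tau> by (intro convex_on_slope_le(2)[OF g xI I(2)]) auto
    moreover have "(g (t - \<tau>) - g t) / ((t - \<tau>) - t) \<le> (g x - g t) / (x - t)"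
      using x 2 by (intro convex_on_slope_le(2)[OF g I(1) t]) auto
    ultimately show ?thesis using flip[of "g t" "g (t + \<tau>)" t "t + \<tau>"] by simp
  qed
  then show "(g (t - \<tau>) - g t) / (- \<tau>) \<le> (g x - g t) / (x - t)"
    and "(g x - g t) / (x - t) \<le> (g (t + \<tau>) - g t) / \<tau>" by auto
qed

text \<open>Peano expansions cannot be differentiated in general. For a convex function,
  however, the slopes at \<open>t\<close> lie between those of the chords from \<open>t\<close>
  to \<open>t - \<tau>\<close> and to \<open>t + \<tau>\<close>. For \<open>\<tau> = \<omega> *
  \<bar>t - t0\<bar>\<close> the expansion determines these slopes, with one error proportional
  to \<open>\<omega>\<close> from the curvature and another one that tends to 0 for fixed
  \<open>\<omega>\<close>.\<close>

lemma convex_expansion_slopes: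
  assumes G: "convex_on {t0-\<delta><..<t0+\<delta>} G" and "\<delta> > 0" and S: "S = {t0<..} \<or> S = {..<t0}"
    and ex: "expands G A B D t0 S" and "\<theta> > 0"
  shows "\<forall>\<^sub>F t in at t0 within S. \<exists>\<tau>>0. \<forall>x. x \<noteq> t \<and> \<bar>x - t\<bar> < \<tau> \<longrightarrow>
    \<bar>(G x - G t) / (x - t) - (B + 2 * D * (t - t0))\<bar> \<le> \<theta> * \<bar>t - t0\<bar>"
proof -
  define \<omega> where "\<omega> = min (1/2) (\<theta> / (2 * (\<bar>D\<bar> + 1)))"
  have "\<omega> \<le> 1/2" unfolding \<omega>_def by (rule min.cobounded1)
  moreover have "0 < \<omega>" using \<open>\<theta> > 0\<close> by (simp add: \<omega>_def)
  ultimately have \<omega>: "0 < \<omega>" "\<omega> \<le> 1/2" by auto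
  have D\<omega>: "\<bar>D\<bar> * \<omega> \<le> \<theta> / 2"
  proof -
    have "\<bar>D\<bar> * \<omega> \<le> (\<bar>D\<bar> + 1) * (\<theta> / (2 * (\<bar>D\<bar> + 1)))"
      using \<omega> by (intro mult_mono) (auto simp: \<omega>_def)
    also have "\<dots> = \<theta> / 2" by (simp add: field_simps)
    finally show ?thesis .
  qed
  \<comment> \<open>The error of the expansion enters the slope of a chord divided by its relative length \<open>\<omega>\<close>.\<close>
  define \<kappa> where "\<kappa> = \<theta> * \<omega> / 8"
  have "\<kappa> > 0" using \<omega> \<open>\<theta> > 0\<close> by (simp add: \<kappa>_def)
  then have "\<forall>\<^sub>F t in at t0 within S. \<bar>G t - (A + B * (t - t0) + D * (t - t0)\<^sup>2)\<bar> \<le> \<kappa> * (t - t0)\<^sup>2"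
    using ex by (simp add: expands_def)
  then obtain d0 where "d0 > 0" and d0: "\<And>t. t \<in> S \<Longrightarrow> t \<noteq> t0 \<Longrightarrow> \<bar>t - t0\<bar> < d0 \<Longrightarrow>
      \<bar>G t - (A + B * (t - t0) + D * (t - t0)\<^sup>2)\<bar> \<le> \<kappa> * (t - t0)\<^sup>2"
    unfolding eventually_at dist_real_def by blast
  define d where "d = min d0 \<delta>"
  have "d > 0" using \<open>d0 > 0\<close> \<open>\<delta> > 0\<close> by (simp add: d_def)
  have main: "\<exists>\<tau>>0. \<forall>x. x \<noteq> t \<and> \<bar>x - t\<bar> < \<tau> \<longrightarrow>
    \<bar>(G x - G t) / (x - t) - (B + 2 * D * (t - t0))\<bar> \<le> \<theta> * \<bar>t - t0\<bar>"
    if t: "t \<in> S" "t \<noteq> t0" "\<bar>t - t0\<bar> < d / 2" for t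
  proof -
    define h where "h = t - t0"
    define \<tau> where "\<tau> = \<omega> * \<bar>h\<bar>"
    have h0: "\<bar>h\<bar> > 0" using t by (simp add: h_def)
    have \<tau>: "\<tau> > 0" "\<tau> \<le> \<bar>h\<bar> / 2" using \<omega> h0 mult_right_mono[OF \<omega>(2), of "\<bar>h\<bar>"] by (auto simp: \<tau>_def)
    have small: "\<bar>t + s - t0\<bar> < d \<and> t + s \<in> S \<and> t + s \<noteq> t0" if "\<bar>s\<bar> \<le> \<tau>" for s
    proof -
      have "\<bar>s\<bar> \<le> \<bar>t - t0\<bar> / 2" using that \<tau> by (simp add: h_def)
      then show ?thesis using S t by (auto simp: abs_if split: if_splits)
    qed
    have slope: "\<bar>(G (t + s) - G t) / s - (B + 2 * D * h)\<bar> \<le> \<theta> * \<bar>h\<bar>" if s: "\<bar>s\<bar> = \<tau>" for s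
    proof -
      have s0: "s \<noteq> 0" using s \<tau> by auto
      have "\<bar>h + s\<bar> \<le> 3/2 * \<bar>h\<bar>" using abs_triangle_ineq[of h s] s \<tau> by simp
      then have "\<bar>h + s\<bar> \<le> \<bar>3/2 * h\<bar>" by (simp add: abs_mult)
      then have hs: "(h + s)\<^sup>2 \<le> (3/2 * h)\<^sup>2" by (rule abs_le_square_iff[THEN iffD1])
      define E where "E = (G (t + s) - (A + B * (h + s) + D * (h + s)\<^sup>2)) - (G t - (A + B * h + D * h\<^sup>2))"
      have "\<bar>G (t + s) - (A + B * (h + s) + D * (h + s)\<^sup>2)\<bar> \<le> \<kappa> * (h + s)\<^sup>2"
        using d0[of "t + s"] small[of s] s by (simp add: d_def h_def algebra_simps)
      moreover have "\<bar>G t - (A + B * h + D * h\<^sup>2)\<bar> \<le> \<kappa> * h\<^sup>2"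
        using d0[of t] small[of 0] t \<tau> by (simp add: d_def h_def)
      moreover have "\<kappa> * (h + s)\<^sup>2 \<le> \<kappa> * (9/4 * h\<^sup>2)"
        using hs \<open>\<kappa> > 0\<close> by (intro mult_left_mono) (auto simp: power_mult_distrib power2_eq_square)
      moreover have "\<bar>E\<bar> \<le> \<bar>G (t + s) - (A + B * (h + s) + D * (h + s)\<^sup>2)\<bar> + \<bar>G t - (A + B * h + D * h\<^sup>2)\<bar>"
        unfolding E_def by (rule abs_triangle_ineq4)
      ultimately have "\<bar>E\<bar> \<le> \<kappa> * (9/4 * h\<^sup>2) + \<kappa> * h\<^sup>2" by linarith
      also have "\<dots> \<le> 4 * \<kappa> * h\<^sup>2" using mult_nonneg_nonneg[of \<kappa> "h\<^sup>2"] \<open>\<kappa> > 0\<close> by simp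
      also have "\<dots> = \<theta> / 2 * \<bar>h\<bar> * \<bar>s\<bar>" unfolding s \<tau>_def \<kappa>_def by (simp add: power2_eq_square)
      finally have E: "\<bar>E\<bar> / \<bar>s\<bar> \<le> \<theta> / 2 * \<bar>h\<bar>" using s0 by (simp add: pos_divide_le_eq)
      have "(G (t + s) - G t) = s * (B + 2 * D * h) + D * s * s + E"
        unfolding E_def by (simp add: algebra_simps power2_eq_square)
      then have "(G (t + s) - G t) / s - (B + 2 * D * h) = D * s + E / s"
        using s0 by (simp add: field_simps)
      moreover have "\<bar>D * s\<bar> \<le> \<theta> / 2 * \<bar>h\<bar>"
        using mult_right_mono[OF D\<omega>, of "\<bar>h\<bar>"] by (simp add: abs_mult s \<tau>_def mult.assoc)
      moreover have "\<bar>E / s\<bar> \<le> \<theta> / 2 * \<bar>h\<bar>" using E by (simp add: abs_divide)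
      moreover have "\<theta> * \<bar>h\<bar> = \<theta> / 2 * \<bar>h\<bar> + \<theta> / 2 * \<bar>h\<bar>" by simp
      ultimately show ?thesis by linarith
    qed
    have I: "t - \<tau> \<in> {t0-\<delta><..<t0+\<delta>}" "t + \<tau> \<in> {t0-\<delta><..<t0+\<delta>}"
      using small[of "-\<tau>"] small[of \<tau>] \<tau> by (auto simp: d_def abs_less_iff)
    show ?thesis
    proof (intro exI[of _ \<tau>] conjI allI impI \<tau>(1))
      fix x assume x: "x \<noteq> t \<and> \<bar>x - t\<bar> < \<tau>"
      have "(G (t - \<tau>) - G t) / (- \<tau>) \<le> (G x - G t) / (x - t)"
        "(G x - G t) / (x - t) \<le> (G (t + \<tau>) - G t) / \<tau>"
        using convex_on_slopes[OF G I] x by auto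
      moreover have "\<bar>(G (t - \<tau>) - G t) / (- \<tau>) - (B + 2 * D * h)\<bar> \<le> \<theta> * \<bar>h\<bar>"
        using slope[of "-\<tau>"] \<tau> by simp
      moreover have "\<bar>(G (t + \<tau>) - G t) / \<tau> - (B + 2 * D * h)\<bar> \<le> \<theta> * \<bar>h\<bar>"
        using slope[of \<tau>] \<tau> by simp
      ultimately show "\<bar>(G x - G t) / (x - t) - (B + 2 * D * (t - t0))\<bar> \<le> \<theta> * \<bar>t - t0\<bar>"
        unfolding h_def by linarith
    qed
  qed
  then show ?thesis unfolding eventually_at dist_real_def using \<open>d > 0\<close> by (intro exI[of _ "d/2"]) auto
qed

section \<open>Clusters of eigenvalues and their jets\<close>

text \<open>The eigenvalues near \<open>z0\<close> are the numbers \<open>r k t\<close> for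
  \<open>k < n\<close>. They are numbered such that the numbers \<open>1 / (r k t - c)\<close>,
  eigenvalues of the resolvent at \<open>c\<close>, decrease in \<open>k\<close>. Then the sums
  in \<open>subgradient\<close> are maxima over orthonormal families, and the assumption says
  that they are semiconvex. The assumption \<open>windows\<close> is only a lower bound;
  equality follows as both sides add up to \<open>n\<close>.\<close>

locale eigenvalue_cluster =
  fixes M :: "real \<Rightarrow> real \<Rightarrow> nat" and m :: "real \<Rightarrow> jet \<Rightarrow> nat" and t0 z0 :: real
    and n :: nat and \<epsilon> \<delta> :: real and r :: "nat \<Rightarrow> real \<Rightarrow> real" and c C :: real and F :: "jet set"
  assumes pos: "\<epsilon> > 0" "\<delta> > 0" "c < z0 - \<epsilon>"
    and near: "\<bar>t - t0\<bar> < \<delta> \<Longrightarrow> k < n \<Longrightarrow> \<bar>r k t - z0\<bar> < \<epsilon>"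
    and center: "k < n \<Longrightarrow> r k t0 = z0"
    and mult: "\<bar>t - t0\<bar> < \<delta> \<Longrightarrow> \<bar>z - z0\<bar> < \<epsilon> \<Longrightarrow> M t z = card {k. k < n \<and> r k t = z}"
    and subgradient: "k \<le> n \<Longrightarrow> \<bar>t - t0\<bar> < \<delta> \<Longrightarrow> \<exists>p. \<forall>s. \<bar>s - t0\<bar> < \<delta> \<longrightarrow>
      (\<Sum>j<k. 1 / (r j t - c)) + p * (s - t) - C * (s - t)\<^sup>2 \<le> (\<Sum>j<k. 1 / (r j s - c))"
    and jets: "finite F" "J \<in> F \<Longrightarrow> jet_val J = z0" "m t0 J > 0 \<Longrightarrow> jet_val J = z0 \<Longrightarrow> J \<in> F"
      "sum (m t0) F = n"
    and windows: "J \<in> F \<Longrightarrow> \<eta> > 0 \<Longrightarrow>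
      \<forall>\<^sub>F t in at t0. m t0 J \<le> card {k. k < n \<and> Jet (r k t) 0 0 \<in> window t0 J \<eta> t}"
begin

definition inside :: "jet \<Rightarrow> real \<Rightarrow> real \<Rightarrow> nat set"
  where "inside J \<eta> t = {k. k < n \<and> Jet (r k t) 0 0 \<in> window t0 J \<eta> t}"

lemma finite_inside [simp]: "finite (inside J \<eta> t)"
  by (simp add: inside_def)

text \<open>The windows are disjoint and contain at least their share of the \<open>n\<close>
  eigenvalues. Since the shares add up to \<open>n\<close>, they contain exactly their share.\<close>

lemma partition:
  assumes F': "finite F'" "F \<subseteq> F'" "\<forall>J\<in>F'. jet_val J = z0"
  shows "\<forall>\<^sub>F \<eta> in at_right 0. \<forall>\<^sub>F t in at t0. (\<forall>J\<in>F'. card (inside J \<eta> t) = m t0 J) \<and>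
    (\<Union>J\<in>F'. inside J \<eta> t) = {..<n} \<and>
    (\<forall>J1\<in>F'. \<forall>J2\<in>F'. J1 \<noteq> J2 \<longrightarrow> window t0 J1 \<eta> t \<inter> window t0 J2 \<eta> t = {})"
  using windows_separate[OF F'(1), of t0] eventually_at_right_less[of "0::real"]
proof eventually_elim
  case (elim \<eta>)
  have m0: "m t0 J = 0" if "J \<in> F' - F" for J using jets(3)[of J] F'(3) that by auto
  have "\<forall>\<^sub>F t in at t0. m t0 J \<le> card (inside J \<eta> t)" if "J \<in> F'" for J
  proof (cases "J \<in> F")
    case True
    then show ?thesis using windows[of J \<eta>] elim by (simp add: inside_def)
  next
    case False
    then show ?thesis using m0 that by simp
  qed
  then have "\<forall>\<^sub>F t in at t0. \<forall>J\<in>F'. m t0 J \<le> card (inside J \<eta> t)"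
    using F'(1) by (intro eventually_ball_finite ballI)
  then show ?case using elim(1)
  proof eventually_elim
    case (elim t)
    have disj: "inside J1 \<eta> t \<inter> inside J2 \<eta> t = {}" if "J1 \<in> F'" "J2 \<in> F'" "J1 \<noteq> J2" for J1 J2
    proof -
      have "window t0 J1 \<eta> t \<inter> window t0 J2 \<eta> t = {}" using elim(2) that by blast
      then show ?thesis by (auto simp: inside_def)
    qed
    have un: "card (\<Union>J\<in>F'. inside J \<eta> t) = (\<Sum>J\<in>F'. card (inside J \<eta> t))"
      using F'(1) disj by (intro card_UN_disjoint) auto
    have sub: "(\<Union>J\<in>F'. inside J \<eta> t) \<subseteq> {..<n}" by (auto simp: inside_def)
    have "card (\<Union>J\<in>F'. inside J \<eta> t) \<le> card {..<n}" using sub by (intro card_mono) auto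
    then have "(\<Sum>J\<in>F'. card (inside J \<eta> t)) \<le> n" using un by simp
    moreover have "sum (m t0) F' = n"
      using F' m0 jets(4) by (metis sum.mono_neutral_right)
    moreover have "sum (m t0) F' \<le> (\<Sum>J\<in>F'. card (inside J \<eta> t))"
      using elim(1) by (intro sum_mono) auto
    ultimately have eq: "sum (m t0) F' = (\<Sum>J\<in>F'. card (inside J \<eta> t))"
      and tot: "(\<Sum>J\<in>F'. card (inside J \<eta> t)) = n" by auto
    have "m t0 J = card (inside J \<eta> t)" if "J \<in> F'" for J
      by (rule sum_mono_inv[OF eq _ that F'(1)]) (use elim(1) in auto)
    moreover have "(\<Union>J\<in>F'. inside J \<eta> t) = {..<n}"
      using un tot sub by (intro card_subset_eq) auto
    ultimately show ?case using elim(2) by simp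
  qed
qed

lemma inside_card:
  assumes "jet_val J = z0"
  shows "\<forall>\<^sub>F \<eta> in at_right 0. \<forall>\<^sub>F t in at t0. card (inside J \<eta> t) = m t0 J"
proof -
  have "finite (insert J F)" "F \<subseteq> insert J F" "\<forall>J'\<in>insert J F. jet_val J' = z0"
    using jets assms by auto
  from partition[OF this] show ?thesis
    by eventually_elim (auto elim: eventually_mono)
qed

lemma inside_cover:
  assumes "\<eta> > 0"
  shows "\<forall>\<^sub>F t in at t0. \<forall>k<n. \<exists>J\<in>F. Jet (r k t) 0 0 \<in> window t0 J \<eta> t"
proof -
  have FV: "\<forall>J\<in>F. jet_val J = z0" using jets(2) by blast
  have "\<forall>\<^sub>F \<eta>' in at_right 0. \<eta>' < \<eta>" using assms by (simp add: eventually_at_right_field) auto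
  then have "\<forall>\<^sub>F \<eta>' in at_right 0. \<eta>' < \<eta> \<and> (\<forall>\<^sub>F t in at t0. (\<Union>J\<in>F. inside J \<eta>' t) = {..<n})"
    using partition[OF jets(1) order_refl FV]
    by eventually_elim (auto elim: eventually_mono)
  then obtain \<eta>' where \<eta>': "\<eta>' < \<eta>" "\<forall>\<^sub>F t in at t0. (\<Union>J\<in>F. inside J \<eta>' t) = {..<n}"
    using eventually_happens'[OF trivial_limit_at_right_real] by blast
  from \<eta>'(2) show ?thesis
  proof eventually_elim
    case (elim t)
    show ?case
    proof (intro allI impI)
      fix k assume "k < n"
      then have "k \<in> (\<Union>J\<in>F. inside J \<eta>' t)" using elim by simp
      then obtain J where "J \<in> F" "Jet (r k t) 0 0 \<in> window t0 J \<eta>' t" by (auto simp: inside_def)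
      then show "\<exists>J\<in>F. Jet (r k t) 0 0 \<in> window t0 J \<eta> t"
        using window_mono[of \<eta>' \<eta> t0 J t] \<eta>'(1) by auto
    qed
  qed
qed

definition interval :: "real set" where "interval = {t0-\<delta><..<t0+\<delta>}"

lemma interval_iff: "t \<in> interval \<longleftrightarrow> \<bar>t - t0\<bar> < \<delta>"
  by (auto simp: interval_def)

text \<open>The quadratic term turns semiconvexity into convexity.\<close>

definition part_sum :: "nat \<Rightarrow> real \<Rightarrow> real"
  where "part_sum k t = (\<Sum>j<k. 1 / (r j t - c)) + C * t\<^sup>2"

lemma convex_part_sum:
  assumes "k \<le> n"
  shows "convex_on interval (part_sum k)"
proof (rule convex_on_subgradients)
  fix t assume "t \<in> interval"
  then obtain p where p: "\<And>s. \<bar>s - t0\<bar> < \<delta> \<Longrightarrow>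
      (\<Sum>j<k. 1 / (r j t - c)) + p * (s - t) - C * (s - t)\<^sup>2 \<le> (\<Sum>j<k. 1 / (r j s - c))"
    using subgradient[OF assms] by (auto simp: interval_iff)
  have "part_sum k t + (p + 2 * C * t) * (s - t) \<le> part_sum k s" if "s \<in> interval" for s
    using p[of s] that by (simp add: interval_iff part_sum_def algebra_simps power2_eq_square)
  then show "\<exists>p. \<forall>s\<in>interval. part_sum k t + p * (s - t) \<le> part_sum k s" by blast
qed (simp add: interval_def)

lemma gap: "\<bar>t - t0\<bar> < \<delta> \<Longrightarrow> k < n \<Longrightarrow> r k t - c > 0"
  using near[of t k] pos by linarith

lemma part_sum_diff: "part_sum (Suc k) t - part_sum k t = 1 / (r k t - c)"
  by (simp add: part_sum_def)

lemma r_isCont: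
  assumes "k < n" "\<bar>t - t0\<bar> < \<delta>"
  shows "isCont (r k) t"
proof -
  have "isCont (part_sum j) t" if "j \<le> n" for j
    using convex_on_continuous[OF _ convex_part_sum[OF that]] assms(2)
    by (simp add: continuous_on_eq_continuous_at interval_def flip: interval_iff)
  from this[of "Suc k"] this[of k] assms(1)
  have "isCont (\<lambda>t. c + 1 / (part_sum (Suc k) t - part_sum k t)) t"
    by (intro continuous_intros) (use part_sum_diff gap[OF assms(2,1)] in auto)
  then show ?thesis by (simp add: part_sum_diff)
qed

lemma one_sided_filter:
  "at t0 within {t0<..<t0+\<delta>} = at_right t0" "at t0 within {t0-\<delta><..<t0} = at_left t0"
  using pos(2) by (intro at_within_nhd[of t0 "ball t0 \<delta>"], auto simp: dist_real_def)+

text \<open>The two sides of \<open>t0\<close> are kept apart because the numbering is by size: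
  where branches cross, \<open>r k\<close> changes from one jet to another.\<close>

lemma one_sided_jet:
  assumes S: "S = {t0<..<t0+\<delta>} \<or> S = {t0-\<delta><..<t0}" and "k < n"
  obtains J where "J \<in> F" "follows (\<lambda>t. Jet (r k t) 0 0) J t0 S"
proof (rule branch_limit[of S t0 "\<lambda>t. Jet (r k t) 0 0" F])
  show "connected S" "open S" "t0 \<notin> S" using S by auto
  show "at t0 within S \<noteq> bot" using S by (auto simp: one_sided_filter)
  show "isCont (\<lambda>s. jet_val (Jet (r k s) 0 0)) t" if "t \<in> S" for t
    using r_isCont[OF \<open>k < n\<close>, of t] that S by auto
  show "\<forall>\<^sub>F t in at t0 within S. \<exists>J\<in>F. Jet (r k t) 0 0 \<in> window t0 J \<eta> t" if "\<eta> > 0" for \<eta>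
    using filter_leD[OF at_le[OF subset_UNIV[of S]] inside_cover[OF that]] \<open>k < n\<close> by (auto elim: eventually_mono)
qed (use jets that in auto)

end

section \<open>Twice differentiable branches\<close>

locale spectral_jets =
  fixes M :: "real \<Rightarrow> real \<Rightarrow> nat" and m :: "real \<Rightarrow> jet \<Rightarrow> nat"
  assumes cluster: "\<exists>n \<epsilon> \<delta> r c C F. eigenvalue_cluster M m t0 z0 n \<epsilon> \<delta> r c C F"
    and slope_growth: "\<exists>C. \<forall>t J. \<bar>t\<bar> \<le> T \<and> m t J > 0 \<longrightarrow> \<bar>jet_slope J\<bar> \<le> C * (1 + \<bar>jet_val J\<bar>)"
begin

lemma jets_total:
  "finite {J. jet_val J = z \<and> m t J > 0} \<and> sum (m t) {J. jet_val J = z \<and> m t J > 0} = M t z"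
proof -
  obtain n \<epsilon> \<delta> r c C F where "eigenvalue_cluster M m t z n \<epsilon> \<delta> r c C F" using cluster by blast
  then interpret eigenvalue_cluster M m t z n \<epsilon> \<delta> r c C F .
  have sub: "{J. jet_val J = z \<and> m t J > 0} \<subseteq> F" using jets(3) by auto
  have "sum (m t) {J. jet_val J = z \<and> m t J > 0} = sum (m t) F"
    using sub jets by (intro sum.mono_neutral_left) auto
  moreover have "M t z = n"
  proof -
    have "{k. k < n \<and> r k t = z} = {..<n}" using center by auto
    then show ?thesis using mult[of t z] pos by simp
  qed
  ultimately show ?thesis using jets(1,4) finite_subset[OF sub] by auto
qed

lemma eigenvalue_iff: "M t z > 0 \<longleftrightarrow> (\<exists>J. jet_val J = z \<and> m t J > 0)"
  using jets_total[of z t] by (metis (mono_tags, lifting) bot_nat_0.not_eq_extremum mem_Collect_eq sum_eq_0_iff)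

sublocale jet_system m
proof
  show "\<forall>\<^sub>F \<eta> in at_right 0. counts m t0 J \<eta>" for t0 J
  proof -
    define z0 where "z0 = jet_val J"
    obtain n \<epsilon> \<delta> r c C F where "eigenvalue_cluster M m t0 z0 n \<epsilon> \<delta> r c C F" using cluster by blast
    then interpret eigenvalue_cluster M m t0 z0 n \<epsilon> \<delta> r c C F .
    have val: "jet_val J = z0" by (simp add: z0_def)
    from inside_card[OF val] show ?thesis
    proof eventually_elim
      case (elim \<eta>)
      have "\<forall>\<^sub>F t in at t0. 0 < \<epsilon> - \<eta> * (t - t0)\<^sup>2 - \<bar>jet_poly t0 J t - z0\<bar>"
        by (rule eventually_pos_at) (use pos val in \<open>auto intro!: continuous_intros\<close>)
      moreover have "\<forall>\<^sub>F t in at t0. 0 < \<delta> - \<bar>t - t0\<bar>"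
        by (rule eventually_pos_at) (use pos in \<open>auto intro!: continuous_intros\<close>)
      ultimately show ?case unfolding counts_def using elim
      proof eventually_elim
        case (elim t)
        let ?A = "{J'\<in>window t0 J \<eta> t. m t J' > 0}"
        define Z where "Z = (\<lambda>k. r k t) ` inside J \<eta> t"
        define B where "B z = {J'. jet_val J' = z \<and> m t J' > 0}" for z
        have winZ: "jet_val J' \<in> Z" if "J' \<in> ?A" for J'
        proof -
          have "\<bar>jet_val J' - z0\<bar> < \<epsilon>" using that elim by (auto simp: window_def)
          moreover have "M t (jet_val J') > 0" using that eigenvalue_iff by auto
          ultimately have "card {k. k < n \<and> r k t = jet_val J'} > 0" using mult[of t "jet_val J'"] elim by simp
          then obtain k where k: "k < n" "r k t = jet_val J'" by (auto simp: card_gt_0_iff)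
          then have "k \<in> inside J \<eta> t" using that by (auto simp: inside_def window_def)
          then have "r k t \<in> Z" unfolding Z_def by (rule imageI)
          then show ?thesis using k by simp
        qed
        have Zwin: "J' \<in> window t0 J \<eta> t" if "jet_val J' \<in> Z" for J'
          using that by (auto simp: Z_def inside_def window_def)
        have A: "?A = (\<Union>z\<in>Z. B z)" using winZ Zwin by (auto simp: B_def)
        have finZ: "finite Z" by (simp add: Z_def)
        have finB: "finite (B z)" and sumB: "sum (m t) (B z) = M t z" for z
          using jets_total[of z t] by (auto simp: B_def)
        have "sum (m t) ?A = (\<Sum>z\<in>Z. sum (m t) (B z))"
          unfolding A using finZ finB by (intro sum.UNION_disjoint) (auto simp: B_def)
        also have "\<dots> = (\<Sum>z\<in>Z. card {k. k < n \<and> r k t = z})"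
          unfolding sumB using mult[of t] near[of t] elim by (intro sum.cong) (auto simp: Z_def inside_def)
        also have "\<dots> = (\<Sum>z\<in>Z. card {k \<in> inside J \<eta> t. r k t = z})"
        proof (rule sum.cong[OF refl])
          fix z assume "z \<in> Z"
          then have "{k. k < n \<and> r k t = z} = {k \<in> inside J \<eta> t. r k t = z}"
            by (auto simp: Z_def inside_def)
          then show "card {k. k < n \<and> r k t = z} = card {k \<in> inside J \<eta> t. r k t = z}" by simp
        qed
        also have "\<dots> = (\<Sum>k\<in>inside J \<eta> t. 1)"
          unfolding Z_def card_eq_sum using finite_inside by (rule sum.image_gen[symmetric])
        finally have "sum (m t) ?A = card (inside J \<eta> t)" by simp
        then show ?case using A finZ finB elim by simp
      qed
    qed
  qed
  show "\<exists>C. \<forall>t J. \<bar>t\<bar> \<le> T \<and> m t J > 0 \<longrightarrow> \<bar>jet_slope J\<bar> \<le> C * (1 + \<bar>jet_val J\<bar>)" for T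
    by (rule slope_growth)
  show "\<exists>\<epsilon>>0. \<exists>F. finite F \<and> (\<forall>J\<in>F. jet_val J = z0) \<and>
      (\<forall>J. m t0 J > 0 \<and> \<bar>jet_val J - z0\<bar> < \<epsilon> \<longrightarrow> J \<in> F) \<and>
      (\<forall>\<eta>>0. \<forall>\<^sub>F t in at t0. \<forall>J'. m t J' > 0 \<and> \<bar>jet_val J' - z0\<bar> < \<epsilon> \<longrightarrow> (\<exists>J\<in>F. J' \<in> window t0 J \<eta> t))"
    for t0 z0
  proof -
    obtain n \<epsilon> \<delta> r c C F where "eigenvalue_cluster M m t0 z0 n \<epsilon> \<delta> r c C F" using cluster by blast
    then interpret eigenvalue_cluster M m t0 z0 n \<epsilon> \<delta> r c C F .
    have ex: "\<exists>k<n. r k t = jet_val J'" if "m t J' > 0" "\<bar>jet_val J' - z0\<bar> < \<epsilon>" "\<bar>t - t0\<bar> < \<delta>" for t J'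
    proof -
      have "card {k. k < n \<and> r k t = jet_val J'} > 0"
        using that mult[of t "jet_val J'"] eigenvalue_iff by metis
      then show ?thesis by (auto simp: card_gt_0_iff)
    qed
    have 1: "\<forall>J. m t0 J > 0 \<and> \<bar>jet_val J - z0\<bar> < \<epsilon> \<longrightarrow> J \<in> F"
    proof (intro allI impI, elim conjE)
      fix J assume J: "m t0 J > 0" "\<bar>jet_val J - z0\<bar> < \<epsilon>"
      obtain k where "k < n" "r k t0 = jet_val J" using ex[OF J, of] pos by auto
      then show "J \<in> F" using center jets(3) J(1) by simp
    qed
    have 2: "\<forall>\<eta>>0. \<forall>\<^sub>F t in at t0. \<forall>J'. m t J' > 0 \<and> \<bar>jet_val J' - z0\<bar> < \<epsilon> \<longrightarrow> (\<exists>J\<in>F. J' \<in> window t0 J \<eta> t)"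
    proof (intro allI impI)
      fix \<eta> :: real assume "\<eta> > 0"
      have "\<forall>\<^sub>F t in at t0. 0 < \<delta> - \<bar>t - t0\<bar>"
        by (rule eventually_pos_at) (use pos in \<open>auto intro!: continuous_intros\<close>)
      with inside_cover[OF \<open>\<eta> > 0\<close>]
      show "\<forall>\<^sub>F t in at t0. \<forall>J'. m t J' > 0 \<and> \<bar>jet_val J' - z0\<bar> < \<epsilon> \<longrightarrow> (\<exists>J\<in>F. J' \<in> window t0 J \<eta> t)"
      proof eventually_elim
        case (elim t)
        show ?case
        proof (intro allI impI, elim conjE)
          fix J' assume "m t J' > 0" "\<bar>jet_val J' - z0\<bar> < \<epsilon>"
          then obtain k where "k < n" "r k t = jet_val J'" using ex[of t J'] elim by auto
          then show "\<exists>J\<in>F. J' \<in> window t0 J \<eta> t" using elim(1) by (force simp: window_def)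
        qed
      qed
    qed
    have 3: "\<forall>J\<in>F. jet_val J = z0" using jets(2) by blast
    show ?thesis by (intro exI[of _ \<epsilon>] conjI exI[of _ F]) (fact pos(1) jets(1) 1 2 3)+
  qed
qed

text \<open>The value \<open>f\<close> of a branch coincides at each time with some \<open>r
  k\<close>, and near \<open>t0\<close> it does so only with those \<open>r k\<close> that
  follow the jet \<open>J0\<close> of \<open>f\<close> at \<open>t0\<close> on the respective
  side. Since \<open>1 / (r k t - c)\<close> is a difference of two convex functions
  \<open>part_sum\<close> with a one-sided expansion at \<open>t0\<close>, its slopes at
  \<open>t\<close> are known up to \<open>o(\<bar>t - t0\<bar>)\<close> by
  \<open>convex_expansion_slopes\<close>. So the same holds for the derivative of \<open>g = 1 /
  (f - c)\<close> at \<open>t\<close>, which means that this derivative is itself differentiable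
  at \<open>t0\<close>.\<close>

lemma branch_slope_differentiable:
  assumes br: "branch (\<lambda>t J. m t J > 0) \<phi> UNIV"
  shows "(\<lambda>t. jet_slope (\<phi> t)) differentiable (at t0)"
proof -
  define f where "f t = jet_val (\<phi> t)" for t
  define d where "d t = jet_slope (\<phi> t)" for t
  define J0 where "J0 = \<phi> t0"
  define z0 where "z0 = f t0"
  have fol: "follows \<phi> (\<phi> t) t UNIV" and mpos: "m t (\<phi> t) > 0" for t using br by (auto simp: branch_def)
  have fd: "(f has_real_derivative d t) (at t)" for t
    using follows_imp_derivative[OF fol] by (simp add: f_def[abs_def] d_def)
  have fcont: "isCont f t" for t using fd DERIV_isCont by blast
  have fpos: "M t (f t) > 0" for t using mpos by (auto simp: eigenvalue_iff f_def)
  obtain n \<epsilon> \<delta> r c C F where "eigenvalue_cluster M m t0 z0 n \<epsilon> \<delta> r c C F" using cluster by blast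
  then interpret eigenvalue_cluster M m t0 z0 n \<epsilon> \<delta> r c C F .
  have J0F: "J0 \<in> F" using jets(3) mpos by (simp add: J0_def z0_def f_def)
  define w where "w = z0 - c"
  have w: "w > 0" using pos by (simp add: w_def)
  define b where "b J = - jet_slope J / w\<^sup>2" for J
  define e where "e J = (jet_slope J)\<^sup>2 / w ^ 3 - jet_curv J / w\<^sup>2" for J
  define g where "g t = 1 / (f t - c)" for t
  define g' where "g' t = - d t / (f t - c)\<^sup>2" for t
  have gder: "(g has_real_derivative g' t) (at t)" if "\<bar>f t - z0\<bar> < \<epsilon>" for t
  proof -
    have "f t - c \<noteq> 0" using that pos by auto
    then show ?thesis unfolding g_def[abs_def] g'_def
      by (auto intro!: derivative_eq_intros fd simp: power2_eq_square)
  qed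
  have g'0: "g' t0 = b J0" by (simp add: g'_def b_def d_def J0_def w_def z0_def)
  have near_f: "\<forall>\<^sub>F x in at t. \<bar>f x - z0\<bar> < \<epsilon> \<and> \<bar>x - t0\<bar> < \<delta>" if "\<bar>f t - z0\<bar> < \<epsilon>" "\<bar>t - t0\<bar> < \<delta>" for t
  proof -
    have "\<forall>\<^sub>F x in at t. 0 < \<epsilon> - \<bar>f x - z0\<bar>"
    proof (rule eventually_pos_at)
      show "isCont (\<lambda>x. \<epsilon> - \<bar>f x - z0\<bar>) t" by (intro continuous_intros fcont)
    qed (use that in simp)
    moreover have "\<forall>\<^sub>F x in at t. 0 < \<delta> - \<bar>x - t0\<bar>"
    proof (rule eventually_pos_at)
      show "isCont (\<lambda>x. \<delta> - \<bar>x - t0\<bar>) t" by (intro continuous_intros)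
    qed (use that in simp)
    ultimately show ?thesis by eventually_elim auto
  qed
  have near_t0: "\<forall>\<^sub>F x in at t0. \<bar>f x - z0\<bar> < \<epsilon> \<and> \<bar>x - t0\<bar> < \<delta>"
    by (rule near_f) (use pos in \<open>auto simp: z0_def\<close>)
  obtain \<eta> :: real where \<eta>: "\<eta> > 0" and
    sep: "\<forall>\<^sub>F t in at t0. \<forall>J1\<in>F. \<forall>J2\<in>F. J1 \<noteq> J2 \<longrightarrow> window t0 J1 \<eta> t \<inter> window t0 J2 \<eta> t = {}"
    using eventually_happens'[OF trivial_limit_at_right_real
        eventually_conj[OF windows_separate[OF jets(1), of t0] eventually_at_right_less]] by blast
  have side: "((\<lambda>t. (g' t - g' t0) / (t - t0)) \<longlongrightarrow> 2 * e J0) (at t0 within S)"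
    if S: "S = {t0<..<t0+\<delta>} \<and> S' = {t0<..} \<or> S = {t0-\<delta><..<t0} \<and> S' = {..<t0}" for S S'
  proof -
    have filt: "at t0 within S = at t0 within S'" using S by (auto simp: one_sided_filter)
    have "\<exists>J. J \<in> F \<and> follows (\<lambda>t. Jet (r k t) 0 0) J t0 S" if "k < n" for k
    proof -
      have "S = {t0<..<t0+\<delta>} \<or> S = {t0-\<delta><..<t0}" using S by auto
      then show ?thesis by (rule one_sided_jet[OF _ that]) auto
    qed
    then obtain Jk where Jk: "\<And>k. k < n \<Longrightarrow> Jk k \<in> F"
      "\<And>k. k < n \<Longrightarrow> follows (\<lambda>t. Jet (r k t) 0 0) (Jk k) t0 S" by metis
    have "expands (\<lambda>t. r k t - c) w (jet_slope (Jk k)) (jet_curv (Jk k)) t0 S" if "k < n" for k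
      unfolding expands_def
    proof (intro allI impI)
      fix \<kappa> :: real assume "\<kappa> > 0"
      from followsD[OF Jk(2)[OF that] this] show "\<forall>\<^sub>F t in at t0 within S.
          \<bar>r k t - c - (w + jet_slope (Jk k) * (t - t0) + jet_curv (Jk k) * (t - t0)\<^sup>2)\<bar> \<le> \<kappa> * (t - t0)\<^sup>2"
      proof eventually_elim
        case (elim t)
        then show ?case using jets(2)[OF Jk(1)[OF that]]
          by (simp add: window_def jet_poly_def w_def algebra_simps)
      qed
    qed
    from expands_reciprocal[OF w this]
    have "expands (\<lambda>t. 1 / (r k t - c)) (1 / w) (b (Jk k)) (e (Jk k)) t0 S" if "k < n" for k
      using that by (simp add: b_def e_def)
    then have "expands (\<lambda>t. \<Sum>j<k. 1 / (r j t - c)) (\<Sum>j<k. 1 / w) (\<Sum>j<k. b (Jk j)) (\<Sum>j<k. e (Jk j)) t0 S"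
      if "k \<le> n" for k
      using that by (intro expands_sum) auto
    from expands_add[OF this expands_exact[of "\<lambda>t. C * t\<^sup>2" "C * t0\<^sup>2" "2 * C * t0" t0 C]]
    have ex: "expands (part_sum k) ((\<Sum>j<k. 1 / w) + C * t0\<^sup>2) ((\<Sum>j<k. b (Jk j)) + 2 * C * t0)
        ((\<Sum>j<k. e (Jk j)) + C) t0 S'" if "k \<le> n" for k
      using that unfolding part_sum_def[abs_def] expands_def filt
      by (simp add: algebra_simps power2_eq_square)
    have sum_slope: "\<forall>\<^sub>F t in at t0 within S. \<exists>\<tau>>0. \<forall>x. x \<noteq> t \<and> \<bar>x - t\<bar> < \<tau> \<longrightarrow>
      \<bar>(part_sum k x - part_sum k t) / (x - t) - ((\<Sum>j<k. b (Jk j)) + 2 * C * t0 + 2 * ((\<Sum>j<k. e (Jk j)) + C) * (t - t0))\<bar>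
        \<le> \<theta> * \<bar>t - t0\<bar>" if "k \<le> n" "\<theta> > 0" for k \<theta>
      unfolding filt using S
      by (intro convex_expansion_slopes[OF convex_part_sum[OF that(1), unfolded interval_def] pos(2) _ ex[OF that(1)] that(2)]) auto
    have r_slope: "\<forall>\<^sub>F t in at t0 within S. \<exists>\<tau>>0. \<forall>x. x \<noteq> t \<and> \<bar>x - t\<bar> < \<tau> \<longrightarrow>
      \<bar>(1 / (r k x - c) - 1 / (r k t - c)) / (x - t) - (b (Jk k) + 2 * e (Jk k) * (t - t0))\<bar> \<le> \<theta> * \<bar>t - t0\<bar>"
      if k: "k < n" and "\<theta> > 0" for k \<theta>
    proof -
      have "\<theta> / 2 > 0" "k \<le> n" "Suc k \<le> n" using that by auto
      from sum_slope[OF this(2,1)] sum_slope[OF this(3,1)] show ?thesis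
      proof eventually_elim
        case (elim t)
        define L where "L k = (\<Sum>j<k. b (Jk j)) + 2 * C * t0 + 2 * ((\<Sum>j<k. e (Jk j)) + C) * (t - t0)" for k
        define Q where "Q k x = (part_sum k x - part_sum k t) / (x - t)" for k x
        obtain \<tau>1 \<tau>2 where \<tau>: "\<tau>1 > 0" "\<tau>2 > 0"
          "\<And>x. x \<noteq> t \<and> \<bar>x - t\<bar> < \<tau>1 \<Longrightarrow> \<bar>Q k x - L k\<bar> \<le> \<theta> / 2 * \<bar>t - t0\<bar>"
          "\<And>x. x \<noteq> t \<and> \<bar>x - t\<bar> < \<tau>2 \<Longrightarrow> \<bar>Q (Suc k) x - L (Suc k)\<bar> \<le> \<theta> / 2 * \<bar>t - t0\<bar>"
          using elim unfolding L_def Q_def by blast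
        have L: "L (Suc k) - L k = b (Jk k) + 2 * e (Jk k) * (t - t0)"
          by (simp add: L_def algebra_simps)
        have Q: "Q (Suc k) x - Q k x = (1 / (r k x - c) - 1 / (r k t - c)) / (x - t)" for x
        proof -
          have "Q (Suc k) x - Q k x = ((part_sum (Suc k) x - part_sum k x) - (part_sum (Suc k) t - part_sum k t)) / (x - t)"
            unfolding Q_def by (simp add: diff_divide_distrib)
          then show ?thesis by (simp only: part_sum_diff)
        qed
        show ?case
        proof (intro exI[of _ "min \<tau>1 \<tau>2"] conjI allI impI)
          fix x assume "x \<noteq> t \<and> \<bar>x - t\<bar> < min \<tau>1 \<tau>2"
          then have "\<bar>Q k x - L k\<bar> \<le> \<theta> / 2 * \<bar>t - t0\<bar>" "\<bar>Q (Suc k) x - L (Suc k)\<bar> \<le> \<theta> / 2 * \<bar>t - t0\<bar>"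
            using \<tau>(3,4) by auto
          then show "\<bar>(1 / (r k x - c) - 1 / (r k t - c)) / (x - t) - (b (Jk k) + 2 * e (Jk k) * (t - t0))\<bar> \<le> \<theta> * \<bar>t - t0\<bar>"
            unfolding Q[symmetric] L[symmetric] by linarith
        qed (use \<tau> in auto)
      qed
    qed
    show ?thesis
    proof (rule tendstoI)
      fix \<theta> :: real assume "\<theta> > 0"
      have "\<forall>\<^sub>F t in at t0 within S. \<forall>k\<in>{..<n}. \<exists>\<tau>>0. \<forall>x. x \<noteq> t \<and> \<bar>x - t\<bar> < \<tau> \<longrightarrow>
        \<bar>(1 / (r k x - c) - 1 / (r k t - c)) / (x - t) - (b (Jk k) + 2 * e (Jk k) * (t - t0))\<bar> \<le> \<theta> / 2 * \<bar>t - t0\<bar>"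
        using r_slope[of _ "\<theta> / 2"] \<open>\<theta> > 0\<close> by (intro eventually_ball_finite ballI) auto
      moreover have "\<forall>\<^sub>F t in at t0 within S. \<forall>k\<in>{..<n}. Jet (r k t) 0 0 \<in> window t0 (Jk k) \<eta> t"
        using followsD[OF Jk(2) \<eta>] by (intro eventually_ball_finite ballI) auto
      moreover have "\<forall>\<^sub>F t in at t0. \<phi> t \<in> window t0 J0 \<eta> t"
        unfolding J0_def using followsD[OF fol \<eta>] .
      then have "\<forall>\<^sub>F t in at t0 within S. \<phi> t \<in> window t0 J0 \<eta> t"
        by (rule filter_leD[OF at_le[OF subset_UNIV]])
      moreover have "\<forall>\<^sub>F t in at t0 within S. \<bar>f t - z0\<bar> < \<epsilon> \<and> \<bar>t - t0\<bar> < \<delta>"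
        by (rule filter_leD[OF at_le[OF subset_UNIV] near_t0])
      moreover have "\<forall>\<^sub>F t in at t0 within S. t \<noteq> t0" by (rule eventually_neq_at_within)
      ultimately show "\<forall>\<^sub>F t in at t0 within S. dist ((g' t - g' t0) / (t - t0)) (2 * e J0) < \<theta>"
        using filter_leD[OF at_le[OF subset_UNIV] sep]
      proof eventually_elim
        case (elim t)
        define L where "L = b J0 + 2 * e J0 * (t - t0)"
        have "\<forall>k\<in>{..<n}. \<forall>\<^sub>F x in at t. x \<noteq> t \<longrightarrow>
          \<bar>(1 / (r k x - c) - 1 / (r k t - c)) / (x - t) - (b (Jk k) + 2 * e (Jk k) * (t - t0))\<bar> \<le> \<theta> / 2 * \<bar>t - t0\<bar>"
        proof
          fix k assume "k \<in> {..<n}"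
          then obtain \<tau> where "\<tau> > 0" "\<And>x. x \<noteq> t \<and> \<bar>x - t\<bar> < \<tau> \<Longrightarrow>
            \<bar>(1 / (r k x - c) - 1 / (r k t - c)) / (x - t) - (b (Jk k) + 2 * e (Jk k) * (t - t0))\<bar> \<le> \<theta> / 2 * \<bar>t - t0\<bar>"
            using elim(1) by blast
          then show "\<forall>\<^sub>F x in at t. x \<noteq> t \<longrightarrow>
            \<bar>(1 / (r k x - c) - 1 / (r k t - c)) / (x - t) - (b (Jk k) + 2 * e (Jk k) * (t - t0))\<bar> \<le> \<theta> / 2 * \<bar>t - t0\<bar>"
            unfolding eventually_at dist_real_def by (intro exI[of _ \<tau>]) auto
        qed
        then have ev1: "\<forall>\<^sub>F x in at t. \<forall>k\<in>{..<n}. x \<noteq> t \<longrightarrow>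
          \<bar>(1 / (r k x - c) - 1 / (r k t - c)) / (x - t) - (b (Jk k) + 2 * e (Jk k) * (t - t0))\<bar> \<le> \<theta> / 2 * \<bar>t - t0\<bar>"
          by (intro eventually_ball_finite) auto
        have "\<forall>k\<in>{..<n}. \<forall>\<^sub>F x in at t. r k x = f x \<longrightarrow> r k t = f t"
        proof
          fix k assume k: "k \<in> {..<n}"
          show "\<forall>\<^sub>F x in at t. r k x = f x \<longrightarrow> r k t = f t"
          proof (cases "r k t = f t")
            case False
            have "\<forall>\<^sub>F x in at t. 0 < \<bar>r k x - f x\<bar>"
              using False k elim(4) fcont[of t] r_isCont[of k t] by (intro eventually_pos_at continuous_intros) auto
            then show ?thesis by eventually_elim auto
          qed simp
        qed
        then have ev2: "\<forall>\<^sub>F x in at t. \<forall>k\<in>{..<n}. r k x = f x \<longrightarrow> r k t = f t"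
          by (intro eventually_ball_finite) auto
        have "\<forall>\<^sub>F x in at t. \<bar>f x - z0\<bar> < \<epsilon> \<and> \<bar>x - t0\<bar> < \<delta>" using near_f elim(4) by blast
        with ev1 ev2 eventually_neq_at_within[of t t UNIV]
        have bound: "\<forall>\<^sub>F x in at t. \<bar>(g x - g t) / (x - t) - L\<bar> \<le> \<theta> / 2 * \<bar>t - t0\<bar>"
        proof eventually_elim
          case (elim x)
          have "card {k. k < n \<and> r k x = f x} > 0" using mult[of x "f x"] fpos[of x] elim by simp
          then obtain k where k: "k < n" "r k x = f x" by (auto simp: card_gt_0_iff)
          then have kt: "r k t = f t" using elim by blast
          have "Jet (r k t) 0 0 \<in> window t0 (Jk k) \<eta> t"
            using \<open>\<forall>k\<in>{..<n}. Jet (r k t) 0 0 \<in> window t0 (Jk k) \<eta> t\<close> k(1) by blast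
          then have "\<phi> t \<in> window t0 (Jk k) \<eta> t" using kt by (simp add: window_def f_def)
          then have "Jk k = J0"
            using \<open>\<phi> t \<in> window t0 J0 \<eta> t\<close> J0F Jk(1)[OF k(1)]
              \<open>\<forall>J1\<in>F. \<forall>J2\<in>F. J1 \<noteq> J2 \<longrightarrow> window t0 J1 \<eta> t \<inter> window t0 J2 \<eta> t = {}\<close> by blast
          moreover have "x \<noteq> t \<longrightarrow> \<bar>(1 / (r k x - c) - 1 / (r k t - c)) / (x - t) - (b (Jk k) + 2 * e (Jk k) * (t - t0))\<bar> \<le> \<theta> / 2 * \<bar>t - t0\<bar>"
            using elim k(1) by blast
          ultimately show ?case using elim kt k(2) by (simp add: g_def L_def)
        qed
        have "((\<lambda>x. (g x - g t) / (x - t)) \<longlongrightarrow> g' t) (at t)"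
          using gder[of t] elim by (simp add: has_field_derivative_iff)
        then have "((\<lambda>x. \<bar>(g x - g t) / (x - t) - L\<bar>) \<longlongrightarrow> \<bar>g' t - L\<bar>) (at t)"
          by (intro tendsto_intros)
        from tendsto_upperbound[OF this bound] have "\<bar>g' t - L\<bar> \<le> \<theta> / 2 * \<bar>t - t0\<bar>" by simp
        then have "\<bar>g' t - L\<bar> / \<bar>t - t0\<bar> \<le> \<theta> / 2" using elim by (simp add: pos_divide_le_eq)
        then have "\<bar>g' t - L\<bar> / \<bar>t - t0\<bar> < \<theta>" using \<open>\<theta> > 0\<close> by linarith
        moreover have "(g' t - g' t0) / (t - t0) - 2 * e J0 = (g' t - L) / (t - t0)"
          using elim by (simp add: L_def g'0 field_simps)
        ultimately show ?case by (simp only: dist_real_def abs_divide)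
      qed
    qed
  qed
  have "((\<lambda>t. (g' t - g' t0) / (t - t0)) \<longlongrightarrow> 2 * e J0) (at t0)"
    using side[of "{t0<..<t0+\<delta>}" "{t0<..}"] side[of "{t0-\<delta><..<t0}" "{..<t0}"]
    by (intro filterlim_split_at) (simp_all add: one_sided_filter)
  then have "(g' has_real_derivative 2 * e J0) (at t0)" by (simp add: has_field_derivative_iff)
  from DERIV_mult[OF DERIV_minus[OF this] DERIV_power[OF DERIV_diff[OF fd[of t0] DERIV_const[of c]], of 2]]
  obtain D where D: "((\<lambda>t. - g' t * (f t - c)\<^sup>2) has_real_derivative D) (at t0)" by blast
  have "\<forall>\<^sub>F t in nhds t0. - g' t * (f t - c)\<^sup>2 = d t"
  proof -
    have "- g' t * (f t - c)\<^sup>2 = d t" if "\<bar>f t - z0\<bar> < \<epsilon>" for t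
    proof -
      have "f t - c \<noteq> 0" using that pos by auto
      then show ?thesis by (simp add: g'_def)
    qed
    moreover have "\<forall>\<^sub>F t in nhds t0. \<bar>f t - z0\<bar> < \<epsilon>"
      unfolding eventually_nhds_conv_at using near_t0 pos by (auto simp: z0_def elim: eventually_mono)
    ultimately show ?thesis by (auto elim: eventually_mono)
  qed
  from DERIV_cong_ev[OF refl this refl, of D] D have "(d has_real_derivative D) (at t0)" by blast
  then show ?thesis unfolding d_def[abs_def] real_differentiable_def by blast
qed

lemma branch_times_differentiable:
  assumes br: "branch (\<lambda>t J. m t J > 0) \<phi> UNIV"
  shows "times_differentiable 2 (\<lambda>t. jet_val (\<phi> t))"
proof -
  have d: "((\<lambda>t. jet_val (\<phi> t)) has_real_derivative jet_slope (\<phi> t)) (at t)" for t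
    using br follows_imp_derivative by (auto simp: branch_def)
  then have "vector_derivative (\<lambda>t. jet_val (\<phi> t)) (at t) = jet_slope (\<phi> t)" for t
    by (simp add: has_real_derivative_iff_has_vector_derivative vector_derivative_at)
  then have "higher_derivative 1 (\<lambda>t. jet_val (\<phi> t)) = (\<lambda>t. jet_slope (\<phi> t))"
    by (simp add: higher_derivative_def)
  moreover have "higher_derivative 0 (\<lambda>t. jet_val (\<phi> t)) = (\<lambda>t. jet_val (\<phi> t))"
    by (simp add: higher_derivative_def)
  moreover have "(\<lambda>t. jet_val (\<phi> t)) differentiable at t" for t
    using d real_differentiable_def by blast
  ultimately show ?thesis
    using branch_slope_differentiable[OF br] by (auto simp: times_differentiable_def less_2_cases_iff)
qed

theorem parameterization:
  "\<exists>N lam. (\<forall>i. enat i < N \<longrightarrow> times_differentiable 2 (lam i)) \<and>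
    (\<forall>t z. ecard {i. enat i < N \<and> lam i t = z} = enat (M t z))"
proof -
  obtain N \<phi>s where br: "\<And>i. enat i < N \<Longrightarrow> branch (\<lambda>t J. m t J > 0) (\<phi>s i) UNIV" and
    fin: "\<And>t J. finite {i. enat i < N \<and> \<phi>s i t = J}" and
    card: "\<And>t J. card {i. enat i < N \<and> \<phi>s i t = J} = m t J"
    using jet_system_parameterization[OF jet_system_axioms] by blast
  have "ecard {i. enat i < N \<and> jet_val (\<phi>s i t) = z} = enat (M t z)" for t z
  proof -
    let ?B = "{J. jet_val J = z \<and> m t J > 0}"
    have eq: "{i. enat i < N \<and> jet_val (\<phi>s i t) = z} = (\<Union>J\<in>?B. {i. enat i < N \<and> \<phi>s i t = J})"
      using br by (auto simp: branch_def)
    have B: "finite ?B" "sum (m t) ?B = M t z" using jets_total by auto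
    have "card (\<Union>J\<in>?B. {i. enat i < N \<and> \<phi>s i t = J}) = sum (m t) ?B"
      using B fin by (subst card_UN_disjoint) (auto simp: card)
    then show ?thesis unfolding eq ecard_def using B fin by simp
  qed
  moreover have "times_differentiable 2 (\<lambda>t. jet_val (\<phi>s i t))" if "enat i < N" for i
    using branch_times_differentiable[OF br[OF that]] .
  ultimately show ?thesis by (intro exI[of _ N] exI[of _ "\<lambda>i t. jet_val (\<phi>s i t)"]) simp
qed

end

section \<open>Complex Hilbert spaces\<close>

lemma cinner_add_right: "cinner x (y + z) = cinner x y + cinner x z"
  by (metis cinner_add_left cinner_commute complex_cnj_add)

lemma cinner_scaleC_right: "cinner x (a *\<^sub>C y) = cnj a * cinner x y"
  by (metis cinner_commute cinner_scaleC_left complex_cnj_mult)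

lemma cinner_minus_left: "cinner (- x) y = - cinner x y"
  using cinner_scaleC_left[of "-1" x y] by simp

lemma cinner_minus_right: "cinner x (- y) = - cinner x y"
  using cinner_scaleC_right[of x "-1" y] by simp

lemma cinner_diff_left: "cinner (x - y) z = cinner x z - cinner y z"
  using cinner_add_left[of x "- y" z] by (simp add: cinner_minus_left)

lemma cinner_diff_right: "cinner x (y - z) = cinner x y - cinner x z"
  using cinner_add_right[of x y "- z"] by (simp add: cinner_minus_right)

lemma cinner_zero_left [simp]: "cinner 0 x = 0"
  using cinner_scaleC_left[of 0 x x] by simp

lemma cinner_zero_right [simp]: "cinner x 0 = 0"
  using cinner_scaleC_right[of x 0 x] by simp

lemma cinner_sum_left: "cinner (\<Sum>i\<in>I. f i) y = (\<Sum>i\<in>I. cinner (f i) y)"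
  by (induction I rule: infinite_finite_induct) (auto simp: cinner_add_left)

lemma cinner_sum_right: "cinner x (\<Sum>i\<in>I. f i) = (\<Sum>i\<in>I. cinner x (f i))"
  by (induction I rule: infinite_finite_induct) (auto simp: cinner_add_right)

lemma scaleR_scaleC: "r *\<^sub>R x = complex_of_real r *\<^sub>C x"
  by (simp add: scaleC_of_real)

lemma cinner_scaleR_left: "cinner (r *\<^sub>R x) y = r * cinner x y"
  by (simp add: scaleR_scaleC cinner_scaleC_left)

lemma cinner_scaleR_right: "cinner x (r *\<^sub>R y) = r * cinner x y"
  by (simp add: scaleR_scaleC cinner_scaleC_right)

lemma scaleC_diff_right: "a *\<^sub>C (x - y) = a *\<^sub>C x - a *\<^sub>C (y::'a::complex_hilbert_space)"
  by (rule complex_vector.scale_right_diff_distrib)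

lemma scaleC_scaleR: "a *\<^sub>C (r *\<^sub>R x) = r *\<^sub>R (a *\<^sub>C (x::'a::complex_hilbert_space))"
  by (simp add: scaleR_scaleC scaleC_scaleC mult.commute)

lemma cinner_self: "cinner x x = complex_of_real ((norm x)\<^sup>2)"
proof -
  have "Im (cinner x x) = - Im (cinner x x)" using arg_cong[OF cinner_commute[of x x], of Im] by simp
  then show ?thesis by (simp add: complex_eq_iff Re_cinner power2_norm_eq_inner)
qed

lemma norm_scaleC: "norm (a *\<^sub>C x) = cmod a * norm (x::'a::complex_hilbert_space)"
proof -
  have "cinner (a *\<^sub>C x) (a *\<^sub>C x) = (a * cnj a) * cinner x x"
    by (simp only: cinner_scaleC_left cinner_scaleC_right mult_ac)
  also have "a * cnj a = complex_of_real ((cmod a)\<^sup>2)" by (rule complex_norm_square[symmetric])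
  finally have "complex_of_real ((norm (a *\<^sub>C x))\<^sup>2) = complex_of_real ((cmod a * norm x)\<^sup>2)"
    by (simp only: cinner_self power_mult_distrib of_real_mult)
  then have "(norm (a *\<^sub>C x))\<^sup>2 = (cmod a * norm x)\<^sup>2" using of_real_eq_iff by blast
  then show ?thesis by (simp add: power2_eq_iff_nonneg)
qed

lemma cinner_cauchy_schwarz: "cmod (cinner x y) \<le> norm x * norm y"
proof (cases "cinner x y = 0")
  case False
  define a where "a = cnj (cinner x y) / cmod (cinner x y)"
  have "cnj (cinner x y) * cinner x y = complex_of_real ((cmod (cinner x y))\<^sup>2)"
    by (simp only: complex_norm_square mult.commute)
  then have "cinner (a *\<^sub>C x) y = cmod (cinner x y)"
    using False by (simp add: a_def cinner_scaleC_left power2_eq_square)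
  then have "cmod (cinner x y) = inner (a *\<^sub>C x) y" by (metis Re_cinner Re_complex_of_real)
  also have "\<dots> \<le> norm (a *\<^sub>C x) * norm y" by (rule norm_cauchy_schwarz)
  also have "norm (a *\<^sub>C x) = norm x" using False by (simp add: norm_scaleC a_def norm_divide)
  finally show ?thesis .
qed auto

lemma bounded_linear_cinner_left: "bounded_linear (\<lambda>x. cinner x y)"
  by (rule bounded_linear_intro[of _ "norm y"])
    (auto simp: cinner_add_left cinner_scaleR_left scaleR_conv_of_real cinner_cauchy_schwarz)

lemma bounded_linear_cinner_right: "bounded_linear (\<lambda>y. cinner x y)"
proof (rule bounded_linear_intro[of _ "norm x"])
  show "norm (cinner x y) \<le> norm y * norm x" for y
    using cinner_cauchy_schwarz[of x y] by (simp add: mult.commute)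
qed (auto simp: cinner_add_right cinner_scaleR_right scaleR_conv_of_real)

lemma tendsto_cinner_left: "(f \<longlongrightarrow> a) F \<Longrightarrow> ((\<lambda>n. cinner (f n) y) \<longlongrightarrow> cinner a y) F"
  by (rule bounded_linear.tendsto[OF bounded_linear_cinner_left])

lemma tendsto_cinner_right: "(f \<longlongrightarrow> a) F \<Longrightarrow> ((\<lambda>n. cinner y (f n)) \<longlongrightarrow> cinner y a) F"
  by (rule bounded_linear.tendsto[OF bounded_linear_cinner_right])

lemma norm_add_orthogonal:
  assumes "cinner x y = 0"
  shows "(norm (x + y))\<^sup>2 = (norm x)\<^sup>2 + (norm y)\<^sup>2"
proof -
  have "inner x y = 0" using assms by (metis Re_cinner zero_complex.sel(1))
  then show ?thesis by (simp add: power2_norm_eq_inner inner_add_left inner_add_right inner_commute)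
qed

text \<open>A minimizing sequence for the distance from \<open>a\<close> to \<open>M\<close> is
  Cauchy by the parallelogram law, and the difference of \<open>a\<close> and its limit is
  normal to \<open>M\<close>.\<close>

lemma closed_subspace_normal:
  fixes M :: "'a::complex_hilbert_space set"
  assumes sub: "complex_vector.subspace M" and "closed M" and "a \<notin> M"
  obtains v where "v \<noteq> 0" "\<And>x. x \<in> M \<Longrightarrow> cinner x v = 0"
proof -
  have M0: "0 \<in> M" and Madd: "\<And>x y. x \<in> M \<Longrightarrow> y \<in> M \<Longrightarrow> x + y \<in> M" and Msc: "\<And>c x. x \<in> M \<Longrightarrow> c *\<^sub>C x \<in> M"
    using sub by (auto simp: complex_vector.subspace_def)
  define d where "d = infdist a M"
  have d: "d \<le> norm (a - x)" if "x \<in> M" for x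
    using infdist_le[OF that, of a] by (simp add: d_def dist_norm)
  have "\<exists>x\<in>M. norm (a - x) < d + inverse (real (Suc n))" for n
  proof -
    have ne: "M \<noteq> {}" using M0 by auto
    then have "Inf (dist a ` M) < d + inverse (real (Suc n))" by (simp add: d_def infdist_notempty)
    then obtain q where "q \<in> dist a ` M" "q < d + inverse (real (Suc n))"
      using ne cInf_lessD by (metis image_is_empty)
    then show ?thesis by (auto simp: dist_norm)
  qed
  then obtain x where xM: "\<And>n. x n \<in> M" and xd: "\<And>n. norm (a - x n) < d + inverse (real (Suc n))" by metis
  have d0: "d \<ge> 0" by (simp add: d_def infdist_nonneg)
  have par: "(norm (x i - x j))\<^sup>2 \<le> 2 * (norm (a - x i))\<^sup>2 + 2 * (norm (a - x j))\<^sup>2 - 4 * d\<^sup>2" for i j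
  proof -
    define y where "y = (1/2) *\<^sub>R (x i + x j)"
    have "y \<in> M" unfolding y_def scaleR_scaleC by (intro Msc Madd xM)
    then have "d\<^sup>2 \<le> (norm (a - y))\<^sup>2" using d d0 by (intro power_mono) auto
    moreover have "(norm (x i - x j))\<^sup>2 = 2 * (norm (a - x i))\<^sup>2 + 2 * (norm (a - x j))\<^sup>2 - 4 * (norm (a - y))\<^sup>2"
      unfolding y_def power2_norm_eq_inner
      by (simp add: inner_diff_left inner_diff_right inner_add_left inner_add_right inner_commute algebra_simps)
    ultimately show ?thesis by linarith
  qed
  have lim: "(\<lambda>n. norm (a - x n)) \<longlonglongrightarrow> d"
  proof (rule tendsto_sandwich[OF _ _ tendsto_const])
    show "(\<lambda>n. d + inverse (real (Suc n))) \<longlonglongrightarrow> d"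
      using tendsto_add[OF tendsto_const LIMSEQ_inverse_real_of_nat, of d] by simp
  qed (use d xM xd in \<open>auto intro!: always_eventually less_imp_le\<close>)
  have "Cauchy x"
  proof (rule metric_CauchyI)
    fix e :: real assume "e > 0"
    have "(\<lambda>n. (norm (a - x n))\<^sup>2) \<longlonglongrightarrow> d\<^sup>2" by (intro tendsto_intros lim)
    moreover have "d\<^sup>2 < d\<^sup>2 + e\<^sup>2 / 4" using \<open>e > 0\<close> by simp
    ultimately have "\<forall>\<^sub>F n in sequentially. (norm (a - x n))\<^sup>2 < d\<^sup>2 + e\<^sup>2 / 4" by (rule order_tendstoD(2))
    then obtain N where N: "\<And>n. n \<ge> N \<Longrightarrow> (norm (a - x n))\<^sup>2 < d\<^sup>2 + e\<^sup>2 / 4"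
      unfolding eventually_sequentially by blast
    have "dist (x i) (x j) < e" if "i \<ge> N" "j \<ge> N" for i j
    proof -
      have "(norm (x i - x j))\<^sup>2 < e\<^sup>2" using par[of i j] N[OF that(1)] N[OF that(2)] by linarith
      then show ?thesis using \<open>e > 0\<close> by (simp add: dist_norm power_less_imp_less_base)
    qed
    then show "\<exists>N. \<forall>m\<ge>N. \<forall>n\<ge>N. dist (x m) (x n) < e" by blast
  qed
  then obtain p where p: "x \<longlonglongrightarrow> p" using Cauchy_convergent convergent_def by blast
  have pM: "p \<in> M" using closed_sequentially[OF \<open>closed M\<close> xM p] .
  have pd: "norm (a - p) = d"
    using LIMSEQ_unique[OF tendsto_norm[OF tendsto_diff[OF tendsto_const p]] lim] .
  define v where "v = a - p"
  have re: "inner y v = 0" if "y \<in> M" for y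
  proof (rule ccontr)
    assume ne: "inner y v \<noteq> 0"
    then have y0: "inner y y > 0" by auto
    define s where "s = inner y v / inner y y"
    have "p + s *\<^sub>R y \<in> M" unfolding scaleR_scaleC using pM that Madd Msc by blast
    then have "d\<^sup>2 \<le> (norm (v - s *\<^sub>R y))\<^sup>2" using d[of "p + s *\<^sub>R y"] d0
      by (intro power_mono) (auto simp: v_def diff_diff_eq)
    moreover have "(norm (v - s *\<^sub>R y))\<^sup>2 = d\<^sup>2 - (inner y v)\<^sup>2 / inner y y"
    proof -
      have "(norm (v - s *\<^sub>R y))\<^sup>2 = inner v v - 2 * s * inner y v + s * s * inner y y"
        by (simp add: power2_norm_eq_inner inner_diff_left inner_diff_right inner_commute algebra_simps)
      moreover have "inner v v = d\<^sup>2" using pd by (simp add: v_def power2_norm_eq_inner[symmetric])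
      ultimately show ?thesis using y0 by (simp add: s_def power2_eq_square field_simps)
    qed
    moreover have "(inner y v)\<^sup>2 / inner y y > 0" using ne y0 by simp
    ultimately show False by linarith
  qed
  have "cinner y v = 0" if "y \<in> M" for y
  proof -
    have "Re (cinner (\<i> *\<^sub>C y) v) = 0" using re[OF Msc[OF that]] by (simp add: Re_cinner)
    then have "Im (cinner y v) = 0" by (simp add: cinner_scaleC_left)
    then show ?thesis using re[OF that] by (simp add: complex_eq_iff Re_cinner)
  qed
  moreover have "v \<noteq> 0" using pM assms(3) by (auto simp: v_def)
  ultimately show thesis using that by blast
qed

section \<open>Orthonormal families\<close>

definition orthonormal :: "'a::complex_hilbert_space set \<Rightarrow> bool"
  where "orthonormal B \<longleftrightarrow> (\<forall>x\<in>B. \<forall>y\<in>B. cinner x y = (if x = y then 1 else 0))"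

definition proj :: "'a::complex_hilbert_space set \<Rightarrow> 'a \<Rightarrow> 'a"
  where "proj B x = (\<Sum>e\<in>B. cinner x e *\<^sub>C e)"

lemma orthonormal_norm:
  assumes "orthonormal B" "e \<in> B"
  shows "norm e = 1"
proof -
  have "cinner e e = 1" using assms by (simp add: orthonormal_def)
  then have "complex_of_real ((norm e)\<^sup>2) = complex_of_real 1" unfolding cinner_self by simp
  then have "(norm e)\<^sup>2 = 1" using of_real_eq_iff by blast
  then have "norm e = 1 \<or> norm e = - 1" by (simp add: power2_eq_1_iff)
  then show ?thesis using norm_ge_zero[of e] by linarith
qed

lemma cinner_combination:
  assumes "orthonormal B" "finite B" "b \<in> B"
  shows "cinner (\<Sum>e\<in>B. c e *\<^sub>C e) b = c b"
proof -
  have "cinner (\<Sum>e\<in>B. c e *\<^sub>C e) b = (\<Sum>e\<in>B. if e = b then c e else 0)"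
    using assms unfolding cinner_sum_left
    by (intro sum.cong) (auto simp: cinner_scaleC_left orthonormal_def)
  then show ?thesis using assms by simp
qed

lemma cinner_proj: "orthonormal B \<Longrightarrow> finite B \<Longrightarrow> b \<in> B \<Longrightarrow> cinner (proj B x) b = cinner x b"
  unfolding proj_def by (rule cinner_combination)

lemma cinner_diff_proj: "orthonormal B \<Longrightarrow> finite B \<Longrightarrow> b \<in> B \<Longrightarrow> cinner (x - proj B x) b = 0"
  by (simp add: cinner_diff_left cinner_proj)

lemma norm_combination:
  assumes "orthonormal B" "finite B"
  shows "(norm (\<Sum>e\<in>B. c e *\<^sub>C e))\<^sup>2 = (\<Sum>e\<in>B. (cmod (c e))\<^sup>2)"
proof -
  have "complex_of_real ((norm (\<Sum>e\<in>B. c e *\<^sub>C e))\<^sup>2) = (\<Sum>e\<in>B. cnj (c e) * c e)"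
    unfolding cinner_self[symmetric] using assms
    by (subst cinner_sum_right) (simp add: cinner_scaleC_right cinner_combination)
  also have "\<dots> = complex_of_real (\<Sum>e\<in>B. (cmod (c e))\<^sup>2)"
    by (simp only: of_real_sum complex_norm_square mult.commute)
  finally show ?thesis using of_real_eq_iff by blast
qed

lemma norm_decomposition:
  assumes "orthonormal B" "finite B"
  shows "(norm x)\<^sup>2 = (\<Sum>e\<in>B. (cmod (cinner x e))\<^sup>2) + (norm (x - proj B x))\<^sup>2"
proof -
  have "cinner (proj B x) (x - proj B x) = (\<Sum>e\<in>B. cinner x e * cnj (cinner (x - proj B x) e))"
    unfolding proj_def[of B x] cinner_sum_left cinner_scaleC_left
    using cinner_commute by (intro sum.cong) auto
  also have "\<dots> = 0" using assms by (intro sum.neutral) (simp add: cinner_diff_proj)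
  finally have "(norm (proj B x + (x - proj B x)))\<^sup>2 = (norm (proj B x))\<^sup>2 + (norm (x - proj B x))\<^sup>2"
    by (rule norm_add_orthogonal)
  then show ?thesis using norm_combination[OF assms, of "\<lambda>e. cinner x e"] by (simp add: proj_def)
qed

lemma bessel:
  assumes "orthonormal B" "finite B"
  shows "(\<Sum>e\<in>B. (cmod (cinner x e))\<^sup>2) \<le> (norm x)\<^sup>2"
  using norm_decomposition[OF assms, of x] by simp

lemma orthonormal_independent:
  assumes "orthonormal B"
  shows "complex_vector.independent B"
  unfolding complex_vector.independent_explicit_module
proof (intro allI impI)
  fix t u v assume t: "finite t" "t \<subseteq> B" "(\<Sum>v\<in>t. u v *\<^sub>C v) = 0" "v \<in> t"
  have "orthonormal t" using assms t(2) by (auto simp: orthonormal_def subset_iff)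
  from cinner_combination[OF this t(1,4), of u] t(3) show "u v = 0" by simp
qed

lemma proj_eq_self:
  assumes "orthonormal B" "finite B" "x \<in> complex_vector.span B"
  shows "proj B x = x"
proof -
  obtain u where "x = (\<Sum>v\<in>B. u v *\<^sub>C v)"
    using assms(3) complex_vector.span_finite[OF assms(2)] by auto
  then show ?thesis using assms by (simp add: proj_def cinner_combination)
qed

text \<open>Gram-Schmidt.\<close>

lemma orthonormal_basis:
  assumes "finite S"
  shows "\<exists>B. finite B \<and> orthonormal B \<and> complex_vector.span B = complex_vector.span S"
  using assms
proof (induction S)
  case empty
  show ?case by (intro exI[of _ "{}"]) (simp add: orthonormal_def)
next
  case (insert a S)
  then obtain B where B: "finite B" "orthonormal B" "complex_vector.span B = complex_vector.span S" by auto
  define w where "w = a - proj B a"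
  have pB: "proj B a \<in> complex_vector.span B" unfolding proj_def
    by (intro complex_vector.span_sum complex_vector.span_scale complex_vector.span_base)
  show ?case
  proof (cases "w = 0")
    case True
    then have "a \<in> complex_vector.span S" using pB B by (simp add: w_def)
    then show ?thesis using B complex_vector.span_redundant by (metis complex_vector.span_redundant)
  next
    case False
    define e where "e = (1 / norm w) *\<^sub>R w"
    have ne: "norm e = 1" using False by (simp add: e_def)
    have eb: "cinner e b = 0" if "b \<in> B" for b
      using cinner_diff_proj[OF B(2,1) that] by (simp add: e_def w_def cinner_scaleR_left)
    then have be: "cinner b e = 0" if "b \<in> B" for b using that cinner_commute[of b e] by simp
    have ee: "cinner e e = 1" using cinner_self[of e] ne by simp
    have on: "orthonormal (insert e B)"
      using B(2) eb be ee by (auto simp: orthonormal_def)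
    have sp: "complex_vector.span (insert e B) = complex_vector.span (insert a S)"
    proof (intro equalityI complex_vector.span_minimal complex_vector.subspace_span)
      have B': "complex_vector.span B \<subseteq> complex_vector.span (insert a S)"
        unfolding B(3) by (intro complex_vector.span_mono) auto
      have "w \<in> complex_vector.span (insert a S)" unfolding w_def using pB B'
        by (intro complex_vector.span_diff) (auto intro: complex_vector.span_base)
      then have "e \<in> complex_vector.span (insert a S)" unfolding e_def scaleR_scaleC
        by (rule complex_vector.span_scale)
      then show "insert e B \<subseteq> complex_vector.span (insert a S)"
        using B' complex_vector.span_superset[of B] by auto
      have B'': "complex_vector.span B \<subseteq> complex_vector.span (insert e B)"
        by (intro complex_vector.span_mono) auto
      have "w = norm w *\<^sub>R e" using False by (simp add: e_def)
      then have "w \<in> complex_vector.span (insert e B)" unfolding scaleR_scaleC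
        by (metis complex_vector.span_base complex_vector.span_scale insertI1)
      then have "w + proj B a \<in> complex_vector.span (insert e B)"
        using pB B'' by (intro complex_vector.span_add) auto
      then have "a \<in> complex_vector.span (insert e B)" by (simp add: w_def)
      moreover have "S \<subseteq> complex_vector.span (insert e B)"
        using B'' complex_vector.span_superset[of S] unfolding B(3) by auto
      ultimately show "insert a S \<subseteq> complex_vector.span (insert e B)" by auto
    qed
    show ?thesis using B(1) on sp by (intro exI[of _ "insert e B"]) auto
  qed
qed

lemma homogeneous_system:
  fixes a :: "nat \<Rightarrow> 'b \<Rightarrow> complex"
  assumes "finite B" "k < card B"
  shows "\<exists>c. (\<exists>b\<in>B. c b \<noteq> 0) \<and> (\<forall>i<k. (\<Sum>b\<in>B. a i b * c b) = 0)"
  using assms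
proof (induction k arbitrary: B a)
  case 0
  then have "B \<noteq> {}" by auto
  then show ?case by (intro exI[of _ "\<lambda>_. 1"]) auto
next
  case (Suc k)
  show ?case
  proof (cases "\<forall>b\<in>B. a k b = 0")
    case True
    obtain c where c: "\<exists>b\<in>B. c b \<noteq> 0" "\<forall>i<k. (\<Sum>b\<in>B. a i b * c b) = 0"
      using Suc.IH[of B a] Suc.prems by auto
    have "(\<Sum>b\<in>B. a k b * c b) = 0" using True by (intro sum.neutral) auto
    then show ?thesis using c by (intro exI[of _ c]) (auto simp: less_Suc_eq)
  next
    case False
    then obtain p where p: "p \<in> B" "a k p \<noteq> 0" by auto
    define B' where "B' = B - {p}"
    have B': "finite B'" "k < card B'" using Suc.prems p by (auto simp: B'_def card_Diff_singleton)
    obtain c where c: "\<exists>b\<in>B'. c b \<noteq> 0" "\<And>i. i < k \<Longrightarrow> (\<Sum>b\<in>B'. (a i b - a i p * a k b / a k p) * c b) = 0"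
      using Suc.IH[OF B', of "\<lambda>i b. a i b - a i p * a k b / a k p"] by blast
    define d where "d b = (if b = p then - (\<Sum>b\<in>B'. a k b * c b) / a k p else c b)" for b
    have split: "(\<Sum>b\<in>B. a i b * d b) = a i p * d p + (\<Sum>b\<in>B'. a i b * c b)" for i
    proof -
      have "(\<Sum>b\<in>B. a i b * d b) = a i p * d p + (\<Sum>b\<in>B'. a i b * d b)"
        unfolding B'_def using Suc.prems p by (intro sum.remove) auto
      also have "(\<Sum>b\<in>B'. a i b * d b) = (\<Sum>b\<in>B'. a i b * c b)"
        by (intro sum.cong) (auto simp: d_def B'_def)
      finally show ?thesis .
    qed
    have dp: "d p = - (\<Sum>b\<in>B'. a k b * c b) / a k p" by (simp add: d_def)
    have "(\<Sum>b\<in>B. a i b * d b) = 0" if "i < Suc k" for i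
    proof (cases "i = k")
      case True
      then show ?thesis using p by (simp add: split dp)
    next
      case False
      have "(\<Sum>b\<in>B'. (a i b - a i p * a k b / a k p) * c b)
        = (\<Sum>b\<in>B'. a i b * c b) - a i p / a k p * (\<Sum>b\<in>B'. a k b * c b)"
        unfolding sum_distrib_left sum_subtractf[symmetric] by (intro sum.cong) (auto simp: algebra_simps)
      then show ?thesis using c(2)[of i] False that by (simp add: split dp)
    qed
    moreover have "\<exists>b\<in>B. d b \<noteq> 0" using c(1) by (auto simp: d_def B'_def)
    ultimately show ?thesis by (intro exI[of _ d]) auto
  qed
qed

lemma common_kernel_vector:
  assumes "finite B" "orthonormal B" "k < card B"
  obtains x where "x \<in> complex_vector.span B" "x \<noteq> 0" "\<And>i. i < k \<Longrightarrow> cinner x (g i) = 0"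
proof -
  obtain c where c: "\<exists>b\<in>B. c b \<noteq> 0" "\<And>i. i < k \<Longrightarrow> (\<Sum>b\<in>B. cinner b (g i) * c b) = 0"
    using homogeneous_system[OF assms(1,3), of "\<lambda>i b. cinner b (g i)"] by blast
  show thesis
  proof (rule that[of "\<Sum>b\<in>B. c b *\<^sub>C b"])
    show "(\<Sum>b\<in>B. c b *\<^sub>C b) \<in> complex_vector.span B"
      by (intro complex_vector.span_sum complex_vector.span_scale complex_vector.span_base)
    obtain b where b: "b \<in> B" "c b \<noteq> 0" using c(1) by auto
    then show "(\<Sum>b\<in>B. c b *\<^sub>C b) \<noteq> 0"
      using cinner_combination[OF assms(2,1) b(1), of c] by auto
    show "cinner (\<Sum>b\<in>B. c b *\<^sub>C b) (g i) = 0" if "i < k" for i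
      using c(2)[OF that] by (simp add: cinner_sum_left cinner_scaleC_left mult.commute)
  qed
qed

definition onf :: "(nat \<Rightarrow> 'a::complex_hilbert_space) \<Rightarrow> nat \<Rightarrow> bool"
  where "onf f k \<longleftrightarrow> (\<forall>i<k. \<forall>j<k. cinner (f i) (f j) = (if i = j then 1 else 0))"

lemma onf_inj: "onf f k \<Longrightarrow> inj_on f {..<k}"
  unfolding onf_def inj_on_def by (metis lessThan_iff zero_neq_one)

lemma onf_orthonormal: "onf f k \<Longrightarrow> orthonormal (f ` {..<k})"
  unfolding orthonormal_def using onf_inj[of f k] by (auto simp: onf_def inj_on_def)

lemma onf_card: "onf f k \<Longrightarrow> card (f ` {..<k}) = k"
  using onf_inj card_image by fastforce

lemma onf_sum: "onf f k \<Longrightarrow> (\<Sum>e\<in>f ` {..<k}. h e) = (\<Sum>i<k. h (f i))"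
  using sum.reindex[OF onf_inj] by auto

lemma onf_mono: "onf f k \<Longrightarrow> j \<le> k \<Longrightarrow> onf f j"
  by (auto simp: onf_def)

definition fproj :: "(nat \<Rightarrow> 'a::complex_hilbert_space) \<Rightarrow> nat \<Rightarrow> 'a \<Rightarrow> 'a"
  where "fproj f k x = (\<Sum>i<k. cinner x (f i) *\<^sub>C f i)"

lemma fproj_eq: "onf f k \<Longrightarrow> fproj f k x = proj (f ` {..<k}) x"
  by (simp add: fproj_def proj_def onf_sum)

lemma fproj_orthogonal: "onf f k \<Longrightarrow> i < k \<Longrightarrow> cinner (x - fproj f k x) (f i) = 0"
  using cinner_diff_proj[OF onf_orthonormal, of f k "f i" x] by (simp add: fproj_eq)

lemma onf_norm_decomposition:
  "onf f k \<Longrightarrow> (norm x)\<^sup>2 = (\<Sum>i<k. (cmod (cinner x (f i)))\<^sup>2) + (norm (x - fproj f k x))\<^sup>2"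
  using norm_decomposition[OF onf_orthonormal, of f k x] by (simp add: fproj_eq onf_sum)

lemma onf_bessel: "onf f k \<Longrightarrow> (\<Sum>i<k. (cmod (cinner x (f i)))\<^sup>2) \<le> (norm x)\<^sup>2"
  using onf_norm_decomposition[of f k x] by simp

lemma onf_norm: "onf f k \<Longrightarrow> i < k \<Longrightarrow> norm (f i) = 1"
  using orthonormal_norm[OF onf_orthonormal] by auto

section \<open>Compact symmetric operators\<close>

locale symmetric_operator =
  fixes R :: "'a::complex_hilbert_space \<Rightarrow> 'a" and L :: real
  assumes add: "R (x + y) = R x + R y" and scale: "R (a *\<^sub>C x) = a *\<^sub>C R x"
    and sym: "cinner (R x) y = cinner x (R y)" and bound: "norm (R x) \<le> L * norm x"
begin

lemma scaleR: "R (s *\<^sub>R x) = s *\<^sub>R R x"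
  by (simp add: scaleR_scaleC scale)

lemma R0 [simp]: "R 0 = 0"
  using scale[of 0 0] by simp

lemma diff: "R (x - y) = R x - R y"
  using add[of x "- y"] scale[of "-1" y] by simp

lemma R_sum: "R (\<Sum>i\<in>I. g i) = (\<Sum>i\<in>I. R (g i))"
  by (induction I rule: infinite_finite_induct) (auto simp: add)

lemma isym: "inner (R x) y = inner x (R y)"
  using sym by (metis Re_cinner)

lemma bounded_linear: "bounded_linear R"
  by (rule bounded_linear_intro[of _ L]) (auto simp: add scaleR bound mult.commute)

lemma form_decomposition:
  assumes f: "onf f k" and ev: "\<And>i. i < k \<Longrightarrow> R (f i) = r i *\<^sub>R f i"
  shows "inner (R x) x = (\<Sum>i<k. r i * (cmod (cinner x (f i)))\<^sup>2)
    + inner (R (x - fproj f k x)) (x - fproj f k x)"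
proof -
  define p y where "p = fproj f k x" and "y = x - fproj f k x"
  have Rp: "R p = (\<Sum>i<k. (r i * cinner x (f i)) *\<^sub>C f i)"
    unfolding p_def fproj_def R_sum scale
    by (intro sum.cong) (auto simp: ev scaleR_scaleC scaleC_scaleC mult.commute)
  have fy: "cinner (f i) y = 0" if "i < k" for i
    using fproj_orthogonal[OF f that, of x] cinner_commute[of "f i" y] by (simp add: y_def)
  have Rpy: "cinner (R p) y = 0" unfolding Rp cinner_sum_left cinner_scaleC_left
    by (intro sum.neutral) (simp add: fy)
  have "cinner (R p) p = (\<Sum>i<k. (r i * cinner x (f i)) * cinner (f i) p)"
    unfolding Rp cinner_sum_left cinner_scaleC_left ..
  also have "\<dots> = (\<Sum>i<k. complex_of_real (r i * (cmod (cinner x (f i)))\<^sup>2))"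
  proof (rule sum.cong)
    fix i assume "i \<in> {..<k}"
    then have "cinner p (f i) = cinner x (f i)" using fproj_orthogonal[OF f, of i x] by (simp add: p_def cinner_diff_left)
    then have "cinner (f i) p = cnj (cinner x (f i))" using cinner_commute[of "f i" p] by simp
    then show "(r i * cinner x (f i)) * cinner (f i) p = complex_of_real (r i * (cmod (cinner x (f i)))\<^sup>2)"
      by (simp only: of_real_mult complex_norm_square mult.assoc)
  qed simp
  finally have pp: "inner (R p) p = (\<Sum>i<k. r i * (cmod (cinner x (f i)))\<^sup>2)"
    unfolding Re_cinner[symmetric] of_real_sum[symmetric] by simp
  have "inner (R p) y = 0" using Rpy by (metis Re_cinner zero_complex.sel(1))
  moreover have "inner (R y) p = 0" using calculation isym[of y p] by (simp add: inner_commute)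
  moreover have "x = p + y" by (simp add: p_def y_def)
  ultimately have "inner (R x) x = inner (R p) p + inner (R y) y"
    by (simp add: add inner_add_left inner_add_right)
  then show ?thesis by (simp add: pp y_def)
qed

text \<open>The Cauchy-Schwarz inequality for the positive form of \<open>B = s - R\<close> on
  \<open>K\<close>, obtained by testing the form at \<open>u - (1 / M) *\<^sub>R B u\<close>. It
  makes vectors that almost maximize the form of \<open>R\<close> approximate eigenvectors.\<close>

lemma positive_form_bound:
  assumes K: "\<And>x y. x \<in> K \<Longrightarrow> y \<in> K \<Longrightarrow> x - y \<in> K" "\<And>s x. x \<in> K \<Longrightarrow> s *\<^sub>R x \<in> K"
    and RK: "\<And>x. x \<in> K \<Longrightarrow> R x \<in> K"
    and s: "\<And>x. x \<in> K \<Longrightarrow> inner (R x) x \<le> s * (norm x)\<^sup>2" and M: "M > 0" "\<bar>s\<bar> + L \<le> M" and "u \<in> K"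
  shows "(norm (s *\<^sub>R u - R u))\<^sup>2 \<le> M * (s * (norm u)\<^sup>2 - inner (R u) u)"
proof -
  define B where "B x = s *\<^sub>R x - R x" for x
  have Bform: "inner (B x) x \<ge> 0" if "x \<in> K" for x
    using s[OF that] by (simp add: B_def inner_diff_left power2_norm_eq_inner)
  have BK: "B x \<in> K" if "x \<in> K" for x using K RK that by (simp add: B_def)
  have Bsym: "inner (B x) y = inner x (B y)" for x y
    by (simp add: B_def inner_diff_left inner_diff_right isym)
  have Blin: "B (x - \<tau> *\<^sub>R y) = B x - \<tau> *\<^sub>R B y" for x y \<tau>
    by (simp add: B_def diff scaleR scaleR_diff_right mult.commute)
  have Bnorm: "norm (B x) \<le> M * norm x" for x
  proof -
    have "norm (B x) \<le> \<bar>s\<bar> * norm x + L * norm x"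
      unfolding B_def using norm_triangle_ineq4[of "s *\<^sub>R x" "R x"] bound[of x] by simp
    also have "\<dots> \<le> M * norm x" using M by (simp add: mult_right_mono flip: distrib_right)
    finally show ?thesis .
  qed
  define \<tau> where "\<tau> = 1 / M"
  define N where "N = (norm (B u))\<^sup>2"
  have N: "N = inner (B u) (B u)" by (simp add: N_def power2_norm_eq_inner)
  have "0 \<le> inner (B (u - \<tau> *\<^sub>R B u)) (u - \<tau> *\<^sub>R B u)"
    by (intro Bform K BK \<open>u \<in> K\<close>)
  also have "\<dots> = inner (B u) u - 2 * \<tau> * N + \<tau>\<^sup>2 * inner (B (B u)) (B u)"
    unfolding Blin N by (simp add: inner_diff_left inner_diff_right Bsym[of "B u" u] power2_eq_square algebra_simps)
  also have "inner (B (B u)) (B u) \<le> M * N"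
  proof -
    have "inner (B (B u)) (B u) \<le> norm (B (B u)) * norm (B u)" by (rule norm_cauchy_schwarz)
    also have "\<dots> \<le> (M * norm (B u)) * norm (B u)" by (intro mult_right_mono Bnorm) auto
    finally show ?thesis by (simp add: N_def power2_eq_square mult.assoc)
  qed
  finally have "0 \<le> inner (B u) u - 2 * \<tau> * N + \<tau>\<^sup>2 * (M * N)"
    by (simp add: mult_left_mono)
  also have "\<dots> = inner (B u) u - N / M" using M by (simp add: \<tau>_def power2_eq_square field_simps)
  finally have "N \<le> M * inner (B u) u" using M by (simp add: field_simps)
  moreover have "inner (B u) u = s * (norm u)\<^sup>2 - inner (R u) u"
    by (simp add: B_def inner_diff_left power2_norm_eq_inner)
  ultimately show ?thesis by (simp add: N_def B_def)
qed

end

locale compact_symmetric_operator = symmetric_operator +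
  assumes compact: "\<And>u C. (\<And>n. norm (u n) \<le> C) \<Longrightarrow> \<exists>l s. strict_mono s \<and> (\<lambda>n. R (u (s n :: nat))) \<longlonglongrightarrow> l"
begin

text \<open>A sequence of unit vectors \<open>u n\<close> that maximizes the form satisfies
  \<open>s *\<^sub>R u n - R (u n) \<longlonglongrightarrow> 0\<close> by
  \<open>positive_form_bound\<close>, and \<open>R (u n)\<close> converges along a subsequence.
  As \<open>s > 0\<close>, so does \<open>u n\<close>.\<close>

lemma top_eigenvector:
  assumes sub: "complex_vector.subspace K" and cl: "closed K" and RK: "\<And>x. x \<in> K \<Longrightarrow> R x \<in> K"
    and x0: "x0 \<in> K" "inner (R x0) x0 > 0"
  obtains e s where "e \<in> K" "norm e = 1" "R e = s *\<^sub>R e" "s > 0"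
    "\<And>x. x \<in> K \<Longrightarrow> inner (R x) x \<le> s * (norm x)\<^sup>2"
proof -
  have Kd: "x - y \<in> K" if "x \<in> K" "y \<in> K" for x y using sub that by (rule complex_vector.subspace_diff)
  have Ks: "t *\<^sub>R x \<in> K" if "x \<in> K" for x t unfolding scaleR_scaleC using sub that by (rule complex_vector.subspace_scale)
  define Q where "Q = (\<lambda>x. inner (R x) x) ` {x\<in>K. norm x = 1}"
  define s where "s = Sup Q"
  have Qb: "q \<le> L" if qQ: "q \<in> Q" for q
  proof -
    obtain x where x: "norm x = 1" "q = inner (R x) x" using qQ by (auto simp: Q_def)
    have "inner (R x) x \<le> norm (R x) * norm x" by (rule norm_cauchy_schwarz)
    then show ?thesis using bound[of x] x by simp
  qed
  then have bdd: "bdd_above Q" by (intro bdd_aboveI)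
  have form: "inner (R x) x \<le> s * (norm x)\<^sup>2" if "x \<in> K" for x
  proof (cases "x = 0")
    case False
    define y where "y = (1 / norm x) *\<^sub>R x"
    have "y \<in> {x\<in>K. norm x = 1}" using False that Ks by (simp add: y_def)
    then have "inner (R y) y \<in> Q" unfolding Q_def by (rule imageI)
    then have "inner (R y) y \<le> s" unfolding s_def using bdd by (rule cSup_upper)
    moreover have "inner (R y) y = inner (R x) x / (norm x)\<^sup>2"
      by (simp add: y_def scaleR power2_eq_square)
    ultimately show ?thesis using False by (simp add: pos_divide_le_eq)
  qed auto
  have "x0 \<noteq> 0" using x0 by auto
  then have s: "s > 0" using form[OF x0(1)] x0(2) by (metis less_le_trans zero_less_mult_pos2 zero_less_norm_iff zero_less_power)
  have "(1 / norm x0) *\<^sub>R x0 \<in> {x\<in>K. norm x = 1}" using \<open>x0 \<noteq> 0\<close> x0 Ks by auto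
  then have ne: "Q \<noteq> {}" by (auto simp: Q_def)
  have "\<exists>u. u \<in> K \<and> norm u = 1 \<and> inner (R u) u > s - inverse (real (Suc n))" for n
  proof -
    have "s - inverse (real (Suc n)) < s" by simp
    then obtain q where "q \<in> Q" "s - inverse (real (Suc n)) < q" using less_cSupE[OF _ ne] unfolding s_def by metis
    then show ?thesis by (auto simp: Q_def)
  qed
  then obtain u where u: "\<And>n. u n \<in> K" "\<And>n. norm (u n) = 1" "\<And>n. inner (R (u n)) (u n) > s - inverse (real (Suc n))"
    by metis
  obtain y \<sigma> where y: "strict_mono \<sigma>" "(\<lambda>n. R (u (\<sigma> n :: nat))) \<longlonglongrightarrow> y"
    using compact[of u 1] u(2) by auto
  define M where "M = \<bar>s\<bar> + \<bar>L\<bar>"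
  have M: "M > 0" "\<bar>s\<bar> + L \<le> M" using s by (auto simp: M_def)
  have inv0: "(\<lambda>n. inverse (real (Suc (\<sigma> n)))) \<longlonglongrightarrow> 0"
    using LIMSEQ_subseq_LIMSEQ[OF LIMSEQ_inverse_real_of_nat y(1)] by (simp add: o_def)
  have "(\<lambda>n. (norm (s *\<^sub>R u (\<sigma> n) - R (u (\<sigma> n))))\<^sup>2) \<longlonglongrightarrow> 0"
  proof (rule tendsto_sandwich[OF _ _ tendsto_const])
    show "(\<lambda>n. M * inverse (real (Suc (\<sigma> n)))) \<longlonglongrightarrow> 0"
      using tendsto_mult[OF tendsto_const inv0, of M] by simp
    show "\<forall>\<^sub>F n in sequentially. (norm (s *\<^sub>R u (\<sigma> n) - R (u (\<sigma> n))))\<^sup>2 \<le> M * inverse (real (Suc (\<sigma> n)))"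
    proof (intro always_eventually allI)
      fix n
      have "(norm (s *\<^sub>R u (\<sigma> n) - R (u (\<sigma> n))))\<^sup>2 \<le> M * (s * (norm (u (\<sigma> n)))\<^sup>2 - inner (R (u (\<sigma> n))) (u (\<sigma> n)))"
        by (rule positive_form_bound[OF Kd Ks RK form M u(1)])
      also have "\<dots> \<le> M * inverse (real (Suc (\<sigma> n)))"
        using u(2,3)[of "\<sigma> n"] M by (intro mult_left_mono) auto
      finally show "(norm (s *\<^sub>R u (\<sigma> n) - R (u (\<sigma> n))))\<^sup>2 \<le> M * inverse (real (Suc (\<sigma> n)))" .
    qed
  qed auto
  from tendsto_real_sqrt[OF this] have "(\<lambda>n. norm (s *\<^sub>R u (\<sigma> n) - R (u (\<sigma> n)))) \<longlonglongrightarrow> 0" by simp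
  then have d0: "(\<lambda>n. s *\<^sub>R u (\<sigma> n) - R (u (\<sigma> n))) \<longlonglongrightarrow> 0" by (rule tendsto_norm_zero_cancel)
  have "(\<lambda>n. (1 / s) *\<^sub>R ((s *\<^sub>R u (\<sigma> n) - R (u (\<sigma> n))) + R (u (\<sigma> n)))) \<longlonglongrightarrow> (1 / s) *\<^sub>R (0 + y)"
    by (intro tendsto_intros d0 y)
  then have lim: "(\<lambda>n. u (\<sigma> n)) \<longlonglongrightarrow> (1 / s) *\<^sub>R y" using s by simp
  define e where "e = (1 / s) *\<^sub>R y"
  have eK: "e \<in> K" using closed_sequentially[OF cl _ lim] u(1) by (simp add: e_def)
  have "(\<lambda>n. norm (u (\<sigma> n))) \<longlonglongrightarrow> norm e" unfolding e_def by (rule tendsto_norm[OF lim])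
  then have ne: "norm e = 1" using u(2) LIMSEQ_unique[OF tendsto_const] by fastforce
  have "(\<lambda>n. R (u (\<sigma> n))) \<longlonglongrightarrow> R e"
    unfolding e_def by (rule bounded_linear.tendsto[OF bounded_linear lim])
  then have "y = R e" by (rule LIMSEQ_unique[OF y(2)])
  moreover have "s *\<^sub>R e = y" using s by (simp add: e_def)
  ultimately have "R e = s *\<^sub>R e" by simp
  from that[OF eK ne this s form] show thesis .
qed

text \<open>Eigenvectors for the \<open>k\<close> largest eigenvalues, in decreasing order. The
  bound on the complements ensures that no larger eigenvalue is left out.\<close>

definition top_family :: "(nat \<Rightarrow> 'a) \<Rightarrow> (nat \<Rightarrow> real) \<Rightarrow> nat \<Rightarrow> bool"
  where "top_family f r k \<longleftrightarrow> onf f k \<and> (\<forall>i<k. R (f i) = r i *\<^sub>R f i) \<and>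
    (\<forall>j\<le>k. \<forall>i<j. r (j - 1) \<le> r i) \<and>
    (\<forall>j\<le>k. 0 < j \<longrightarrow> (\<forall>x. (\<forall>i<j. cinner x (f i) = 0) \<longrightarrow> inner (R x) x \<le> r (j - 1) * (norm x)\<^sup>2))"

lemma top_family_extend:
  assumes tf: "top_family f r k" and x0: "\<And>i. i < k \<Longrightarrow> cinner x0 (f i) = 0" "x0 \<noteq> 0"
    "a * (norm x0)\<^sup>2 \<le> inner (R x0) x0" "a > 0"
  obtains f' r' where "top_family f' r' (Suc k)" "r' k \<ge> a" "\<And>i. i < k \<Longrightarrow> r' i = r i"
proof -
  define K where "K = {x. \<forall>i<k. cinner x (f i) = 0}"
  have sub: "complex_vector.subspace K"
    by (auto simp: complex_vector.subspace_def K_def cinner_add_left cinner_scaleC_left)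
  have "closed {x. cinner x (f i) = 0}" for i
    by (intro closed_Collect_eq linear_continuous_on bounded_linear_cinner_left continuous_on_const)
  then have "closed (\<Inter>i\<in>{..<k}. {x. cinner x (f i) = 0})" by (intro closed_INT) auto
  moreover have "(\<Inter>i\<in>{..<k}. {x. cinner x (f i) = 0}) = K" by (auto simp: K_def)
  ultimately have cl: "closed K" by simp
  have ev: "R (f i) = r i *\<^sub>R f i" if "i < k" for i using tf that by (simp add: top_family_def)
  have RK: "R x \<in> K" if "x \<in> K" for x
    using that unfolding K_def by (auto simp: sym ev cinner_scaleR_right)
  have "inner (R x0) x0 > 0"
  proof -
    have "0 < a * (norm x0)\<^sup>2" using x0(2,4) by simp
    then show ?thesis using x0(3) by linarith
  qed
  moreover have "x0 \<in> K" using x0(1) by (simp add: K_def)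
  ultimately obtain e s where e: "e \<in> K" "norm e = 1" "R e = s *\<^sub>R e" "s > 0"
    "\<And>x. x \<in> K \<Longrightarrow> inner (R x) x \<le> s * (norm x)\<^sup>2"
    using top_eigenvector[OF sub cl RK] by metis
  have "a * (norm x0)\<^sup>2 \<le> s * (norm x0)\<^sup>2" using e(5)[OF \<open>x0 \<in> K\<close>] x0(3) by linarith
  then have sa: "s \<ge> a" using x0(2) by simp
  define f' where "f' i = (if i = k then e else f i)" for i
  define r' where "r' i = (if i = k then s else r i)" for i
  have fe: "cinner e (f i) = 0" if "i < k" for i using e(1) that by (simp add: K_def)
  have ef: "cinner (f i) e = 0" if "i < k" for i using fe[OF that] cinner_commute[of "f i" e] by simp
  have ee: "cinner e e = 1" using e(2) by (simp add: cinner_self)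
  have onf: "onf f k" using tf by (simp add: top_family_def)
  then have "onf f' (Suc k)"
    unfolding onf_def by (auto simp: f'_def less_Suc_eq fe ef ee)
  moreover have "R (f' i) = r' i *\<^sub>R f' i" if "i < Suc k" for i
    using ev[of i] that e(3) by (auto simp: f'_def r'_def)
  moreover have "r' (j - 1) \<le> r' i" if "j \<le> Suc k" "i < j" for i j
  proof (cases "j = Suc k")
    case False
    then have "j \<le> k" using that by simp
    then show ?thesis using tf that by (auto simp: top_family_def r'_def)
  next
    case True
    show ?thesis
    proof (cases "i = k")
      case False
      then have ik: "i < k" using that True by simp
      have "inner (R e) e \<le> r (k - 1) * (norm e)\<^sup>2"
        using tf fe ik unfolding top_family_def by (metis order_refl gr_implies_not0 neq0_conv)
      moreover have "inner (R e) e = s" using e(2,3) by (simp add: power2_norm_eq_inner[symmetric])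
      moreover have "r (k - 1) \<le> r i" using tf ik by (simp add: top_family_def)
      ultimately show ?thesis using e(2) True ik by (simp add: r'_def)
    qed (use True in simp)
  qed
  moreover have "inner (R x) x \<le> r' (j - 1) * (norm x)\<^sup>2"
    if "j \<le> Suc k" "0 < j" "\<forall>i<j. cinner x (f' i) = 0" for j x
  proof (cases "j = Suc k")
    case True
    have "cinner x (f i) = 0" if "i < k" for i
      using \<open>\<forall>i<j. cinner x (f' i) = 0\<close> True that by (auto simp: f'_def dest: spec[of _ i])
    then have "x \<in> K" by (simp add: K_def)
    then show ?thesis using e(5) True by (simp add: r'_def)
  next
    case False
    then have jk: "j \<le> k" using that by simp
    have "\<forall>i<j. cinner x (f i) = 0" using that(3) jk by (auto simp: f'_def)
    then have "inner (R x) x \<le> r (j - 1) * (norm x)\<^sup>2" using tf jk that(2) unfolding top_family_def by blast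
    moreover have "j - 1 \<noteq> k" using jk that(2) by auto
    ultimately show ?thesis by (simp add: r'_def)
  qed
  ultimately have "top_family f' r' (Suc k)" unfolding top_family_def by blast
  then show thesis using sa by (intro that[of f' r']) (auto simp: r'_def)
qed

text \<open>As long as there are fewer eigenvectors than dimensions of the span of
  \<open>B\<close>, some vector of this span is orthogonal to them, and its form produces a
  further eigenvalue above \<open>a\<close>. Afterwards, one more direction with form above
  \<open>b\<close> would lead to a space of dimension \<open>card B + 1\<close> with form above
  \<open>b\<close>, and this space would meet the complement of \<open>B\<close>.\<close>

lemma top_cluster:
  assumes B: "finite B" "orthonormal B" and "a > 0" "b < a"
    and low: "\<And>x. x \<in> complex_vector.span B \<Longrightarrow> a * (norm x)\<^sup>2 \<le> inner (R x) x"
    and high: "\<And>x. (\<And>e. e \<in> B \<Longrightarrow> cinner x e = 0) \<Longrightarrow> inner (R x) x \<le> b * (norm x)\<^sup>2"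
  obtains f r where "top_family f r (card B)" "\<And>i. i < card B \<Longrightarrow> r i \<ge> a"
    "\<And>x. (\<And>i. i < card B \<Longrightarrow> cinner x (f i) = 0) \<Longrightarrow> inner (R x) x \<le> b * (norm x)\<^sup>2"
proof -
  have "\<exists>f r. top_family f r k \<and> (\<forall>i<k. r i \<ge> a)" if "k \<le> card B" for k
    using that
  proof (induction k)
    case 0
    show ?case by (auto simp: top_family_def onf_def)
  next
    case (Suc k)
    then obtain f r where fr: "top_family f r k" "\<forall>i<k. r i \<ge> a" by auto
    obtain x where x: "x \<in> complex_vector.span B" "x \<noteq> 0" "\<And>i. i < k \<Longrightarrow> cinner x (f i) = 0"
      by (rule common_kernel_vector[OF B, of k f]) (use Suc in auto)
    obtain f' r' where fr': "top_family f' r' (Suc k)" "r' k \<ge> a" "\<And>i. i < k \<Longrightarrow> r' i = r i"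
      by (rule top_family_extend[OF fr(1) x(3,2) low[OF x(1)] \<open>a > 0\<close>]) auto
    then have "\<forall>i<Suc k. r' i \<ge> a" using fr(2) by (auto simp: less_Suc_eq)
    then show ?case using fr'(1) by blast
  qed
  then obtain f r where fr: "top_family f r (card B)" "\<And>i. i < card B \<Longrightarrow> r i \<ge> a" by blast
  define m where "m = card B"
  have onf: "onf f m" and ev: "\<And>i. i < m \<Longrightarrow> R (f i) = r i *\<^sub>R f i" using fr by (auto simp: top_family_def m_def)
  have "inner (R x) x \<le> b * (norm x)\<^sup>2" if x: "\<And>i. i < card B \<Longrightarrow> cinner x (f i) = 0" for x
  proof (rule ccontr)
    assume neg: "\<not> inner (R x) x \<le> b * (norm x)\<^sup>2"
    have "x \<noteq> 0" using neg by auto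
    define e where "e = (1 / norm x) *\<^sub>R x"
    have ne: "norm e = 1" using \<open>x \<noteq> 0\<close> by (simp add: e_def)
    have ef: "cinner e (f i) = 0" if "i < m" for i using x that by (simp add: e_def cinner_scaleR_left m_def)
    have form_e: "inner (R e) e > b"
    proof -
      have "inner (R e) e = inner (R x) x / (norm x)\<^sup>2" by (simp add: e_def scaleR power2_eq_square)
      then show ?thesis using neg \<open>x \<noteq> 0\<close> by (simp add: pos_less_divide_eq)
    qed
    define F where "F i = (if i = m then e else f i)" for i
    have fe: "cinner (f i) e = 0" if "i < m" for i using ef[OF that] cinner_commute[of "f i" e] by simp
    have ee: "cinner e e = 1" using ne by (simp add: cinner_self)
    have F: "onf F (Suc m)" using onf unfolding onf_def by (auto simp: F_def less_Suc_eq fe ef ee)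
    define B' where "B' = F ` {..<Suc m}"
    have B': "finite B'" "orthonormal B'" "m < card B'"
      using onf_orthonormal[OF F] onf_card[OF F] by (auto simp: B'_def)
    obtain h where h: "bij_betw h {..<m} B" using ex_bij_betw_nat_finite[OF B(1)] by (auto simp: m_def atLeast0LessThan)
    obtain y where y: "y \<in> complex_vector.span B'" "y \<noteq> 0" "\<And>i. i < m \<Longrightarrow> cinner y (h i) = 0"
      by (rule common_kernel_vector[OF B', of h]) auto
    have "cinner y e' = 0" if "e' \<in> B" for e' using h y(3) that by (metis bij_betw_iff_bijections lessThan_iff)
    then have up: "inner (R y) y \<le> b * (norm y)\<^sup>2" by (rule high)
    define c where "c = cinner y e"
    define z where "z = y - fproj f m y"
    have yexp: "y = (\<Sum>i<Suc m. cinner y (F i) *\<^sub>C F i)"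
      using proj_eq_self[OF B'(2,1) y(1)] by (simp add: proj_def B'_def onf_sum[OF F])
    have "(\<Sum>i<m. cinner y (F i) *\<^sub>C F i) = fproj f m y"
      unfolding fproj_def by (intro sum.cong) (auto simp: F_def)
    then have "y = fproj f m y + c *\<^sub>C e" using yexp by (simp add: F_def c_def)
    then have z: "z = c *\<^sub>C e" unfolding z_def by (metis add_diff_cancel_left')
    have nz: "(norm z)\<^sup>2 = (cmod c)\<^sup>2" by (simp add: z norm_scaleC ne)
    have "inner (R z) z = (cmod c)\<^sup>2 * inner (R e) e"
    proof -
      have "cinner (R z) z = (c * cnj c) * cinner (R e) e"
        by (simp add: z scale cinner_scaleC_left cinner_scaleC_right mult_ac)
      also have "c * cnj c = complex_of_real ((cmod c)\<^sup>2)" by (rule complex_norm_square[symmetric])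
      finally show ?thesis unfolding Re_cinner[symmetric] by simp
    qed
    then have "inner (R y) y = (\<Sum>i<m. r i * (cmod (cinner y (f i)))\<^sup>2) + (cmod c)\<^sup>2 * inner (R e) e"
      using form_decomposition[OF onf ev, of y] by (simp add: z_def)
    moreover have "(norm y)\<^sup>2 = (\<Sum>i<m. (cmod (cinner y (f i)))\<^sup>2) + (cmod c)\<^sup>2"
      using onf_norm_decomposition[OF onf, of y] nz by (simp add: z_def)
    ultimately have "(\<Sum>i<m. (r i - b) * (cmod (cinner y (f i)))\<^sup>2) + (inner (R e) e - b) * (cmod c)\<^sup>2 \<le> 0"
      using up by (simp add: left_diff_distrib sum_subtractf distrib_left sum_distrib_left mult.commute)
    moreover have t1: "(r i - b) * (cmod (cinner y (f i)))\<^sup>2 \<ge> 0" if "i < m" for i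
      using fr(2)[of i] that \<open>b < a\<close> by (simp add: m_def)
    moreover have "(inner (R e) e - b) * (cmod c)\<^sup>2 \<ge> 0" using form_e by simp
    moreover have "(\<Sum>i<m. (r i - b) * (cmod (cinner y (f i)))\<^sup>2) \<ge> 0"
      by (intro sum_nonneg) (use t1 in auto)
    ultimately have s0: "(\<Sum>i<m. (r i - b) * (cmod (cinner y (f i)))\<^sup>2) = 0" and c0: "(inner (R e) e - b) * (cmod c)\<^sup>2 = 0"
      by linarith+
    have "\<forall>i\<in>{..<m}. (r i - b) * (cmod (cinner y (f i)))\<^sup>2 = 0"
      using s0 t1 by (subst (asm) sum_nonneg_eq_0_iff) auto
    then have "cinner y (f i) = 0" if "i < m" for i
    proof -
      have "a \<le> r i" using fr(2)[of i] that by (simp add: m_def)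
      then have "r i - b \<noteq> 0" using \<open>b < a\<close> by linarith
      then show ?thesis using \<open>\<forall>i\<in>{..<m}. (r i - b) * (cmod (cinner y (f i)))\<^sup>2 = 0\<close> that by auto
    qed
    moreover have "c = 0" using c0 form_e by simp
    ultimately have "(norm y)\<^sup>2 = 0"
      using \<open>(norm y)\<^sup>2 = (\<Sum>i<m. (cmod (cinner y (f i)))\<^sup>2) + (cmod c)\<^sup>2\<close> by simp
    then show False using y(2) by simp
  qed
  then show thesis using that fr by blast
qed

text \<open>Ky Fan's maximum principle. The sum on the left distributes the weights \<open>(cmod
  (cinner (u i) (f j)))\<^sup>2\<close> over the \<open>r j\<close>, and by Bessel's inequality
  each \<open>r j\<close> receives at most 1.\<close>

lemma ky_fan:
  assumes tf: "top_family f r k" and u: "onf u k"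
  shows "(\<Sum>i<k. inner (R (u i)) (u i)) \<le> (\<Sum>i<k. r i)"
proof (cases "k = 0")
  case False
  define \<rho> where "\<rho> = r (k - 1)"
  have onf: "onf f k" and ev: "\<And>i. i < k \<Longrightarrow> R (f i) = r i *\<^sub>R f i" and
    le: "\<And>i. i < k \<Longrightarrow> \<rho> \<le> r i" and
    rest: "\<And>x. (\<forall>i<k. cinner x (f i) = 0) \<Longrightarrow> inner (R x) x \<le> \<rho> * (norm x)\<^sup>2"
    using tf False by (auto simp: top_family_def \<rho>_def)
  have "inner (R x) x \<le> \<rho> + (\<Sum>j<k. (r j - \<rho>) * (cmod (cinner x (f j)))\<^sup>2)" if "norm x = 1" for x
  proof -
    define y where "y = x - fproj f k x"
    have "inner (R y) y \<le> \<rho> * (norm y)\<^sup>2" using fproj_orthogonal[OF onf] by (intro rest) (simp add: y_def)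
    also have "(norm y)\<^sup>2 = 1 - (\<Sum>j<k. (cmod (cinner x (f j)))\<^sup>2)"
      using onf_norm_decomposition[OF onf, of x] that by (simp add: y_def)
    finally show ?thesis using form_decomposition[OF onf ev, of x]
      by (simp add: y_def[symmetric] left_diff_distrib sum_subtractf right_diff_distrib sum_distrib_left)
  qed
  then have "(\<Sum>i<k. inner (R (u i)) (u i)) \<le> (\<Sum>i<k. \<rho> + (\<Sum>j<k. (r j - \<rho>) * (cmod (cinner (u i) (f j)))\<^sup>2))"
    using onf_norm[OF u] by (intro sum_mono) auto
  also have "\<dots> = k * \<rho> + (\<Sum>j<k. (r j - \<rho>) * (\<Sum>i<k. (cmod (cinner (u i) (f j)))\<^sup>2))"
    by (simp add: sum.distrib sum_distrib_left) (rule sum.swap)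
  also have "\<dots> \<le> k * \<rho> + (\<Sum>j<k. (r j - \<rho>) * 1)"
  proof (intro add_left_mono sum_mono mult_left_mono)
    fix j assume j: "j \<in> {..<k}"
    have "cmod (cinner (u i) (f j)) = cmod (cinner (f j) (u i))" for i
      using cinner_commute[of "u i" "f j"] by simp
    then show "(\<Sum>i<k. (cmod (cinner (u i) (f j)))\<^sup>2) \<le> 1"
      using onf_bessel[OF u, of "f j"] onf_norm[OF onf] j by simp
    show "0 \<le> r j - \<rho>" using le j by simp
  qed
  also have "\<dots> = (\<Sum>j<k. r j)" by (simp add: sum_subtractf)
  finally show ?thesis .
qed simp

end

section \<open>Self-adjoint operators whose graph-bounded sets are precompact\<close>

text \<open>Compactness of the resolvent is stated as precompactness of sets that are bounded in
  the graph norm. In this form it involves no point of the resolvent set, and it visibly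
  survives bounded perturbations.\<close>

locale compact_resolvent_operator =
  fixes V :: "'a::complex_hilbert_space set" and T :: "'a \<Rightarrow> 'a"
  assumes sa: "self_adjoint_operator V T"
    and graph_compact: "\<And>u C. (\<And>n::nat. u n \<in> V) \<Longrightarrow> (\<And>n. norm (u n) \<le> C) \<Longrightarrow> (\<And>n. norm (T (u n)) \<le> C) \<Longrightarrow>
      \<exists>l s. strict_mono s \<and> (\<lambda>n. u (s n :: nat)) \<longlonglongrightarrow> l"
begin

lemma subspace: "complex_vector.subspace V" and dense: "closure V = UNIV"
  using sa by (auto simp: self_adjoint_operator_def)

lemma V0 [simp]: "0 \<in> V" and V_add: "x \<in> V \<Longrightarrow> y \<in> V \<Longrightarrow> x + y \<in> V"
  and V_scale: "x \<in> V \<Longrightarrow> a *\<^sub>C x \<in> V" and V_diff: "x \<in> V \<Longrightarrow> y \<in> V \<Longrightarrow> x - y \<in> V"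
  using subspace complex_vector.subspace_diff[OF subspace] by (auto simp: complex_vector.subspace_def)

lemma V_scaleR: "x \<in> V \<Longrightarrow> s *\<^sub>R x \<in> V"
  by (simp add: scaleR_scaleC V_scale)

lemma V_sum: "(\<And>i. i \<in> I \<Longrightarrow> g i \<in> V) \<Longrightarrow> (\<Sum>i\<in>I. g i) \<in> V"
  by (induction I rule: infinite_finite_induct) (auto simp: V_add)

lemma T_add: "x \<in> V \<Longrightarrow> y \<in> V \<Longrightarrow> T (x + y) = T x + T y" and T_scale: "x \<in> V \<Longrightarrow> T (a *\<^sub>C x) = a *\<^sub>C T x"
  using sa by (auto simp: self_adjoint_operator_def)

lemma T_scaleR: "x \<in> V \<Longrightarrow> T (s *\<^sub>R x) = s *\<^sub>R T x"
  by (simp add: scaleR_scaleC T_scale)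

lemma T0 [simp]: "T 0 = 0"
  using T_scale[OF V0, of 0] by simp

lemma T_diff: "x \<in> V \<Longrightarrow> y \<in> V \<Longrightarrow> T (x - y) = T x - T y"
  using T_add[of x "- y"] T_scale[of y "-1"] V_scale[of y "-1"] by simp

lemma T_sum: "(\<And>i. i \<in> I \<Longrightarrow> g i \<in> V) \<Longrightarrow> T (\<Sum>i\<in>I. g i) = (\<Sum>i\<in>I. T (g i))"
  by (induction I rule: infinite_finite_induct) (auto simp: T_add V_sum)

lemma adjoint_iff: "(\<forall>u\<in>V. cinner (T u) v = cinner u w) \<longleftrightarrow> v \<in> V \<and> w = T v"
proof -
  have "adjoint_graph V T = op_graph V T" using sa by (simp add: self_adjoint_operator_def)
  then have "(v, w) \<in> adjoint_graph V T \<longleftrightarrow> (v, w) \<in> op_graph V T" by simp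
  then show ?thesis by (auto simp: adjoint_graph_def op_graph_def)
qed

lemma symmetric: "u \<in> V \<Longrightarrow> v \<in> V \<Longrightarrow> cinner (T u) v = cinner u (T v)"
  using adjoint_iff[of v "T v"] by blast

lemma closed_graph:
  assumes "\<And>n. u n \<in> V" "u \<longlonglongrightarrow> x" "(\<lambda>n. T (u n)) \<longlonglongrightarrow> y"
  shows "x \<in> V \<and> T x = y"
proof -
  have "cinner (T v) x = cinner v y" if "v \<in> V" for v
  proof (rule LIMSEQ_unique)
    show "(\<lambda>n. cinner (T v) (u n)) \<longlonglongrightarrow> cinner (T v) x" by (rule tendsto_cinner_right[OF assms(2)])
    show "(\<lambda>n. cinner (T v) (u n)) \<longlonglongrightarrow> cinner v y"
      using tendsto_cinner_right[OF assms(3), of v] symmetric[OF that assms(1)] by simp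
  qed
  then show ?thesis using adjoint_iff[of x y] by auto
qed

text \<open>Otherwise a sequence of unit vectors with \<open>T u - c *\<^sub>R u\<close> tending
  to 0 would have a limit point, which would be an eigenvector.\<close>

lemma lower_bound:
  assumes inj: "\<And>u. u \<in> V \<Longrightarrow> T u = c *\<^sub>R u \<Longrightarrow> u = 0"
  obtains \<kappa> where "\<kappa> > 0" "\<And>u. u \<in> V \<Longrightarrow> \<kappa> * norm u \<le> norm (T u - c *\<^sub>R u)"
proof -
  have "\<exists>\<kappa>>0. \<forall>u\<in>V. \<kappa> * norm u \<le> norm (T u - c *\<^sub>R u)"
  proof (rule ccontr)
    assume neg: "\<not> ?thesis"
    have "\<exists>u\<in>V. norm u = 1 \<and> norm (T u - c *\<^sub>R u) < inverse (real (Suc n))" for n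
    proof -
      have "inverse (real (Suc n)) > 0" by simp
      with neg obtain u where u: "u \<in> V" "norm (T u - c *\<^sub>R u) < inverse (real (Suc n)) * norm u"
        by (metis not_le)
      then have "u \<noteq> 0" by auto
      define v where "v = (1 / norm u) *\<^sub>R u"
      have "T v - c *\<^sub>R v = (1 / norm u) *\<^sub>R (T u - c *\<^sub>R u)"
        using u by (simp add: v_def T_scaleR scaleR_diff_right mult.commute)
      then have "norm (T v - c *\<^sub>R v) = norm (T u - c *\<^sub>R u) / norm u" by simp
      then have "norm (T v - c *\<^sub>R v) < inverse (real (Suc n))"
        using u \<open>u \<noteq> 0\<close> by (simp add: pos_divide_less_eq)
      moreover have "v \<in> V" "norm v = 1" using u \<open>u \<noteq> 0\<close> by (auto simp: v_def V_scaleR)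
      ultimately show ?thesis by blast
    qed
    then obtain u where u: "\<And>n. u n \<in> V" "\<And>n. norm (u n) = 1"
      "\<And>n. norm (T (u n) - c *\<^sub>R u n) < inverse (real (Suc n))" by metis
    have "norm (T (u n)) \<le> 1 + \<bar>c\<bar>" for n
    proof -
      have "inverse (real (Suc n)) \<le> 1" by (simp add: inverse_le_1_iff)
      moreover have "norm (T (u n)) \<le> norm (T (u n) - c *\<^sub>R u n) + norm (c *\<^sub>R u n)"
        by (metis diff_add_cancel norm_triangle_ineq)
      ultimately show ?thesis using u(3)[of n] u(2)[of n] by simp
    qed
    moreover have "norm (u n) \<le> 1 + \<bar>c\<bar>" for n using u(2) by simp
    ultimately obtain l s where s: "strict_mono s" "(\<lambda>n. u (s n :: nat)) \<longlonglongrightarrow> l"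
      using graph_compact[of u "1 + \<bar>c\<bar>"] u(1) by blast
    have inv: "(\<lambda>n. inverse (real (Suc (s n)))) \<longlonglongrightarrow> 0"
      using LIMSEQ_subseq_LIMSEQ[OF LIMSEQ_inverse_real_of_nat s(1)] by (simp add: o_def)
    have d0: "(\<lambda>n. T (u (s n)) - c *\<^sub>R u (s n)) \<longlonglongrightarrow> 0"
      by (rule Lim_null_comparison[OF _ inv]) (use u(3) in \<open>auto intro!: always_eventually less_imp_le\<close>)
    have "(\<lambda>n. (T (u (s n)) - c *\<^sub>R u (s n)) + c *\<^sub>R u (s n)) \<longlonglongrightarrow> 0 + c *\<^sub>R l"
      by (intro tendsto_intros d0 s)
    then have "(\<lambda>n. T (u (s n))) \<longlonglongrightarrow> c *\<^sub>R l" by simp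
    then have "l \<in> V" "T l = c *\<^sub>R l" using closed_graph[OF u(1) s(2)] by auto
    then have "l = 0" by (rule inj)
    moreover have "norm l = 1"
      using LIMSEQ_unique[OF tendsto_norm[OF s(2)], of 1] u(2) by simp
    ultimately show False by simp
  qed
  then show thesis using that by blast
qed

text \<open>By the lower bound the range is closed. A vector normal to it belongs to the domain
  of the adjoint, so it is an eigenvector for \<open>c\<close> and hence 0.\<close>

lemma surjective:
  assumes "\<kappa> > 0" and lb: "\<And>u. u \<in> V \<Longrightarrow> \<kappa> * norm u \<le> norm (T u - c *\<^sub>R u)"
  shows "\<exists>u\<in>V. T u - c *\<^sub>R u = f"
proof -
  define N where "N = (\<lambda>u. T u - c *\<^sub>R u) ` V"
  have N_lin: "T (x - y) - c *\<^sub>R (x - y) = (T x - c *\<^sub>R x) - (T y - c *\<^sub>R y)" if "x \<in> V" "y \<in> V" for x y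
    using that by (simp add: T_diff algebra_simps)
  have sub: "complex_vector.subspace N"
    unfolding complex_vector.subspace_def
  proof (intro conjI ballI allI)
    show "0 \<in> N" unfolding N_def by (rule image_eqI[of _ _ 0]) auto
    fix x y assume "x \<in> N" "y \<in> N"
    then obtain u v where "u \<in> V" "v \<in> V" "x = T u - c *\<^sub>R u" "y = T v - c *\<^sub>R v" by (auto simp: N_def)
    then show "x + y \<in> N" unfolding N_def
      by (intro image_eqI[of _ _ "u + v"]) (auto simp: T_add V_add scaleR_add_right)
  next
    fix a x assume "x \<in> N"
    then obtain u where "u \<in> V" "x = T u - c *\<^sub>R u" by (auto simp: N_def)
    then show "a *\<^sub>C x \<in> N" unfolding N_def
      by (intro image_eqI[of _ _ "a *\<^sub>C u"]) (auto simp: T_scale V_scale scaleC_diff_right scaleC_scaleR)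
  qed
  have "closed N"
    unfolding closed_sequential_limits
  proof (intro allI impI, elim conjE)
    fix x l assume x: "\<forall>n. x n \<in> N" "x \<longlonglongrightarrow> l"
    have "\<exists>v. v \<in> V \<and> x n = T v - c *\<^sub>R v" for n using x(1) by (auto simp: N_def)
    then obtain u where u: "\<And>n. u n \<in> V" "\<And>n. x n = T (u n) - c *\<^sub>R u n" by metis
    have "Cauchy u"
    proof (rule metric_CauchyI)
      fix e :: real assume "e > 0"
      then have "e * \<kappa> > 0" using \<open>\<kappa> > 0\<close> by simp
      then obtain M where M: "\<And>i j. i \<ge> M \<Longrightarrow> j \<ge> M \<Longrightarrow> dist (x i) (x j) < e * \<kappa>"
        using LIMSEQ_imp_Cauchy[OF x(2)] unfolding Cauchy_def by blast
      have "dist (u i) (u j) < e" if "i \<ge> M" "j \<ge> M" for i j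
      proof -
        have "\<kappa> * norm (u i - u j) \<le> norm (x i - x j)"
          using lb[OF V_diff[OF u(1) u(1)], of i j] N_lin[OF u(1) u(1), of i j] by (simp add: u(2))
        also have "\<dots> < e * \<kappa>" using M[OF that] by (simp add: dist_norm)
        finally show ?thesis using \<open>\<kappa> > 0\<close> by (simp add: dist_norm mult.commute)
      qed
      then show "\<exists>M. \<forall>m\<ge>M. \<forall>n\<ge>M. dist (u m) (u n) < e" by blast
    qed
    then obtain p where p: "u \<longlonglongrightarrow> p" using Cauchy_convergent convergent_def by blast
    have "(\<lambda>n. x n + c *\<^sub>R u n) \<longlonglongrightarrow> l + c *\<^sub>R p" by (intro tendsto_intros x p)
    then have "(\<lambda>n. T (u n)) \<longlonglongrightarrow> l + c *\<^sub>R p" by (simp add: u(2))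
    then have "p \<in> V" "T p = l + c *\<^sub>R p" using closed_graph[OF u(1) p] by auto
    then show "l \<in> N" unfolding N_def by (intro image_eqI[of _ _ p]) auto
  qed
  show ?thesis
  proof (rule ccontr)
    assume "\<not> ?thesis"
    then have "f \<notin> N" by (auto simp: N_def)
    then obtain v where v: "v \<noteq> 0" "\<And>x. x \<in> N \<Longrightarrow> cinner x v = 0"
      using closed_subspace_normal[OF sub \<open>closed N\<close>] by metis
    have "cinner (T u) v = cinner u (c *\<^sub>R v)" if "u \<in> V" for u
      using v(2)[of "T u - c *\<^sub>R u"] that
      by (simp add: N_def cinner_diff_left cinner_scaleR_left cinner_scaleR_right)
    then have "v \<in> V" "T v = c *\<^sub>R v" using adjoint_iff[of v "c *\<^sub>R v"] by auto
    then have "\<kappa> * norm v \<le> 0" using lb[of v] by simp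
    then show False using \<open>\<kappa> > 0\<close> v(1) by (simp add: mult_le_0_iff)
  qed
qed

lemma eigenvectors_orthogonal:
  assumes "u \<in> V" "v \<in> V" "T u = a *\<^sub>R u" "T v = b *\<^sub>R v" "a \<noteq> b"
  shows "cinner u v = 0"
proof -
  have "complex_of_real a * cinner u v = complex_of_real b * cinner u v"
    using symmetric[OF assms(1,2)] assms(3,4) by (simp add: cinner_scaleR_left cinner_scaleR_right)
  then show ?thesis using assms(5) by simp
qed

text \<open>Normalized eigenvectors for distinct eigenvalues have distance \<open>sqrt
  2\<close>, so that infinitely many of them cannot accumulate.\<close>

lemma finite_eigenvalues: "finite {x. \<bar>x\<bar> \<le> C \<and> (\<exists>u\<in>V. u \<noteq> 0 \<and> T u = x *\<^sub>R u)}"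
proof (rule ccontr)
  assume "infinite {x. \<bar>x\<bar> \<le> C \<and> (\<exists>u\<in>V. u \<noteq> 0 \<and> T u = x *\<^sub>R u)}"
  from infinite_countable_subset[OF this] obtain x :: "nat \<Rightarrow> real"
    where x: "inj x" "range x \<subseteq> {x. \<bar>x\<bar> \<le> C \<and> (\<exists>u\<in>V. u \<noteq> 0 \<and> T u = x *\<^sub>R u)}"
    by (elim exE conjE) (rule that)
  have "\<exists>u\<in>V. norm u = 1 \<and> T u = x n *\<^sub>R u" for n
  proof -
    obtain u where u: "u \<in> V" "u \<noteq> 0" "T u = x n *\<^sub>R u" using x(2) by auto
    then show ?thesis by (intro bexI[of _ "(1 / norm u) *\<^sub>R u"]) (auto simp: T_scaleR V_scaleR)
  qed
  then obtain u where u: "\<And>n. u n \<in> V" "\<And>n. norm (u n) = 1" "\<And>n. T (u n) = x n *\<^sub>R u n" by metis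
  have xC: "\<bar>x n\<bar> \<le> C" for n using x(2) by auto
  have "\<exists>l s. strict_mono s \<and> (\<lambda>n. u (s n :: nat)) \<longlonglongrightarrow> l"
    by (rule graph_compact[of u "max 1 C"]) (use u xC in \<open>auto simp: le_max_iff_disj\<close>)
  then obtain l s where s: "strict_mono s" "(\<lambda>n. u (s n :: nat)) \<longlonglongrightarrow> l" by blast
  then obtain M where M: "\<And>i j. i \<ge> M \<Longrightarrow> j \<ge> M \<Longrightarrow> dist (u (s i)) (u (s j)) < 1"
    using LIMSEQ_imp_Cauchy[OF s(2)] unfolding Cauchy_def by (metis zero_less_one)
  have ne: "s M \<noteq> s (Suc M)" using s(1) by (metis strict_mono_eq n_not_Suc_n)
  then have "x (s M) \<noteq> x (s (Suc M))" using x(1) by (simp add: inj_eq)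
  then have "cinner (u (s M)) (u (s (Suc M))) = 0" by (rule eigenvectors_orthogonal[OF u(1) u(1) u(3) u(3)])
  then have "cinner (u (s M)) (- u (s (Suc M))) = 0" by (simp add: cinner_minus_right)
  from norm_add_orthogonal[OF this] have "(norm (u (s M) - u (s (Suc M))))\<^sup>2 = 2" using u(2) by simp
  moreover have "norm (u (s M) - u (s (Suc M))) < 1" using M[of M "Suc M"] by (simp add: dist_norm)
  then have "(norm (u (s M) - u (s (Suc M))))\<^sup>2 < 1" by (simp add: power_less_one_iff)
  ultimately show False by simp
qed

end

section \<open>Uniform boundedness\<close>

text \<open>The Banach-Steinhaus theorem by Baire's category argument. The formulation with
  seminorms covers linear and antilinear maps.\<close>

lemma uniform_boundedness:
  fixes p :: "'i \<Rightarrow> 'a::{real_normed_vector, complete_space} \<Rightarrow> real"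
  assumes add: "\<And>i x y. i \<in> I \<Longrightarrow> p i (x + y) \<le> p i x + p i y"
    and scale: "\<And>i s x. i \<in> I \<Longrightarrow> p i (s *\<^sub>R x) = \<bar>s\<bar> * p i x"
    and bounded: "\<And>i. i \<in> I \<Longrightarrow> \<exists>K. \<forall>x. p i x \<le> K * norm x"
    and pointwise: "\<And>x. \<exists>B. \<forall>i\<in>I. p i x \<le> B"
  shows "\<exists>C\<ge>0. \<forall>i\<in>I. \<forall>x. p i x \<le> C * norm x"
proof -
  have cont: "continuous_on UNIV (p i)" if i: "i \<in> I" for i
  proof -
    obtain K where K: "\<And>x. p i x \<le> K * norm x" using bounded[OF i] by blast
    have "p i y - p i x \<le> \<bar>K\<bar> * norm (y - x)" for x y
    proof -
      have "p i y \<le> p i x + p i (y - x)" using add[OF i, of x "y - x"] by simp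
      also have "p i (y - x) \<le> K * norm (y - x)" by (rule K)
      also have "\<dots> \<le> \<bar>K\<bar> * norm (y - x)" by (intro mult_right_mono) auto
      finally show ?thesis by simp
    qed
    then have "\<bar>p i y - p i x\<bar> \<le> \<bar>K\<bar> * norm (y - x)" for x y
      by (metis abs_le_iff minus_diff_eq norm_minus_commute)
    then have "\<bar>K\<bar>-lipschitz_on UNIV (p i)" by (intro lipschitz_onI) (auto simp: dist_real_def dist_norm)
    then show ?thesis by (rule lipschitz_on_continuous_on)
  qed
  define F where "F n = {x. \<forall>i\<in>I. p i x \<le> real n}" for n :: nat
  have closedF: "closed (F n)" for n
  proof -
    have "F n = (\<Inter>i\<in>I. {x. p i x \<le> real n})" by (auto simp: F_def)
    moreover have "closed (\<Inter>i\<in>I. {x. p i x \<le> real n})"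
      using cont by (intro closed_INT ballI closed_Collect_le continuous_on_const) auto
    ultimately show ?thesis by simp
  qed
  have "\<Union>(range F) = UNIV"
  proof -
    have "\<exists>n. x \<in> F n" for x
    proof -
      obtain B where B: "\<And>i. i \<in> I \<Longrightarrow> p i x \<le> B" using pointwise[of x] by blast
      obtain n :: nat where "B \<le> real n" using real_arch_simple by blast
      then have "p i x \<le> real n" if "i \<in> I" for i using B[OF that] by linarith
      then show ?thesis by (auto simp: F_def)
    qed
    then show ?thesis by auto
  qed
  have "\<exists>n. interior (F n) \<noteq> {}"
  proof (rule ccontr)
    assume neg: "\<not> (\<exists>n. interior (F n) \<noteq> {})"
    have compl: "Met_TC.mcomplete TYPE('a)"
      unfolding Met_TC.mcomplete_def by (auto simp: Cauchy_convergent convergent_def[symmetric] intro: Cauchy_convergent)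
    have "Met_TC.mtopology interior_of \<Union>(range F) = {}"
      using neg closedF by (intro Met_TC.metric_Baire_category_alt[OF compl]) auto
    then show False using \<open>\<Union>(range F) = UNIV\<close> by simp
  qed
  then obtain n x0 where "x0 \<in> interior (F n)" by auto
  then obtain e where e: "e > 0" "ball x0 e \<subseteq> F n" by (auto simp: mem_interior)
  have small: "p i z \<le> real n" if i: "i \<in> I" and z: "norm z < e" for i z
  proof -
    have "x0 + z \<in> F n" "x0 - z \<in> F n" using e(2) z by (auto simp: subset_iff dist_norm)
    then have pp: "p i (x0 + z) \<le> n" "p i (x0 - z) \<le> n" using i by (auto simp: F_def)
    have "2 * p i z = p i (2 *\<^sub>R z)" using scale[OF i, of 2 z] by simp
    also have "2 *\<^sub>R z = (x0 + z) + (-1) *\<^sub>R (x0 - z)" by (simp add: scaleR_2)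
    also have "p i \<dots> \<le> p i (x0 + z) + p i ((-1) *\<^sub>R (x0 - z))" by (rule add[OF i])
    also have "p i ((-1) *\<^sub>R (x0 - z)) = p i (x0 - z)" unfolding scale[OF i] by simp
    finally show ?thesis using pp by linarith
  qed
  have "p i x \<le> (2 * real n / e) * norm x" if i: "i \<in> I" for i x
  proof (cases "x = 0")
    case True
    then show ?thesis using scale[OF i, of 0 0] by simp
  next
    case False
    define s where "s = e / (2 * norm x)"
    have s: "s > 0" using False e by (simp add: s_def)
    have "norm (s *\<^sub>R x) < e" using False e by (simp add: s_def)
    from small[OF i this] have "s * p i x \<le> n" using scale[OF i, of s x] s by simp
    then have "p i x \<le> n / s" using s by (simp add: pos_le_divide_eq mult.commute)
    also have "n / s = (2 * real n / e) * norm x" using False e by (simp add: s_def)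
    finally show ?thesis .
  qed
  then show ?thesis using e by (intro exI[of _ "2 * real n / e"]) auto
qed

lemma weak_bounded_imp_bounded:
  fixes x :: "'i \<Rightarrow> 'a::complex_hilbert_space"
  assumes "\<And>v. \<exists>B. \<forall>i\<in>I. cmod (cinner (x i) v) \<le> B"
  shows "\<exists>C\<ge>0. \<forall>i\<in>I. norm (x i) \<le> C"
proof -
  have "\<exists>C\<ge>0. \<forall>i\<in>I. \<forall>v. cmod (cinner (x i) v) \<le> C * norm v"
  proof (rule uniform_boundedness)
    show "\<exists>K. \<forall>v. cmod (cinner (x i) v) \<le> K * norm v" for i using cinner_cauchy_schwarz by blast
  qed (use assms in \<open>auto simp: cinner_add_right norm_triangle_ineq cinner_scaleR_right norm_mult\<close>)
  then obtain C where C: "C \<ge> 0" "\<And>i v. i \<in> I \<Longrightarrow> cmod (cinner (x i) v) \<le> C * norm v" by blast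
  have "norm (x i) \<le> C" if "i \<in> I" for i
  proof (cases "x i = 0")
    case False
    have "norm (x i) * norm (x i) \<le> C * norm (x i)"
      using C(2)[OF that, of "x i"] by (simp add: cinner_self power2_eq_square norm_mult)
    then show ?thesis using False by simp
  qed (use C in simp)
  then show ?thesis using C(1) by blast
qed

text \<open>The quotients \<open>(D h - D k) / (\<bar>h\<bar> + \<bar>k\<bar>)\<close> are
  weakly bounded, hence bounded, which makes \<open>D h\<close> a Cauchy family as
  \<open>h\<close> tends to 0.\<close>

lemma weak_limit_imp_strong:
  fixes D :: "real \<Rightarrow> 'a::complex_hilbert_space"
  assumes weak: "\<And>v. \<exists>C. \<forall>h. h \<noteq> 0 \<and> \<bar>h\<bar> \<le> 1 \<longrightarrow> cmod (cinner (D h) v - l v) \<le> C * \<bar>h\<bar>"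
  obtains x C where "\<And>v. cinner x v = l v" "C \<ge> 0" "\<And>h. h \<noteq> 0 \<Longrightarrow> \<bar>h\<bar> \<le> 1 \<Longrightarrow> norm (D h - x) \<le> C * \<bar>h\<bar>"
proof -
  define I where "I = {(h::real, k::real). h \<noteq> 0 \<and> \<bar>h\<bar> \<le> 1 \<and> k \<noteq> 0 \<and> \<bar>k\<bar> \<le> 1}"
  have "\<exists>C\<ge>0. \<forall>i\<in>I. norm ((\<lambda>(h, k). (1 / (\<bar>h\<bar> + \<bar>k\<bar>)) *\<^sub>R (D h - D k)) i) \<le> C"
  proof (rule weak_bounded_imp_bounded)
    fix v
    obtain C where C: "\<And>h. h \<noteq> 0 \<Longrightarrow> \<bar>h\<bar> \<le> 1 \<Longrightarrow> cmod (cinner (D h) v - l v) \<le> C * \<bar>h\<bar>" using weak[of v] by blast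
    have "cmod (cinner ((1 / (\<bar>h\<bar> + \<bar>k\<bar>)) *\<^sub>R (D h - D k)) v) \<le> C"
      if "h \<noteq> 0" "\<bar>h\<bar> \<le> 1" "k \<noteq> 0" "\<bar>k\<bar> \<le> 1" for h k
    proof -
      have "cmod (cinner (D h - D k) v) = cmod ((cinner (D h) v - l v) - (cinner (D k) v - l v))"
        by (simp add: cinner_diff_left)
      also have "\<dots> \<le> C * \<bar>h\<bar> + C * \<bar>k\<bar>"
        using norm_triangle_ineq4[of "cinner (D h) v - l v" "cinner (D k) v - l v"] C[OF that(1,2)] C[OF that(3,4)] by linarith
      finally have "cmod (cinner (D h - D k) v) \<le> C * (\<bar>h\<bar> + \<bar>k\<bar>)" by (simp add: distrib_left)
      moreover have pos: "\<bar>h\<bar> + \<bar>k\<bar> > 0" using that by simp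
      ultimately have "cmod (cinner (D h - D k) v) / (\<bar>h\<bar> + \<bar>k\<bar>) \<le> C" by (simp add: pos_divide_le_eq)
      moreover have "cmod (cinner ((1 / (\<bar>h\<bar> + \<bar>k\<bar>)) *\<^sub>R (D h - D k)) v) = cmod (cinner (D h - D k) v) / (\<bar>h\<bar> + \<bar>k\<bar>)"
        using pos unfolding cinner_scaleR_left norm_mult norm_of_real by simp
      ultimately show ?thesis by simp
    qed
    then show "\<exists>B. \<forall>i\<in>I. cmod (cinner ((\<lambda>(h, k). (1 / (\<bar>h\<bar> + \<bar>k\<bar>)) *\<^sub>R (D h - D k)) i) v) \<le> B"
      unfolding I_def by (intro exI[of _ C]) auto
  qed
  then obtain C where "C \<ge> 0" and C: "\<And>h k. (h, k) \<in> I \<Longrightarrow> norm ((1 / (\<bar>h\<bar> + \<bar>k\<bar>)) *\<^sub>R (D h - D k)) \<le> C"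
    by fastforce
  have C': "norm (D h - D k) \<le> C * (\<bar>h\<bar> + \<bar>k\<bar>)" if "h \<noteq> 0" "\<bar>h\<bar> \<le> 1" "k \<noteq> 0" "\<bar>k\<bar> \<le> 1" for h k
  proof -
    have pos: "\<bar>h\<bar> + \<bar>k\<bar> > 0" using that by simp
    have "(h, k) \<in> I" using that by (simp add: I_def)
    from C[OF this] have "norm (D h - D k) / (\<bar>h\<bar> + \<bar>k\<bar>) \<le> C" using pos by simp
    then show ?thesis using pos by (simp add: pos_divide_le_eq)
  qed
  define e where "e n = inverse (real (Suc n))" for n
  have e: "e n \<noteq> 0" "\<bar>e n\<bar> \<le> 1" "e n > 0" for n by (auto simp: e_def inverse_le_1_iff)
  have e0: "e \<longlonglongrightarrow> 0" unfolding e_def[abs_def] by (rule LIMSEQ_inverse_real_of_nat)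
  have "Cauchy (\<lambda>n. D (e n))"
  proof (rule metric_CauchyI)
    fix \<epsilon> :: real assume "\<epsilon> > 0"
    define B where "B = C + 1"
    have B: "B > 0" "C \<le> B" using \<open>C \<ge> 0\<close> by (auto simp: B_def)
    have "\<epsilon> / (2 * B) > 0" using \<open>\<epsilon> > 0\<close> B by simp
    then obtain N where N: "\<And>n. n \<ge> N \<Longrightarrow> \<bar>e n\<bar> < \<epsilon> / (2 * B)"
      using LIMSEQ_D[OF e0] by fastforce
    have "dist (D (e i)) (D (e j)) < \<epsilon>" if "i \<ge> N" "j \<ge> N" for i j
    proof -
      have "norm (D (e i) - D (e j)) \<le> C * (\<bar>e i\<bar> + \<bar>e j\<bar>)" by (intro C' e)
      also have "\<dots> \<le> B * (\<bar>e i\<bar> + \<bar>e j\<bar>)" using B by (intro mult_right_mono) auto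
      also have "\<dots> < B * (\<epsilon> / (2 * B) + \<epsilon> / (2 * B))"
        using N[OF that(1)] N[OF that(2)] B by (intro mult_strict_left_mono add_strict_mono) auto
      also have "\<dots> = \<epsilon>" using B by (simp add: field_simps)
      finally show ?thesis by (simp add: dist_norm)
    qed
    then show "\<exists>M. \<forall>m\<ge>M. \<forall>n\<ge>M. dist (D (e m)) (D (e n)) < \<epsilon>" by blast
  qed
  then obtain x where x: "(\<lambda>n. D (e n)) \<longlonglongrightarrow> x" using Cauchy_convergent convergent_def by blast
  have xl: "cinner x v = l v" for v
  proof -
    obtain B where B: "\<And>h. h \<noteq> 0 \<Longrightarrow> \<bar>h\<bar> \<le> 1 \<Longrightarrow> cmod (cinner (D h) v - l v) \<le> B * \<bar>h\<bar>" using weak[of v] by blast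
    have "(\<lambda>n. cinner (D (e n)) v - l v) \<longlonglongrightarrow> 0"
    proof (rule Lim_null_comparison)
      show "\<forall>\<^sub>F n in sequentially. norm (cinner (D (e n)) v - l v) \<le> B * \<bar>e n\<bar>"
        using B e by (intro always_eventually) auto
      show "(\<lambda>n. B * \<bar>e n\<bar>) \<longlonglongrightarrow> 0" using tendsto_mult[OF tendsto_const tendsto_rabs[OF e0], of B] by simp
    qed
    then have "(\<lambda>n. cinner (D (e n)) v) \<longlonglongrightarrow> l v" by (rule LIM_zero_cancel)
    with tendsto_cinner_left[OF x, of v] show ?thesis by (rule LIMSEQ_unique)
  qed
  have "norm (D h - x) \<le> C * \<bar>h\<bar>" if h: "h \<noteq> 0" "\<bar>h\<bar> \<le> 1" for h
  proof (rule tendsto_le[OF sequentially_bot])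
    show "(\<lambda>n. norm (D h - D (e n))) \<longlonglongrightarrow> norm (D h - x)" by (intro tendsto_intros x)
    show "(\<lambda>n. C * (\<bar>h\<bar> + \<bar>e n\<bar>)) \<longlonglongrightarrow> C * \<bar>h\<bar>"
      using tendsto_mult[OF tendsto_const tendsto_add[OF tendsto_const tendsto_rabs[OF e0]], of C "\<bar>h\<bar>"] by simp
    show "\<forall>\<^sub>F n in sequentially. norm (D h - D (e n)) \<le> C * (\<bar>h\<bar> + \<bar>e n\<bar>)"
      using C' h e by (intro always_eventually) auto
  qed
  then show thesis using that xl \<open>C \<ge> 0\<close> by blast
qed

section \<open>Taylor bounds for scalar functions\<close>

lemma mean_value_bound:
  fixes f :: "real \<Rightarrow> 'b::real_normed_vector"
  assumes "\<And>x. (f has_vector_derivative f' x) (at x)"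
    and "\<And>x. x \<in> closed_segment s t \<Longrightarrow> norm (f' x) \<le> B"
  shows "norm (f t - f s) \<le> B * \<bar>t - s\<bar>"
proof -
  have "norm (f t - f s) \<le> B * norm (t - s)"
  proof (rule differentiable_bound[of "closed_segment s t" f "\<lambda>x h. h *\<^sub>R f' x"])
    fix x assume x: "x \<in> closed_segment s t"
    show "(f has_derivative (\<lambda>h. h *\<^sub>R f' x)) (at x within closed_segment s t)"
      using assms(1)[of x] unfolding has_vector_derivative_def by (rule has_derivative_at_withinI)
    show "onorm (\<lambda>h. h *\<^sub>R f' x) \<le> B"
    proof (rule onorm_le)
      show "norm (h *\<^sub>R f' x) \<le> B * norm h" for h
        using mult_right_mono[OF assms(2)[OF x], of "\<bar>h\<bar>"] by (simp add: mult.commute)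
    qed
  qed auto
  then show ?thesis by simp
qed

locale thrice_differentiable =
  fixes g g1 g2 g3 :: "real \<Rightarrow> complex"
  assumes g: "\<And>t. (g has_vector_derivative g1 t) (at t)" and g1: "\<And>t. (g1 has_vector_derivative g2 t) (at t)"
    and g2: "\<And>t. (g2 has_vector_derivative g3 t) (at t)"
begin

lemma continuous: "continuous_on S g1" "continuous_on S g2"
proof -
  show "continuous_on S g1"
    by (intro continuous_at_imp_continuous_on ballI has_vector_derivative_continuous[OF g1])
  show "continuous_on S g2"
    by (intro continuous_at_imp_continuous_on ballI has_vector_derivative_continuous[OF g2])
qed

lemma bounded_on_Icc:
  assumes "continuous_on {a..b::real} (f :: real \<Rightarrow> complex)"
  obtains C where "C \<ge> 0" "\<And>x. x \<in> {a..b} \<Longrightarrow> norm (f x) \<le> C"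
proof -
  have "bounded (f ` {a..b})" using assms by (intro compact_imp_bounded compact_continuous_image) auto
  then obtain C where C: "\<forall>y\<in>f ` {a..b}. norm y \<le> C" unfolding bounded_iff by blast
  show thesis
  proof (rule that[of "max C 0"])
    show "norm (f x) \<le> max C 0" if "x \<in> {a..b}" for x
      using bspec[OF C imageI[OF that]] by simp
  qed simp
qed

lemma Lipschitz: "\<exists>C. \<forall>s\<in>{a..b}. \<forall>t\<in>{a..b}. norm (g s - g t) \<le> C * \<bar>s - t\<bar>"
proof -
  obtain C where C: "\<And>x. x \<in> {a..b} \<Longrightarrow> norm (g1 x) \<le> C" using bounded_on_Icc[OF continuous(1)] by metis
  have "norm (g s - g t) \<le> C * \<bar>s - t\<bar>" if "s \<in> {a..b}" "t \<in> {a..b}" for s t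
    by (rule mean_value_bound[OF g]) (use that C closed_segment_subset[of t "{a..b}" s] in auto)
  then show ?thesis by blast
qed

lemma Taylor1: "\<exists>C. \<forall>s\<in>{a..b}. \<forall>t\<in>{a..b}. norm (g s - g t - (s - t) *\<^sub>R g1 t) \<le> C * (s - t)\<^sup>2"
proof -
  obtain C where C: "C \<ge> 0" "\<And>x. x \<in> {a..b} \<Longrightarrow> norm (g2 x) \<le> C" using bounded_on_Icc[OF continuous(2)] by metis
  have "norm (g s - g t - (s - t) *\<^sub>R g1 t) \<le> C * (s - t)\<^sup>2" if st: "s \<in> {a..b}" "t \<in> {a..b}" for s t
  proof -
    have seg: "closed_segment t s \<subseteq> {a..b}" using st by (intro closed_segment_subset) auto
    have b1: "norm (g1 x - g1 t) \<le> C * \<bar>s - t\<bar>" if x: "x \<in> closed_segment t s" for x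
    proof -
      have "closed_segment t x \<subseteq> {a..b}" using x seg st by (intro closed_segment_subset) auto
      then have "norm (g1 x - g1 t) \<le> C * \<bar>x - t\<bar>"
        by (intro mean_value_bound[OF g1]) (use C in auto)
      also have "\<dots> \<le> C * \<bar>s - t\<bar>"
        using x C(1) by (intro mult_left_mono) (auto simp: closed_segment_eq_real_ivl split: if_splits)
      finally show ?thesis .
    qed
    have "norm ((g s - (s - t) *\<^sub>R g1 t) - (g t - (t - t) *\<^sub>R g1 t)) \<le> (C * \<bar>s - t\<bar>) * \<bar>s - t\<bar>"
    proof (rule mean_value_bound)
      show "((\<lambda>x. g x - (x - t) *\<^sub>R g1 t) has_vector_derivative g1 x - g1 t) (at x)" for x
        by (auto intro!: derivative_eq_intros g)
    qed (rule b1)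
    then show ?thesis by (simp add: power2_eq_square mult.assoc algebra_simps)
  qed
  then show ?thesis by blast
qed

text \<open>Differentiability of \<open>g2\<close> at \<open>t\<close> makes its difference
  quotient there extend continuously, so that \<open>g2 x - g2 t\<close> is bounded by a
  multiple of \<open>\<bar>x - t\<bar>\<close>. Two applications of the mean value bound lead
  from this to the remainder of order 3.\<close>

lemma Taylor2:
  "\<exists>C. \<forall>h. \<bar>h\<bar> \<le> 1 \<longrightarrow> norm (g (t + h) - g t - h *\<^sub>R g1 t - h\<^sup>2 *\<^sub>R (g2 t / 2)) \<le> C * \<bar>h\<bar> ^ 3"
proof -
  define q where "q x = (if x = t then g3 t else (1 / (x - t)) *\<^sub>R (g2 x - g2 t))" for x
  have "isCont q x" for x
  proof (cases "x = t")
    case True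
    have "((\<lambda>x. q x - g3 t) \<longlongrightarrow> 0) (at t)"
    proof (rule tendsto_norm_zero_cancel, rule Lim_transform_eventually)
      show "((\<lambda>x. norm ((1 / norm (x - t)) *\<^sub>R (g2 x - (g2 t + (x - t) *\<^sub>R g3 t)))) \<longlongrightarrow> 0) (at t)"
        using g2[of t] unfolding has_vector_derivative_def has_derivative_within
        by (intro tendsto_norm_zero) (simp add: divide_inverse)
      show "\<forall>\<^sub>F x in at t. norm ((1 / norm (x - t)) *\<^sub>R (g2 x - (g2 t + (x - t) *\<^sub>R g3 t))) = norm (q x - g3 t)"
        using eventually_neq_at_within[of t t UNIV]
      proof eventually_elim
        case (elim x)
        have "q x - g3 t = (1 / (x - t)) *\<^sub>R (g2 x - (g2 t + (x - t) *\<^sub>R g3 t))"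
          using elim by (simp add: q_def scaleR_diff_right scaleR_add_right)
        then show ?case by simp
      qed
    qed
    then have "(q \<longlongrightarrow> g3 t) (at t)" by (rule LIM_zero_cancel)
    then show ?thesis unfolding isCont_def True by (simp add: q_def)
  next
    case False
    have "isCont (\<lambda>x. (1 / (x - t)) *\<^sub>R (g2 x - g2 t)) x"
      using False g2[of x] has_vector_derivative_continuous by (intro continuous_intros) auto
    moreover have ev: "\<forall>\<^sub>F y in nhds x. q y = (1 / (y - t)) *\<^sub>R (g2 y - g2 t)"
      using t1_space_nhds[OF False] by eventually_elim (simp add: q_def)
    ultimately show ?thesis using isCont_cong[OF ev] by simp
  qed
  then obtain C where C: "C \<ge> 0" "\<And>x. x \<in> {t-1..t+1} \<Longrightarrow> norm (q x) \<le> C"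
    using bounded_on_Icc[of "t-1" "t+1" q] by (metis continuous_at_imp_continuous_on)
  have b2: "norm (g2 x - g2 t) \<le> C * \<bar>x - t\<bar>" if "\<bar>x - t\<bar> \<le> 1" for x
  proof (cases "x = t")
    case False
    have "x \<in> {t-1..t+1}" using that by (auto simp: abs_le_iff)
    then show ?thesis using C(2)[of x] False by (simp add: q_def pos_divide_le_eq)
  qed simp
  have seg: "\<bar>x - t\<bar> \<le> \<bar>y - t\<bar>" if "x \<in> closed_segment t y" for x y
    using that by (auto simp: closed_segment_eq_real_ivl split: if_splits)
  have b1: "norm (g1 x - g1 t - (x - t) *\<^sub>R g2 t) \<le> C * \<bar>x - t\<bar> ^ 2" if x: "\<bar>x - t\<bar> \<le> 1" for x
  proof -
    have "norm ((g1 x - (x - t) *\<^sub>R g2 t) - (g1 t - (t - t) *\<^sub>R g2 t)) \<le> (C * \<bar>x - t\<bar>) * \<bar>x - t\<bar>"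
    proof (rule mean_value_bound)
      show "((\<lambda>x. g1 x - (x - t) *\<^sub>R g2 t) has_vector_derivative g2 y - g2 t) (at y)" for y
        by (auto intro!: derivative_eq_intros g1)
      fix y assume "y \<in> closed_segment t x"
      then have "\<bar>y - t\<bar> \<le> \<bar>x - t\<bar>" by (rule seg)
      then show "norm (g2 y - g2 t) \<le> C * \<bar>x - t\<bar>"
        using b2[of y] x mult_left_mono[OF _ C(1), of "\<bar>y - t\<bar>" "\<bar>x - t\<bar>"] by linarith
    qed
    then show ?thesis by (simp add: power2_eq_square mult.assoc algebra_simps)
  qed
  have "norm (g (t + h) - g t - h *\<^sub>R g1 t - h\<^sup>2 *\<^sub>R (g2 t / 2)) \<le> C * \<bar>h\<bar> ^ 3" if h: "\<bar>h\<bar> \<le> 1" for h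
  proof -
    define P where "P x = g x - (x - t) *\<^sub>R g1 t - (x - t)\<^sup>2 *\<^sub>R (g2 t / 2)" for x
    have "norm (P (t + h) - P t) \<le> (C * \<bar>h\<bar> ^ 2) * \<bar>(t + h) - t\<bar>"
    proof (rule mean_value_bound)
      show "(P has_vector_derivative g1 x - g1 t - (x - t) *\<^sub>R g2 t) (at x)" for x
      proof -
        have d2: "((\<lambda>x. (x - t)\<^sup>2) has_real_derivative 2 * (x - t)) (at x)"
          by (auto intro!: derivative_eq_intros)
        have d1: "((\<lambda>x. (x - t) *\<^sub>R g1 t) has_vector_derivative g1 t) (at x)"
          by (auto intro!: derivative_eq_intros)
        have "(P has_vector_derivative (g1 x - g1 t - ((x - t)\<^sup>2 *\<^sub>R 0 + (2 * (x - t)) *\<^sub>R (g2 t / 2)))) (at x)"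
          unfolding P_def[abs_def]
          by (intro has_vector_derivative_diff g d1 has_vector_derivative_scaleR d2 has_vector_derivative_const)
        moreover have "(2 * (x - t)) *\<^sub>R (g2 t / 2) = (x - t) *\<^sub>R g2 t"
          by (simp add: scaleR_conv_of_real field_simps)
        ultimately show ?thesis by simp
      qed
      fix y assume "y \<in> closed_segment t (t + h)"
      then have y: "\<bar>y - t\<bar> \<le> \<bar>h\<bar>" using seg[of y "t + h"] by simp
      have "norm (g1 y - g1 t - (y - t) *\<^sub>R g2 t) \<le> C * \<bar>y - t\<bar> ^ 2" using y h by (intro b1) auto
      also have "\<dots> \<le> C * \<bar>h\<bar> ^ 2" using y C(1) by (intro mult_left_mono power_mono) auto
      finally show "norm (g1 y - g1 t - (y - t) *\<^sub>R g2 t) \<le> C * \<bar>h\<bar> ^ 2" .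
    qed
    moreover have "P (t + h) - P t = g (t + h) - g t - h *\<^sub>R g1 t - h\<^sup>2 *\<^sub>R (g2 t / 2)"
      by (simp add: P_def)
    ultimately show ?thesis by (simp add: power3_eq_cube power2_eq_square mult.assoc)
  qed
  then show ?thesis by blast
qed

end

section \<open>Simultaneous diagonalization on a finite-dimensional subspace\<close>

lemma compact_unit_sphere_span:
  fixes B :: "'a::complex_hilbert_space set"
  assumes B: "finite B" "orthonormal B"
  shows "compact {x \<in> complex_vector.span B. norm x = 1}"
proof -
  define K where "K B = {\<Sum>e\<in>B. c e *\<^sub>C e | c. \<forall>e\<in>B. cmod (c e) \<le> 1}" for B :: "'a set"
  have "compact (K B)" using B(1)
  proof (induction B rule: finite_induct)
    case empty
    show ?case by (simp add: K_def)
  next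
    case (insert a B)
    have "bounded_linear (\<lambda>z. z *\<^sub>C a)"
    proof (rule bounded_linear_intro[of _ "norm a"])
      show "(r *\<^sub>R z) *\<^sub>C a = r *\<^sub>R (z *\<^sub>C a)" for r z
        by (simp add: scaleR_conv_of_real scaleR_scaleC[of r "z *\<^sub>C a"] scaleC_scaleC)
    qed (auto simp: scaleC_add_left norm_scaleC)
    then have c: "compact ((\<lambda>z. z *\<^sub>C a) ` cball 0 1)"
      by (intro compact_continuous_image linear_continuous_on compact_cball)
    have "K (insert a B) = {x + y | x y. x \<in> (\<lambda>z. z *\<^sub>C a) ` cball 0 1 \<and> y \<in> K B}"
    proof (intro equalityI subsetI)
      fix x assume "x \<in> K (insert a B)"
      then obtain c where "x = (\<Sum>e\<in>insert a B. c e *\<^sub>C e)" "\<forall>e\<in>insert a B. cmod (c e) \<le> 1" by (auto simp: K_def)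
      moreover from this have "c a *\<^sub>C a \<in> (\<lambda>z. z *\<^sub>C a) ` cball 0 1" by (intro imageI) simp
      moreover have "(\<Sum>e\<in>B. c e *\<^sub>C e) \<in> K B" using calculation(2) by (auto simp: K_def)
      ultimately show "x \<in> {x + y | x y. x \<in> (\<lambda>z. z *\<^sub>C a) ` cball 0 1 \<and> y \<in> K B}"
        using insert.hyps by auto
    next
      fix x assume "x \<in> {x + y | x y. x \<in> (\<lambda>z. z *\<^sub>C a) ` cball 0 1 \<and> y \<in> K B}"
      then obtain z c where zc: "x = z *\<^sub>C a + (\<Sum>e\<in>B. c e *\<^sub>C e)" "cmod z \<le> 1" "\<forall>e\<in>B. cmod (c e) \<le> 1"
        by (auto simp: K_def)
      have "(\<Sum>e\<in>B. (c(a := z)) e *\<^sub>C e) = (\<Sum>e\<in>B. c e *\<^sub>C e)"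
        using insert.hyps by (intro sum.cong) auto
      then have "x = (\<Sum>e\<in>insert a B. (c(a := z)) e *\<^sub>C e)"
        using zc(1) insert.hyps by simp
      then show "x \<in> K (insert a B)" unfolding K_def using zc(2,3) by (intro CollectI exI[of _ "c(a := z)"]) auto
    qed
    then show ?case using compact_sums[OF c insert.IH] by simp
  qed
  moreover have "closed {x::'a. norm x = 1}"
    by (intro closed_Collect_eq continuous_on_norm continuous_on_id continuous_on_const)
  ultimately have "compact (K B \<inter> {x. norm x = 1})" by (rule compact_Int_closed)
  moreover have "K B \<inter> {x. norm x = 1} = {x \<in> complex_vector.span B. norm x = 1}"
  proof (intro equalityI subsetI)
    fix x assume "x \<in> K B \<inter> {x. norm x = 1}"
    then show "x \<in> {x \<in> complex_vector.span B. norm x = 1}"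
      by (auto simp: K_def intro!: complex_vector.span_sum intro: complex_vector.span_scale[OF complex_vector.span_base])
  next
    fix x assume x: "x \<in> {x \<in> complex_vector.span B. norm x = 1}"
    have "cmod (cinner x e) \<le> 1" if "e \<in> B" for e
      using cinner_cauchy_schwarz[of x e] orthonormal_norm[OF B(2) that] x by simp
    moreover have "x = (\<Sum>e\<in>B. cinner x e *\<^sub>C e)"
      using proj_eq_self[OF B(2,1)] x by (simp add: proj_def)
    ultimately show "x \<in> K B \<inter> {x. norm x = 1}" using x unfolding K_def by auto
  qed
  ultimately show ?thesis by simp
qed

text \<open>The values of \<open>T\<close> may leave \<open>E\<close>. This allows one to deal
  with the compression of \<open>T\<close> to \<open>E\<close> without writing a projection.\<close>

definition symmetric_on :: "'a::complex_hilbert_space set \<Rightarrow> ('a \<Rightarrow> 'a) \<Rightarrow> bool"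
  where "symmetric_on E T \<longleftrightarrow> (\<forall>x\<in>E. \<forall>y\<in>E. T (x + y) = T x + T y) \<and> (\<forall>a. \<forall>x\<in>E. T (a *\<^sub>C x) = a *\<^sub>C T x) \<and>
    (\<forall>x\<in>E. \<forall>y\<in>E. cinner (T x) y = cinner x (T y))"

lemma symmetric_on_subset: "symmetric_on E T \<Longrightarrow> F \<subseteq> E \<Longrightarrow> symmetric_on F T"
  unfolding symmetric_on_def by blast

lemma symmetric_on_sum:
  assumes T: "symmetric_on E T" and E: "complex_vector.subspace E" and "finite B" "B \<subseteq> E"
  shows "T (\<Sum>e\<in>B. c e *\<^sub>C e) = (\<Sum>e\<in>B. c e *\<^sub>C T e)"
  using assms(3,4)
proof (induction B rule: finite_induct)
  case empty
  have "T (0 *\<^sub>C 0) = 0 *\<^sub>C T 0" using T complex_vector.subspace_0[OF E] unfolding symmetric_on_def by blast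
  then show ?case by simp
next
  case (insert a B)
  have "c a *\<^sub>C a \<in> E" "(\<Sum>e\<in>B. c e *\<^sub>C e) \<in> E"
    using insert.prems E by (auto intro!: complex_vector.subspace_scale complex_vector.subspace_sum)
  then show ?case using insert T by (auto simp: symmetric_on_def)
qed

text \<open>An extremal point of the form of \<open>T\<close> on the compact unit sphere of
  \<open>E\<close> is an eigenvector of the compression of \<open>T\<close> to \<open>E\<close>.\<close>

lemma extremal_vector:
  assumes B: "finite B" "orthonormal B" "B \<noteq> {}" and E: "E = complex_vector.span B" and T: "symmetric_on E T"
  obtains e s where "e \<in> E" "norm e = 1" "\<And>x. x \<in> E \<Longrightarrow> cinner (T e) x = complex_of_real s * cinner e x"
proof -
  have sub: "complex_vector.subspace E" unfolding E by (rule complex_vector.subspace_span)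
  have Tadd: "T (x + y) = T x + T y" and Tsc: "T (a *\<^sub>C x) = a *\<^sub>C T x" and Tsym: "cinner (T x) y = cinner x (T y)"
    if "x \<in> E" "y \<in> E" for x y a using T that unfolding symmetric_on_def by blast+
  have BE: "B \<subseteq> E" unfolding E by (rule complex_vector.span_superset)
  define U where "U = {x \<in> E. norm x = 1}"
  have cU: "compact U" unfolding U_def E using B(1,2) by (rule compact_unit_sphere_span)
  have "continuous_on U (\<lambda>x. \<Sum>e\<in>B. cinner x e *\<^sub>C T e)"
  proof -
    have "bounded_linear (\<lambda>x. cinner x e *\<^sub>C T e)" for e
    proof (rule bounded_linear_intro[of _ "norm e * norm (T e)"])
      show "cinner (r *\<^sub>R x) e *\<^sub>C T e = r *\<^sub>R (cinner x e *\<^sub>C T e)" for r x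
        by (simp add: cinner_scaleR_left scaleR_scaleC[of r "cinner x e *\<^sub>C T e"] scaleC_scaleC)
      show "norm (cinner x e *\<^sub>C T e) \<le> norm x * (norm e * norm (T e))" for x
        using mult_right_mono[OF cinner_cauchy_schwarz[of x e], of "norm (T e)"] by (simp add: norm_scaleC mult.assoc)
    qed (simp add: cinner_add_left scaleC_add_left)
    then show ?thesis by (intro continuous_on_sum linear_continuous_on)
  qed
  moreover have "T x = (\<Sum>e\<in>B. cinner x e *\<^sub>C T e)" if "x \<in> U" for x
    using symmetric_on_sum[OF T sub B(1) BE, of "\<lambda>e. cinner x e"] proj_eq_self[OF B(2,1), of x] that
    by (simp add: U_def E proj_def)
  ultimately have "continuous_on U T" by (metis (no_types, lifting) continuous_on_cong)
  then have cont: "continuous_on U (\<lambda>x. inner (T x) x)" by (intro continuous_intros)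
  have ne: "U \<noteq> {}" using B(2,3) BE orthonormal_norm by (auto simp: U_def)
  obtain e where e: "e \<in> U" and max: "\<forall>x\<in>U. inner (T x) x \<le> inner (T e) e"
    using continuous_attains_sup[OF cU ne cont] by blast
  define s where "s = inner (T e) e"
  have eE: "e \<in> E" "norm e = 1" using e by (auto simp: U_def)
  have scR: "r *\<^sub>R x \<in> E" if "x \<in> E" for x r unfolding scaleR_scaleC by (rule complex_vector.subspace_scale[OF sub that])
  have form: "inner (T x) x \<le> s * (norm x)\<^sup>2" if x: "x \<in> E" for x
  proof (cases "x = 0")
    case True
    then show ?thesis by simp
  next
    case False
    define y where "y = (1 / norm x) *\<^sub>R x"
    have "y \<in> U" using False scR[OF x] by (simp add: U_def y_def)
    then have "inner (T y) y \<le> s" using max by (simp add: s_def)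
    moreover have "T y = (1 / norm x) *\<^sub>R T x" unfolding y_def scaleR_scaleC by (rule Tsc[OF x x])
    ultimately have "inner (T x) x / (norm x)\<^sup>2 \<le> s" by (simp add: y_def power2_eq_square)
    then show ?thesis using False by (simp add: pos_divide_le_eq)
  qed
  have re: "inner (T e) x = s * inner e x" if x: "x \<in> E" for x
  proof (rule ccontr)
    assume ne: "inner (T e) x \<noteq> s * inner e x"
    define \<beta> where "\<beta> = inner (T e) x - s * inner e x"
    define \<gamma> where "\<gamma> = \<bar>inner (T x) x - s * inner x x\<bar> + 1"
    have "\<gamma> > 0" by (simp add: \<gamma>_def)
    define \<tau> where "\<tau> = \<beta> / \<gamma>"
    have "e + \<tau> *\<^sub>R x \<in> E" using eE scR[OF x] complex_vector.subspace_add[OF sub] by blast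
    then have "inner (T (e + \<tau> *\<^sub>R x)) (e + \<tau> *\<^sub>R x) \<le> s * inner (e + \<tau> *\<^sub>R x) (e + \<tau> *\<^sub>R x)"
      using form by (simp add: power2_norm_eq_inner)
    moreover have "T (e + \<tau> *\<^sub>R x) = T e + \<tau> *\<^sub>R T x"
      using Tadd[OF eE(1) scR[OF x]] Tsc[OF x x, of "complex_of_real \<tau>"] by (simp add: scaleR_scaleC)
    moreover have "inner (T x) e = inner (T e) x"
      using Tsym[OF x eE(1)] by (metis Re_cinner inner_commute)
    moreover have "inner (T e) e = s * inner e e" using eE(2) by (simp add: s_def power2_norm_eq_inner[symmetric])
    ultimately have "2 * \<tau> * \<beta> + \<tau>\<^sup>2 * (inner (T x) x - s * inner x x) \<le> 0"
      by (simp add: \<beta>_def inner_add_left inner_add_right inner_commute[of x e] power2_eq_square algebra_simps)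
    moreover have "- (\<tau>\<^sup>2 * \<gamma>) \<le> \<tau>\<^sup>2 * (inner (T x) x - s * inner x x)"
    proof -
      have "- \<gamma> \<le> inner (T x) x - s * inner x x" by (simp add: \<gamma>_def abs_le_iff)
      then show ?thesis using mult_left_mono[of "- \<gamma>" "inner (T x) x - s * inner x x" "\<tau>\<^sup>2"] by simp
    qed
    moreover have "2 * \<tau> * \<beta> - \<tau>\<^sup>2 * \<gamma> = \<beta>\<^sup>2 / \<gamma>"
      using \<open>\<gamma> > 0\<close> by (simp add: \<tau>_def power2_eq_square field_simps)
    moreover have "\<beta>\<^sup>2 / \<gamma> > 0" using ne \<open>\<gamma> > 0\<close> by (simp add: \<beta>_def)
    ultimately show False by linarith
  qed
  have "cinner (T e) x = complex_of_real s * cinner e x" if x: "x \<in> E" for x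
  proof (rule complex_eqI)
    show "Re (cinner (T e) x) = Re (complex_of_real s * cinner e x)" using re[OF x] by (simp add: Re_cinner)
    have "\<i> *\<^sub>C x \<in> E" by (rule complex_vector.subspace_scale[OF sub x])
    from re[OF this] have "Re (cinner (T e) (\<i> *\<^sub>C x)) = s * Re (cinner e (\<i> *\<^sub>C x))" by (simp add: Re_cinner)
    then show "Im (cinner (T e) x) = Im (complex_of_real s * cinner e x)" by (simp add: cinner_scaleC_right)
  qed
  with that eE show thesis by blast
qed

lemma finite_span_subspace:
  assumes "finite S" "E \<subseteq> complex_vector.span S" "complex_vector.subspace E"
  shows "\<exists>B. finite B \<and> orthonormal B \<and> complex_vector.span B = (E :: 'a::complex_hilbert_space set)"
proof -
  obtain B where B: "B \<subseteq> E" "complex_vector.independent B" "E \<subseteq> complex_vector.span B"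
    using complex_vector.basis_exists by metis
  have "finite B" using complex_vector.independent_span_bound[OF assms(1) B(2)] B(1) assms(2) by auto
  moreover have "complex_vector.span B = E"
    using B complex_vector.span_minimal[OF B(1) assms(3)] by auto
  ultimately show ?thesis using orthonormal_basis by metis
qed

text \<open>The compressions of \<open>T1\<close> and \<open>T2\<close> need not commute, so
  \<open>T2\<close> is diagonalized only within the eigenspaces of the compression of
  \<open>T1\<close>. The induction splits off one vector at a time, an extremal vector for
  \<open>T2\<close> on such an eigenspace \<open>G\<close>.\<close>

lemma simultaneous_diagonalization:
  assumes "finite S" "E \<subseteq> complex_vector.span S" "complex_vector.subspace E"
    and "symmetric_on E T1" "symmetric_on E T2"
  shows "\<exists>B \<mu> \<nu>. finite B \<and> orthonormal B \<and> complex_vector.span B = (E :: 'a::complex_hilbert_space set) \<and>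
    (\<forall>b\<in>B. \<forall>b'\<in>B. cinner (T1 b) b' = (if b = b' then complex_of_real (\<mu> b) else 0) \<and>
      (\<mu> b = \<mu> b' \<longrightarrow> cinner (T2 b) b' = (if b = b' then complex_of_real (\<nu> b) else 0)))"
  using assms
proof (induction "complex_vector.dim E" arbitrary: E rule: less_induct)
  case less
  have sub: "complex_vector.subspace E" by fact
  have T1sym: "cinner (T1 x) y = cinner x (T1 y)" and T2sym: "cinner (T2 x) y = cinner x (T2 y)"
    if "x \<in> E" "y \<in> E" for x y using less.prems(4,5) that unfolding symmetric_on_def by blast+
  obtain B0 where B0: "finite B0" "orthonormal B0" "complex_vector.span B0 = E"
    using finite_span_subspace less.prems by metis
  show ?case
  proof (cases "B0 = {}")
    case True
    then show ?thesis using B0 by (intro exI[of _ "{}"]) auto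
  next
    case False
    obtain e0 m where e0: "e0 \<in> E" "norm e0 = 1" "\<And>x. x \<in> E \<Longrightarrow> cinner (T1 e0) x = complex_of_real m * cinner e0 x"
      using extremal_vector[OF B0(1,2) False B0(3)[symmetric] less.prems(4)] by metis
    define G where "G = {x \<in> E. \<forall>y\<in>E. cinner (T1 x) y = complex_of_real m * cinner x y}"
    have subG: "complex_vector.subspace G"
      unfolding complex_vector.subspace_def
    proof (intro conjI ballI allI)
      have "T1 (0 *\<^sub>C 0) = 0 *\<^sub>C T1 0" using less.prems(4) complex_vector.subspace_0[OF sub] unfolding symmetric_on_def by blast
      then show "0 \<in> G" using complex_vector.subspace_0[OF sub] by (simp add: G_def)
    next
      fix x y assume "x \<in> G" "y \<in> G"
      moreover from this have "T1 (x + y) = T1 x + T1 y" using less.prems(4) unfolding symmetric_on_def G_def by blast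
      ultimately show "x + y \<in> G" using complex_vector.subspace_add[OF sub]
        by (auto simp: G_def cinner_add_left distrib_left)
    next
      fix a x assume "x \<in> G"
      moreover from this have "T1 (a *\<^sub>C x) = a *\<^sub>C T1 x" using less.prems(4) unfolding symmetric_on_def G_def by blast
      ultimately show "a *\<^sub>C x \<in> G" using complex_vector.subspace_scale[OF sub]
        by (auto simp: G_def cinner_scaleC_left)
    qed
    have GE: "G \<subseteq> E" by (auto simp: G_def)
    obtain BG where BG: "finite BG" "orthonormal BG" "complex_vector.span BG = G"
      using finite_span_subspace[OF less.prems(1) _ subG] GE less.prems(2) by blast
    have "e0 \<in> G" using e0 by (simp add: G_def)
    moreover have "e0 \<noteq> 0" using e0(2) by auto
    ultimately have "BG \<noteq> {}" using BG(3) complex_vector.span_empty by auto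
    obtain e k where e: "e \<in> G" "norm e = 1" "\<And>x. x \<in> G \<Longrightarrow> cinner (T2 e) x = complex_of_real k * cinner e x"
      using extremal_vector[OF BG(1,2) \<open>BG \<noteq> {}\<close> BG(3)[symmetric] symmetric_on_subset[OF less.prems(5) GE]] by metis
    have eE: "e \<in> E" using e(1) GE by blast
    have ee: "cinner e e = 1" using e(2) by (simp add: cinner_self)
    define F where "F = {x \<in> E. cinner x e = 0}"
    have subF: "complex_vector.subspace F"
      using sub by (auto simp: complex_vector.subspace_def F_def cinner_add_left cinner_scaleC_left)
    have FE: "F \<subseteq> E" by (auto simp: F_def)
    have "e \<notin> F" using ee by (simp add: F_def)
    obtain BF where BF: "finite BF" "orthonormal BF" "complex_vector.span BF = F"
      using finite_span_subspace[OF less.prems(1) _ subF] FE less.prems(2) by blast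
    have BFe: "cinner b e = 0" "cinner e b = 0" if "b \<in> F" for b
      using that cinner_commute[of e b] by (auto simp: F_def)
    have extend: "finite (insert e C) \<and> orthonormal (insert e C) \<and> complex_vector.span (insert e C) = E"
      if C: "finite C" "orthonormal C" "complex_vector.span C = F" for C
    proof (intro conjI)
      have CF: "C \<subseteq> F" using C(3) complex_vector.span_superset by blast
      show "finite (insert e C)" using C by simp
      show "orthonormal (insert e C)" using C(2) CF BFe ee by (auto simp: orthonormal_def subset_iff)
      show "complex_vector.span (insert e C) = E"
      proof (intro equalityI complex_vector.span_minimal[OF _ sub])
        show "insert e C \<subseteq> E" using CF FE eE by auto
        show "E \<subseteq> complex_vector.span (insert e C)"
        proof
          fix x assume x: "x \<in> E"
          have "x - cinner x e *\<^sub>C e \<in> F"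
            using x eE ee complex_vector.subspace_diff[OF sub] complex_vector.subspace_scale[OF sub]
            by (simp add: F_def cinner_diff_left cinner_scaleC_left)
          then have "x - cinner x e *\<^sub>C e \<in> complex_vector.span (insert e C)"
            using C(3) complex_vector.span_mono[of C "insert e C"] by blast
          moreover have "cinner x e *\<^sub>C e \<in> complex_vector.span (insert e C)"
            by (intro complex_vector.span_scale complex_vector.span_base) auto
          ultimately show "x \<in> complex_vector.span (insert e C)"
            using complex_vector.span_add by fastforce
        qed
      qed
    qed
    have "complex_vector.dim F = card BF"
      using complex_vector.dim_span_eq_card_independent[OF orthonormal_independent[OF BF(2)]] BF(3) by simp
    moreover have "complex_vector.dim E = card (insert e BF)"
      using complex_vector.dim_span_eq_card_independent[OF orthonormal_independent[of "insert e BF"]] extend[OF BF] by simp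
    moreover have "e \<notin> BF" using \<open>e \<notin> F\<close> BF(3) complex_vector.span_base by blast
    ultimately have "complex_vector.dim F < complex_vector.dim E" using BF(1) by simp
    moreover have "F \<subseteq> complex_vector.span S" using FE less.prems(2) by blast
    ultimately obtain B \<mu> \<nu> where B: "finite B" "orthonormal B" "complex_vector.span B = F"
      and d: "\<forall>b\<in>B. \<forall>b'\<in>B. cinner (T1 b) b' = (if b = b' then complex_of_real (\<mu> b) else 0) \<and>
        (\<mu> b = \<mu> b' \<longrightarrow> cinner (T2 b) b' = (if b = b' then complex_of_real (\<nu> b) else 0))"
      using less.hyps[OF _ less.prems(1) _ subF symmetric_on_subset[OF less.prems(4) FE] symmetric_on_subset[OF less.prems(5) FE]]
      by blast
    have diag: "cinner (T1 b) b' = (if b = b' then complex_of_real (\<mu> b) else 0)"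
      "\<mu> b = \<mu> b' \<Longrightarrow> cinner (T2 b) b' = (if b = b' then complex_of_real (\<nu> b) else 0)"
      if "b \<in> B" "b' \<in> B" for b b' using d that by blast+
    have BF': "B \<subseteq> F" using B(3) complex_vector.span_superset by blast
    have eB: "e \<notin> B" using BF' \<open>e \<notin> F\<close> by blast
    define \<mu>' where "\<mu>' = \<mu>(e := m)"
    define \<nu>' where "\<nu>' = \<nu>(e := k)"
    have T1e: "cinner (T1 e) y = complex_of_real m * cinner e y" if "y \<in> E" for y
      using e(1) that by (simp add: G_def)
    have T1be: "cinner (T1 b) e = 0" "cinner (T1 e) b = 0" if "b \<in> B" for b
    proof -
      have b: "b \<in> F" "b \<in> E" using that BF' FE by auto
      show "cinner (T1 e) b = 0" using T1e[OF b(2)] BFe[OF b(1)] by simp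
      then show "cinner (T1 b) e = 0" using T1sym[OF b(2) eE] cinner_commute[of b "T1 e"] by simp
    qed
    have inG: "b \<in> G" if b: "b \<in> B" "\<mu> b = m" for b
    proof -
      have bE: "b \<in> E" using b BF' FE by auto
      have "cinner (T1 b) y = complex_of_real m * cinner b y" if y: "y \<in> E" for y
      proof -
        have ex: "y = (\<Sum>x\<in>insert e B. cinner y x *\<^sub>C x)"
          using proj_eq_self[of "insert e B" y] extend[OF B] y by (simp add: proj_def)
        have "cinner (T1 b) x = complex_of_real m * cinner b x" if "x \<in> insert e B" for x
        proof (cases "x = e")
          case True
          then show ?thesis using T1be[OF b(1)] BFe[of b] b(1) BF' by auto
        next
          case False
          then have "x \<in> B" using that by simp
          then show ?thesis using diag(1)[OF b(1)] b B(2) by (auto simp: orthonormal_def)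
        qed
        then have "cinner (T1 b) (\<Sum>x\<in>insert e B. cinner y x *\<^sub>C x) = complex_of_real m * cinner b (\<Sum>x\<in>insert e B. cinner y x *\<^sub>C x)"
          unfolding cinner_sum_right sum_distrib_left by (intro sum.cong) (auto simp: cinner_scaleC_right)
        then show ?thesis using ex by simp
      qed
      then show ?thesis using bE by (simp add: G_def)
    qed
    have T2be: "cinner (T2 b) e = 0" "cinner (T2 e) b = 0" if b: "b \<in> B" "\<mu> b = m" for b
    proof -
      have bF: "b \<in> F" "b \<in> E" using b BF' FE by auto
      show "cinner (T2 e) b = 0" using e(3)[OF inG[OF b]] BFe[OF bF(1)] by simp
      then show "cinner (T2 b) e = 0" using T2sym[OF bF(2) eE] cinner_commute[of b "T2 e"] by simp
    qed
    have "cinner (T1 b) b' = (if b = b' then complex_of_real (\<mu>' b) else 0) \<and>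
      (\<mu>' b = \<mu>' b' \<longrightarrow> cinner (T2 b) b' = (if b = b' then complex_of_real (\<nu>' b) else 0))"
      if mem: "b \<in> insert e B" "b' \<in> insert e B" for b b'
    proof -
      consider "b = e" "b' = e" | "b = e" "b' \<in> B" | "b \<in> B" "b' = e" | "b \<in> B" "b' \<in> B" using mem by auto
      then show ?thesis
      proof cases
        case 1
        then show ?thesis using T1e[OF eE] e(3)[OF e(1)] ee by (simp add: \<mu>'_def \<nu>'_def)
      next
        case 2
        then have "b' \<noteq> e" using eB by auto
        then show ?thesis using 2 T1be T2be by (auto simp: \<mu>'_def)
      next
        case 3
        then have "b \<noteq> e" using eB by auto
        then show ?thesis using 3 T1be T2be by (auto simp: \<mu>'_def)
      next
        case 4
        then have "b \<noteq> e" "b' \<noteq> e" using eB by auto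
        then show ?thesis using 4 diag by (simp add: \<mu>'_def \<nu>'_def)
      qed
    qed
    then have all: "\<forall>b\<in>insert e B. \<forall>b'\<in>insert e B. cinner (T1 b) b' = (if b = b' then complex_of_real (\<mu>' b) else 0) \<and>
      (\<mu>' b = \<mu>' b' \<longrightarrow> cinner (T2 b) b' = (if b = b' then complex_of_real (\<nu>' b) else 0))"
      by (intro ballI)
    have ext: "finite (insert e B)" "orthonormal (insert e B)" "complex_vector.span (insert e B) = E"
      using extend[OF B] by simp_all
    show ?thesis
      by (intro exI[of _ "insert e B"] exI[of _ \<mu>'] exI[of _ \<nu>'] conjI) (fact ext all)+
  qed
qed

section \<open>Approximate eigenspaces\<close>

context compact_resolvent_operator
begin

lemma residual_decomposition:
  assumes f: "onf f k" "\<And>i. i < k \<Longrightarrow> f i \<in> V" "\<And>i. i < k \<Longrightarrow> T (f i) = l i *\<^sub>R f i" and x: "x \<in> V"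
  defines "y \<equiv> x - fproj f k x"
  shows "y \<in> V" and "(norm (T x - z *\<^sub>R x))\<^sup>2 = (\<Sum>i<k. (l i - z)\<^sup>2 * (cmod (cinner x (f i)))\<^sup>2) + (norm (T y - z *\<^sub>R y))\<^sup>2"
proof -
  have pV: "fproj f k x \<in> V" unfolding fproj_def using f(2) by (intro V_sum V_scale) auto
  then show yV: "y \<in> V" unfolding y_def using x by (intro V_diff)
  define p where "p = fproj f k x"
  have Tp: "T p - z *\<^sub>R p = (\<Sum>i<k. (complex_of_real (l i - z) * cinner x (f i)) *\<^sub>C f i)"
  proof -
    have "T p = (\<Sum>i<k. T (cinner x (f i) *\<^sub>C f i))"
      unfolding p_def fproj_def using f(2) by (intro T_sum V_scale) auto
    also have "\<dots> = (\<Sum>i<k. (complex_of_real (l i) * cinner x (f i)) *\<^sub>C f i)"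
      using f(2,3) by (intro sum.cong) (auto simp: T_scale scaleR_scaleC scaleC_scaleC mult.commute)
    finally have 1: "T p = (\<Sum>i<k. (complex_of_real (l i) * cinner x (f i)) *\<^sub>C f i)" .
    have 2: "z *\<^sub>R p = (\<Sum>i<k. (complex_of_real z * cinner x (f i)) *\<^sub>C f i)"
      unfolding p_def fproj_def scaleR_sum_right by (simp add: scaleR_scaleC[of z "_ *\<^sub>C _"] scaleC_scaleC)
    show ?thesis unfolding 1 2 sum_subtractf[symmetric]
      by (intro sum.cong) (auto simp: left_diff_distrib complex_vector.scale_left_diff_distrib)
  qed
  have fy: "cinner (f i) (T y - z *\<^sub>R y) = 0" if "i < k" for i
  proof -
    have "cinner (f i) y = 0"
      using fproj_orthogonal[OF f(1) that, of x] cinner_commute[of "f i" y] by (simp add: y_def)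
    moreover have "cinner (f i) (T y) = cinner (T (f i)) y" using symmetric[OF f(2)[OF that] yV] by simp
    ultimately show ?thesis using f(3)[OF that] by (simp add: cinner_diff_right cinner_scaleR_left cinner_scaleR_right)
  qed
  have "cinner (T p - z *\<^sub>R p) (T y - z *\<^sub>R y) = 0"
    unfolding Tp cinner_sum_left cinner_scaleC_left using fy by (intro sum.neutral) auto
  from norm_add_orthogonal[OF this] have "(norm ((T p - z *\<^sub>R p) + (T y - z *\<^sub>R y)))\<^sup>2
      = (norm (T p - z *\<^sub>R p))\<^sup>2 + (norm (T y - z *\<^sub>R y))\<^sup>2" .
  moreover have "(T p - z *\<^sub>R p) + (T y - z *\<^sub>R y) = T x - z *\<^sub>R x"
  proof -
    have xp: "fproj f k x + y = x" by (simp add: y_def)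
    then have Tx: "T x = T p + T y" unfolding p_def using T_add[OF pV yV] by simp
    have zx: "z *\<^sub>R x = z *\<^sub>R p + z *\<^sub>R y" unfolding p_def by (metis xp scaleR_add_right)
    show ?thesis unfolding Tx zx by simp
  qed
  moreover have "(norm (T p - z *\<^sub>R p))\<^sup>2 = (\<Sum>i<k. (l i - z)\<^sup>2 * (cmod (cinner x (f i)))\<^sup>2)"
  proof -
    define h where "h i = complex_of_real (l i - z) * cinner x (f i)" for i
    define d where "d e = h (THE i. i < k \<and> f i = e)" for e
    have d: "d (f i) = h i" if "i < k" for i
    proof -
      have "(THE j. j < k \<and> f j = f i) = i"
        using onf_inj[OF f(1)] that by (intro the_equality) (auto simp: inj_on_def)
      then show ?thesis by (simp add: d_def)
    qed
    have "(norm (\<Sum>e\<in>f ` {..<k}. d e *\<^sub>C e))\<^sup>2 = (\<Sum>e\<in>f ` {..<k}. (cmod (d e))\<^sup>2)"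
      by (intro norm_combination onf_orthonormal f) auto
    then have "(norm (\<Sum>i<k. h i *\<^sub>C f i))\<^sup>2 = (\<Sum>i<k. (cmod (h i))\<^sup>2)"
      by (simp add: onf_sum[OF f(1)] d)
    then show ?thesis unfolding Tp by (simp add: h_def norm_mult power_mult_distrib flip: of_real_diff)
  qed
  ultimately show "(norm (T x - z *\<^sub>R x))\<^sup>2 = (\<Sum>i<k. (l i - z)\<^sup>2 * (cmod (cinner x (f i)))\<^sup>2) + (norm (T y - z *\<^sub>R y))\<^sup>2"
    by simp
qed

text \<open>If fewer eigenvalues were within \<open>e\<close> of \<open>z\<close>, some
  combination of the \<open>u b\<close> would be orthogonal to all of their eigenvectors. Then
  every component of it would be multiplied by more than \<open>e\<close> in absolute value,
  contrary to the bound on its residual.\<close>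

lemma quasimode_count:
  fixes u :: "'b \<Rightarrow> 'a"
  assumes f: "onf f k" "\<And>i. i < k \<Longrightarrow> f i \<in> V" "\<And>i. i < k \<Longrightarrow> T (f i) = l i *\<^sub>R f i"
    and gap: "\<And>y. y \<in> V \<Longrightarrow> (\<And>i. i < k \<Longrightarrow> cinner y (f i) = 0) \<Longrightarrow> g * norm y \<le> norm (T y - z *\<^sub>R y)"
    and e: "0 \<le> e" "e < g" and B: "finite B" "\<And>b. b \<in> B \<Longrightarrow> u b \<in> V"
    and quasi: "\<And>c. (\<exists>b\<in>B. c b \<noteq> 0) \<Longrightarrow> (\<Sum>b\<in>B. c b *\<^sub>C u b) \<noteq> 0 \<and>
      norm (T (\<Sum>b\<in>B. c b *\<^sub>C u b) - z *\<^sub>R (\<Sum>b\<in>B. c b *\<^sub>C u b)) \<le> e * norm (\<Sum>b\<in>B. c b *\<^sub>C u b)"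
  shows "card B \<le> card {i. i < k \<and> \<bar>l i - z\<bar> \<le> e}"
proof (rule ccontr)
  define I where "I = {i. i < k \<and> \<bar>l i - z\<bar> \<le> e}"
  assume "\<not> ?thesis"
  then have less: "card I < card B" by (simp add: I_def)
  have finI: "finite I" by (simp add: I_def)
  obtain h where h: "bij_betw h {..<card I} I"
    using ex_bij_betw_nat_finite[OF finI] by (auto simp: atLeast0LessThan)
  obtain c where c: "\<exists>b\<in>B. c b \<noteq> 0" "\<And>i. i < card I \<Longrightarrow> (\<Sum>b\<in>B. cinner (u b) (f (h i)) * c b) = 0"
    using homogeneous_system[OF B(1) less, of "\<lambda>i b. cinner (u b) (f (h i))"] by blast
  define w where "w = (\<Sum>b\<in>B. c b *\<^sub>C u b)"
  have wV: "w \<in> V" unfolding w_def using B(2) by (intro V_sum V_scale) auto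
  have w0: "w \<noteq> 0" and we: "norm (T w - z *\<^sub>R w) \<le> e * norm w" using quasi[OF c(1)] by (auto simp: w_def)
  have wI: "cinner w (f i) = 0" if "i \<in> I" for i
  proof -
    have "i \<in> h ` {..<card I}" using h that by (simp add: bij_betw_def)
    then obtain j where "j < card I" "h j = i" by auto
    then show ?thesis using c(2)[of j] by (simp add: w_def cinner_sum_left cinner_scaleC_left mult.commute)
  qed
  define y where "y = w - fproj f k w"
  have yV: "y \<in> V" and res: "(norm (T w - z *\<^sub>R w))\<^sup>2 = (\<Sum>i<k. (l i - z)\<^sup>2 * (cmod (cinner w (f i)))\<^sup>2) + (norm (T y - z *\<^sub>R y))\<^sup>2"
    using residual_decomposition[OF f wV] by (auto simp: y_def)
  have "g * norm y \<le> norm (T y - z *\<^sub>R y)" using fproj_orthogonal[OF f(1)] by (intro gap yV) (simp add: y_def)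
  then have gy: "(g * norm y)\<^sup>2 \<le> (norm (T y - z *\<^sub>R y))\<^sup>2" using e by (intro power_mono) auto
  have "(norm (T w - z *\<^sub>R w))\<^sup>2 \<le> (e * norm w)\<^sup>2" using we by (intro power_mono) auto
  also have "\<dots> = (\<Sum>i<k. e\<^sup>2 * (cmod (cinner w (f i)))\<^sup>2) + e\<^sup>2 * (norm y)\<^sup>2"
    using onf_norm_decomposition[OF f(1), of w] by (simp add: y_def power_mult_distrib distrib_left sum_distrib_left)
  finally have le: "(\<Sum>i<k. ((l i - z)\<^sup>2 - e\<^sup>2) * (cmod (cinner w (f i)))\<^sup>2) + (g\<^sup>2 - e\<^sup>2) * (norm y)\<^sup>2 \<le> 0"
    using gy unfolding res by (simp add: left_diff_distrib sum_subtractf power_mult_distrib)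
  have far: "(l i - z)\<^sup>2 - e\<^sup>2 > 0" if "i < k" "i \<notin> I" for i
  proof -
    have "\<bar>e\<bar> < \<bar>l i - z\<bar>" using that e by (auto simp: I_def)
    then have "\<bar>e\<bar>\<^sup>2 < \<bar>l i - z\<bar>\<^sup>2" by (intro power_strict_mono) auto
    then show ?thesis by simp
  qed
  have term_nonneg: "((l i - z)\<^sup>2 - e\<^sup>2) * (cmod (cinner w (f i)))\<^sup>2 \<ge> 0" if "i < k" for i
    using far[OF that] wI[of i] by (cases "i \<in> I") auto
  have "g\<^sup>2 - e\<^sup>2 > 0" using e power_strict_mono[of e g 2] by simp
  moreover have "(\<Sum>i<k. ((l i - z)\<^sup>2 - e\<^sup>2) * (cmod (cinner w (f i)))\<^sup>2) \<ge> 0"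
    using term_nonneg by (intro sum_nonneg) auto
  moreover have "(g\<^sup>2 - e\<^sup>2) * (norm y)\<^sup>2 \<ge> 0" using calculation(1) by simp
  ultimately have "(\<Sum>i<k. ((l i - z)\<^sup>2 - e\<^sup>2) * (cmod (cinner w (f i)))\<^sup>2) = 0" and y0: "(g\<^sup>2 - e\<^sup>2) * (norm y)\<^sup>2 = 0"
    using le by linarith+
  then have "\<forall>i\<in>{..<k}. ((l i - z)\<^sup>2 - e\<^sup>2) * (cmod (cinner w (f i)))\<^sup>2 = 0"
    using term_nonneg by (subst (asm) sum_nonneg_eq_0_iff) auto
  then have c0: "((l i - z)\<^sup>2 - e\<^sup>2) * (cmod (cinner w (f i)))\<^sup>2 = 0" if "i < k" for i using that by simp
  have wf: "cinner w (f i) = 0" if "i < k" for i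
  proof (cases "i \<in> I")
    case False
    show ?thesis using c0[OF that] far[OF that False] by (metis less_irrefl mult_eq_0_iff norm_eq_zero power_eq_0_iff)
  qed (rule wI)
  have "y = 0" using y0 \<open>g\<^sup>2 - e\<^sup>2 > 0\<close> by simp
  then have "(norm w)\<^sup>2 = 0" using onf_norm_decomposition[OF f(1), of w] wf by (simp add: y_def)
  then show False using w0 by simp
qed

text \<open>By \<open>residual_decomposition\<close> an eigenvector for \<open>z\<close> has
  components only along those \<open>f i\<close> with \<open>l i = z\<close>, and by the gap
  none outside the family.\<close>

lemma multiplicity_cluster:
  assumes f: "onf f k" "\<And>i. i < k \<Longrightarrow> f i \<in> V" "\<And>i. i < k \<Longrightarrow> T (f i) = l i *\<^sub>R f i"
    and gap: "\<And>y. y \<in> V \<Longrightarrow> (\<And>i. i < k \<Longrightarrow> cinner y (f i) = 0) \<Longrightarrow> g * norm y \<le> norm (T y - z *\<^sub>R y)"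
    and g: "g > 0"
  shows "multiplicity_at V T (complex_of_real z) = enat (card {i. i < k \<and> l i = z})"
proof -
  define I where "I = {i. i < k \<and> l i = z}"
  have finI: "finite I" by (simp add: I_def)
  have on: "orthonormal (f ` I)" using onf_orthonormal[OF f(1)] by (auto simp: orthonormal_def I_def)
  have eig: "eigenspace V T (complex_of_real z) = {u \<in> V. T u = z *\<^sub>R u}"
    by (simp add: eigenspace_def scaleC_of_real)
  have "complex_vector.subspace {u \<in> V. T u = z *\<^sub>R u}"
    by (auto simp: complex_vector.subspace_def V_add V_scale T_add T_scale scaleR_add_right scaleC_scaleR)
  then have "complex_vector.span (f ` I) \<subseteq> {u \<in> V. T u = z *\<^sub>R u}"
    by (rule complex_vector.span_minimal[rotated]) (use f in \<open>auto simp: I_def\<close>)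
  moreover have "{u \<in> V. T u = z *\<^sub>R u} \<subseteq> complex_vector.span (f ` I)"
  proof
    fix x assume "x \<in> {u \<in> V. T u = z *\<^sub>R u}"
    then have x: "x \<in> V" "T x = z *\<^sub>R x" by auto
    define y where "y = x - fproj f k x"
    have yV: "y \<in> V" and res: "(norm (T x - z *\<^sub>R x))\<^sup>2 = (\<Sum>i<k. (l i - z)\<^sup>2 * (cmod (cinner x (f i)))\<^sup>2) + (norm (T y - z *\<^sub>R y))\<^sup>2"
      using residual_decomposition[OF f x(1)] by (auto simp: y_def)
    have s: "(\<Sum>i<k. (l i - z)\<^sup>2 * (cmod (cinner x (f i)))\<^sup>2) \<ge> 0" by (intro sum_nonneg) auto
    have "(norm (T y - z *\<^sub>R y))\<^sup>2 \<ge> 0" by simp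
    moreover have "(\<Sum>i<k. (l i - z)\<^sup>2 * (cmod (cinner x (f i)))\<^sup>2) + (norm (T y - z *\<^sub>R y))\<^sup>2 = 0"
      using res x(2) by simp
    ultimately have s0: "(\<Sum>i<k. (l i - z)\<^sup>2 * (cmod (cinner x (f i)))\<^sup>2) = 0" and y0: "(norm (T y - z *\<^sub>R y))\<^sup>2 = 0"
      using s by linarith+
    have "g * norm y \<le> norm (T y - z *\<^sub>R y)" using fproj_orthogonal[OF f(1)] by (intro gap yV) (simp add: y_def)
    then have "g * norm y \<le> 0" using y0 by simp
    then have "y = 0" using g by (simp add: mult_le_0_iff)
    have c0: "\<forall>i\<in>{..<k}. (l i - z)\<^sup>2 * (cmod (cinner x (f i)))\<^sup>2 = 0"
      using s0 by (subst (asm) sum_nonneg_eq_0_iff) auto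
    have "x = fproj f k x" using \<open>y = 0\<close> by (simp add: y_def)
    also have "\<dots> = (\<Sum>i\<in>I. cinner x (f i) *\<^sub>C f i)"
      unfolding fproj_def using c0 by (intro sum.mono_neutral_right) (auto simp: I_def)
    also have "\<dots> \<in> complex_vector.span (f ` I)"
      by (intro complex_vector.span_sum complex_vector.span_scale complex_vector.span_base imageI)
    finally show "x \<in> complex_vector.span (f ` I)" .
  qed
  ultimately have span: "complex_vector.span (f ` I) = eigenspace V T (complex_of_real z)" using eig by auto
  have "complex_vector.dim (eigenspace V T (complex_of_real z)) = card (f ` I)"
    unfolding span[symmetric] by (rule complex_vector.dim_span_eq_card_independent[OF orthonormal_independent[OF on]])
  also have "card (f ` I) = card I"
    by (intro card_image inj_on_subset[OF onf_inj[OF f(1)]]) (auto simp: I_def)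
  finally have dim: "complex_vector.dim (eigenspace V T (complex_of_real z)) = card I" .
  have "\<exists>B. finite B \<and> complex_vector.span B = eigenspace V T (complex_of_real z)"
    using span finI by blast
  then show ?thesis unfolding multiplicity_at_def using dim by (simp add: I_def)
qed

end

section \<open>The resolvent at a real point\<close>

locale resolvent_operator = compact_resolvent_operator +
  fixes c \<kappa> :: real
  assumes \<kappa>: "\<kappa> > 0" and lb: "u \<in> V \<Longrightarrow> \<kappa> * norm u \<le> norm (T u - c *\<^sub>R u)"
begin

definition Res :: "'a \<Rightarrow> 'a" where "Res x = (SOME u. u \<in> V \<and> T u - c *\<^sub>R u = x)"

lemma Res_V: "Res x \<in> V" and T_Res: "T (Res x) - c *\<^sub>R Res x = x"
  using someI_ex[of "\<lambda>u. u \<in> V \<and> T u - c *\<^sub>R u = x"] surjective[OF \<kappa> lb, of x] by (auto simp: Res_def)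

lemma Res_eqI:
  assumes "u \<in> V" "T u - c *\<^sub>R u = x"
  shows "Res x = u"
proof -
  have "T (Res x - u) - c *\<^sub>R (Res x - u) = (T (Res x) - c *\<^sub>R Res x) - (T u - c *\<^sub>R u)"
    using T_diff[OF Res_V assms(1)] by (simp add: scaleR_diff_right)
  also have "\<dots> = 0" using T_Res assms(2) by simp
  finally have "\<kappa> * norm (Res x - u) \<le> 0" using lb[OF V_diff[OF Res_V assms(1)], of x] by simp
  then show ?thesis using \<kappa> by (simp add: mult_le_0_iff)
qed

lemma Res_norm: "norm (Res x) \<le> 1 / \<kappa> * norm x"
  using lb[OF Res_V, of x] \<kappa> by (simp add: T_Res field_simps)

sublocale Res: compact_symmetric_operator Res "1 / \<kappa>"
proof
  show "Res (x + y) = Res x + Res y" for x y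
  proof (rule Res_eqI)
    have "T (Res x + Res y) - c *\<^sub>R (Res x + Res y) = (T (Res x) - c *\<^sub>R Res x) + (T (Res y) - c *\<^sub>R Res y)"
      by (simp add: T_add Res_V scaleR_add_right)
    then show "T (Res x + Res y) - c *\<^sub>R (Res x + Res y) = x + y" by (simp only: T_Res)
  qed (simp add: V_add Res_V)
  show "Res (a *\<^sub>C x) = a *\<^sub>C Res x" for a x
  proof (rule Res_eqI)
    show "T (a *\<^sub>C Res x) - c *\<^sub>R a *\<^sub>C Res x = a *\<^sub>C x"
      using arg_cong[OF T_Res[of x], of "\<lambda>y. a *\<^sub>C y"] by (simp add: T_scale Res_V scaleC_diff_right scaleC_scaleR)
  qed (simp add: V_scale Res_V)
  show "cinner (Res x) y = cinner x (Res y)" for x y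
  proof -
    have "cinner (Res x) y = cinner (Res x) (T (Res y) - c *\<^sub>R Res y)" by (simp add: T_Res)
    also have "\<dots> = cinner (T (Res x) - c *\<^sub>R Res x) (Res y)"
      using symmetric[OF Res_V Res_V, of x y]
      by (simp add: cinner_diff_left cinner_diff_right cinner_scaleR_left cinner_scaleR_right)
    finally show ?thesis by (simp add: T_Res)
  qed
  show "norm (Res x) \<le> 1 / \<kappa> * norm x" for x by (rule Res_norm)
  fix u :: "nat \<Rightarrow> 'a" and C assume C: "\<And>n. norm (u n) \<le> C"
  have n1: "norm (Res (u n)) \<le> 1 / \<kappa> * C" for n
    using Res_norm[of "u n"] mult_left_mono[OF C[of n], of "1 / \<kappa>"] \<kappa> by simp
  have C0: "C \<ge> 0" using C[of 0] norm_ge_zero order_trans by blast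
  have n2: "norm (T (Res (u n))) \<le> C + \<bar>c\<bar> * (1 / \<kappa> * C)" for n
  proof -
    have "T (Res (u n)) = u n + c *\<^sub>R Res (u n)" using T_Res[of "u n"] by (simp add: algebra_simps)
    then have "norm (T (Res (u n))) \<le> norm (u n) + \<bar>c\<bar> * norm (Res (u n))"
      using norm_triangle_ineq[of "u n" "c *\<^sub>R Res (u n)"] by simp
    also have "\<dots> \<le> C + \<bar>c\<bar> * (1 / \<kappa> * C)" using C n1 by (intro add_mono mult_left_mono) auto
    finally show ?thesis .
  qed
  show "\<exists>l s. strict_mono s \<and> (\<lambda>n. Res (u (s n :: nat))) \<longlonglongrightarrow> l"
  proof (rule graph_compact)
    show "norm (Res (u n)) \<le> max (1 / \<kappa> * C) (C + \<bar>c\<bar> * (1 / \<kappa> * C))" for n using n1[of n] by (simp add: le_max_iff_disj)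
    show "norm (T (Res (u n))) \<le> max (1 / \<kappa> * C) (C + \<bar>c\<bar> * (1 / \<kappa> * C))" for n using n2[of n] by (simp add: le_max_iff_disj)
  qed (rule Res_V)
qed

lemma Res_eigenvector:
  assumes "Res x = s *\<^sub>R x" "s \<noteq> 0"
  shows "x \<in> V" and "T x = (c + 1 / s) *\<^sub>R x"
proof -
  have x: "x = (1 / s) *\<^sub>R Res x" using assms by simp
  then show xV: "x \<in> V" using V_scaleR[OF Res_V] by metis
  have "x = T (s *\<^sub>R x) - c *\<^sub>R (s *\<^sub>R x)" using T_Res[of x] assms(1) by simp
  also have "\<dots> = s *\<^sub>R (T x - c *\<^sub>R x)" using xV by (simp add: T_scaleR scaleR_diff_right mult.commute)
  finally have "(1 / s) *\<^sub>R x = (1 / s) *\<^sub>R (s *\<^sub>R (T x - c *\<^sub>R x))" by simp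
  then have "(1 / s) *\<^sub>R x = T x - c *\<^sub>R x" using assms(2) by simp
  then show "T x = (c + 1 / s) *\<^sub>R x" by (simp add: scaleR_add_left algebra_simps)
qed

text \<open>For \<open>y = T w - c *\<^sub>R w\<close> one has \<open>T w - z *\<^sub>R w = y -
  (z - c) *\<^sub>R Res y\<close>, and the bound on the form of the resolvent makes the inner
  product of this vector with \<open>y\<close> large.\<close>

lemma resolvent_gap:
  assumes f: "\<And>i. i < k \<Longrightarrow> f i \<in> V" "\<And>i. i < k \<Longrightarrow> T (f i) = l i *\<^sub>R f i"
    and form: "\<And>x. (\<And>i. i < k \<Longrightarrow> cinner x (f i) = 0) \<Longrightarrow> inner (Res x) x \<le> b * (norm x)\<^sup>2"
    and z: "c \<le> z" "(z - c) * b \<le> 1" and w: "w \<in> V" "\<And>i. i < k \<Longrightarrow> cinner w (f i) = 0"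
  shows "(1 - (z - c) * b) * \<kappa> * norm w \<le> norm (T w - z *\<^sub>R w)"
proof -
  define y where "y = T w - c *\<^sub>R w"
  have Ry: "Res y = w" by (rule Res_eqI[OF w(1)]) (simp add: y_def)
  have "cinner y (f i) = 0" if "i < k" for i
    using symmetric[OF w(1) f(1)[OF that]] f(2)[OF that] w(2)[OF that]
    by (simp add: y_def cinner_diff_left cinner_scaleR_left cinner_scaleR_right)
  then have form': "inner w y \<le> b * (norm y)\<^sup>2" using form[of y] Ry by simp
  have Tz: "T w - z *\<^sub>R w = y - (z - c) *\<^sub>R w" by (simp add: y_def algebra_simps)
  have "(1 - (z - c) * b) * (norm y)\<^sup>2 = (norm y)\<^sup>2 - (z - c) * (b * (norm y)\<^sup>2)" by (simp add: algebra_simps)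
  also have "\<dots> \<le> (norm y)\<^sup>2 - (z - c) * inner w y" using form' z(1) by (intro diff_left_mono mult_left_mono) auto
  also have "\<dots> = inner (T w - z *\<^sub>R w) y" by (simp add: Tz inner_diff_left power2_norm_eq_inner)
  also have "\<dots> \<le> norm (T w - z *\<^sub>R w) * norm y" by (rule norm_cauchy_schwarz)
  finally have "((1 - (z - c) * b) * norm y) * norm y \<le> norm (T w - z *\<^sub>R w) * norm y"
    by (simp add: power2_eq_square mult.assoc)
  then have "(1 - (z - c) * b) * norm y \<le> norm (T w - z *\<^sub>R w)"
    by (cases "y = 0") auto
  moreover have "(1 - (z - c) * b) * (\<kappa> * norm w) \<le> (1 - (z - c) * b) * norm y"
    using lb[OF w(1)] z(2) by (intro mult_left_mono) (auto simp: y_def)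
  ultimately show ?thesis by (simp add: mult.assoc)
qed

end

section \<open>Smooth curves of operators\<close>

lemma cinner_eqI:
  assumes "\<And>v. cinner x v = cinner y v"
  shows "x = y"
  using assms[of "x - y"] by (metis Re_cinner cinner_diff_left eq_iff_diff_eq_0 inner_eq_zero_iff zero_complex.sel(1))

lemma compact_resolvent_operatorI:
  assumes sa: "self_adjoint_operator V T" and cr: "has_compact_resolvent V T"
  shows "compact_resolvent_operator V T"
proof
  show "self_adjoint_operator V T" by (rule sa)
  fix u :: "nat \<Rightarrow> 'a" and C assume u: "\<And>n. u n \<in> V" "\<And>n. norm (u n) \<le> C" "\<And>n. norm (T (u n)) \<le> C"
  obtain z where z: "z \<in> resolvent_set V T" and comp: "compact_operator (resolvent V T z)"
    using cr by (auto simp: has_compact_resolvent_def)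
  define g where "g n = T (u n) - z *\<^sub>C u n" for n
  have "inj_on (\<lambda>u. T u - z *\<^sub>C u) V" using z by (simp add: resolvent_set_def bij_betw_def)
  then have R: "resolvent V T z (g n) = u n" for n
    unfolding resolvent_def g_def using inv_into_f_f[of "\<lambda>u. T u - z *\<^sub>C u" V "u n"] u(1) by simp
  have "norm (g n) \<le> C + cmod z * C" for n
  proof -
    have "norm (g n) \<le> norm (T (u n)) + norm (z *\<^sub>C u n)" unfolding g_def by (rule norm_triangle_ineq4)
    also have "\<dots> \<le> C + cmod z * C" using u(2,3) by (intro add_mono) (auto simp: norm_scaleC mult_left_mono)
    finally show ?thesis .
  qed
  then have "bounded (range g)" by (auto simp: bounded_iff)
  then have "compact (closure (resolvent V T z ` range g))" using comp by (simp add: compact_operator_def)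
  moreover have "u n \<in> closure (resolvent V T z ` range g)" for n
    using R[of n] closure_subset by (metis image_eqI rangeI subsetD)
  ultimately obtain l s where "strict_mono s" "(u \<circ> s) \<longlonglongrightarrow> l"
    unfolding compact_def by metis
  then show "\<exists>l s. strict_mono s \<and> (\<lambda>n. u (s n :: nat)) \<longlonglongrightarrow> l" by (auto simp: o_def)
qed

lemma C_k_alpha_imp_thrice_differentiable:
  assumes "C_k_alpha k \<alpha> f" "k \<ge> 3"
  shows "\<exists>g1 g2 g3. thrice_differentiable f g1 g2 g3"
proof -
  have d: "(higher_derivative j f has_vector_derivative higher_derivative (Suc j) f t) (at t)" if "j < 3" for j t
  proof -
    have "higher_derivative j f differentiable (at t)"
      using assms that by (auto simp: C_k_alpha_def times_differentiable_def)
    then show ?thesis by (simp add: vector_derivative_works higher_derivative_def)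
  qed
  have "thrice_differentiable f (higher_derivative 1 f) (higher_derivative 2 f) (higher_derivative 3 f)"
    using d[of 0] d[of 1] d[of 2] by unfold_locales (simp_all add: higher_derivative_def numeral_eq_Suc)
  then show ?thesis by blast
qed

lemma weak_expansion:
  fixes D :: "real \<Rightarrow> 'a::complex_hilbert_space"
  assumes weak: "\<And>v. \<exists>C. \<forall>h. \<bar>h\<bar> \<le> 1 \<longrightarrow> cmod (cinner (D h) v - h ^ k *\<^sub>R l v) \<le> C * \<bar>h\<bar> ^ Suc k"
    and D0: "D 0 = 0" and k: "k > 0"
  obtains w C where "\<And>v. cinner w v = l v" "\<And>h. \<bar>h\<bar> \<le> 1 \<Longrightarrow> norm (D h - h ^ k *\<^sub>R w) \<le> C * \<bar>h\<bar> ^ Suc k"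
proof -
  have "\<exists>C. \<forall>h. h \<noteq> 0 \<and> \<bar>h\<bar> \<le> 1 \<longrightarrow> cmod (cinner ((1 / h ^ k) *\<^sub>R D h) v - l v) \<le> C * \<bar>h\<bar>" for v
  proof -
    obtain C where C: "\<And>h. \<bar>h\<bar> \<le> 1 \<Longrightarrow> cmod (cinner (D h) v - h ^ k *\<^sub>R l v) \<le> C * \<bar>h\<bar> ^ Suc k" using weak by blast
    have "cmod (cinner ((1 / h ^ k) *\<^sub>R D h) v - l v) \<le> C * \<bar>h\<bar>" if h: "h \<noteq> 0" "\<bar>h\<bar> \<le> 1" for h
    proof -
      have "cinner ((1 / h ^ k) *\<^sub>R D h) v - l v = (1 / h ^ k) *\<^sub>R (cinner (D h) v - h ^ k *\<^sub>R l v)"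
        using h(1) by (simp add: cinner_scaleR_left scaleR_diff_right scaleR_conv_of_real diff_divide_distrib)
      then have "cmod (cinner ((1 / h ^ k) *\<^sub>R D h) v - l v) = cmod (cinner (D h) v - h ^ k *\<^sub>R l v) / \<bar>h\<bar> ^ k"
        by (simp add: power_abs)
      also have "\<dots> \<le> C * \<bar>h\<bar> ^ Suc k / \<bar>h\<bar> ^ k" using C[OF h(2)] by (intro divide_right_mono) auto
      also have "\<dots> = C * \<bar>h\<bar>" using h(1) by simp
      finally show ?thesis .
    qed
    then show ?thesis by blast
  qed
  from weak_limit_imp_strong[OF this] obtain w C where w: "\<And>v. cinner w v = l v"
    and C: "C \<ge> 0" "\<And>h. h \<noteq> 0 \<Longrightarrow> \<bar>h\<bar> \<le> 1 \<Longrightarrow> norm ((1 / h ^ k) *\<^sub>R D h - w) \<le> C * \<bar>h\<bar>" by blast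
  have "norm (D h - h ^ k *\<^sub>R w) \<le> C * \<bar>h\<bar> ^ Suc k" if "\<bar>h\<bar> \<le> 1" for h
  proof (cases "h = 0")
    case False
    then have "D h - h ^ k *\<^sub>R w = h ^ k *\<^sub>R ((1 / h ^ k) *\<^sub>R D h - w)" by (simp add: scaleR_diff_right)
    then have "norm (D h - h ^ k *\<^sub>R w) = \<bar>h\<bar> ^ k * norm ((1 / h ^ k) *\<^sub>R D h - w)" by (simp add: power_abs)
    also have "\<dots> \<le> \<bar>h\<bar> ^ k * (C * \<bar>h\<bar>)" using C(2)[OF False that] by (intro mult_left_mono) auto
    finally show ?thesis by (simp add: mult_ac)
  qed (use D0 k in \<open>auto simp: power_0_left\<close>)
  with w show ?thesis by (rule that)
qed

text \<open>Here \<open>A1\<close> is the first derivative and \<open>A2\<close> half of the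
  second one, as coefficients of a Taylor expansion in the norm of the Hilbert space.\<close>

locale operator_curve =
  fixes V :: "'a::complex_hilbert_space set" and A A1 A2 :: "real \<Rightarrow> 'a \<Rightarrow> 'a"
  assumes operator: "compact_resolvent_operator V (A t)"
    and smooth: "u \<in> V \<Longrightarrow> \<exists>g3. thrice_differentiable (\<lambda>t. cinner (A t u) v) (\<lambda>t. cinner (A1 t u) v) (\<lambda>t. 2 * cinner (A2 t u) v) g3"
    and expansion: "u \<in> V \<Longrightarrow> \<exists>C. \<forall>h. \<bar>h\<bar> \<le> 1 \<longrightarrow> norm (A (t + h) u - A t u - h *\<^sub>R A1 t u - h\<^sup>2 *\<^sub>R A2 t u) \<le> C * \<bar>h\<bar> ^ 3"

text \<open>The scalar Taylor bounds with their constants depending on \<open>v\<close> are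
  turned into bounds in norm by \<open>weak_expansion\<close>, first for the difference quotient
  and then for that of second order.\<close>

lemma curve_derivatives:
  fixes a :: "real \<Rightarrow> 'a::complex_hilbert_space"
  assumes smooth: "\<And>v. \<exists>g1 g2 g3. thrice_differentiable (\<lambda>t. cinner (a t) v) g1 g2 g3"
  shows "\<exists>a1 a2. (\<forall>v. \<exists>g3. thrice_differentiable (\<lambda>t. cinner (a t) v) (\<lambda>t. cinner (a1 t) v) (\<lambda>t. 2 * cinner (a2 t) v) g3) \<and>
    (\<forall>t. \<exists>C. \<forall>h. \<bar>h\<bar> \<le> 1 \<longrightarrow> norm (a (t + h) - a t - h *\<^sub>R a1 t - h\<^sup>2 *\<^sub>R a2 t) \<le> C * \<bar>h\<bar> ^ 3)"
proof -
  obtain G1 G2 G3 where G: "\<And>v. thrice_differentiable (\<lambda>t. cinner (a t) v) (G1 v) (G2 v) (G3 v)"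
    using smooth by metis
  have "\<exists>w C. (\<forall>v. cinner w v = G1 v t) \<and> (\<forall>h. \<bar>h\<bar> \<le> 1 \<longrightarrow> norm ((a (t + h) - a t) - h ^ 1 *\<^sub>R w) \<le> C * \<bar>h\<bar> ^ Suc 1)" for t
  proof -
    have "\<exists>C. \<forall>h. \<bar>h\<bar> \<le> 1 \<longrightarrow> cmod (cinner (a (t + h) - a t) v - h ^ 1 *\<^sub>R G1 v t) \<le> C * \<bar>h\<bar> ^ Suc 1" for v
    proof -
      interpret thrice_differentiable "\<lambda>t. cinner (a t) v" "G1 v" "G2 v" "G3 v" by (rule G)
      obtain C where C: "\<And>s r. s \<in> {t - 1..t + 1} \<Longrightarrow> r \<in> {t - 1..t + 1} \<Longrightarrow>
          norm (cinner (a s) v - cinner (a r) v - (s - r) *\<^sub>R G1 v r) \<le> C * (s - r)\<^sup>2"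
        using Taylor1[of "t - 1" "t + 1"] by blast
      have "cmod (cinner (a (t + h) - a t) v - h ^ 1 *\<^sub>R G1 v t) \<le> C * \<bar>h\<bar> ^ Suc 1" if "\<bar>h\<bar> \<le> 1" for h
        using C[of "t + h" t] that by (simp add: cinner_diff_left abs_le_iff power2_eq_square[symmetric])
      then show ?thesis by blast
    qed
    from weak_expansion[of "\<lambda>h. a (t + h) - a t" 1 "\<lambda>v. G1 v t", OF this] show ?thesis by simp metis
  qed
  then obtain a1 C1 where a1: "\<And>t v. cinner (a1 t) v = G1 v t" by metis
  have "\<exists>w C. (\<forall>v. cinner w v = G2 v t / 2) \<and>
      (\<forall>h. \<bar>h\<bar> \<le> 1 \<longrightarrow> norm ((a (t + h) - a t - h *\<^sub>R a1 t) - h\<^sup>2 *\<^sub>R w) \<le> C * \<bar>h\<bar> ^ Suc 2)" for t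
  proof -
    have "\<exists>C. \<forall>h. \<bar>h\<bar> \<le> 1 \<longrightarrow> cmod (cinner (a (t + h) - a t - h *\<^sub>R a1 t) v - h\<^sup>2 *\<^sub>R (G2 v t / 2)) \<le> C * \<bar>h\<bar> ^ Suc 2" for v
    proof -
      interpret thrice_differentiable "\<lambda>t. cinner (a t) v" "G1 v" "G2 v" "G3 v" by (rule G)
      show ?thesis using Taylor2[of t]
        by (simp add: cinner_diff_left cinner_scaleR_left a1 scaleR_conv_of_real numeral_3_eq_3 numeral_2_eq_2)
    qed
    from weak_expansion[of "\<lambda>h. a (t + h) - a t - h *\<^sub>R a1 t" 2 "\<lambda>v. G2 v t / 2", OF this] show ?thesis by simp metis
  qed
  then obtain a2 C2 where a2: "\<And>t v. cinner (a2 t) v = G2 v t / 2"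
    "\<And>t h. \<bar>h\<bar> \<le> 1 \<Longrightarrow> norm ((a (t + h) - a t - h *\<^sub>R a1 t) - h\<^sup>2 *\<^sub>R a2 t) \<le> C2 t * \<bar>h\<bar> ^ Suc 2" by metis
  have "(\<lambda>t. cinner (a1 t) v) = G1 v" "(\<lambda>t. 2 * cinner (a2 t) v) = G2 v" for v by (auto simp: a1 a2)
  then have "\<exists>g3. thrice_differentiable (\<lambda>t. cinner (a t) v) (\<lambda>t. cinner (a1 t) v) (\<lambda>t. 2 * cinner (a2 t) v) g3" for v
    using G[of v] by auto
  then show ?thesis using a2(2) by (intro exI[of _ a1] exI[of _ a2]) (auto simp: numeral_3_eq_3 numeral_2_eq_2)
qed

lemma operator_curve_exists:
  assumes "\<And>t. compact_resolvent_operator V (A t)"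
    and "\<And>u v. u \<in> V \<Longrightarrow> \<exists>g1 g2 g3. thrice_differentiable (\<lambda>t. cinner (A t u) v) g1 g2 g3"
  obtains A1 A2 where "operator_curve V A A1 A2"
proof -
  have "\<forall>u. \<exists>a1 a2. u \<in> V \<longrightarrow> (\<forall>v. \<exists>g3. thrice_differentiable (\<lambda>t. cinner (A t u) v) (\<lambda>t. cinner (a1 t) v) (\<lambda>t. 2 * cinner (a2 t) v) g3) \<and>
    (\<forall>t. \<exists>C. \<forall>h. \<bar>h\<bar> \<le> 1 \<longrightarrow> norm (A (t + h) u - A t u - h *\<^sub>R a1 t - h\<^sup>2 *\<^sub>R a2 t) \<le> C * \<bar>h\<bar> ^ 3)"
  proof
    fix u
    show "\<exists>a1 a2. u \<in> V \<longrightarrow> (\<forall>v. \<exists>g3. thrice_differentiable (\<lambda>t. cinner (A t u) v) (\<lambda>t. cinner (a1 t) v) (\<lambda>t. 2 * cinner (a2 t) v) g3) \<and>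
      (\<forall>t. \<exists>C. \<forall>h. \<bar>h\<bar> \<le> 1 \<longrightarrow> norm (A (t + h) u - A t u - h *\<^sub>R a1 t - h\<^sup>2 *\<^sub>R a2 t) \<le> C * \<bar>h\<bar> ^ 3)"
    proof (cases "u \<in> V")
      case True
      from curve_derivatives[of "\<lambda>t. A t u", OF assms(2)[OF True]] show ?thesis by simp
    qed simp
  qed
  then obtain a1 where "\<forall>u. \<exists>a2. u \<in> V \<longrightarrow> (\<forall>v. \<exists>g3. thrice_differentiable (\<lambda>t. cinner (A t u) v) (\<lambda>t. cinner (a1 u t) v) (\<lambda>t. 2 * cinner (a2 t) v) g3) \<and>
    (\<forall>t. \<exists>C. \<forall>h. \<bar>h\<bar> \<le> 1 \<longrightarrow> norm (A (t + h) u - A t u - h *\<^sub>R a1 u t - h\<^sup>2 *\<^sub>R a2 t) \<le> C * \<bar>h\<bar> ^ 3)"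
    by (rule choice[THEN exE])
  then obtain a2 where "\<forall>u. u \<in> V \<longrightarrow> (\<forall>v. \<exists>g3. thrice_differentiable (\<lambda>t. cinner (A t u) v) (\<lambda>t. cinner (a1 u t) v) (\<lambda>t. 2 * cinner (a2 u t) v) g3) \<and>
    (\<forall>t. \<exists>C. \<forall>h. \<bar>h\<bar> \<le> 1 \<longrightarrow> norm (A (t + h) u - A t u - h *\<^sub>R a1 u t - h\<^sup>2 *\<^sub>R a2 u t) \<le> C * \<bar>h\<bar> ^ 3)"
    by (rule choice[THEN exE])
  then have "operator_curve V A (\<lambda>t u. a1 u t) (\<lambda>t u. a2 u t)"
    using assms(1) unfolding operator_curve_def by simp
  then show ?thesis by (rule that)
qed

lemma symmetric_on_derivative:
  fixes S D :: "real \<Rightarrow> 'a::complex_hilbert_space \<Rightarrow> 'a" and c :: real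
  assumes S: "\<And>t. symmetric_on V (S t)" and V: "complex_vector.subspace V" and c: "c \<noteq> 0"
    and d: "\<And>t u v. u \<in> V \<Longrightarrow> ((\<lambda>s. cinner (S s u) v) has_vector_derivative c * cinner (D t u) v) (at t)"
  shows "symmetric_on V (D t)"
  unfolding symmetric_on_def
proof (intro conjI ballI allI)
  fix x y assume xy: "x \<in> V" "y \<in> V"
  then have "x + y \<in> V" using V by (simp add: complex_vector.subspace_add)
  show "D t (x + y) = D t x + D t y"
  proof (rule cinner_eqI)
    fix v
    have "((\<lambda>s. cinner (S s x) v + cinner (S s y) v) has_vector_derivative c * cinner (D t x) v + c * cinner (D t y) v) (at t)"
      by (intro has_vector_derivative_add d xy)
    moreover have "(\<lambda>s. cinner (S s x) v + cinner (S s y) v) = (\<lambda>s. cinner (S s (x + y)) v)"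
      using S xy by (simp add: symmetric_on_def cinner_add_left)
    ultimately have "c * cinner (D t (x + y)) v = c * cinner (D t x) v + c * cinner (D t y) v"
      using vector_derivative_unique_at[OF d[OF \<open>x + y \<in> V\<close>]] by metis
    then have "c * cinner (D t (x + y)) v = c * (cinner (D t x) v + cinner (D t y) v)" by (simp add: distrib_left)
    then show "cinner (D t (x + y)) v = cinner (D t x + D t y) v" using c by (simp add: cinner_add_left)
  qed
  have "((\<lambda>s. cnj (cinner (S s y) x)) has_vector_derivative cnj (c * cinner (D t y) x)) (at t)"
    by (intro bounded_linear.has_vector_derivative[OF bounded_linear_cnj] d xy)
  moreover have "(\<lambda>s. cnj (cinner (S s y) x)) = (\<lambda>s. cinner (S s x) y)"
    using S xy cinner_commute by (metis symmetric_on_def)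
  ultimately have "c * cinner (D t x) y = cnj (c * cinner (D t y) x)"
    using vector_derivative_unique_at[OF d[OF xy(1)]] by metis
  also have "\<dots> = c * cinner x (D t y)" using cinner_commute[of x "D t y"] by simp
  finally show "cinner (D t x) y = cinner x (D t y)" using c by simp
next
  fix a x assume x: "x \<in> V"
  then have "a *\<^sub>C x \<in> V" using V by (simp add: complex_vector.subspace_scale)
  show "D t (a *\<^sub>C x) = a *\<^sub>C D t x"
  proof (rule cinner_eqI)
    fix v
    have "((\<lambda>s. a * cinner (S s x) v) has_vector_derivative a * (c * cinner (D t x) v)) (at t)"
      by (intro has_vector_derivative_mult_right d x)
    moreover have "(\<lambda>s. a * cinner (S s x) v) = (\<lambda>s. cinner (S s (a *\<^sub>C x)) v)"
      using S x by (simp add: symmetric_on_def cinner_scaleC_left)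
    ultimately have "c * cinner (D t (a *\<^sub>C x)) v = a * (c * cinner (D t x) v)"
      using vector_derivative_unique_at[OF d[OF \<open>a *\<^sub>C x \<in> V\<close>]] by metis
    also have "\<dots> = c * (a * cinner (D t x) v)" by simp
    finally show "cinner (D t (a *\<^sub>C x)) v = cinner (a *\<^sub>C D t x) v"
      using c by (simp add: cinner_scaleC_left)
  qed
qed

lemma symmetric_on_diff: "symmetric_on V S \<Longrightarrow> symmetric_on V T \<Longrightarrow> symmetric_on V (\<lambda>u. S u - T u)"
  by (auto simp: symmetric_on_def cinner_diff_left cinner_diff_right scaleC_diff_right)

lemma symmetric_on_scaleR: "symmetric_on V S \<Longrightarrow> symmetric_on V (\<lambda>u. r *\<^sub>R S u)"
  by (auto simp: symmetric_on_def cinner_scaleR_left cinner_scaleR_right scaleR_add_right scaleC_scaleR)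

lemma norm_le_dense:
  assumes V: "closure V = UNIV" and K0: "K \<ge> 0" and K: "\<And>v. v \<in> V \<Longrightarrow> cmod (cinner y v) \<le> K * norm v"
  shows "norm y \<le> K"
proof -
  obtain v where v: "\<And>n. v n \<in> V" "v \<longlonglongrightarrow> y" using V closure_sequential[of y V] by auto
  have "(\<lambda>n. cmod (cinner y (v n))) \<longlonglongrightarrow> cmod (cinner y y)"
    by (intro tendsto_norm tendsto_cinner_right v)
  moreover have "(\<lambda>n. K * norm (v n)) \<longlonglongrightarrow> K * norm y" by (intro tendsto_intros v)
  ultimately have "cmod (cinner y y) \<le> K * norm y"
    by (rule LIMSEQ_le) (use K v(1) in auto)
  then have *: "norm y * norm y \<le> K * norm y" by (simp add: cinner_self power2_eq_square norm_mult)
  show ?thesis by (cases "y = 0") (use * K0 in auto)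
qed

context resolvent_operator
begin

text \<open>Composed with the resolvent, the operators become defined everywhere, and symmetry makes each of
  the functionals \<open>p j\<close> bounded, so that the principle of uniform boundedness applies.\<close>

lemma family_bound:
  fixes S :: "'i \<Rightarrow> 'a \<Rightarrow> 'a"
  assumes sym: "\<And>i. i \<in> I \<Longrightarrow> symmetric_on V (S i)"
    and pointwise: "\<And>u v. u \<in> V \<Longrightarrow> \<exists>B. \<forall>i\<in>I. cmod (cinner (S i u) v) \<le> B"
  shows "\<exists>C\<ge>0. \<forall>i\<in>I. \<forall>u\<in>V. norm (S i u) \<le> C * norm (T u - c *\<^sub>R u)"
proof -
  \<comment> \<open>For \<open>v = 0\<close> the quotient is 0.\<close>
  define p where "p j w = cmod (cinner (S (fst j) (Res w)) (snd j)) / norm (snd j)" for j w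
  have "\<exists>C\<ge>0. \<forall>j\<in>I \<times> V. \<forall>x. p j x \<le> C * norm x"
  proof (rule uniform_boundedness)
    fix j assume "j \<in> I \<times> V"
    then have j: "symmetric_on V (S (fst j))" "snd j \<in> V" using sym by auto
    show "p j (x + y) \<le> p j x + p j y" for x y
      using j(1) norm_triangle_ineq[of "cinner (S (fst j) (Res x)) (snd j)" "cinner (S (fst j) (Res y)) (snd j)"]
      by (simp add: p_def Res.add symmetric_on_def Res_V cinner_add_left add_divide_distrib[symmetric] divide_right_mono)
    show "p j (s *\<^sub>R x) = \<bar>s\<bar> * p j x" for s x
      using j(1) by (simp add: p_def scaleR_scaleC[of s x] Res.scale symmetric_on_def Res_V cinner_scaleC_left norm_mult)
    have "p j x \<le> (1 / \<kappa> * norm (S (fst j) (snd j)) / norm (snd j)) * norm x" for x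
    proof -
      have "cmod (cinner (S (fst j) (Res x)) (snd j)) = cmod (cinner (Res x) (S (fst j) (snd j)))"
        using j by (simp add: symmetric_on_def Res_V)
      also have "\<dots> \<le> norm (Res x) * norm (S (fst j) (snd j))" by (rule cinner_cauchy_schwarz)
      also have "\<dots> \<le> (1 / \<kappa> * norm x) * norm (S (fst j) (snd j))" by (intro mult_right_mono Res_norm) auto
      finally have "p j x \<le> (1 / \<kappa> * norm x) * norm (S (fst j) (snd j)) / norm (snd j)"
        unfolding p_def by (intro divide_right_mono) auto
      then show ?thesis by (simp add: mult_ac)
    qed
    then show "\<exists>K. \<forall>x. p j x \<le> K * norm x" by blast
  next
    fix x
    obtain C where C: "\<forall>i\<in>I. norm (S i (Res x)) \<le> C"
      using weak_bounded_imp_bounded[of I "\<lambda>i. S i (Res x)"] pointwise[OF Res_V] by blast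
    have "p j x \<le> max C 0" if "j \<in> I \<times> V" for j
    proof (cases "snd j = 0")
      case False
      have "cmod (cinner (S (fst j) (Res x)) (snd j)) \<le> norm (S (fst j) (Res x)) * norm (snd j)"
        by (rule cinner_cauchy_schwarz)
      also have "\<dots> \<le> max C 0 * norm (snd j)" using C that by (intro mult_right_mono) (auto simp: le_max_iff_disj)
      finally show ?thesis using False by (simp add: p_def divide_le_eq)
    qed (simp add: p_def)
    then show "\<exists>B. \<forall>j\<in>I \<times> V. p j x \<le> B" by blast
  qed
  then obtain C where C: "C \<ge> 0" "\<And>i v x. i \<in> I \<Longrightarrow> v \<in> V \<Longrightarrow> p (i, v) x \<le> C * norm x" by auto
  have "norm (S i u) \<le> C * norm (T u - c *\<^sub>R u)" if i: "i \<in> I" and u: "u \<in> V" for i u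
  proof (rule norm_le_dense[OF dense])
    show "0 \<le> C * norm (T u - c *\<^sub>R u)" using C(1) by simp
    fix v assume v: "v \<in> V"
    have "Res (T u - c *\<^sub>R u) = u" by (rule Res_eqI[OF u]) simp
    then have "cmod (cinner (S i u) v) / norm v \<le> C * norm (T u - c *\<^sub>R u)"
      using C(2)[OF i v, of "T u - c *\<^sub>R u"] by (simp add: p_def)
    then show "cmod (cinner (S i u) v) \<le> C * norm (T u - c *\<^sub>R u) * norm v"
      by (cases "v = 0") (auto simp: divide_le_eq)
  qed
  then show ?thesis using C(1) by blast
qed

end

context operator_curve
begin

lemma subspace: "complex_vector.subspace V"
  using compact_resolvent_operator.subspace[OF operator] .

lemma derivative:
  assumes "u \<in> V"
  shows "((\<lambda>s. cinner (A s u) v) has_vector_derivative cinner (A1 t u) v) (at t)"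
    and "((\<lambda>s. cinner (A1 s u) v) has_vector_derivative 2 * cinner (A2 t u) v) (at t)"
  using smooth[OF assms, of v] by (auto simp: thrice_differentiable_def)

lemma symmetric_A: "symmetric_on V (A t)"
proof -
  interpret compact_resolvent_operator V "A t" by (rule operator)
  show ?thesis by (simp add: symmetric_on_def T_add T_scale symmetric)
qed

lemma symmetric_A1: "symmetric_on V (A1 t)"
  by (rule symmetric_on_derivative[OF symmetric_A subspace, of 1]) (use derivative in auto)

lemma symmetric_A2: "symmetric_on V (A2 t)"
  by (rule symmetric_on_derivative[OF symmetric_A1 subspace, of 2]) (use derivative in auto)

text \<open>The difference quotients and Taylor quotients of \<open>A\<close> are symmetric on
  \<open>V\<close>, and weakly bounded for each vector by the scalar Taylor bounds;
  \<open>family_bound\<close> makes the bounds uniform.\<close>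

lemma local_bounds:
  assumes R: "resolvent_operator V (A t0) c \<kappa>"
  obtains K where "K \<ge> 0"
    "\<And>s t u. \<bar>s - t0\<bar> \<le> 1 \<Longrightarrow> \<bar>t - t0\<bar> \<le> 1 \<Longrightarrow> u \<in> V \<Longrightarrow> norm (A s u - A t u) \<le> K * \<bar>s - t\<bar> * norm (A t0 u - c *\<^sub>R u)"
    "\<And>t u. \<bar>t - t0\<bar> \<le> 1 \<Longrightarrow> u \<in> V \<Longrightarrow> norm (A1 t u) \<le> K * norm (A t0 u - c *\<^sub>R u)"
    "\<And>s t u. \<bar>s - t0\<bar> \<le> 1 \<Longrightarrow> \<bar>t - t0\<bar> \<le> 1 \<Longrightarrow> u \<in> V \<Longrightarrow>
      norm (A s u - A t u - (s - t) *\<^sub>R A1 t u) \<le> K * (s - t)\<^sup>2 * norm (A t0 u - c *\<^sub>R u)"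
proof -
  interpret resolvent_operator V "A t0" c \<kappa> by (rule R)
  define D where "D = {t0 - 1..t0 + 1}"
  have D: "t \<in> D \<longleftrightarrow> \<bar>t - t0\<bar> \<le> 1" for t by (auto simp: D_def abs_le_iff)
  have "\<exists>C\<ge>0. \<forall>j\<in>D \<times> D. \<forall>u\<in>V. norm ((1 / (fst j - snd j)) *\<^sub>R (A (fst j) u - A (snd j) u)) \<le> C * norm (A t0 u - c *\<^sub>R u)"
  proof (rule family_bound)
    fix u v assume u: "u \<in> V"
    obtain g3 where "thrice_differentiable (\<lambda>t. cinner (A t u) v) (\<lambda>t. cinner (A1 t u) v) (\<lambda>t. 2 * cinner (A2 t u) v) g3"
      using smooth[OF u] by blast
    then interpret g: thrice_differentiable "\<lambda>t. cinner (A t u) v" "\<lambda>t. cinner (A1 t u) v" "\<lambda>t. 2 * cinner (A2 t u) v" g3 .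
    obtain C where C: "\<And>s t. s \<in> D \<Longrightarrow> t \<in> D \<Longrightarrow> norm (cinner (A s u) v - cinner (A t u) v) \<le> C * \<bar>s - t\<bar>"
      using g.Lipschitz[of "t0 - 1" "t0 + 1"] unfolding D_def by blast
    have "cmod (cinner ((1 / (s - t)) *\<^sub>R (A s u - A t u)) v) \<le> max C 0" if "s \<in> D" "t \<in> D" for s t
      using C[OF that] by (cases "s = t") (auto simp: cinner_scaleR_left cinner_diff_left norm_mult norm_divide divide_le_eq le_max_iff_disj simp flip: of_real_diff)
    then show "\<exists>B. \<forall>j\<in>D \<times> D. cmod (cinner ((1 / (fst j - snd j)) *\<^sub>R (A (fst j) u - A (snd j) u)) v) \<le> B" by auto
  qed (intro symmetric_on_scaleR symmetric_on_diff symmetric_A)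
  then obtain C0 where C0: "C0 \<ge> 0" "\<And>s t u. s \<in> D \<Longrightarrow> t \<in> D \<Longrightarrow> u \<in> V \<Longrightarrow>
      norm ((1 / (s - t)) *\<^sub>R (A s u - A t u)) \<le> C0 * norm (A t0 u - c *\<^sub>R u)" by auto
  have "\<exists>C\<ge>0. \<forall>t\<in>D. \<forall>u\<in>V. norm (A1 t u) \<le> C * norm (A t0 u - c *\<^sub>R u)"
  proof (rule family_bound)
    fix u v assume u: "u \<in> V"
    obtain g3 where "thrice_differentiable (\<lambda>t. cinner (A t u) v) (\<lambda>t. cinner (A1 t u) v) (\<lambda>t. 2 * cinner (A2 t u) v) g3"
      using smooth[OF u] by blast
    then interpret g: thrice_differentiable "\<lambda>t. cinner (A t u) v" "\<lambda>t. cinner (A1 t u) v" "\<lambda>t. 2 * cinner (A2 t u) v" g3 .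
    show "\<exists>B. \<forall>t\<in>D. cmod (cinner (A1 t u) v) \<le> B"
      using g.bounded_on_Icc[OF g.continuous(1), of "t0 - 1" "t0 + 1"] unfolding D_def by metis
  qed (rule symmetric_A1)
  then obtain C1 where C1: "C1 \<ge> 0" "\<And>t u. t \<in> D \<Longrightarrow> u \<in> V \<Longrightarrow> norm (A1 t u) \<le> C1 * norm (A t0 u - c *\<^sub>R u)" by auto
  have "\<exists>C\<ge>0. \<forall>j\<in>D \<times> D. \<forall>u\<in>V. norm ((1 / (fst j - snd j)\<^sup>2) *\<^sub>R (A (fst j) u - A (snd j) u - (fst j - snd j) *\<^sub>R A1 (snd j) u))
      \<le> C * norm (A t0 u - c *\<^sub>R u)"
  proof (rule family_bound)
    fix u v assume u: "u \<in> V"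
    obtain g3 where "thrice_differentiable (\<lambda>t. cinner (A t u) v) (\<lambda>t. cinner (A1 t u) v) (\<lambda>t. 2 * cinner (A2 t u) v) g3"
      using smooth[OF u] by blast
    then interpret g: thrice_differentiable "\<lambda>t. cinner (A t u) v" "\<lambda>t. cinner (A1 t u) v" "\<lambda>t. 2 * cinner (A2 t u) v" g3 .
    obtain C where C: "\<And>s t. s \<in> D \<Longrightarrow> t \<in> D \<Longrightarrow>
        norm (cinner (A s u) v - cinner (A t u) v - (s - t) *\<^sub>R cinner (A1 t u) v) \<le> C * (s - t)\<^sup>2"
      using g.Taylor1[of "t0 - 1" "t0 + 1"] unfolding D_def by blast
    have "cmod (cinner ((1 / (s - t)\<^sup>2) *\<^sub>R (A s u - A t u - (s - t) *\<^sub>R A1 t u)) v) \<le> max C 0" if "s \<in> D" "t \<in> D" for s t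
    proof -
      have "cinner (A s u - A t u - (s - t) *\<^sub>R A1 t u) v = cinner (A s u) v - cinner (A t u) v - (s - t) *\<^sub>R cinner (A1 t u) v"
        by (simp add: cinner_diff_left cinner_scaleR_left scaleR_conv_of_real)
      then have "cmod (cinner ((1 / (s - t)\<^sup>2) *\<^sub>R (A s u - A t u - (s - t) *\<^sub>R A1 t u)) v)
          = cmod (cinner (A s u) v - cinner (A t u) v - (s - t) *\<^sub>R cinner (A1 t u) v) / (s - t)\<^sup>2"
        by (simp add: cinner_scaleR_left norm_mult norm_divide del: of_real_diff of_real_power)
      also have "\<dots> \<le> C * (s - t)\<^sup>2 / (s - t)\<^sup>2" using C[OF that] by (rule divide_right_mono) simp
      also have "\<dots> \<le> max C 0" by (cases "s = t") auto
      finally show ?thesis .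
    qed
    then show "\<exists>B. \<forall>j\<in>D \<times> D. cmod (cinner ((1 / (fst j - snd j)\<^sup>2) *\<^sub>R (A (fst j) u - A (snd j) u - (fst j - snd j) *\<^sub>R A1 (snd j) u)) v) \<le> B"
      by auto
  qed (intro symmetric_on_scaleR symmetric_on_diff symmetric_A symmetric_A1)
  then obtain C2 where C2: "C2 \<ge> 0" "\<And>s t u. s \<in> D \<Longrightarrow> t \<in> D \<Longrightarrow> u \<in> V \<Longrightarrow>
      norm ((1 / (s - t)\<^sup>2) *\<^sub>R (A s u - A t u - (s - t) *\<^sub>R A1 t u)) \<le> C2 * norm (A t0 u - c *\<^sub>R u)" by auto
  define K where "K = C0 + C1 + C2"
  have K: "C0 \<le> K" "C1 \<le> K" "C2 \<le> K" "K \<ge> 0" using C0(1) C1(1) C2(1) by (auto simp: K_def)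
  show ?thesis
  proof (rule that[of K])
    show "K \<ge> 0" by (rule K)
    show "norm (A s u - A t u) \<le> K * \<bar>s - t\<bar> * norm (A t0 u - c *\<^sub>R u)" if "\<bar>s - t0\<bar> \<le> 1" "\<bar>t - t0\<bar> \<le> 1" "u \<in> V" for s t u
    proof (cases "s = t")
      case False
      have "norm (A s u - A t u) / \<bar>s - t\<bar> \<le> C0 * norm (A t0 u - c *\<^sub>R u)" using C0(2)[of s t u] that by (simp add: D)
      also have "\<dots> \<le> K * norm (A t0 u - c *\<^sub>R u)" by (intro mult_right_mono K) auto
      finally show ?thesis using False by (simp add: divide_le_eq mult_ac)
    qed simp
    show "norm (A1 t u) \<le> K * norm (A t0 u - c *\<^sub>R u)" if "\<bar>t - t0\<bar> \<le> 1" "u \<in> V" for t u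
      using C1(2)[of t u] that mult_right_mono[OF K(2), of "norm (A t0 u - c *\<^sub>R u)"] by (simp add: D)
    show "norm (A s u - A t u - (s - t) *\<^sub>R A1 t u) \<le> K * (s - t)\<^sup>2 * norm (A t0 u - c *\<^sub>R u)"
      if "\<bar>s - t0\<bar> \<le> 1" "\<bar>t - t0\<bar> \<le> 1" "u \<in> V" for s t u
    proof (cases "s = t")
      case False
      have "norm (A s u - A t u - (s - t) *\<^sub>R A1 t u) / (s - t)\<^sup>2 \<le> C2 * norm (A t0 u - c *\<^sub>R u)"
        using C2(2)[of s t u] that by (simp add: D)
      also have "\<dots> \<le> K * norm (A t0 u - c *\<^sub>R u)" by (intro mult_right_mono K) auto
      finally show ?thesis using False by (simp add: divide_le_eq mult_ac)
    qed simp
  qed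
qed

end

section \<open>Second order perturbation theory\<close>

lemma proj_add: "proj B (x + y) = proj B x + proj B y"
  by (simp add: proj_def cinner_add_left scaleC_add_left sum.distrib)

lemma proj_scale: "proj B (a *\<^sub>C x) = a *\<^sub>C proj B x"
  by (simp add: proj_def cinner_scaleC_left complex_vector.scale_sum_right)

lemma proj_symmetric: "cinner (proj B x) y = cinner x (proj B y)"
  unfolding proj_def cinner_sum_left cinner_sum_right
  by (intro sum.cong) (auto simp: cinner_scaleC_left cinner_scaleC_right cinner_commute[of y])

lemma norm_proj_le:
  assumes "orthonormal B" "finite B"
  shows "norm (proj B x) \<le> norm x"
proof (rule power2_le_imp_le)
  have "(norm (proj B x))\<^sup>2 = (\<Sum>e\<in>B. (cmod (cinner x e))\<^sup>2)"
    unfolding proj_def by (rule norm_combination[OF assms])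
  then show "(norm (proj B x))\<^sup>2 \<le> (norm x)\<^sup>2" using bessel[OF assms, of x] by simp
qed simp

lemma proj_eq_0: "(\<And>b. b \<in> B \<Longrightarrow> cinner x b = 0) \<Longrightarrow> proj B x = 0"
  by (simp add: proj_def)

context compact_resolvent_operator
begin

text \<open>Adding the projection to the eigenspace makes the eigenvalue regular, without changing the
  operator on the orthogonal complement.\<close>

lemma reduced_resolvent:
  assumes B: "finite B" "orthonormal B" and span: "complex_vector.span B = {u \<in> V. T u = z *\<^sub>R u}"
  obtains S where "\<And>f. S f \<in> V" "\<And>f. T (S f) - z *\<^sub>R S f = f - proj B f"
    "\<And>f b. b \<in> B \<Longrightarrow> cinner (S f) b = 0" "\<And>f g. cinner (S f) g = cinner f (S g)"
    "\<And>f g. S (f + g) = S f + S g" "\<And>a f. S (a *\<^sub>C f) = a *\<^sub>C S f"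
proof -
  define T' where "T' u = T u + proj B u" for u
  have BV: "b \<in> V" "T b = z *\<^sub>R b" if "b \<in> B" for b
    using complex_vector.span_base[OF that] span by auto
  have Tb: "cinner (T u) b = z * cinner u b" if "u \<in> V" "b \<in> B" for u b
    using symmetric[OF that(1) BV(1)[OF that(2)]] BV(2)[OF that(2)] by (simp add: cinner_scaleR_right)
  have op: "compact_resolvent_operator V T'"
  proof
    have "adjoint_graph V T' = op_graph V T'"
    proof -
      have "(\<forall>u\<in>V. cinner (T' u) v = cinner u w) \<longleftrightarrow> v \<in> V \<and> w = T' v" for v w
      proof -
        have "cinner (T' u) v = cinner u w \<longleftrightarrow> cinner (T u) v = cinner u (w - proj B v)" for u
          by (simp add: T'_def cinner_add_left cinner_diff_right proj_symmetric eq_diff_eq)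
        then have "(\<forall>u\<in>V. cinner (T' u) v = cinner u w) \<longleftrightarrow> v \<in> V \<and> w - proj B v = T v"
          using adjoint_iff[of v "w - proj B v"] by simp
        then show ?thesis by (auto simp: T'_def algebra_simps)
      qed
      then show ?thesis by (auto simp: adjoint_graph_def op_graph_def)
    qed
    then show "self_adjoint_operator V T'"
      unfolding self_adjoint_operator_def using subspace dense
      by (auto simp: T'_def T_add T_scale proj_add proj_scale scaleC_add_right)
    fix u :: "nat \<Rightarrow> 'a" and C assume u: "\<And>n. u n \<in> V" "\<And>n. norm (u n) \<le> C" "\<And>n. norm (T' (u n)) \<le> C"
    have "norm (T (u n)) \<le> C + C" for n
    proof -
      have "T (u n) = T' (u n) - proj B (u n)" by (simp add: T'_def)
      then have "norm (T (u n)) \<le> norm (T' (u n)) + norm (proj B (u n))" using norm_triangle_ineq4 by metis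
      then show ?thesis using u(2,3)[of n] norm_proj_le[OF B(2,1), of "u n"] by linarith
    qed
    moreover have "norm (u n) \<le> C + C" for n using u(2)[of n] norm_ge_zero[of "u n"] by linarith
    ultimately show "\<exists>l s. strict_mono s \<and> (\<lambda>n. u (s n :: nat)) \<longlonglongrightarrow> l" by (intro graph_compact u)
  qed
  have "u = 0" if u: "u \<in> V" "T' u = z *\<^sub>R u" for u
  proof -
    have "cinner u b = 0" if b: "b \<in> B" for b
    proof -
      have "cinner (T' u) b = z * cinner u b + cinner u b"
        using Tb[OF u(1) b] cinner_proj[OF B(2,1) b] by (simp add: T'_def cinner_add_left)
      then show ?thesis by (simp add: u(2) cinner_scaleR_left)
    qed
    then have P: "proj B u = 0" by (rule proj_eq_0)
    then have "u \<in> complex_vector.span B" using u unfolding span by (simp add: T'_def)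
    then show "u = 0" using proj_eq_self[OF B(2,1)] P by simp
  qed
  then obtain \<kappa> where \<kappa>: "\<kappa> > 0" "\<And>u. u \<in> V \<Longrightarrow> \<kappa> * norm u \<le> norm (T' u - z *\<^sub>R u)"
    using compact_resolvent_operator.lower_bound[OF op, of z] by blast
  interpret R: resolvent_operator V T' z \<kappa>
    by (intro resolvent_operator.intro op resolvent_operator_axioms.intro \<kappa>)
  define S where "S f = R.Res (f - proj B f)" for f
  have SV: "S f \<in> V" for f by (simp add: S_def R.Res_V)
  have eq: "T (S f) + proj B (S f) - z *\<^sub>R S f = f - proj B f" for f
    using R.T_Res[of "f - proj B f"] by (simp add: S_def T'_def)
  have SB: "cinner (S f) b = 0" if b: "b \<in> B" for f b
  proof -
    have "cinner (T (S f) + proj B (S f) - z *\<^sub>R S f) b = cinner (S f) b"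
      using Tb[OF SV b, of f] cinner_proj[OF B(2,1) b, of "S f"] by (simp add: cinner_add_left cinner_diff_left cinner_scaleR_left)
    then show ?thesis unfolding eq using cinner_diff_proj[OF B(2,1) b] by simp
  qed
  have PS: "proj B (S f) = 0" for f by (intro proj_eq_0 SB)
  have Q: "cinner (S f) (g - proj B g) = cinner (S f) g" for f g
    using proj_symmetric[of B "S f" g] by (simp add: cinner_diff_right PS)
  show ?thesis
  proof (rule that[of S])
    show "S f \<in> V" for f by (rule SV)
    show "T (S f) - z *\<^sub>R S f = f - proj B f" for f using eq[of f] by (simp add: PS)
    show "cinner (S f) b = 0" if "b \<in> B" for f b using that by (rule SB)
    show "cinner (S f) g = cinner f (S g)" for f g
    proof -
      have "cinner (S f) g = cinner (S f) (g - proj B g)" by (rule Q[symmetric])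
      also have "\<dots> = cinner (f - proj B f) (S g)" by (simp add: S_def R.Res.sym)
      also have "\<dots> = cnj (cinner (S g) (f - proj B f))" by (rule cinner_commute)
      also have "\<dots> = cinner f (S g)" unfolding Q by (rule cinner_commute[symmetric])
      finally show ?thesis .
    qed
    show "S (f + g) = S f + S g" for f g
      unfolding S_def R.Res.add[symmetric] by (simp add: proj_add algebra_simps)
    show "S (a *\<^sub>C f) = a *\<^sub>C S f" for a f
      unfolding S_def R.Res.scale[symmetric] by (simp add: proj_scale scaleC_diff_right)
  qed
qed

end

context operator_curve
begin

text \<open>The assumptions \<open>e0\<close>, \<open>e1\<close> and \<open>e2\<close> cancel
  the terms of order 0, 1 and 2 in \<open>h\<close>.\<close>

lemma residual_estimate:
  assumes V: "b \<in> V" "x \<in> V" "y \<in> V" and e0: "A t b = z *\<^sub>R b"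
    and e1: "A t x - z *\<^sub>R x + (A1 t b - \<mu> *\<^sub>R b) = 0"
    and e2: "A t y - z *\<^sub>R y + ((A1 t x - \<mu> *\<^sub>R x) + (A2 t b - \<nu> *\<^sub>R b)) = 0"
  shows "\<exists>C. \<forall>h. \<bar>h\<bar> \<le> 1 \<longrightarrow> norm (A (t + h) (b + h *\<^sub>R x + h\<^sup>2 *\<^sub>R y)
    - (z + \<mu> * h + \<nu> * h\<^sup>2) *\<^sub>R (b + h *\<^sub>R x + h\<^sup>2 *\<^sub>R y)) \<le> C * \<bar>h\<bar> ^ 3"
proof -
  obtain Cb Cx Cy where C: "\<And>h. \<bar>h\<bar> \<le> 1 \<Longrightarrow> norm (A (t + h) b - A t b - h *\<^sub>R A1 t b - h\<^sup>2 *\<^sub>R A2 t b) \<le> Cb * \<bar>h\<bar> ^ 3"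
    "\<And>h. \<bar>h\<bar> \<le> 1 \<Longrightarrow> norm (A (t + h) x - A t x - h *\<^sub>R A1 t x - h\<^sup>2 *\<^sub>R A2 t x) \<le> Cx * \<bar>h\<bar> ^ 3"
    "\<And>h. \<bar>h\<bar> \<le> 1 \<Longrightarrow> norm (A (t + h) y - A t y - h *\<^sub>R A1 t y - h\<^sup>2 *\<^sub>R A2 t y) \<le> Cy * \<bar>h\<bar> ^ 3"
    using expansion[OF V(1), of t] expansion[OF V(2), of t] expansion[OF V(3), of t] by blast
  define p where "p = A1 t y + A2 t x - \<mu> *\<^sub>R y - \<nu> *\<^sub>R x"
  define q where "q = A2 t y - \<nu> *\<^sub>R y"
  have "norm (A (t + h) (b + h *\<^sub>R x + h\<^sup>2 *\<^sub>R y) - (z + \<mu> * h + \<nu> * h\<^sup>2) *\<^sub>R (b + h *\<^sub>R x + h\<^sup>2 *\<^sub>R y))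
      \<le> (\<bar>Cb\<bar> + \<bar>Cx\<bar> + \<bar>Cy\<bar> + norm p + norm q) * \<bar>h\<bar> ^ 3" if h: "\<bar>h\<bar> \<le> 1" for h
  proof -
    interpret compact_resolvent_operator V "A (t + h)" by (rule operator)
    define rb where "rb = A (t + h) b - A t b - h *\<^sub>R A1 t b - h\<^sup>2 *\<^sub>R A2 t b"
    define rx where "rx = A (t + h) x - A t x - h *\<^sub>R A1 t x - h\<^sup>2 *\<^sub>R A2 t x"
    define ry where "ry = A (t + h) y - A t y - h *\<^sub>R A1 t y - h\<^sup>2 *\<^sub>R A2 t y"
    have b: "A (t + h) b = rb + A t b + h *\<^sub>R A1 t b + h\<^sup>2 *\<^sub>R A2 t b" by (simp add: rb_def)
    have x: "A (t + h) x = rx + A t x + h *\<^sub>R A1 t x + h\<^sup>2 *\<^sub>R A2 t x" by (simp add: rx_def)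
    have y: "A (t + h) y = ry + A t y + h *\<^sub>R A1 t y + h\<^sup>2 *\<^sub>R A2 t y" by (simp add: ry_def)
    have Ax: "A t x = z *\<^sub>R x - A1 t b + \<mu> *\<^sub>R b" using e1 by (simp add: algebra_simps)
    have Ay: "A t y = z *\<^sub>R y - A1 t x + \<mu> *\<^sub>R x - A2 t b + \<nu> *\<^sub>R b" using e2 by (simp add: algebra_simps)
    have "A (t + h) (b + h *\<^sub>R x + h\<^sup>2 *\<^sub>R y) = A (t + h) b + h *\<^sub>R A (t + h) x + h\<^sup>2 *\<^sub>R A (t + h) y"
      using V by (simp add: T_add T_scaleR V_add V_scaleR)
    then have eq: "A (t + h) (b + h *\<^sub>R x + h\<^sup>2 *\<^sub>R y) - (z + \<mu> * h + \<nu> * h\<^sup>2) *\<^sub>R (b + h *\<^sub>R x + h\<^sup>2 *\<^sub>R y)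
        = rb + h *\<^sub>R rx + h\<^sup>2 *\<^sub>R ry + h ^ 3 *\<^sub>R p + h ^ 4 *\<^sub>R q"
      unfolding b x y e0 Ax Ay p_def q_def
      by (simp add: scaleR_add_left scaleR_add_right scaleR_diff_right power2_eq_square power3_eq_cube power4_eq_xxxx algebra_simps)
    have "norm (rb + h *\<^sub>R rx + h\<^sup>2 *\<^sub>R ry + h ^ 3 *\<^sub>R p + h ^ 4 *\<^sub>R q)
        \<le> norm rb + norm (h *\<^sub>R rx) + norm (h\<^sup>2 *\<^sub>R ry) + norm (h ^ 3 *\<^sub>R p) + norm (h ^ 4 *\<^sub>R q)"
      by (intro order_trans[OF norm_triangle_ineq] add_mono order_refl)
    moreover have "norm rb \<le> \<bar>Cb\<bar> * \<bar>h\<bar> ^ 3"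
      using C(1)[OF h] mult_right_mono[OF abs_ge_self[of Cb], of "\<bar>h\<bar> ^ 3"] by (simp add: rb_def)
    moreover have "norm (h *\<^sub>R rx) \<le> \<bar>Cx\<bar> * \<bar>h\<bar> ^ 3"
    proof -
      have "norm rx \<le> \<bar>Cx\<bar> * \<bar>h\<bar> ^ 3"
        using C(2)[OF h] mult_right_mono[OF abs_ge_self[of Cx], of "\<bar>h\<bar> ^ 3"] by (simp add: rx_def)
      then have "\<bar>h\<bar> * norm rx \<le> 1 * (\<bar>Cx\<bar> * \<bar>h\<bar> ^ 3)" using h by (intro mult_mono) auto
      then show ?thesis by simp
    qed
    moreover have "norm (h\<^sup>2 *\<^sub>R ry) \<le> \<bar>Cy\<bar> * \<bar>h\<bar> ^ 3"
    proof -
      have "norm ry \<le> \<bar>Cy\<bar> * \<bar>h\<bar> ^ 3"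
        using C(3)[OF h] mult_right_mono[OF abs_ge_self[of Cy], of "\<bar>h\<bar> ^ 3"] by (simp add: ry_def)
      moreover have "h\<^sup>2 \<le> 1" using h by (simp add: abs_square_le_1)
      ultimately have "h\<^sup>2 * norm ry \<le> 1 * (\<bar>Cy\<bar> * \<bar>h\<bar> ^ 3)" by (intro mult_mono) auto
      then show ?thesis by simp
    qed
    moreover have "norm (h ^ 3 *\<^sub>R p) = norm p * \<bar>h\<bar> ^ 3" by (simp add: power_abs)
    moreover have "norm (h ^ 4 *\<^sub>R q) \<le> norm q * \<bar>h\<bar> ^ 3"
    proof -
      have "\<bar>h\<bar> ^ 4 \<le> \<bar>h\<bar> ^ 3" using h by (intro power_decreasing) auto
      then show ?thesis using mult_left_mono[of "\<bar>h\<bar> ^ 4" "\<bar>h\<bar> ^ 3" "norm q"] by (simp add: power_abs mult.commute)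
    qed
    ultimately show ?thesis unfolding eq distrib_right by linarith
  qed
  then show ?thesis by blast
qed

text \<open>The equations \<open>e1\<close> and \<open>e2\<close> of
  \<open>residual_estimate\<close> are solved with the reduced resolvent \<open>S\<close>,
  provided that their inhomogeneities are orthogonal to the eigenspace. For \<open>e1\<close>
  this means that \<open>\<mu>\<close> diagonalizes the compression of \<open>A1\<close>. In
  \<open>x\<close> a component \<open>k\<close> in the eigenspace is still free. The condition
  for \<open>e2\<close> at \<open>b'\<close> involves \<open>T2 = A2 - A1 \<circ> S \<circ>
  A1\<close>: if \<open>\<mu> b' \<noteq> \<mu> b\<close>, it determines the coefficient
  \<open>\<kappa> b b'\<close> of \<open>k\<close>, and otherwise it says that
  \<open>\<nu>\<close> diagonalizes the compression of \<open>T2\<close> to an eigenspace of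
  that of \<open>A1\<close>.\<close>

lemma quasimodes:
  assumes fin: "finite S0" "complex_vector.span S0 = {u \<in> V. A t u = z *\<^sub>R u}"
  obtains B \<mu> \<nu> W C where "finite B" "orthonormal B" "complex_vector.span B = {u \<in> V. A t u = z *\<^sub>R u}"
    "\<And>b. b \<in> B \<Longrightarrow> cinner (A1 t b) b = complex_of_real (\<mu> b)" "\<And>b h. b \<in> B \<Longrightarrow> W b h \<in> V" "C \<ge> 0"
    "\<And>b h. b \<in> B \<Longrightarrow> \<bar>h\<bar> \<le> 1 \<Longrightarrow> norm (W b h - b) \<le> C * \<bar>h\<bar>"
    "\<And>b h. b \<in> B \<Longrightarrow> \<bar>h\<bar> \<le> 1 \<Longrightarrow>
      norm (A (t + h) (W b h) - (z + \<mu> b * h + \<nu> b * h\<^sup>2) *\<^sub>R W b h) \<le> C * \<bar>h\<bar> ^ 3"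
proof -
  interpret compact_resolvent_operator V "A t" by (rule operator)
  define E where "E = {u \<in> V. A t u = z *\<^sub>R u}"
  have EV: "E \<subseteq> V" by (auto simp: E_def)
  obtain B0 where B0: "finite B0" "orthonormal B0" "complex_vector.span B0 = E"
    using orthonormal_basis[OF fin(1)] fin(2) unfolding E_def by metis
  have span0: "complex_vector.span B0 = {u \<in> V. A t u = z *\<^sub>R u}" using B0(3) by (simp add: E_def)
  obtain S where S: "\<And>f. S f \<in> V" "\<And>f. A t (S f) - z *\<^sub>R S f = f - proj B0 f"
    "\<And>f b. b \<in> B0 \<Longrightarrow> cinner (S f) b = 0" "\<And>f g. cinner (S f) g = cinner f (S g)"
    "\<And>f g. S (f + g) = S f + S g" "\<And>a f. S (a *\<^sub>C f) = a *\<^sub>C S f"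
    by (rule reduced_resolvent[OF B0(1,2) span0]) (rule that)
  define T2 where "T2 x = A2 t x - A1 t (S (A1 t x))" for x
  have A1: "A1 t (x + y) = A1 t x + A1 t y" "A1 t (a *\<^sub>C x) = a *\<^sub>C A1 t x" "cinner (A1 t x) y = cinner x (A1 t y)"
    if "x \<in> V" "y \<in> V" for x y a
    using symmetric_A1[of t] that by (auto simp: symmetric_on_def)
  have "symmetric_on V (\<lambda>x. A1 t (S (A1 t x)))"
    by (auto simp: symmetric_on_def A1 S)
  then have symT2: "symmetric_on V T2"
    unfolding T2_def by (intro symmetric_on_diff symmetric_A2)
  have subE: "complex_vector.subspace E" using B0(3) complex_vector.subspace_span by metis
  obtain B \<mu> \<nu> where B: "finite B" "orthonormal B" "complex_vector.span B = E"
    and d1: "\<And>b b'. b \<in> B \<Longrightarrow> b' \<in> B \<Longrightarrow> cinner (A1 t b) b' = (if b = b' then complex_of_real (\<mu> b) else 0)"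
    and d2: "\<And>b b'. b \<in> B \<Longrightarrow> b' \<in> B \<Longrightarrow> \<mu> b = \<mu> b' \<Longrightarrow> cinner (T2 b) b' = (if b = b' then complex_of_real (\<nu> b) else 0)"
    using simultaneous_diagonalization[of B0 E "A1 t" T2, OF B0(1) _ subE symmetric_on_subset[OF symmetric_A1 EV] symmetric_on_subset[OF symT2 EV]]
      B0(3) by auto
  have BE: "b \<in> V" "A t b = z *\<^sub>R b" if "b \<in> B" for b
    using complex_vector.span_base[OF that] B(3) by (auto simp: E_def)
  have proj_E: "proj B0 f = proj B f" for f
  proof -
    have c: "cinner (f - proj B0 f) b = 0" if "b \<in> B" for b
    proof -
      have "b \<in> complex_vector.span B0" using complex_vector.span_base[OF that] B(3) B0(3) by simp
      then have "cinner (f - proj B0 f) b = cinner (f - proj B0 f) (proj B0 b)" using proj_eq_self[OF B0(2,1)] by simp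
      also have "\<dots> = cinner (proj B0 (f - proj B0 f)) b" by (rule proj_symmetric[symmetric])
      also have "proj B0 (f - proj B0 f) = 0" by (intro proj_eq_0 cinner_diff_proj B0)
      finally show ?thesis by simp
    qed
    have "proj B0 f \<in> complex_vector.span B0" unfolding proj_def
      by (intro complex_vector.span_sum complex_vector.span_scale complex_vector.span_base)
    then have "proj B (proj B0 f) = proj B0 f" using B(3) B0(3) by (intro proj_eq_self B) simp
    moreover have "proj B f = proj B (f - proj B0 f) + proj B (proj B0 f)" unfolding proj_add[symmetric] by simp
    moreover have "proj B (f - proj B0 f) = 0" by (intro proj_eq_0 c)
    ultimately show ?thesis by simp
  qed
  have SB: "cinner (S f) b = 0" if "b \<in> B" for f b
  proof -
    have "b \<in> complex_vector.span B0" using complex_vector.span_base[OF that] B(3) B0(3) by simp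
    then have "cinner (S f) b = cinner (S f) (proj B0 b)" using proj_eq_self[OF B0(2,1)] by simp
    also have "\<dots> = cinner (proj B0 (S f)) b" by (rule proj_symmetric[symmetric])
    also have "proj B0 (S f) = 0" by (intro proj_eq_0 S)
    finally show ?thesis by simp
  qed
  have dirac: "cinner b b' = (if b = b' then 1 else 0)" if "b \<in> B" "b' \<in> B" for b b'
    using B(2) that by (auto simp: orthonormal_def)
  define \<kappa> where "\<kappa> b b' = (if \<mu> b' = \<mu> b then 0 else cinner (T2 b) b' / complex_of_real (\<mu> b - \<mu> b'))" for b b'
  define k where "k b = (\<Sum>b'\<in>B. \<kappa> b b' *\<^sub>C b')" for b
  define x where "x b = k b - S (A1 t b)" for b
  define g where "g b = (A1 t (x b) - \<mu> b *\<^sub>R x b) + (A2 t b - \<nu> b *\<^sub>R b)" for b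
  define y where "y b = - S (g b)" for b
  have kV: "k b \<in> V" and k_eig: "A t (k b) = z *\<^sub>R k b" for b
  proof -
    have "k b \<in> complex_vector.span B" unfolding k_def
      by (intro complex_vector.span_sum complex_vector.span_scale complex_vector.span_base)
    then show "k b \<in> V" "A t (k b) = z *\<^sub>R k b" unfolding B(3) E_def by auto
  qed
  have xV: "x b \<in> V" for b unfolding x_def by (intro V_diff kV S)
  have yV: "y b \<in> V" for b unfolding y_def using V_scale[OF S(1), of "-1"] by simp
  have e1: "A t (x b) - z *\<^sub>R x b + (A1 t b - \<mu> b *\<^sub>R b) = 0" if b: "b \<in> B" for b
  proof -
    have "proj B (A1 t b) = (\<Sum>b'\<in>B. if b' = b then complex_of_real (\<mu> b) *\<^sub>C b else 0)"
      unfolding proj_def using b by (intro sum.cong) (auto simp: d1)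
    also have "\<dots> = \<mu> b *\<^sub>R b" using b B(1) by (simp add: scaleC_of_real)
    finally have P: "proj B (A1 t b) = \<mu> b *\<^sub>R b" .
    have "A t (x b) - z *\<^sub>R x b = - (A t (S (A1 t b)) - z *\<^sub>R S (A1 t b))"
      unfolding x_def using k_eig by (simp add: T_diff kV S(1) algebra_simps)
    then show ?thesis unfolding S(2) proj_E P by simp
  qed
  have g0: "cinner (g b) b' = 0" if b: "b \<in> B" "b' \<in> B" for b b'
  proof -
    have d1': "cinner e (A1 t b') = (if e = b' then complex_of_real (\<mu> b') else 0)" if "e \<in> B" for e
      using A1(3)[OF BE(1)[OF that] BE(1)[OF b(2)]] d1[OF that b(2)] by auto
    have "cinner (A1 t (k b)) b' = cinner (k b) (A1 t b')" using A1(3)[OF kV BE(1)[OF b(2)]] .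
    also have "\<dots> = (\<Sum>e\<in>B. \<kappa> b e * cinner e (A1 t b'))" by (simp add: k_def cinner_sum_left cinner_scaleC_left)
    also have "\<dots> = (\<Sum>e\<in>B. if e = b' then \<kappa> b b' * complex_of_real (\<mu> b') else 0)"
      by (intro sum.cong) (auto simp: d1')
    also have "\<dots> = \<kappa> b b' * \<mu> b'" using B(1) b(2) by simp
    finally have k1: "cinner (A1 t (k b)) b' = \<kappa> b b' * \<mu> b'" .
    have k2: "cinner (k b) b' = \<kappa> b b'" unfolding k_def by (rule cinner_combination[OF B(2,1) b(2)])
    have "A1 t (k b) = A1 t (x b) + A1 t (S (A1 t b))"
      unfolding A1(1)[OF xV S(1), symmetric] by (simp add: x_def)
    then have x1: "cinner (A1 t (x b)) b' = \<kappa> b b' * \<mu> b' - cinner (A1 t (S (A1 t b))) b'"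
      using k1 by (simp add: cinner_add_left eq_diff_eq)
    have x2: "cinner (x b) b' = \<kappa> b b'" by (simp add: x_def cinner_diff_left k2 SB[OF b(2)])
    have T: "cinner (T2 b) b' = cinner (A2 t b) b' - cinner (A1 t (S (A1 t b))) b'" by (simp add: T2_def cinner_diff_left)
    have "cinner (g b) b' = cinner (T2 b) b' - (complex_of_real (\<mu> b) - complex_of_real (\<mu> b')) * \<kappa> b b' - \<nu> b * cinner b b'"
      unfolding g_def cinner_add_left cinner_diff_left cinner_scaleR_left x1 x2 T by (simp add: algebra_simps)
    also have "\<dots> = 0"
    proof (cases "\<mu> b = \<mu> b'")
      case True
      then show ?thesis using d2[OF b True] dirac[OF b] by simp
    next
      case False
      then have "complex_of_real (\<mu> b) - complex_of_real (\<mu> b') \<noteq> 0" by (simp flip: of_real_diff)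
      moreover have "b \<noteq> b'" using False by auto
      ultimately show ?thesis using False dirac[OF b] by (simp add: \<kappa>_def)
    qed
    finally show ?thesis .
  qed
  have e2: "A t (y b) - z *\<^sub>R y b + g b = 0" if b: "b \<in> B" for b
  proof -
    have "proj B (g b) = 0" using g0[OF b] by (rule proj_eq_0)
    moreover have "A t (y b) = - A t (S (g b))" using T_scale[OF S(1), of "-1" "g b"] by (simp add: y_def)
    ultimately show ?thesis using S(2)[of "g b"] by (simp add: proj_E y_def algebra_simps)
  qed
  define W where "W b h = b + h *\<^sub>R x b + h\<^sup>2 *\<^sub>R y b" for b h
  have "\<exists>C. \<forall>h. \<bar>h\<bar> \<le> 1 \<longrightarrow> norm (A (t + h) (W b h) - (z + \<mu> b * h + \<nu> b * h\<^sup>2) *\<^sub>R W b h) \<le> C * \<bar>h\<bar> ^ 3" if b: "b \<in> B" for b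
    unfolding W_def using e2[OF b] by (intro residual_estimate BE b xV yV e1) (simp add: g_def)
  then obtain C where C: "\<And>b h. b \<in> B \<Longrightarrow> \<bar>h\<bar> \<le> 1 \<Longrightarrow>
      norm (A (t + h) (W b h) - (z + \<mu> b * h + \<nu> b * h\<^sup>2) *\<^sub>R W b h) \<le> C b * \<bar>h\<bar> ^ 3" by metis
  define M where "M = (\<Sum>b\<in>B. \<bar>C b\<bar> + norm (x b) + norm (y b))"
  have M: "\<bar>C b\<bar> + norm (x b) + norm (y b) \<le> M" if "b \<in> B" for b
    unfolding M_def by (rule member_le_sum[OF that]) (use B in auto)
  show ?thesis
  proof (rule that[of B \<mu> W M \<nu>])
    show "finite B" "orthonormal B" by (rule B)+
    show "complex_vector.span B = {u \<in> V. A t u = z *\<^sub>R u}" using B(3) by (simp add: E_def)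
    show "cinner (A1 t b) b = complex_of_real (\<mu> b)" if "b \<in> B" for b using d1[OF that that] by simp
    show "W b h \<in> V" if "b \<in> B" for b h unfolding W_def by (intro V_add V_scaleR BE xV yV that)
    show "M \<ge> 0" unfolding M_def by (intro sum_nonneg) auto
    show "norm (W b h - b) \<le> M * \<bar>h\<bar>" if "b \<in> B" "\<bar>h\<bar> \<le> 1" for b h
    proof -
      have "norm (W b h - b) \<le> norm (h *\<^sub>R x b) + norm (h\<^sup>2 *\<^sub>R y b)"
        unfolding W_def using norm_triangle_ineq[of "h *\<^sub>R x b" "h\<^sup>2 *\<^sub>R y b"] by (simp add: add.assoc)
      also have "\<dots> \<le> \<bar>h\<bar> * norm (x b) + \<bar>h\<bar> * norm (y b)"
        using mult_left_le[OF that(2), of "\<bar>h\<bar>"] by (auto simp: power2_eq_square abs_mult intro!: mult_right_mono)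
      also have "\<dots> \<le> \<bar>h\<bar> * M" unfolding distrib_left[symmetric] using M[OF that(1)] by (intro mult_left_mono) auto
      finally show ?thesis by (simp add: mult.commute)
    qed
    show "norm (A (t + h) (W b h) - (z + \<mu> b * h + \<nu> b * h\<^sup>2) *\<^sub>R W b h) \<le> M * \<bar>h\<bar> ^ 3" if "b \<in> B" "\<bar>h\<bar> \<le> 1" for b h
    proof -
      have "C b \<le> M" using M[OF that(1)] norm_ge_zero[of "x b"] norm_ge_zero[of "y b"] abs_ge_self[of "C b"] by linarith
      then show ?thesis using C[OF that] mult_right_mono[of "C b" M "\<bar>h\<bar> ^ 3"] by simp
    qed
  qed
qed

text \<open>As the \<open>W b\<close> are close to an orthonormal family, the norm of a
  combination controls its coefficients.\<close>

lemma quasimode_class: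
  fixes d r :: real
  assumes B: "finite B" "orthonormal B" and W: "\<And>b. b \<in> B \<Longrightarrow> W b \<in> V"
    and close: "\<And>b. b \<in> B \<Longrightarrow> norm (W b - b) \<le> d" and d: "card B * d \<le> 1 / 2"
    and res: "\<And>b. b \<in> B \<Longrightarrow> norm (A s (W b) - q *\<^sub>R W b) \<le> r" and r: "r \<ge> 0"
    and c: "\<exists>b\<in>B. c b \<noteq> 0"
  shows "(\<Sum>b\<in>B. c b *\<^sub>C W b) \<noteq> 0 \<and>
    norm (A s (\<Sum>b\<in>B. c b *\<^sub>C W b) - q *\<^sub>R (\<Sum>b\<in>B. c b *\<^sub>C W b)) \<le> (2 * card B * r) * norm (\<Sum>b\<in>B. c b *\<^sub>C W b)"
proof -
  interpret compact_resolvent_operator V "A s" by (rule operator)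
  define w where "w = (\<Sum>b\<in>B. c b *\<^sub>C W b)"
  define m where "m = norm (\<Sum>b\<in>B. c b *\<^sub>C b)"
  have m: "m\<^sup>2 = (\<Sum>b\<in>B. (cmod (c b))\<^sup>2)" unfolding m_def by (rule norm_combination[OF B(2,1)])
  have m0: "m \<ge> 0" by (simp add: m_def)
  have cm: "cmod (c b) \<le> m" if "b \<in> B" for b
  proof (rule power2_le_imp_le)
    show "(cmod (c b))\<^sup>2 \<le> m\<^sup>2" unfolding m by (rule member_le_sum[OF that]) (use B in auto)
  qed (rule m0)
  have "m > 0"
  proof -
    obtain b where "b \<in> B" "c b \<noteq> 0" using c by blast
    then have "0 < cmod (c b)" "cmod (c b) \<le> m" using cm by auto
    then show ?thesis by linarith
  qed
  have "norm ((\<Sum>b\<in>B. c b *\<^sub>C b) - w) \<le> m / 2"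
  proof -
    have "(\<Sum>b\<in>B. c b *\<^sub>C b) - w = (\<Sum>b\<in>B. c b *\<^sub>C (b - W b))"
      by (simp add: w_def sum_subtractf scaleC_diff_right)
    then have "norm ((\<Sum>b\<in>B. c b *\<^sub>C b) - w) \<le> (\<Sum>b\<in>B. norm (c b *\<^sub>C (b - W b)))" by (simp add: norm_sum)
    also have "\<dots> \<le> (\<Sum>b\<in>B. m * d)"
      using cm close m0 by (intro sum_mono) (auto simp: norm_scaleC norm_minus_commute intro!: mult_mono)
    also have "\<dots> = m * (card B * d)" by simp
    also have "\<dots> \<le> m * (1 / 2)" using d m0 by (rule mult_left_mono)
    finally show ?thesis by simp
  qed
  then have wm: "m / 2 \<le> norm w" using norm_triangle_ineq2[of "\<Sum>b\<in>B. c b *\<^sub>C b" w] by (simp add: m_def)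
  have "A s w - q *\<^sub>R w = (\<Sum>b\<in>B. c b *\<^sub>C (A s (W b) - q *\<^sub>R W b))"
  proof -
    have "A s w = (\<Sum>b\<in>B. c b *\<^sub>C A s (W b))" unfolding w_def
      using W by (subst T_sum) (auto simp: V_scale T_scale)
    moreover have "q *\<^sub>R w = (\<Sum>b\<in>B. c b *\<^sub>C (q *\<^sub>R W b))" by (simp add: w_def scaleR_sum_right scaleC_scaleR)
    ultimately show ?thesis by (simp add: sum_subtractf scaleC_diff_right)
  qed
  then have "norm (A s w - q *\<^sub>R w) \<le> (\<Sum>b\<in>B. norm (c b *\<^sub>C (A s (W b) - q *\<^sub>R W b)))" by (simp add: norm_sum)
  also have "\<dots> \<le> (\<Sum>b\<in>B. m * r)" using cm res m0 r by (intro sum_mono) (auto simp: norm_scaleC intro!: mult_mono)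
  also have "\<dots> = card B * r * m" by simp
  also have "\<dots> \<le> card B * r * (2 * norm w)" using wm r by (intro mult_left_mono) auto
  finally show ?thesis using wm \<open>m > 0\<close> by (auto simp: w_def mult_ac)
qed

end

section \<open>Eigenvalue clusters along a curve\<close>

context compact_resolvent_operator
begin

lemma gap_below:
  obtains c where "c < z0" "\<And>x u. c \<le> x \<Longrightarrow> x < z0 \<Longrightarrow> u \<in> V \<Longrightarrow> T u = x *\<^sub>R u \<Longrightarrow> u = 0"
proof -
  define X where "X = {x. \<bar>x\<bar> \<le> \<bar>z0\<bar> + 1 \<and> (\<exists>u\<in>V. u \<noteq> 0 \<and> T u = x *\<^sub>R u)}"
  define Y where "Y = insert (z0 - 1) {x \<in> X. x < z0}"
  have "finite X" unfolding X_def by (rule finite_eigenvalues)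
  then have Y: "finite Y" "Y \<noteq> {}" by (auto simp: Y_def)
  have less: "Max Y < z0" using Max_in[OF Y] by (auto simp: Y_def)
  have ge: "z0 - 1 \<le> Max Y" using Y by (intro Max_ge) (auto simp: Y_def)
  show ?thesis
  proof (rule that[of "(Max Y + z0) / 2"])
    show "(Max Y + z0) / 2 < z0" using less by simp
    fix x u assume x: "(Max Y + z0) / 2 \<le> x" "x < z0" and u: "u \<in> V" "T u = x *\<^sub>R u"
    show "u = 0"
    proof (rule ccontr)
      assume "u \<noteq> 0"
      moreover have "\<bar>x\<bar> \<le> \<bar>z0\<bar> + 1"
      proof (rule abs_leI)
        show "x \<le> \<bar>z0\<bar> + 1" using x(2) abs_ge_self[of z0] by simp
        have "z0 - 1 \<le> (Max Y + z0) / 2" using ge less by simp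
        then show "- x \<le> \<bar>z0\<bar> + 1" using x(1) abs_ge_minus_self[of z0] by linarith
      qed
      ultimately have "x \<in> Y" using u x(2) by (auto simp: Y_def X_def)
      then have "x \<le> Max Y" using Y by simp
      then show False using x(1) less by simp
    qed
  qed
qed

end

context resolvent_operator
begin

text \<open>A positive eigenvalue \<open>s\<close> of the resolvent corresponds to the
  eigenvalue \<open>c + 1 / s\<close> of \<open>T\<close>, which does not lie in
  \<open>{c..<z0}\<close>. So \<open>1 / (z0 - c)\<close> is the largest one, and its eigenspace
  is the span of \<open>B\<close>.\<close>

lemma form_bounds:
  assumes cz: "c < z0" and none: "\<And>x u. c \<le> x \<Longrightarrow> x < z0 \<Longrightarrow> u \<in> V \<Longrightarrow> T u = x *\<^sub>R u \<Longrightarrow> u = 0"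
    and B: "finite B" "orthonormal B" and span: "complex_vector.span B = {u \<in> V. T u = z0 *\<^sub>R u}"
  obtains b where "0 \<le> b" "b < 1 / (z0 - c)" "\<And>x. inner (Res x) x \<le> 1 / (z0 - c) * (norm x)\<^sup>2"
    "\<And>x. (\<And>e. e \<in> B \<Longrightarrow> cinner x e = 0) \<Longrightarrow> inner (Res x) x \<le> b * (norm x)\<^sup>2"
    "\<And>x. x \<in> complex_vector.span B \<Longrightarrow> Res x = (1 / (z0 - c)) *\<^sub>R x"
proof -
  define \<rho> where "\<rho> = 1 / (z0 - c)"
  have \<rho>: "\<rho> > 0" using cz by (simp add: \<rho>_def)
  have top: "s \<le> \<rho>" if "Res e = s *\<^sub>R e" "s > 0" "norm e = 1" for e s
  proof -
    have e: "e \<in> V" "T e = (c + 1 / s) *\<^sub>R e" using Res_eigenvector[OF that(1)] that(2) by auto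
    have "\<not> c + 1 / s < z0" using none[of "c + 1 / s" e] e that by auto
    then have "z0 - c \<le> 1 / s" by simp
    then show ?thesis using that(2) cz by (simp add: \<rho>_def field_simps)
  qed
  have ResB: "Res x = \<rho> *\<^sub>R x" if "x \<in> complex_vector.span B" for x
  proof (rule Res_eqI)
    have x: "x \<in> V" "T x = z0 *\<^sub>R x" using that span by auto
    show "\<rho> *\<^sub>R x \<in> V" by (rule V_scaleR[OF x(1)])
    have "T (\<rho> *\<^sub>R x) - c *\<^sub>R \<rho> *\<^sub>R x = (\<rho> * (z0 - c)) *\<^sub>R x"
      using T_scaleR[OF x(1)] by (simp add: x(2) scaleR_left_diff_distrib right_diff_distrib mult.commute)
    then show "T (\<rho> *\<^sub>R x) - c *\<^sub>R \<rho> *\<^sub>R x = x" using cz by (simp add: \<rho>_def)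
  qed
  have form: "inner (Res x) x \<le> \<rho> * (norm x)\<^sup>2" for x
  proof (cases "inner (Res x) x > 0")
    case True
    obtain e s where e: "norm e = 1" "Res e = s *\<^sub>R e" "s > 0" "\<And>x. inner (Res x) x \<le> s * (norm x)\<^sup>2"
      using Res.top_eigenvector[of UNIV x] True by (auto simp: complex_vector.subspace_UNIV)
    show ?thesis using e(4)[of x] mult_right_mono[OF top[OF e(2,3,1)], of "(norm x)\<^sup>2"] by simp
  next
    case False
    then show ?thesis using \<rho> by (smt (verit) mult_nonneg_nonneg zero_le_power2)
  qed
  define K where "K = {x. \<forall>e\<in>B. cinner x e = 0}"
  have K: "complex_vector.subspace K"
    by (auto simp: K_def complex_vector.subspace_def cinner_add_left cinner_scaleC_left)
  have "K = (\<Inter>e\<in>B. {x. cinner x e = 0})" by (auto simp: K_def)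
  then have clK: "closed K"
    by (auto intro!: closed_Collect_eq linear_continuous_on bounded_linear_cinner_left)
  have RK: "Res x \<in> K" if "x \<in> K" for x
  proof -
    have "cinner (Res x) e = 0" if "e \<in> B" for e
      using Res.sym[of x e] ResB[OF complex_vector.span_base[OF that]] \<open>x \<in> K\<close> that
      by (simp add: K_def cinner_scaleR_right)
    then show ?thesis by (simp add: K_def)
  qed
  show ?thesis
  proof (cases "\<exists>x\<in>K. inner (Res x) x > 0")
    case True
    then obtain e s where e: "e \<in> K" "norm e = 1" "Res e = s *\<^sub>R e" "s > 0" "\<And>x. x \<in> K \<Longrightarrow> inner (Res x) x \<le> s * (norm x)\<^sup>2"
      using Res.top_eigenvector[OF K clK RK] by metis
    have "s \<noteq> \<rho>"
    proof
      assume "s = \<rho>"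
      then have "e \<in> V" "T e = (c + 1 / \<rho>) *\<^sub>R e" using Res_eigenvector[OF e(3)] \<rho> by auto
      then have "e \<in> complex_vector.span B" using cz unfolding span by (simp add: \<rho>_def)
      then have "proj B e = e" by (rule proj_eq_self[OF B(2,1)])
      moreover have "proj B e = 0" using e(1) by (intro proj_eq_0) (simp add: K_def)
      ultimately show False using e(2) by simp
    qed
    then have "s < \<rho>" using top[OF e(3,4,2)] by simp
    then show ?thesis
      using e form ResB by (intro that[of s]) (auto simp: \<rho>_def[symmetric] K_def)
  next
    case False
    then have "inner (Res x) x \<le> 0 * (norm x)\<^sup>2" if "x \<in> K" for x using that by (auto simp: not_less)
    then show ?thesis
      using \<rho> form ResB by (intro that[of 0]) (auto simp: \<rho>_def[symmetric] K_def)
  qed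
qed

end

context operator_curve
begin

definition quasimode_system :: "real \<Rightarrow> real \<Rightarrow> 'a set \<Rightarrow> ('a \<Rightarrow> real) \<Rightarrow> ('a \<Rightarrow> real) \<Rightarrow> bool"
  where "quasimode_system t z B \<mu> \<nu> \<longleftrightarrow> finite B \<and> orthonormal B \<and>
    complex_vector.span B = {u \<in> V. A t u = z *\<^sub>R u} \<and>
    (\<forall>b\<in>B. cinner (A1 t b) b = complex_of_real (\<mu> b)) \<and>
    (\<exists>W C. C \<ge> 0 \<and> (\<forall>b\<in>B. \<forall>h. W b h \<in> V \<and> (\<bar>h\<bar> \<le> 1 \<longrightarrow> norm (W b h - b) \<le> C * \<bar>h\<bar> \<and>
      norm (A (t + h) (W b h) - (z + \<mu> b * h + \<nu> b * h\<^sup>2) *\<^sub>R W b h) \<le> C * \<bar>h\<bar> ^ 3)))"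

lemma quasimode_system_exists:
  assumes "multiplicity_at V (A t) (complex_of_real z) \<noteq> \<infinity>"
  shows "\<exists>B \<mu> \<nu>. quasimode_system t z B \<mu> \<nu>"
proof -
  have "eigenspace V (A t) (complex_of_real z) = {u \<in> V. A t u = z *\<^sub>R u}"
    by (simp add: eigenspace_def scaleC_of_real)
  then obtain S0 where S0: "finite S0" "complex_vector.span S0 = {u \<in> V. A t u = z *\<^sub>R u}"
    using assms unfolding multiplicity_at_def by (auto split: if_splits)
  show ?thesis
  proof (rule quasimodes[OF S0])
    fix B \<mu> \<nu> W and C :: real
    assume *: "finite B" "orthonormal B" "complex_vector.span B = {u \<in> V. A t u = z *\<^sub>R u}"
      "\<And>b. b \<in> B \<Longrightarrow> cinner (A1 t b) b = complex_of_real (\<mu> b)" "\<And>b h. b \<in> B \<Longrightarrow> W b h \<in> V" "C \<ge> 0"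
      "\<And>b h. b \<in> B \<Longrightarrow> \<bar>h\<bar> \<le> 1 \<Longrightarrow> norm (W b h - b) \<le> C * \<bar>h\<bar>"
      "\<And>b h. b \<in> B \<Longrightarrow> \<bar>h\<bar> \<le> 1 \<Longrightarrow>
        norm (A (t + h) (W b h) - (z + \<mu> b * h + \<nu> b * h\<^sup>2) *\<^sub>R W b h) \<le> C * \<bar>h\<bar> ^ 3"
    have "\<exists>W C. C \<ge> 0 \<and> (\<forall>b\<in>B. \<forall>h. W b h \<in> V \<and> (\<bar>h\<bar> \<le> 1 \<longrightarrow> norm (W b h - b) \<le> C * \<bar>h\<bar> \<and>
      norm (A (t + h) (W b h) - (z + \<mu> b * h + \<nu> b * h\<^sup>2) *\<^sub>R W b h) \<le> C * \<bar>h\<bar> ^ 3))"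
      by (rule exI[of _ W], rule exI[of _ C]) (use * in blast)
    then have "quasimode_system t z B \<mu> \<nu>" unfolding quasimode_system_def using * by blast
    then show ?thesis by blast
  qed
qed

text \<open>The quasimodes with the common jet \<open>J\<close> have residuals of order
  \<open>\<bar>h\<bar> ^ 3\<close> for the common approximate eigenvalue \<open>q\<close>. By
  \<open>quasimode_count\<close> they produce as many eigenvalues within \<open>L *
  \<bar>h\<bar> ^ 3\<close> of \<open>q\<close>, and for small \<open>h\<close> these lie in the
  window.\<close>

lemma window_count:
  assumes qm: "quasimode_system t0 z0 B \<mu> \<nu>" and J: "jet_val J = z0" and pos: "\<delta> > 0" "\<epsilon> > 0" "g > 0" "\<eta> > 0"
    and f: "\<And>t. \<bar>t - t0\<bar> < \<delta> \<Longrightarrow> onf (f t) N" "\<And>t i. \<bar>t - t0\<bar> < \<delta> \<Longrightarrow> i < N \<Longrightarrow> f t i \<in> V"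
      "\<And>t i. \<bar>t - t0\<bar> < \<delta> \<Longrightarrow> i < N \<Longrightarrow> A t (f t i) = l i t *\<^sub>R f t i"
    and gap: "\<And>t z y. \<bar>t - t0\<bar> < \<delta> \<Longrightarrow> \<bar>z - z0\<bar> < \<epsilon> \<Longrightarrow> y \<in> V \<Longrightarrow> (\<And>i. i < N \<Longrightarrow> cinner y (f t i) = 0) \<Longrightarrow>
      g * norm y \<le> norm (A t y - z *\<^sub>R y)"
  shows "\<forall>\<^sub>F t in at t0. card {b \<in> B. Jet z0 (\<mu> b) (\<nu> b) = J} \<le> card {i. i < N \<and> Jet (l i t) 0 0 \<in> window t0 J \<eta> t}"
proof -
  define Q where "Q = {b \<in> B. Jet z0 (\<mu> b) (\<nu> b) = J}"
  have B: "finite B" "orthonormal B" using qm by (auto simp: quasimode_system_def)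
  then have Q: "finite Q" "orthonormal Q" by (auto simp: Q_def orthonormal_def)
  obtain W C where C: "C \<ge> 0" and WC: "\<forall>b\<in>B. \<forall>h. W b h \<in> V \<and> (\<bar>h\<bar> \<le> 1 \<longrightarrow> norm (W b h - b) \<le> C * \<bar>h\<bar> \<and>
      norm (A (t0 + h) (W b h) - (z0 + \<mu> b * h + \<nu> b * h\<^sup>2) *\<^sub>R W b h) \<le> C * \<bar>h\<bar> ^ 3)"
    using qm unfolding quasimode_system_def by blast
  then have W: "\<And>b h. b \<in> B \<Longrightarrow> W b h \<in> V"
    "\<And>b h. b \<in> B \<Longrightarrow> \<bar>h\<bar> \<le> 1 \<Longrightarrow> norm (W b h - b) \<le> C * \<bar>h\<bar>"
    "\<And>b h. b \<in> B \<Longrightarrow> \<bar>h\<bar> \<le> 1 \<Longrightarrow> norm (A (t0 + h) (W b h) - (z0 + \<mu> b * h + \<nu> b * h\<^sup>2) *\<^sub>R W b h) \<le> C * \<bar>h\<bar> ^ 3"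
    by blast+
  define L where "L = 2 * card Q * C"
  have L: "L \<ge> 0" using C by (simp add: L_def)
  have lim: "\<forall>\<^sub>F t in at t0. a * \<bar>t - t0\<bar> < y" if y: "y > 0" for a y :: real
  proof -
    have "((\<lambda>t. a * \<bar>t - t0\<bar>) \<longlongrightarrow> a * \<bar>t0 - t0\<bar>) (at t0)" by (intro tendsto_intros)
    then show ?thesis using y by (intro order_tendstoD(2)) auto
  qed
  have "((\<lambda>t. jet_poly t0 J t) \<longlongrightarrow> jet_poly t0 J t0) (at t0)"
    using continuous_jet_poly isContD by blast
  then have near: "\<forall>\<^sub>F t in at t0. dist (jet_poly t0 J t) (jet_poly t0 J t0) < \<epsilon>" using pos(2) by (rule tendstoD)
  have "\<forall>\<^sub>F t in at t0. card Q \<le> card {i. i < N \<and> Jet (l i t) 0 0 \<in> window t0 J \<eta> t}"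
    using near lim[OF pos(1), of 1] lim[of 1 1, OF zero_less_one] lim[OF zero_less_one, of L] lim[OF pos(3), of L] lim[OF pos(4), of L]
  proof eventually_elim
    case (elim t)
    interpret compact_resolvent_operator V "A t" by (rule operator)
    define h where "h = t - t0"
    have th: "t = t0 + h" by (simp add: h_def)
    have h: "\<bar>t - t0\<bar> < \<delta>" "\<bar>h\<bar> \<le> 1" "L * \<bar>h\<bar> < 1" "L * \<bar>h\<bar> < g" "L * \<bar>h\<bar> < \<eta>" using elim by (auto simp: h_def)
    define q where "q = jet_poly t0 J t"
    have q: "\<bar>q - z0\<bar> < \<epsilon>" using elim(1) J by (simp add: q_def dist_real_def)
    have QW: "b \<in> B" "q = z0 + \<mu> b * h + \<nu> b * h\<^sup>2" if "b \<in> Q" for b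
      using that by (auto simp: Q_def q_def jet_poly_def h_def)
    have e1: "L * \<bar>h\<bar> ^ 3 \<le> L * \<bar>h\<bar>"
      using power_decreasing[of 1 3 "\<bar>h\<bar>"] h(2) L by (intro mult_left_mono) auto
    have e2: "L * \<bar>h\<bar> ^ 3 \<le> \<eta> * h\<^sup>2"
      using mult_right_mono[of "L * \<bar>h\<bar>" \<eta> "h\<^sup>2"] h(5) by (simp add: power3_eq_cube power2_eq_square mult.assoc)
    have "card Q \<le> card {i. i < N \<and> \<bar>l i t - q\<bar> \<le> L * \<bar>h\<bar> ^ 3}"
    proof (rule quasimode_count[of "f t" N "\<lambda>i. l i t" g q "L * \<bar>h\<bar> ^ 3" Q "\<lambda>b. W b h"])
      show "onf (f t) N" by (rule f(1)[OF h(1)])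
      show "f t i \<in> V" "A t (f t i) = l i t *\<^sub>R f t i" if "i < N" for i using f(2,3)[OF h(1) that] by auto
      show "g * norm y \<le> norm (A t y - q *\<^sub>R y)" if "y \<in> V" "\<And>i. i < N \<Longrightarrow> cinner y (f t i) = 0" for y
        by (rule gap[OF h(1) q]) (fact that)+
      show "0 \<le> L * \<bar>h\<bar> ^ 3" using L by simp
      show "L * \<bar>h\<bar> ^ 3 < g" using e1 h(4) by simp
      show "W b h \<in> V" if "b \<in> Q" for b using W(1) QW[OF that] by simp
      show "(\<Sum>b\<in>Q. c b *\<^sub>C W b h) \<noteq> 0 \<and> norm (A t (\<Sum>b\<in>Q. c b *\<^sub>C W b h) - q *\<^sub>R (\<Sum>b\<in>Q. c b *\<^sub>C W b h))
          \<le> L * \<bar>h\<bar> ^ 3 * norm (\<Sum>b\<in>Q. c b *\<^sub>C W b h)" if c: "\<exists>b\<in>Q. c b \<noteq> 0" for c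
      proof -
        have "(\<Sum>b\<in>Q. c b *\<^sub>C W b h) \<noteq> 0 \<and> norm (A t (\<Sum>b\<in>Q. c b *\<^sub>C W b h) - q *\<^sub>R (\<Sum>b\<in>Q. c b *\<^sub>C W b h))
          \<le> (2 * card Q * (C * \<bar>h\<bar> ^ 3)) * norm (\<Sum>b\<in>Q. c b *\<^sub>C W b h)"
        proof (rule quasimode_class[where B = Q and W = "\<lambda>b. W b h" and d = "C * \<bar>h\<bar>"])
          show "finite Q" "orthonormal Q" "\<exists>b\<in>Q. c b \<noteq> 0" by (fact Q c)+
          show "W b h \<in> V" if "b \<in> Q" for b using W(1) QW[OF that] by simp
          show "norm (W b h - b) \<le> C * \<bar>h\<bar>" if "b \<in> Q" for b using W(2)[OF _ h(2)] QW[OF that] by simp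
          show "card Q * (C * \<bar>h\<bar>) \<le> 1 / 2" using h(3) by (simp add: L_def mult.assoc)
          show "norm (A t (W b h) - q *\<^sub>R W b h) \<le> C * \<bar>h\<bar> ^ 3" if "b \<in> Q" for b
            using W(3)[OF QW(1)[OF that] h(2)] QW(2)[OF that] by (simp add: th)
          show "0 \<le> C * \<bar>h\<bar> ^ 3" using C by simp
        qed
        then show ?thesis by (simp add: L_def mult.assoc)
      qed
    qed (rule Q)
    also have "\<dots> \<le> card {i. i < N \<and> Jet (l i t) 0 0 \<in> window t0 J \<eta> t}"
      using e2 by (intro card_mono) (auto simp: window_def q_def h_def)
    finally show ?case .
  qed
  then show ?thesis by (simp add: Q_def)
qed

end

text \<open>A time interval around \<open>t0\<close> that is so short that \<open>A t -
  c\<close> remains invertible, with the constant \<open>\<kappa>\<close> at worst halved.\<close>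

locale local_curve = operator_curve +
  fixes t0 c \<kappa> K \<delta> :: real
  assumes base: "resolvent_operator V (A t0) c \<kappa>" and K: "K \<ge> 0" and \<delta>: "0 < \<delta>" "K * \<delta> \<le> 1 / 2"
    and difference: "\<bar>s - t0\<bar> < \<delta> \<Longrightarrow> \<bar>t - t0\<bar> < \<delta> \<Longrightarrow> u \<in> V \<Longrightarrow> norm (A s u - A t u) \<le> K * \<bar>s - t\<bar> * norm (A t0 u - c *\<^sub>R u)"
    and slope: "\<bar>t - t0\<bar> < \<delta> \<Longrightarrow> u \<in> V \<Longrightarrow> norm (A1 t u) \<le> K * norm (A t0 u - c *\<^sub>R u)"
    and remainder: "\<bar>s - t0\<bar> < \<delta> \<Longrightarrow> \<bar>t - t0\<bar> < \<delta> \<Longrightarrow> u \<in> V \<Longrightarrow>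
      norm (A s u - A t u - (s - t) *\<^sub>R A1 t u) \<le> K * (s - t)\<^sup>2 * norm (A t0 u - c *\<^sub>R u)"
begin

lemma \<kappa>_pos: "\<kappa> > 0" using resolvent_operator.\<kappa>[OF base] .

lemma relative_bound:
  assumes t: "\<bar>t - t0\<bar> < \<delta>" and u: "u \<in> V"
  shows "norm (A t0 u - c *\<^sub>R u) \<le> 2 * norm (A t u - c *\<^sub>R u)"
proof -
  have "norm (A t0 u - A t u) \<le> K * \<bar>t0 - t\<bar> * norm (A t0 u - c *\<^sub>R u)"
    using t \<delta>(1) by (intro difference u) auto
  also have "\<dots> \<le> 1 / 2 * norm (A t0 u - c *\<^sub>R u)"
  proof (rule mult_right_mono)
    have "K * \<bar>t0 - t\<bar> \<le> K * \<delta>" using t K by (intro mult_left_mono) (auto simp: abs_minus_commute)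
    then show "K * \<bar>t0 - t\<bar> \<le> 1 / 2" using \<delta>(2) by (rule order_trans)
  qed simp
  finally have "norm (A t0 u - A t u) \<le> 1 / 2 * norm (A t0 u - c *\<^sub>R u)" .
  moreover have "norm (A t0 u - c *\<^sub>R u) \<le> norm (A t0 u - A t u) + norm (A t u - c *\<^sub>R u)"
    using norm_triangle_ineq[of "A t0 u - A t u" "A t u - c *\<^sub>R u"] by simp
  ultimately show ?thesis by linarith
qed

lemma resolvent_near:
  assumes t: "\<bar>t - t0\<bar> < \<delta>"
  shows "resolvent_operator V (A t) c (\<kappa> / 2)"
proof (intro resolvent_operator.intro operator resolvent_operator_axioms.intro)
  show "\<kappa> / 2 > 0" using \<kappa>_pos by simp
  show "\<kappa> / 2 * norm u \<le> norm (A t u - c *\<^sub>R u)" if "u \<in> V" for u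
    using resolvent_operator.lb[OF base that] relative_bound[OF t that] by simp
qed

abbreviation R :: "real \<Rightarrow> 'a \<Rightarrow> 'a" where "R t \<equiv> resolvent_operator.Res V (A t) c"

lemma resolvent_graph:
  assumes t: "\<bar>t - t0\<bar> < \<delta>"
  shows "norm (A t0 (R t x) - c *\<^sub>R R t x) \<le> 2 * norm x" and "norm (R t x) \<le> 2 / \<kappa> * norm x"
proof -
  interpret t: resolvent_operator V "A t" c "\<kappa> / 2" by (rule resolvent_near[OF t])
  show "norm (A t0 (R t x) - c *\<^sub>R R t x) \<le> 2 * norm x"
    using relative_bound[OF t t.Res_V, of x] by (simp add: t.T_Res)
  show "norm (R t x) \<le> 2 / \<kappa> * norm x" using t.Res_norm[of x] by simp
qed

lemma resolvent_close:
  assumes t: "\<bar>t - t0\<bar> < \<delta>"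
  shows "norm (R t x - R t0 x) \<le> 2 * K * \<delta> / \<kappa> * norm x"
proof -
  interpret t: resolvent_operator V "A t" c "\<kappa> / 2" by (rule resolvent_near[OF t])
  interpret t0: resolvent_operator V "A t0" c \<kappa> by (rule base)
  define y where "y = R t x"
  have yV: "y \<in> V" by (simp add: y_def t.Res_V)
  have "A t0 y - c *\<^sub>R y = x + (A t0 y - A t y)" using t.T_Res[of x] by (simp add: y_def algebra_simps)
  then have "R t0 (x + (A t0 y - A t y)) = y" by (intro t0.Res_eqI yV)
  then have "y - R t0 x = R t0 (A t0 y - A t y)" by (metis t0.Res.add add_diff_cancel_left')
  then have "norm (y - R t0 x) \<le> 1 / \<kappa> * norm (A t0 y - A t y)" using t0.Res_norm by simp
  also have "norm (A t0 y - A t y) \<le> K * \<bar>t0 - t\<bar> * norm (A t0 y - c *\<^sub>R y)"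
    using t \<delta>(1) by (intro difference yV) auto
  also have "\<dots> \<le> K * \<delta> * (2 * norm x)"
    using t K \<delta> resolvent_graph(1)[OF t, of x] by (intro mult_mono) (auto simp: y_def)
  finally show ?thesis using \<kappa>_pos by (simp add: y_def divide_right_mono mult_ac)
qed

text \<open>For \<open>y = R t f\<close> and \<open>\<Delta> = A s y - A t y\<close>, the
  resolvent identity gives \<open>inner (R s f) f = inner y f - inner \<Delta> y + inner
  \<Delta> (R s \<Delta>)\<close>. Here \<open>\<Delta>\<close> is \<open>(s - t) *\<^sub>R A1 t
  y\<close> up to second order, and the last term is of second order.\<close>

lemma resolvent_form_lower:
  assumes t: "\<bar>t - t0\<bar> < \<delta>" and s: "\<bar>s - t0\<bar> < \<delta>" and f: "norm f = 1"
  shows "inner (R t f) f - inner (A1 t (R t f)) (R t f) * (s - t) - (4 * K / \<kappa> + 8 * K\<^sup>2 / \<kappa>) * (s - t)\<^sup>2 \<le> inner (R s f) f"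
proof -
  interpret t: resolvent_operator V "A t" c "\<kappa> / 2" by (rule resolvent_near[OF t])
  interpret s: resolvent_operator V "A s" c "\<kappa> / 2" by (rule resolvent_near[OF s])
  define y where "y = R t f"
  define \<Delta> where "\<Delta> = A s y - A t y"
  define E where "E = \<Delta> - (s - t) *\<^sub>R A1 t y"
  have yV: "y \<in> V" by (simp add: y_def t.Res_V)
  have "A s y - c *\<^sub>R y = f + \<Delta>" using t.T_Res[of f] by (simp add: y_def \<Delta>_def algebra_simps)
  then have "R s (f + \<Delta>) = y" by (intro s.Res_eqI yV)
  then have Rsf: "R s f = y - R s \<Delta>" by (simp add: s.Res.add eq_diff_eq)
  have "inner (R s f) f = inner y f - inner \<Delta> (R s f)"
    using s.Res.isym[of \<Delta> f] by (simp add: Rsf inner_diff_left)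
  also have "inner \<Delta> (R s f) = inner \<Delta> y - inner \<Delta> (R s \<Delta>)" by (simp add: Rsf inner_diff_right)
  also have "inner \<Delta> y = (s - t) * inner (A1 t y) y + inner E y" by (simp add: E_def inner_diff_left)
  finally have eq: "inner (R s f) f = inner y f - inner (A1 t y) y * (s - t) - inner E y + inner \<Delta> (R s \<Delta>)" by (simp add: mult.commute)
  have g: "norm (A t0 y - c *\<^sub>R y) \<le> 2" and y: "norm y \<le> 2 / \<kappa>"
    using resolvent_graph[OF t, of f] f by (auto simp: y_def)
  have "norm E \<le> K * (s - t)\<^sup>2 * norm (A t0 y - c *\<^sub>R y)" unfolding E_def \<Delta>_def by (rule remainder[OF s t yV])
  also have "\<dots> \<le> K * (s - t)\<^sup>2 * 2" using g K by (intro mult_left_mono) auto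
  finally have nE: "norm E \<le> K * (s - t)\<^sup>2 * 2" .
  have "norm \<Delta> \<le> K * \<bar>s - t\<bar> * norm (A t0 y - c *\<^sub>R y)" unfolding \<Delta>_def by (rule difference[OF s t yV])
  also have "\<dots> \<le> K * \<bar>s - t\<bar> * 2" using g K by (intro mult_left_mono) auto
  finally have n\<Delta>: "norm \<Delta> \<le> K * \<bar>s - t\<bar> * 2" .
  have "inner E y \<le> norm E * norm y" by (rule norm_cauchy_schwarz)
  also have "\<dots> \<le> (K * (s - t)\<^sup>2 * 2) * (2 / \<kappa>)" using nE y K by (intro mult_mono) auto
  finally have 1: "inner E y \<le> 4 * K / \<kappa> * (s - t)\<^sup>2" by (simp add: mult_ac)
  have "- inner \<Delta> (R s \<Delta>) \<le> norm \<Delta> * norm (R s \<Delta>)" using Cauchy_Schwarz_ineq2[of \<Delta> "R s \<Delta>"] by linarith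
  also have "\<dots> \<le> norm \<Delta> * (2 / \<kappa> * norm \<Delta>)" by (intro mult_left_mono resolvent_graph(2)[OF s]) auto
  also have "\<dots> = 2 / \<kappa> * (norm \<Delta>)\<^sup>2" by (simp add: power2_eq_square)
  also have "\<dots> \<le> 2 / \<kappa> * (K * \<bar>s - t\<bar> * 2)\<^sup>2" using n\<Delta> \<kappa>_pos by (intro mult_left_mono power_mono) auto
  also have "\<dots> = 8 * K\<^sup>2 / \<kappa> * (s - t)\<^sup>2" by (simp add: power_mult_distrib)
  finally have 2: "- inner \<Delta> (R s \<Delta>) \<le> 8 * K\<^sup>2 / \<kappa> * (s - t)\<^sup>2" .
  show ?thesis unfolding eq distrib_right using 1 2 by (simp add: y_def)
qed

text \<open>By Ky Fan's principle, evaluating the form of the resolvent at \<open>s\<close> on a family chosen at \<open>t\<close>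
  bounds the sum of its largest eigenvalues from below.\<close>

lemma resolvent_sum_subgradient:
  assumes t: "\<bar>t - t0\<bar> < \<delta>" and f: "onf f k"
  shows "\<exists>p. \<forall>s g r. \<bar>s - t0\<bar> < \<delta> \<longrightarrow> compact_symmetric_operator.top_family (R s) g r k \<longrightarrow>
    (\<Sum>i<k. inner (R t (f i)) (f i)) + p * (s - t) - k * (4 * K / \<kappa> + 8 * K\<^sup>2 / \<kappa>) * (s - t)\<^sup>2 \<le> (\<Sum>i<k. r i)"
proof (intro exI allI impI)
  fix s g r assume s: "\<bar>s - t0\<bar> < \<delta>" and tf: "compact_symmetric_operator.top_family (R s) g r k"
  interpret s: resolvent_operator V "A s" c "\<kappa> / 2" by (rule resolvent_near[OF s])
  have "(\<Sum>i<k. inner (R t (f i)) (f i)) + (- (\<Sum>i<k. inner (A1 t (R t (f i))) (R t (f i)))) * (s - t) - k * (4 * K / \<kappa> + 8 * K\<^sup>2 / \<kappa>) * (s - t)\<^sup>2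
      = (\<Sum>i<k. inner (R t (f i)) (f i) - inner (A1 t (R t (f i))) (R t (f i)) * (s - t) - (4 * K / \<kappa> + 8 * K\<^sup>2 / \<kappa>) * (s - t)\<^sup>2)"
    by (simp add: sum_subtractf sum_distrib_right mult.assoc)
  also have "\<dots> \<le> (\<Sum>i<k. inner (R s (f i)) (f i))"
    by (intro sum_mono resolvent_form_lower[OF t s] onf_norm[OF f]) simp
  also have "\<dots> \<le> (\<Sum>i<k. r i)" by (rule s.Res.ky_fan[OF tf f])
  finally show "(\<Sum>i<k. inner (R t (f i)) (f i)) + (- (\<Sum>i<k. inner (A1 t (R t (f i))) (R t (f i)))) * (s - t)
    - k * (4 * K / \<kappa> + 8 * K\<^sup>2 / \<kappa>) * (s - t)\<^sup>2 \<le> (\<Sum>i<k. r i)" .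
qed

end

context operator_curve
begin

lemma local_curve_exists:
  assumes R: "resolvent_operator V (A t0) c \<kappa>" and \<theta>: "\<theta> > 0"
  obtains K \<delta> where "local_curve V A A1 A2 t0 c \<kappa> K \<delta>" "2 * K * \<delta> / \<kappa> \<le> \<theta>"
proof -
  have \<kappa>: "\<kappa> > 0" using resolvent_operator.\<kappa>[OF R] .
  obtain K where K: "K \<ge> 0"
    "\<And>s t u. \<bar>s - t0\<bar> \<le> 1 \<Longrightarrow> \<bar>t - t0\<bar> \<le> 1 \<Longrightarrow> u \<in> V \<Longrightarrow> norm (A s u - A t u) \<le> K * \<bar>s - t\<bar> * norm (A t0 u - c *\<^sub>R u)"
    "\<And>t u. \<bar>t - t0\<bar> \<le> 1 \<Longrightarrow> u \<in> V \<Longrightarrow> norm (A1 t u) \<le> K * norm (A t0 u - c *\<^sub>R u)"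
    "\<And>s t u. \<bar>s - t0\<bar> \<le> 1 \<Longrightarrow> \<bar>t - t0\<bar> \<le> 1 \<Longrightarrow> u \<in> V \<Longrightarrow>
      norm (A s u - A t u - (s - t) *\<^sub>R A1 t u) \<le> K * (s - t)\<^sup>2 * norm (A t0 u - c *\<^sub>R u)"
    using local_bounds[OF R] by blast
  define \<delta> where "\<delta> = min 1 (min (1 / (2 * (K + 1))) (\<theta> * \<kappa> / (2 * (K + 1))))"
  have \<delta>: "\<delta> > 0" "\<delta> \<le> 1" "\<delta> \<le> 1 / (2 * (K + 1))" "\<delta> \<le> \<theta> * \<kappa> / (2 * (K + 1))"
    using K(1) \<kappa> \<theta> by (auto simp: \<delta>_def)
  have "(K + 1) * \<delta> \<le> 1 / 2" using \<delta>(3) K(1) by (simp add: field_simps)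
  then have K\<delta>: "K * \<delta> \<le> 1 / 2" using \<delta>(1) by (simp add: distrib_right)
  have "2 * (K + 1) * \<delta> \<le> \<theta> * \<kappa>" using \<delta>(4) K(1) by (simp add: field_simps)
  then have "2 * K * \<delta> \<le> \<theta> * \<kappa>" using \<delta>(1) by (simp add: distrib_right distrib_left)
  then have "2 * K * \<delta> / \<kappa> \<le> \<theta>" using \<kappa> by (simp add: divide_le_eq)
  moreover have "local_curve V A A1 A2 t0 c \<kappa> K \<delta>"
    by (intro local_curve.intro operator_curve_axioms local_curve_axioms.intro R K \<delta> K\<delta>)
      (use \<delta>(2) in auto)
  ultimately show ?thesis by (rule that[rotated])
qed

text \<open>At \<open>t0\<close> the form of the resolvent at \<open>c\<close> equals
  \<open>\<rho>\<close> on the unit sphere of the eigenspace of \<open>z0\<close>, and it is at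
  most \<open>b0 < \<rho>\<close> on that of the complement. Near \<open>t0\<close> the form
  changes by at most \<open>\<theta>\<close>, so the level \<open>b\<close> halfway between
  \<open>b0\<close> and \<open>\<rho>\<close> separates the \<open>N\<close> largest eigenvalues
  from the rest. The choice of \<open>\<epsilon>\<close> keeps the rest of the spectrum away
  from the interval of radius \<open>\<epsilon>\<close> around \<open>z0\<close>, and that of
  \<open>\<theta>\<close> keeps the cluster inside.\<close>

theorem eigenvalue_cluster_exists:
  assumes qm: "quasimode_system t0 z0 B \<mu> \<nu>"
    and M: "\<And>t z. multiplicity_at V (A t) (complex_of_real z) = enat (M t z)"
    and m: "\<And>J. jet_val J = z0 \<Longrightarrow> m t0 J = card {b \<in> B. Jet z0 (\<mu> b) (\<nu> b) = J}"
  shows "\<exists>n \<epsilon> \<delta> r c C F. eigenvalue_cluster M m t0 z0 n \<epsilon> \<delta> r c C F"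
proof -
  interpret op0: compact_resolvent_operator V "A t0" by (rule operator)
  have B: "finite B" "orthonormal B" and span: "complex_vector.span B = {u \<in> V. A t0 u = z0 *\<^sub>R u}"
    using qm by (auto simp: quasimode_system_def)
  obtain c where cz: "c < z0" and none: "\<And>x u. c \<le> x \<Longrightarrow> x < z0 \<Longrightarrow> u \<in> V \<Longrightarrow> A t0 u = x *\<^sub>R u \<Longrightarrow> u = 0"
    using op0.gap_below by blast
  obtain \<kappa> where \<kappa>: "\<kappa> > 0" "\<And>u. u \<in> V \<Longrightarrow> \<kappa> * norm u \<le> norm (A t0 u - c *\<^sub>R u)"
    using op0.lower_bound[of c] none[of c] cz by auto
  interpret R0: resolvent_operator V "A t0" c \<kappa>
    by (intro resolvent_operator.intro operator resolvent_operator_axioms.intro \<kappa>)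
  define \<rho> where "\<rho> = 1 / (z0 - c)"
  have \<rho>: "\<rho> > 0" "z0 = c + 1 / \<rho>" using cz by (auto simp: \<rho>_def)
  obtain b0 where b0: "0 \<le> b0" "b0 < \<rho>" and form: "\<And>x. inner (R0.Res x) x \<le> \<rho> * (norm x)\<^sup>2"
    "\<And>x. (\<And>e. e \<in> B \<Longrightarrow> cinner x e = 0) \<Longrightarrow> inner (R0.Res x) x \<le> b0 * (norm x)\<^sup>2"
    and ResB: "\<And>x. x \<in> complex_vector.span B \<Longrightarrow> R0.Res x = \<rho> *\<^sub>R x"
    by (rule R0.form_bounds[OF cz _ B span, folded \<rho>_def], erule (3) none, rule that) blast+
  define b where "b = (b0 + \<rho>) / 2"
  have b: "0 < b" "b0 < b" "b < \<rho>" using b0 \<rho> by (auto simp: b_def)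
  have "(z0 - c) * b < (z0 - c) * \<rho>" using b cz by (intro mult_strict_left_mono) auto
  then have zb: "(z0 - c) * b < 1" using cz by (simp add: \<rho>_def)
  define \<epsilon> where "\<epsilon> = min ((z0 - c) / 2) ((1 - (z0 - c) * b) / (2 * b))"
  have \<epsilon>: "\<epsilon> > 0" "\<epsilon> \<le> (z0 - c) / 2" "\<epsilon> \<le> (1 - (z0 - c) * b) / (2 * b)"
    using cz zb b unfolding \<epsilon>_def by (simp, intro min.cobounded1 min.cobounded2, intro min.cobounded1 min.cobounded2)
  have \<epsilon>b: "(z0 + \<epsilon> - c) * b < 1"
  proof -
    have "\<epsilon> * (2 * b) \<le> 1 - (z0 - c) * b" using \<epsilon>(3) b(1) by (simp add: pos_le_divide_eq)
    then have "2 * (\<epsilon> * b) + (z0 - c) * b \<le> 1" by simp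
    moreover have "(z0 + \<epsilon> - c) * b = \<epsilon> * b + (z0 - c) * b" by (simp add: algebra_simps)
    ultimately show ?thesis using zb by linarith
  qed
  define \<theta> where "\<theta> = min ((\<rho> - b0) / 4) (min (\<rho> / 2) (\<epsilon> * \<rho>\<^sup>2 / 4))"
  have \<theta>: "\<theta> > 0" "\<theta> \<le> (\<rho> - b0) / 4" "\<theta> \<le> \<rho> / 2" "\<theta> \<le> \<epsilon> * \<rho>\<^sup>2 / 4"
    using b0 \<rho> \<epsilon> unfolding \<theta>_def by (simp, linarith+)
  obtain K \<delta> where "local_curve V A A1 A2 t0 c \<kappa> K \<delta>" and K\<delta>: "2 * K * \<delta> / \<kappa> \<le> \<theta>"
    using local_curve_exists[OF R0.resolvent_operator_axioms \<theta>(1)] by blast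
  then interpret local_curve V A A1 A2 t0 c \<kappa> K \<delta> by simp
  have close: "\<bar>inner (R t x) x - inner (R t0 x) x\<bar> \<le> \<theta> * (norm x)\<^sup>2" if t: "\<bar>t - t0\<bar> < \<delta>" for t x
  proof -
    have "\<bar>inner (R t x) x - inner (R t0 x) x\<bar> = \<bar>inner (R t x - R t0 x) x\<bar>" by (simp add: inner_diff_left)
    also have "\<dots> \<le> norm (R t x - R t0 x) * norm x" by (rule Cauchy_Schwarz_ineq2)
    also have "\<dots> \<le> (2 * K * \<delta> / \<kappa> * norm x) * norm x" by (intro mult_right_mono resolvent_close[OF t]) auto
    also have "\<dots> \<le> (\<theta> * norm x) * norm x" using K\<delta> by (intro mult_right_mono) auto
    finally show ?thesis by (simp add: power2_eq_square)
  qed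
  define N where "N = card B"
  define a where "a = \<rho> - \<theta>"
  have a: "a > 0" "b < a" "a \<ge> \<rho> / 2" "b0 + \<theta> \<le> b" using \<theta> \<rho> b0 by (auto simp: a_def b_def field_simps)
  have "\<exists>f r. compact_symmetric_operator.top_family (R t) f r N \<and> (\<forall>i<N. r i \<ge> a) \<and>
      (\<forall>x. (\<forall>i<N. cinner x (f i) = 0) \<longrightarrow> inner (R t x) x \<le> b * (norm x)\<^sup>2)" if t: "\<bar>t - t0\<bar> < \<delta>" for t
  proof -
    interpret t: resolvent_operator V "A t" c "\<kappa> / 2" by (rule resolvent_near[OF t])
    have low: "a * (norm x)\<^sup>2 \<le> inner (R t x) x" if "x \<in> complex_vector.span B" for x
    proof -
      have "inner (R t0 x) x = \<rho> * (norm x)\<^sup>2" using ResB[OF that] by (simp add: power2_norm_eq_inner)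
      then show ?thesis using close[OF t, of x] unfolding a_def left_diff_distrib by linarith
    qed
    have high: "inner (R t x) x \<le> b * (norm x)\<^sup>2" if "\<And>e. e \<in> B \<Longrightarrow> cinner x e = 0" for x
    proof -
      have "inner (R t x) x \<le> (b0 + \<theta>) * (norm x)\<^sup>2"
        using close[OF t, of x] form(2)[OF that] unfolding distrib_right by linarith
      also have "\<dots> \<le> b * (norm x)\<^sup>2" using a(4) by (intro mult_right_mono) auto
      finally show ?thesis .
    qed
    show ?thesis unfolding N_def
      by (rule t.Res.top_cluster[OF B a(1,2) low high]) blast+
  qed
  then obtain f r where tf: "\<And>t. \<bar>t - t0\<bar> < \<delta> \<Longrightarrow> compact_symmetric_operator.top_family (R t) (f t) (r t) N"
    and ra: "\<And>t i. \<bar>t - t0\<bar> < \<delta> \<Longrightarrow> i < N \<Longrightarrow> r t i \<ge> a"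
    and comp: "\<And>t x. \<bar>t - t0\<bar> < \<delta> \<Longrightarrow> (\<And>i. i < N \<Longrightarrow> cinner x (f t i) = 0) \<Longrightarrow> inner (R t x) x \<le> b * (norm x)\<^sup>2"
    by metis
  have tfD: "onf (f t) N" "\<And>i. i < N \<Longrightarrow> R t (f t i) = r t i *\<^sub>R f t i"
    "\<And>k. k \<le> N \<Longrightarrow> compact_symmetric_operator.top_family (R t) (f t) (r t) k" if t: "\<bar>t - t0\<bar> < \<delta>" for t
  proof -
    interpret t: resolvent_operator V "A t" c "\<kappa> / 2" by (rule resolvent_near[OF t])
    show "onf (f t) N" "\<And>i. i < N \<Longrightarrow> R t (f t i) = r t i *\<^sub>R f t i"
      using tf[OF t] unfolding t.Res.top_family_def by blast+
    show "compact_symmetric_operator.top_family (R t) (f t) (r t) k" if "k \<le> N" for k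
      using tf[OF t] that onf_mono[of "f t" N k] unfolding t.Res.top_family_def by auto
  qed
  have rform: "inner (R t (f t i)) (f t i) = r t i" if "\<bar>t - t0\<bar> < \<delta>" "i < N" for t i
    using tfD(2)[OF that] onf_norm[OF tfD(1)[OF that(1)] that(2)] by (simp add: dot_square_norm)
  have r\<rho>: "\<bar>r t i - \<rho>\<bar> \<le> \<theta>" if t: "\<bar>t - t0\<bar> < \<delta>" "i < N" for t i
  proof -
    have n: "norm (f t i) = 1" by (rule onf_norm[OF tfD(1)[OF that(1)] that(2)])
    have "r t i \<le> \<rho> + \<theta>" using close[OF t(1), of "f t i"] form(1)[of "f t i"] n by (simp add: rform[OF t])
    then show ?thesis using ra[OF t] by (simp add: a_def abs_le_iff)
  qed
  have r0: "r t i > 0" if "\<bar>t - t0\<bar> < \<delta>" "i < N" for t i using ra[OF that] a(1) by simp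
  define l where "l i t = c + 1 / r t i" for i t
  have fV: "f t i \<in> V" and fl: "A t (f t i) = l i t *\<^sub>R f t i" if t: "\<bar>t - t0\<bar> < \<delta>" "i < N" for t i
  proof -
    interpret t: resolvent_operator V "A t" c "\<kappa> / 2" by (rule resolvent_near[OF t(1)])
    show "f t i \<in> V" "A t (f t i) = l i t *\<^sub>R f t i"
      unfolding l_def using t.Res_eigenvector[OF tfD(2)[OF t]] r0[OF t] by auto
  qed
  have near: "\<bar>l i t - z0\<bar> < \<epsilon>" if t: "\<bar>t - t0\<bar> < \<delta>" "i < N" for t i
  proof -
    have "l i t - z0 = (\<rho> - r t i) / (r t i * \<rho>)" unfolding l_def using r0[OF t] \<rho>(1) by (subst \<rho>(2)) (simp add: field_simps)
    then have "\<bar>l i t - z0\<bar> = \<bar>r t i - \<rho>\<bar> / (r t i * \<rho>)" using r0[OF t] \<rho>(1) by (simp add: abs_mult abs_minus_commute)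
    also have "\<dots> \<le> \<theta> / (\<rho> / 2 * \<rho>)"
      using r\<rho>[OF t] ra[OF t] a(3) \<rho>(1) \<theta>(1) by (intro frac_le mult_right_mono) auto
    also have "\<dots> \<le> (\<epsilon> * \<rho>\<^sup>2 / 4) / (\<rho> / 2 * \<rho>)" using \<theta>(4) \<rho>(1) by (intro divide_right_mono) auto
    also have "\<dots> = \<epsilon> / 2" using \<rho>(1) by (simp add: power2_eq_square)
    finally show ?thesis using \<epsilon>(1) by simp
  qed
  define g where "g = (1 - (z0 + \<epsilon> - c) * b) * (\<kappa> / 2)"
  have g: "g > 0" using \<epsilon>b \<kappa>(1) by (simp add: g_def)
  have gap: "g * norm y \<le> norm (A t y - z *\<^sub>R y)"
    if t: "\<bar>t - t0\<bar> < \<delta>" and z: "\<bar>z - z0\<bar> < \<epsilon>" and y: "y \<in> V" "\<And>i. i < N \<Longrightarrow> cinner y (f t i) = 0" for t z y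
  proof -
    interpret t: resolvent_operator V "A t" c "\<kappa> / 2" by (rule resolvent_near[OF t])
    have "(z - c) * b \<le> (z0 + \<epsilon> - c) * b" using z b(1) by (intro mult_right_mono) auto
    then have zle: "(z - c) * b \<le> (z0 + \<epsilon> - c) * b" .
    have "(1 - (z - c) * b) * (\<kappa> / 2) * norm y \<le> norm (A t y - z *\<^sub>R y)"
    proof (rule t.resolvent_gap[of N "f t" "\<lambda>i. l i t"])
      show "f t i \<in> V" "A t (f t i) = l i t *\<^sub>R f t i" if "i < N" for i using fV[OF t that] fl[OF t that] by auto
      show "inner (R t x) x \<le> b * (norm x)\<^sup>2" if "\<And>i. i < N \<Longrightarrow> cinner x (f t i) = 0" for x using comp[OF t that] .
      show "c \<le> z" using z \<epsilon>(2) cz by (simp add: abs_less_iff field_simps)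
      show "(z - c) * b \<le> 1" using zle \<epsilon>b by linarith
    qed (fact y)+
    moreover have "g * norm y \<le> (1 - (z - c) * b) * (\<kappa> / 2) * norm y"
      unfolding g_def using zle \<kappa>(1) by (intro mult_right_mono) auto
    ultimately show ?thesis by linarith
  qed
  define F where "F = (\<lambda>b. Jet z0 (\<mu> b) (\<nu> b)) ` B"
  have "eigenvalue_cluster M m t0 z0 N \<epsilon> \<delta> l c (N * (4 * K / \<kappa> + 8 * K\<^sup>2 / \<kappa>)) F"
  proof
    show "\<epsilon> > 0" "\<delta> > 0" by (rule \<epsilon> \<delta>)+
    show "c < z0 - \<epsilon>" using \<epsilon>(2) cz by (simp add: field_simps)
    show "\<bar>l i t - z0\<bar> < \<epsilon>" if "\<bar>t - t0\<bar> < \<delta>" "i < N" for t i using that by (rule near)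
    show "l i t0 = z0" if i: "i < N" for i
    proof (rule ccontr)
      assume ne: "l i t0 \<noteq> z0"
      have t0: "\<bar>t0 - t0\<bar> < \<delta>" using \<delta>(1) by simp
      have "cinner (f t0 i) e = 0" if e: "e \<in> B" for e
      proof -
        have "e \<in> V" "A t0 e = z0 *\<^sub>R e" using complex_vector.span_base[OF e] span by auto
        then show ?thesis using op0.eigenvectors_orthogonal[OF fV[OF t0 i] _ fl[OF t0 i] _ ne] by simp
      qed
      then have "inner (R t0 (f t0 i)) (f t0 i) \<le> b0 * (norm (f t0 i))\<^sup>2" by (rule form(2))
      then have "r t0 i \<le> b0" using rform[OF t0 i] onf_norm[OF tfD(1)[OF t0] i] by simp
      then show False using ra[OF t0 i] a(2) b(2) by simp
    qed
    show "M t z = card {k. k < N \<and> l k t = z}" if t: "\<bar>t - t0\<bar> < \<delta>" and z: "\<bar>z - z0\<bar> < \<epsilon>" for t z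
    proof -
      interpret t: resolvent_operator V "A t" c "\<kappa> / 2" by (rule resolvent_near[OF t])
      have "multiplicity_at V (A t) (complex_of_real z) = enat (card {i. i < N \<and> l i t = z})"
        by (rule t.multiplicity_cluster[OF tfD(1)[OF t] fV[OF t] fl[OF t] gap[OF t z] g])
      then show ?thesis using M[of t z] by simp
    qed
    show "\<exists>p. \<forall>s. \<bar>s - t0\<bar> < \<delta> \<longrightarrow> (\<Sum>j<k. 1 / (l j t - c)) + p * (s - t) - N * (4 * K / \<kappa> + 8 * K\<^sup>2 / \<kappa>) * (s - t)\<^sup>2
        \<le> (\<Sum>j<k. 1 / (l j s - c))" if k: "k \<le> N" and t: "\<bar>t - t0\<bar> < \<delta>" for k t
    proof -
      have onk: "onf (f t) k" by (rule onf_mono[OF tfD(1)[OF t] k])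
      have sum_l: "(\<Sum>j<k. 1 / (l j s - c)) = (\<Sum>j<k. r s j)" for s by (simp add: l_def)
      have "(\<Sum>i<k. inner (R t (f t i)) (f t i)) = (\<Sum>j<k. r t j)"
        using k by (intro sum.cong) (auto intro!: rform[OF t])
      then obtain p where p: "\<And>s g r'. \<bar>s - t0\<bar> < \<delta> \<Longrightarrow> compact_symmetric_operator.top_family (R s) g r' k \<Longrightarrow>
          (\<Sum>j<k. r t j) + p * (s - t) - k * (4 * K / \<kappa> + 8 * K\<^sup>2 / \<kappa>) * (s - t)\<^sup>2 \<le> (\<Sum>i<k. r' i)"
        using resolvent_sum_subgradient[OF t onk] by auto
      have "(\<Sum>j<k. r t j) + p * (s - t) - N * (4 * K / \<kappa> + 8 * K\<^sup>2 / \<kappa>) * (s - t)\<^sup>2 \<le> (\<Sum>j<k. r s j)" if s: "\<bar>s - t0\<bar> < \<delta>" for s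
      proof -
        have "k * (4 * K / \<kappa> + 8 * K\<^sup>2 / \<kappa>) * (s - t)\<^sup>2 \<le> N * (4 * K / \<kappa> + 8 * K\<^sup>2 / \<kappa>) * (s - t)\<^sup>2"
          using k K \<kappa>(1) by (intro mult_right_mono) auto
        then show ?thesis using p[OF s tfD(3)[OF s k]] by linarith
      qed
      then show ?thesis unfolding sum_l by blast
    qed
    show "finite F" using B(1) by (simp add: F_def)
    show Fz: "jet_val J = z0" if "J \<in> F" for J using that by (auto simp: F_def)
    show "J \<in> F" if "m t0 J > 0" "jet_val J = z0" for J
    proof -
      have "{b \<in> B. Jet z0 (\<mu> b) (\<nu> b) = J} \<noteq> {}" using that(1) unfolding m[OF that(2)] card_gt_0_iff by simp
      then obtain b where "b \<in> B" "Jet z0 (\<mu> b) (\<nu> b) = J" by blast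
      then show ?thesis unfolding F_def by (intro image_eqI[of _ _ b]) simp_all
    qed
    have "sum (m t0) F = (\<Sum>J\<in>F. \<Sum>b\<in>{b \<in> B. Jet z0 (\<mu> b) (\<nu> b) = J}. 1)"
      using m Fz by (intro sum.cong) auto
    also have "\<dots> = (\<Sum>b\<in>B. 1)" unfolding F_def by (rule sum.image_gen[OF B(1), symmetric])
    finally show "sum (m t0) F = N" by (simp add: N_def)
    show "\<forall>\<^sub>F t in at t0. m t0 J \<le> card {k. k < N \<and> Jet (l k t) 0 0 \<in> window t0 J \<eta> t}" if J: "J \<in> F" and \<eta>: "\<eta> > 0" for J \<eta>
      unfolding m[OF Fz[OF J]]
      by (rule window_count[OF qm Fz[OF J] \<delta>(1) \<epsilon>(1) g \<eta> tfD(1) fV fl gap])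
  qed
  then show ?thesis by blast
qed

text \<open>The first derivative is bounded relative to \<open>A t0 - c\<close>, which near
  \<open>t0\<close> is bounded relative to \<open>A t - c\<close>; the latter multiplies the
  eigenvector by \<open>z - c\<close>.\<close>

lemma slope_bound:
  "\<exists>d>0. \<exists>C\<ge>0. \<forall>t z u. \<bar>t - t0\<bar> < d \<longrightarrow> u \<in> V \<longrightarrow> norm u = 1 \<longrightarrow> A t u = z *\<^sub>R u \<longrightarrow> norm (A1 t u) \<le> C * (1 + \<bar>z\<bar>)"
proof -
  interpret op0: compact_resolvent_operator V "A t0" by (rule operator)
  obtain c where "c < 0" and none: "\<And>x u. c \<le> x \<Longrightarrow> x < 0 \<Longrightarrow> u \<in> V \<Longrightarrow> A t0 u = x *\<^sub>R u \<Longrightarrow> u = 0"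
    using op0.gap_below by blast
  have "u = 0" if "u \<in> V" "A t0 u = c *\<^sub>R u" for u using none[of c u] \<open>c < 0\<close> that by simp
  then obtain \<kappa> where \<kappa>: "\<kappa> > 0" "\<And>u. u \<in> V \<Longrightarrow> \<kappa> * norm u \<le> norm (A t0 u - c *\<^sub>R u)"
    using op0.lower_bound[of c] by blast
  have "resolvent_operator V (A t0) c \<kappa>"
    by (intro resolvent_operator.intro operator resolvent_operator_axioms.intro \<kappa>)
  then obtain K \<delta> where "local_curve V A A1 A2 t0 c \<kappa> K \<delta>" using local_curve_exists zero_less_one by blast
  then interpret local_curve V A A1 A2 t0 c \<kappa> K \<delta> .
  have "norm (A1 t u) \<le> 2 * K * (1 + \<bar>c\<bar>) * (1 + \<bar>z\<bar>)"
    if t: "\<bar>t - t0\<bar> < \<delta>" and u: "u \<in> V" "norm u = 1" "A t u = z *\<^sub>R u" for t z u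
  proof -
    have "norm (A1 t u) \<le> K * norm (A t0 u - c *\<^sub>R u)" by (rule slope[OF t u(1)])
    also have "\<dots> \<le> K * (2 * norm (A t u - c *\<^sub>R u))" using relative_bound[OF t u(1)] K by (rule mult_left_mono)
    also have "norm (A t u - c *\<^sub>R u) = \<bar>z - c\<bar>" using u by (simp flip: scaleR_left_diff_distrib)
    also have "K * (2 * \<bar>z - c\<bar>) \<le> K * (2 * ((1 + \<bar>c\<bar>) * (1 + \<bar>z\<bar>)))"
    proof -
      have "\<bar>z - c\<bar> \<le> \<bar>z\<bar> + \<bar>c\<bar>" by linarith
      also have "\<dots> \<le> (1 + \<bar>c\<bar>) * (1 + \<bar>z\<bar>)" by (simp add: algebra_simps)
      finally show ?thesis using K by (intro mult_left_mono) auto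
    qed
    finally show ?thesis by (simp only: mult_ac)
  qed
  then show ?thesis using \<delta>(1) K by (intro exI[of _ \<delta>] conjI exI[of _ "2 * K * (1 + \<bar>c\<bar>)"]) auto
qed

lemma slope_bound_compact:
  "\<exists>C\<ge>0. \<forall>t z u. \<bar>t\<bar> \<le> X \<longrightarrow> u \<in> V \<longrightarrow> norm u = 1 \<longrightarrow> A t u = z *\<^sub>R u \<longrightarrow> norm (A1 t u) \<le> C * (1 + \<bar>z\<bar>)"
proof (cases "X \<ge> 0")
  case True
  define P where "P a b \<longleftrightarrow> (\<exists>C\<ge>0. \<forall>t z u. a \<le> t \<and> t \<le> b \<longrightarrow> u \<in> V \<longrightarrow> norm u = 1 \<longrightarrow> A t u = z *\<^sub>R u \<longrightarrow> norm (A1 t u) \<le> C * (1 + \<bar>z\<bar>))"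
    for a b
  have "- X \<le> X" using True by simp
  then have "P (- X) X"
  proof (induction rule: Bolzano)
    case (trans a b d)
    obtain C1 C2 where C: "C1 \<ge> 0" "C2 \<ge> 0"
      "\<And>t z u. a \<le> t \<Longrightarrow> t \<le> b \<Longrightarrow> u \<in> V \<Longrightarrow> norm u = 1 \<Longrightarrow> A t u = z *\<^sub>R u \<Longrightarrow> norm (A1 t u) \<le> C1 * (1 + \<bar>z\<bar>)"
      "\<And>t z u. b \<le> t \<Longrightarrow> t \<le> d \<Longrightarrow> u \<in> V \<Longrightarrow> norm u = 1 \<Longrightarrow> A t u = z *\<^sub>R u \<Longrightarrow> norm (A1 t u) \<le> C2 * (1 + \<bar>z\<bar>)"
      using trans(1,2) unfolding P_def by metis
    have "norm (A1 t u) \<le> (C1 + C2) * (1 + \<bar>z\<bar>)"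
      if "a \<le> t" "t \<le> d" "u \<in> V" "norm u = 1" "A t u = z *\<^sub>R u" for t z u
    proof -
      have "norm (A1 t u) \<le> C1 * (1 + \<bar>z\<bar>) \<or> norm (A1 t u) \<le> C2 * (1 + \<bar>z\<bar>)"
        using C(3)[of t u z] C(4)[of t u z] that linear[of t b] by blast
      moreover have "C1 * (1 + \<bar>z\<bar>) \<ge> 0" "C2 * (1 + \<bar>z\<bar>) \<ge> 0" using C(1,2) by auto
      ultimately show ?thesis unfolding distrib_right[of C1] by linarith
    qed
    then show ?case unfolding P_def using C(1,2) by (intro exI[of _ "C1 + C2"]) auto
  next
    case (local x)
    obtain d C where d: "d > 0" "C \<ge> 0"
      "\<And>t z u. \<bar>t - x\<bar> < d \<Longrightarrow> u \<in> V \<Longrightarrow> norm u = 1 \<Longrightarrow> A t u = z *\<^sub>R u \<Longrightarrow> norm (A1 t u) \<le> C * (1 + \<bar>z\<bar>)"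
      using slope_bound[of x] by blast
    have "P a b" if "a \<le> x \<and> x \<le> b \<and> b - a < d" for a b
      unfolding P_def using that d by (intro exI[of _ C]) (auto simp: abs_less_iff)
    then show ?case using d(1) by blast
  qed
  then show ?thesis unfolding P_def by (auto simp: abs_le_iff minus_le_iff)
qed (intro exI[of _ 0], auto)

theorem eigenvalues_parameterization:
  assumes fin: "\<And>t z. multiplicity_at V (A t) (complex_of_real z) \<noteq> \<infinity>"
  shows "\<exists>N lam. (\<forall>i. enat i < N \<longrightarrow> times_differentiable 2 (lam i)) \<and> parameterizes_eigenvalues N lam V A"
proof -
  define M where "M t z = the_enat (multiplicity_at V (A t) (complex_of_real z))" for t z
  have M: "multiplicity_at V (A t) (complex_of_real z) = enat (M t z)" for t z
    using fin[of t z] by (auto simp: M_def)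
  obtain B \<mu> \<nu> where qm: "\<And>t z. quasimode_system t z (B t z) (\<mu> t z) (\<nu> t z)"
    using quasimode_system_exists[OF fin] by metis
  define m where "m t J = (let z = jet_val J in card {b \<in> B t z. Jet z (\<mu> t z b) (\<nu> t z b) = J})" for t J
  interpret spectral_jets M m
  proof
    show "\<exists>n \<epsilon> \<delta> r c C F. eigenvalue_cluster M m t0 z0 n \<epsilon> \<delta> r c C F" for t0 z0
      by (rule eigenvalue_cluster_exists[OF qm M]) (simp add: m_def)
    fix X
    obtain C where C: "C \<ge> 0" "\<And>t z u. \<bar>t\<bar> \<le> X \<Longrightarrow> u \<in> V \<Longrightarrow> norm u = 1 \<Longrightarrow> A t u = z *\<^sub>R u \<Longrightarrow> norm (A1 t u) \<le> C * (1 + \<bar>z\<bar>)"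
      using slope_bound_compact[of X] by blast
    have "\<bar>jet_slope J\<bar> \<le> C * (1 + \<bar>jet_val J\<bar>)" if t: "\<bar>t\<bar> \<le> X" and mJ: "m t J > 0" for t J
    proof -
      define z where "z = jet_val J"
      obtain b where b: "b \<in> B t z" and J: "Jet z (\<mu> t z b) (\<nu> t z b) = J"
        using mJ by (auto simp: m_def Let_def z_def card_gt_0_iff)
      have bV: "b \<in> V" "A t b = z *\<^sub>R b" and bn: "norm b = 1" and \<mu>: "cinner (A1 t b) b = complex_of_real (\<mu> t z b)"
        using qm[of t z] complex_vector.span_base[OF b] orthonormal_norm[OF _ b] b by (auto simp: quasimode_system_def)
      have "\<bar>jet_slope J\<bar> = cmod (cinner (A1 t b) b)" using J \<mu> by auto
      also have "\<dots> \<le> norm (A1 t b) * norm b" by (rule cinner_cauchy_schwarz)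
      also have "\<dots> \<le> C * (1 + \<bar>z\<bar>)" using C(2)[OF t bV(1) bn bV(2)] bn by simp
      finally show ?thesis by (simp add: z_def)
    qed
    then show "\<exists>C. \<forall>t J. \<bar>t\<bar> \<le> X \<and> m t J > 0 \<longrightarrow> \<bar>jet_slope J\<bar> \<le> C * (1 + \<bar>jet_val J\<bar>)" by blast
  qed
  show ?thesis using parameterization unfolding parameterizes_eigenvalues_def M by simp
qed

end

theorem mainTheorem3:
  fixes V :: "'a::complex_hilbert_space set"
    and A :: "real \<Rightarrow> 'a \<Rightarrow> 'a"
    and n :: nat and \<alpha> :: real
  assumes "n \<ge> 1" and "\<alpha> > 0"
    and "\<And>t. self_adjoint_operator V (A t)"
    and "\<And>t. has_compact_resolvent V (A t)"
    and "C_k_alpha_curve (3 * n) \<alpha> V A"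
    and "\<And>t z. multiplicity_at V (A t) z \<le> enat n"
  shows "\<exists>N lam. (\<forall>i. enat i < N \<longrightarrow> times_differentiable 2 (lam i)) \<and>
    parameterizes_eigenvalues N lam V A"
proof -
  have "\<exists>g1 g2 g3. thrice_differentiable (\<lambda>t. cinner (A t u) v) g1 g2 g3" if "u \<in> V" for u v
    using assms(1,5) that by (intro C_k_alpha_imp_thrice_differentiable[of "3 * n" \<alpha>]) (auto simp: C_k_alpha_curve_def)
  then obtain A1 A2 where "operator_curve V A A1 A2"
    using operator_curve_exists compact_resolvent_operatorI[OF assms(3,4)] by metis
  moreover have "multiplicity_at V (A t) (complex_of_real z) \<noteq> \<infinity>" for t z
  proof
    assume "multiplicity_at V (A t) (complex_of_real z) = \<infinity>"
    then show False using assms(6)[of t "complex_of_real z"] by simp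
  qed
  ultimately show ?thesis by (rule operator_curve.eigenvalues_parameterization)
qed

end
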